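(* Let $\beta>\alpha\ge 1$. If $k\in[1,\infty)$, then the function $z\mapsto\dfrac{\theta(\beta,z)}{\theta(\alpha,z)^k}$ attains its maximum over $\mathbb{H}$ at $e^{i\pi/3}$, and this maximizer is unique up to the action of the modular group. If $k\in(0,1)$, then this function has no maximizer over $\mathbb{H}$.
   Context: $\mathbb{H}=\{z\in\mathbb{C}:\operatorname{Im}(z)>0\}$. For $\alpha>0$ and $z\in\mathbb{H}$, $$\theta(\alpha,z)=\sum_{(m,n)\in\mathbb{Z}^2}e^{-\pi\alpha\frac{|mz+n|^2}{\operatorname{Im}(z)}}.$$ The modular group is $\mathrm{SL}_2(\mathbb{Z})$ acting on $\mathbb{H}$ by $z\mapsto\frac{az+b}{cz+d}$; the functions $\theta(\alpha,\cdot)$ are invariant under it. *)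

theory Defs
  imports "HOL-Analysis.Analysis"
begin

definition upper_half_plane :: "complex set"
  where "upper_half_plane = {z. Im z > 0}"

text \<open>
  For \<open>\<alpha> > 0\<close> and \<open>Im z > 0\<close> the family is summable,
  so \<open>infsum\<close> is a genuine sum over the lattice there.
\<close>
definition theta :: "real \<Rightarrow> complex \<Rightarrow> real"
  where "theta \<alpha> z =
    (\<Sum>\<^sub>\<infinity>(m, n)\<in>(UNIV :: (int \<times> int) set).
      exp (- pi * \<alpha> * (cmod (of_int m * z + of_int n))\<^sup>2 / Im z))"

definition SL2Z :: "(int ^ 2 ^ 2) set"
  where "SL2Z = {A. det A = 1}"

definition modular_action :: "int ^ 2 ^ 2 \<Rightarrow> complex \<Rightarrow> complex"
  where "modular_action A z =
    (of_int (A $ 1 $ 1) * z + of_int (A $ 1 $ 2)) / (of_int (A $ 2 $ 1) * z + of_int (A $ 2 $ 2))"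

text \<open>Positivity of \<open>theta\<close> makes \<open>powr\<close> the ordinary real power.\<close>
definition theta_quotient :: "real \<Rightarrow> real \<Rightarrow> real \<Rightarrow> complex \<Rightarrow> real"
  where "theta_quotient \<alpha> \<beta> k z = theta \<beta> z / theta \<alpha> z powr k"

definition maximizer_on_H :: "(complex \<Rightarrow> real) \<Rightarrow> complex \<Rightarrow> bool"
  where "maximizer_on_H f = is_arg_max f (\<lambda>z. z \<in> upper_half_plane)"

end

theory Submission
  imports Defs "HOL-Probability.Probability"
begin

text \<open>
  With \<open>s = exp t\<close> and \<open>G(t, z) = sqrt s * theta s z\<close>, Poisson summation makes \<open>G\<close> even in \<open>t\<close>, and
  \<open>G' = exp (t/2) * U\<close> with \<open>U(s, z) = (\<Sum>(1/2 - w) exp (-w))\<close>, \<open>w\<close> ranging over the values of the quadratic form.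
  Everything rests on \<open>U(s, z) < U(s, z0)\<close> for \<open>s > 1\<close>, \<open>z0 = exp (i \<pi>/3)\<close>, and every other \<open>z\<close> with
  \<open>0 \<le> Re z \<le> 1/2\<close> and \<open>\<bar>z\<bar> \<ge> 1\<close>.
  First \<open>z\<close> is moved to the line \<open>Re z = 1/2\<close>. On that line the six shortest vectors of the hexagonal lattice give
  a second order gain in the deformation, while the first order contributions of the longer vectors cancel by hexagonal
  symmetry and their second order remainders are smaller than the gain. For \<open>s\<close> near \<open>1\<close>, where \<open>U\<close> vanishes
  identically, this is done for \<open>G''\<close> instead; strong deformations are compared by values, in the dual form.

  Hence \<open>G(t, z0) - G(t, z)\<close> increases to its limit \<open>0\<close>, so \<open>theta \<alpha>\<close> is minimal at \<open>z0\<close> and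
  \<open>G(ln \<beta>, z) - G(ln \<alpha>, z) < G(ln \<beta>, z0) - G(ln \<alpha>, z0)\<close>; the ratio \<open>theta \<beta> / theta \<alpha>\<close>
  is therefore maximal at \<open>z0\<close>, and the remaining factor \<open>(theta \<alpha>) powr (1 - k)\<close> is maximal there as well when \<open>k \<ge> 1\<close>.
  For \<open>k < 1\<close> the quotient grows like \<open>y powr ((1 - k)/2)\<close> at \<open>z = iy\<close>, \<open>y \<rightarrow> \<infinity>\<close>.
\<close>

section \<open>Summation over integer lattices\<close>

text \<open>The comparison of \<open>U\<close> degenerates wherever it matters: the difference
  vanishes linearly in \<open>s - 1\<close>, quadratically in \<open>1/2 - x\<close> at the line,
  and quadratically in \<open>u - 1\<close> at the hexagonal point, where the points of the line are
  written \<open>1/2 + i * u * sqrt 3 / 2\<close>. A bound that loses one of these factors is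
  useless near the corresponding boundary, so every regime extracts the factor first and compares
  only coefficients. On the line the form is diagonal in \<open>m\<close> and
  \<open>2 * n + m\<close>, and \<open>u\<close> stretches the two axes against each other. The
  coefficients differ little (20 against less than 19.1, and 125/1000 against 12/100), which
  dictates the accuracy of the numerical bounds. Spatial sums converge fast when
  \<open>s / y\<close> is large, dual sums when \<open>y / s\<close> is large; the cut-offs 115/100
  for \<open>s\<close> and 12935/10000, 1963/1000 for \<open>u\<close> are where neighbouring
  methods meet. Almost every value of \<open>exp\<close> is bounded by a Taylor polynomial at a
  sixteenth of the argument, raised to the power 16, so that numerical steps become rational
  arithmetic.\<close>

lemma has_sum_int_geometric:
  fixes r :: real
  assumes "0 \<le> r" "r < 1"
  shows "((\<lambda>m::int. r ^ nat \<bar>m\<bar>) has_sum (1 + r) / (1 - r)) UNIV"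
proof -
  have pos: "((\<lambda>m::int. r ^ nat \<bar>m\<bar>) has_sum 1 / (1 - r)) {0..}"
  proof -
    have "(\<lambda>n. r ^ n) sums (1 / (1 - r))" using assms by (intro geometric_sums) auto
    hence "((\<lambda>n::nat. r ^ n) has_sum 1 / (1 - r)) UNIV"
      using assms by (intro sums_nonneg_imp_has_sum) auto
    moreover have "((\<lambda>n::nat. r ^ n) has_sum 1 / (1 - r)) UNIV \<longleftrightarrow> ?thesis"
      by (rule has_sum_reindex_bij_witness[of _ nat int]) auto
    ultimately show ?thesis by simp
  qed
  have neg: "((\<lambda>m::int. r ^ nat \<bar>m\<bar>) has_sum r / (1 - r)) {..<0}"
  proof -
    have "((\<lambda>m::int. r * r ^ nat \<bar>m\<bar>) has_sum r * (1 / (1 - r))) {0..}"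
      by (intro has_sum_cmult_right pos)
    moreover have "((\<lambda>m::int. r * r ^ nat \<bar>m\<bar>) has_sum r * (1 / (1 - r))) {0..} \<longleftrightarrow> ?thesis"
    proof (rule has_sum_reindex_bij_witness[of _ "\<lambda>m. -m - 1" "\<lambda>m. -m - 1"])
      fix m :: int assume "m \<in> {0..}"
      hence "nat \<bar>- m - 1\<bar> = Suc (nat \<bar>m\<bar>)" by auto
      thus "r ^ nat \<bar>- m - 1\<bar> = r * r ^ nat \<bar>m\<bar>" by (metis power_Suc)
    qed auto
    ultimately show ?thesis by simp
  qed
  have "((\<lambda>m::int. r ^ nat \<bar>m\<bar>) has_sum (1 / (1 - r) + r / (1 - r))) ({0..} \<union> {..<0})"
    by (intro has_sum_Un_disjoint pos neg) auto
  moreover have "{0::int..} \<union> {..<0} = UNIV" by auto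
  ultimately show ?thesis by (simp add: add_divide_distrib)
qed

lemma exp_le_power_abs_int:
  fixes c :: real and m :: int
  assumes "c \<ge> 0"
  shows "exp (- c * (real_of_int m)\<^sup>2) \<le> exp (-c) ^ nat \<bar>m\<bar>"
proof -
  have "\<bar>m\<bar> * 1 \<le> \<bar>m\<bar> * \<bar>m\<bar>" by (cases "m = 0") (auto intro!: mult_left_mono simp del: abs_mult_self_eq mult_1_right)
  hence "\<bar>m\<bar> \<le> m\<^sup>2" by (simp add: power2_eq_square)
  hence "real_of_int \<bar>m\<bar> \<le> real_of_int (m\<^sup>2)" by (simp only: of_int_le_iff)
  hence "c * real (nat \<bar>m\<bar>) \<le> c * (real_of_int m)\<^sup>2"
    using assms by (intro mult_left_mono) auto
  thus ?thesis by (simp add: exp_of_nat_mult[symmetric] mult.commute)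
qed

lemma summable_gauss_int:
  fixes c :: real
  assumes "c > 0"
  shows "(\<lambda>m::int. exp (- c * (real_of_int m)\<^sup>2)) summable_on UNIV"
proof (rule summable_on_comparison_test)
  show "(\<lambda>m::int. exp (-c) ^ nat \<bar>m\<bar>) summable_on UNIV"
    using has_sum_int_geometric[of "exp (-c)"] assms by (auto simp: summable_on_def)
qed (use assms exp_le_power_abs_int[of c] in auto)

lemma summable_gauss_int2:
  fixes c :: real
  assumes "c > 0"
  shows "(\<lambda>(m::int, k::int). exp (- c * ((real_of_int m)\<^sup>2 + (real_of_int k)\<^sup>2))) summable_on UNIV"
proof -
  let ?f = "\<lambda>m::int. exp (- c * (real_of_int m)\<^sup>2)"
  have "(\<lambda>(m, k). ?f m * ?f k) summable_on (UNIV \<times> UNIV)"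
  proof (rule summable_on_SigmaI)
    fix m :: int
    show "((\<lambda>k. case (m, k) of (m, k) \<Rightarrow> ?f m * ?f k) has_sum ?f m * infsum ?f UNIV) UNIV"
      using summable_gauss_int[OF assms] by (auto intro!: has_sum_cmult_right has_sum_infsum)
  next
    show "(\<lambda>m. ?f m * infsum ?f UNIV) summable_on UNIV"
      using summable_gauss_int[OF assms] by (intro summable_on_cmult_left) auto
  qed auto
  thus ?thesis
    by (simp add: case_prod_unfold exp_add[symmetric] algebra_simps)
qed

lemma has_sum_diff:
  fixes f g :: "'a \<Rightarrow> real"
  assumes "(f has_sum a) A" "(g has_sum b) A"
  shows "((\<lambda>x. f x - g x) has_sum (a - b)) A"
  using has_sum_add[OF assms(1) has_sum_uminusI[OF assms(2)]] by simp

lemma summable_on_diff_real: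
  fixes f g :: "'a \<Rightarrow> real"
  assumes "f summable_on A" "g summable_on A"
  shows "(\<lambda>x. f x - g x) summable_on A"
  using assms has_sum_diff unfolding summable_on_def by blast

lemma infsum_diff_real:
  fixes f g :: "'a \<Rightarrow> real"
  assumes "f summable_on A" "g summable_on A"
  shows "infsum (\<lambda>x. f x - g x) A = infsum f A - infsum g A"
  using assms by (intro infsumI has_sum_diff has_sum_infsum)

text \<open>The mean value bound is applied twice, to \<open>f'\<close> and then to \<open>f\<close>
  minus its tangent; this costs the factor 1/2 of the sharp remainder.\<close>

lemma taylor2_bound:
  fixes f f' f'' :: "real \<Rightarrow> real"
  assumes "\<And>t. \<bar>t - s\<bar> < r \<Longrightarrow> (f has_real_derivative f' t) (at t)"
    and "\<And>t. \<bar>t - s\<bar> < r \<Longrightarrow> (f' has_real_derivative f'' t) (at t)"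
    and "\<And>t. \<bar>t - s\<bar> < r \<Longrightarrow> \<bar>f'' t\<bar> \<le> M"
    and "\<bar>h\<bar> < r"
  shows "\<bar>f (s + h) - f s - h * f' s\<bar> \<le> M * h\<^sup>2"
proof -
  have r: "r > 0" using assms(4) by linarith
  have M: "M \<ge> 0" using assms(3)[of s] r by auto
  have b: "\<bar>f' t - f' s\<bar> \<le> M * \<bar>t - s\<bar>" if t: "\<bar>t - s\<bar> < r" for t
    using field_differentiable_bound[of "ball s r" f' f'' M t s] assms(2,3) t r
    by (auto simp: dist_real_def abs_minus_commute intro: has_field_derivative_at_within)
  define g where "g = (\<lambda>t. f t - t * f' s)"
  have "\<bar>g (s + h) - g s\<bar> \<le> (M * \<bar>h\<bar>) * \<bar>(s + h) - s\<bar>"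
  proof (rule field_differentiable_bound[of "cball s \<bar>h\<bar>" g "\<lambda>t. f' t - f' s", unfolded real_norm_def])
    fix t assume t: "t \<in> cball s \<bar>h\<bar>"
    hence t': "\<bar>t - s\<bar> \<le> \<bar>h\<bar>" by (simp add: dist_real_def abs_minus_commute)
    have "(f has_real_derivative f' t) (at t)" using assms(1,4) t' by auto
    thus "(g has_real_derivative (f' t - f' s)) (at t within cball s \<bar>h\<bar>)"
      unfolding g_def
      using DERIV_diff[OF _ DERIV_cmult_Id[of "f' s"]] has_field_derivative_at_within
      by (fastforce simp: mult.commute)
    have "\<bar>f' t - f' s\<bar> \<le> M * \<bar>t - s\<bar>" using b t' assms(4) by auto
    also have "\<dots> \<le> M * \<bar>h\<bar>" using t' M by (intro mult_left_mono) auto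
    finally show "\<bar>f' t - f' s\<bar> \<le> M * \<bar>h\<bar>" .
  qed (auto simp: dist_real_def)
  thus ?thesis by (simp add: g_def algebra_simps power2_eq_square)
qed

text \<open>The Taylor remainders of the terms add up to at most \<open>C * h\<^sup>2\<close>, so
  the difference quotient is off by at most \<open>C * \<bar>h\<bar>\<close>. A summable majorant of
  the second derivatives thus takes the place of uniform convergence of the differentiated
  series.\<close>

lemma has_derivative_infsum_real:
  fixes f f' f'' :: "'i \<Rightarrow> real \<Rightarrow> real"
  assumes r: "r > 0"
    and d1: "\<And>i t. i \<in> I \<Longrightarrow> \<bar>t - s\<bar> < r \<Longrightarrow> (f i has_real_derivative f' i t) (at t)"
    and d2: "\<And>i t. i \<in> I \<Longrightarrow> \<bar>t - s\<bar> < r \<Longrightarrow> (f' i has_real_derivative f'' i t) (at t)"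
    and bd: "\<And>i t. i \<in> I \<Longrightarrow> \<bar>t - s\<bar> < r \<Longrightarrow> \<bar>f'' i t\<bar> \<le> M i"
    and M: "M summable_on I"
    and s0: "\<And>t. (\<lambda>i. f i t) summable_on I"
    and s1: "(\<lambda>i. f' i s) summable_on I"
  shows "((\<lambda>t. \<Sum>\<^sub>\<infinity>i\<in>I. f i t) has_real_derivative (\<Sum>\<^sub>\<infinity>i\<in>I. f' i s)) (at s)"
proof -
  define F where "F = (\<lambda>t. \<Sum>\<^sub>\<infinity>i\<in>I. f i t)"
  define F' where "F' = (\<Sum>\<^sub>\<infinity>i\<in>I. f' i s)"
  define C where "C = (\<Sum>\<^sub>\<infinity>i\<in>I. M i)"
  have key: "\<bar>F (s + h) - F s - h * F'\<bar> \<le> C * h\<^sup>2" if h: "\<bar>h\<bar> < r" for h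
  proof -
    let ?e = "\<lambda>i. f i (s + h) - f i s - h * f' i s"
    have 1: "(?e has_sum (F (s + h) - F s - h * F')) I"
      unfolding F_def F'_def
      by (intro has_sum_diff has_sum_cmult_right has_sum_infsum s0 s1)
    have 2: "((\<lambda>i. M i * h\<^sup>2) has_sum C * h\<^sup>2) I"
      unfolding C_def by (intro has_sum_cmult_left has_sum_infsum M)
    have 3: "\<bar>?e i\<bar> \<le> M i * h\<^sup>2" if "i \<in> I" for i
      by (rule taylor2_bound[OF d1 d2 bd h]) (use that in auto)
    have "F (s + h) - F s - h * F' \<le> C * h\<^sup>2"
      by (rule has_sum_mono[OF 1 2]) (use 3 in \<open>simp add: abs_le_iff\<close>)
    moreover have "-(C * h\<^sup>2) \<le> F (s + h) - F s - h * F'"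
    proof (rule has_sum_mono[OF has_sum_uminusI[OF 2] 1])
      fix i assume "i \<in> I"
      from 3[OF this] show "- (M i * h\<^sup>2) \<le> ?e i" by linarith
    qed
    ultimately have "F (s + h) - F s - h * F' \<le> C * h\<^sup>2" "-(C * h\<^sup>2) \<le> F (s + h) - F s - h * F'"
      by blast+
    thus ?thesis by linarith
  qed
  have "((\<lambda>h. (F (s + h) - F s) / h - F') \<longlongrightarrow> 0) (at 0)"
  proof (rule Lim_null_comparison[of _ "\<lambda>h. C * \<bar>h\<bar>"])
    have "eventually (\<lambda>h. \<bar>h\<bar> < r \<and> h \<noteq> 0) (at (0::real))"
      using r by (auto simp: eventually_at dist_real_def intro!: exI[of _ r])
    thus "eventually (\<lambda>h. norm ((F (s + h) - F s) / h - F') \<le> C * \<bar>h\<bar>) (at 0)"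
    proof eventually_elim
      case (elim h)
      have "norm ((F (s + h) - F s) / h - F') = \<bar>F (s + h) - F s - h * F'\<bar> / \<bar>h\<bar>"
        using elim by (simp add: abs_divide[symmetric] diff_divide_distrib)
      also have "\<dots> \<le> C * h\<^sup>2 / \<bar>h\<bar>" using key[of h] elim by (intro divide_right_mono) auto
      also have "\<dots> = C * \<bar>h\<bar>" using elim by (simp add: power2_eq_square field_simps abs_if)
      finally show ?case .
    qed
    have "((\<lambda>h. C * \<bar>h\<bar>) \<longlongrightarrow> C * \<bar>0\<bar>) (at (0::real))" by (intro tendsto_intros)
    thus "((\<lambda>h. C * \<bar>h\<bar>) \<longlongrightarrow> 0) (at (0::real))" by simp
  qed
  hence "((\<lambda>h. (F (s + h) - F s) / h) \<longlongrightarrow> F') (at 0)" by (rule LIM_zero_cancel)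
  thus ?thesis unfolding F_def F'_def by (simp add: DERIV_def)
qed

section \<open>Poisson summation for shifted Gaussians\<close>

text \<open>The cosine transform is the real part of the characteristic function of the standard
  normal law, rescaled by \<open>c = sqrt (2 * a)\<close>.\<close>

lemma gauss_fourier:
  fixes a b :: real
  assumes "a > 0"
  shows "integrable lborel (\<lambda>x. exp (- a * x\<^sup>2) * cos (b * x))"
    and "(LINT x|lborel. exp (- a * x\<^sup>2) * cos (b * x)) = sqrt (pi / a) * exp (- b\<^sup>2 / (4 * a))"
proof -
  define c where "c = sqrt (2 * a)"
  have c: "c > 0" "c\<^sup>2 = 2 * a" using assms by (auto simp: c_def)
  let ?g = "\<lambda>x. exp (- x\<^sup>2 / 2) * cos (b / c * x)"
  interpret real_distribution std_normal_distribution by (rule real_dist_normal_dist)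
  have n: "integrable lborel std_normal_density" using integrable_normal_density[of 1 0] by simp
  have i0: "integrable lborel (\<lambda>x. std_normal_density x * cos (b / c * x))"
    by (rule Bochner_Integration.integrable_bound[OF n]) (auto simp: abs_mult intro!: mult_left_le)
  have e: "?g = (\<lambda>x. sqrt (2 * pi) * (std_normal_density x * cos (b / c * x)))"
    by (auto simp: std_normal_density_def fun_eq_iff)
  have ig: "integrable lborel ?g" unfolding e using i0 by (rule integrable_mult_right)
  have "Re (char std_normal_distribution (b / c)) = (LINT x|std_normal_distribution. Re (iexp (b / c * x)))"
    unfolding char_def by (intro integral_Re[symmetric] integrable_iexp) auto
  also have "\<dots> = (LINT x|std_normal_distribution. cos (b / c * x))"
    by (simp add: Re_exp)
  also have "\<dots> = (LINT x|lborel. std_normal_density x * cos (b / c * x))"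
    by (subst integral_density) auto
  finally have "(LINT x|lborel. std_normal_density x * cos (b / c * x)) = exp (- (b / c)\<^sup>2 / 2)"
    by (simp add: char_std_normal_distribution)
  hence I: "(LINT x|lborel. ?g x) = sqrt (2 * pi) * exp (- (b / c)\<^sup>2 / 2)"
    unfolding e by simp
  have eq: "?g (0 + c * x) = exp (- a * x\<^sup>2) * cos (b * x)" for x
    using c by (simp add: power_mult_distrib)
  show "integrable lborel (\<lambda>x. exp (- a * x\<^sup>2) * cos (b * x))"
    using lborel_integrable_real_affine[OF ig, of c 0] c unfolding eq by simp
  have "(LINT x|lborel. ?g x) = c * (LINT x|lborel. exp (- a * x\<^sup>2) * cos (b * x))"
    using lborel_integral_real_affine[of c ?g 0] c unfolding eq by simp
  hence "(LINT x|lborel. exp (- a * x\<^sup>2) * cos (b * x)) = sqrt (2 * pi) / c * exp (- (b / c)\<^sup>2 / 2)"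
    using c I by (simp add: field_simps)
  also have "sqrt (2 * pi) / c = sqrt (pi / a)" unfolding c_def by (simp add: real_sqrt_divide real_sqrt_mult)
  also have "- (b / c)\<^sup>2 / 2 = - b\<^sup>2 / (4 * a)" using c by (simp add: power_divide)
  finally show "(LINT x|lborel. exp (- a * x\<^sup>2) * cos (b * x)) = sqrt (pi / a) * exp (- b\<^sup>2 / (4 * a))" .
qed

lemma integral_sum_unit_intervals:
  fixes F :: "real \<Rightarrow> real"
  assumes "continuous_on UNIV F"
  shows "(\<Sum>n\<in>{-int N..int N}. integral {real_of_int n..real_of_int n + 1} F) = integral {-real N..real N + 1} F"
proof (induction N)
  case (Suc N)
  have i: "F integrable_on {a..b}" for a b
    by (rule integrable_continuous_interval) (use assms continuous_on_subset in blast)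
  have "{-int (Suc N)..int (Suc N)} = insert (- int (Suc N)) (insert (int (Suc N)) {-int N..int N})" by auto
  hence "(\<Sum>n\<in>{-int (Suc N)..int (Suc N)}. integral {real_of_int n..real_of_int n + 1} F)
     = integral {-real (Suc N)..-real N} F + integral {real (Suc N)..real (Suc N) + 1} F + integral {-real N..real N + 1} F"
    using Suc by (simp add: algebra_simps)
  also have "\<dots> = integral {-real (Suc N)..real (Suc N) + 1} F"
    using Henstock_Kurzweil_Integration.integral_combine[where a="-real (Suc N)" and c="-real N" and b="real (Suc N)" and f=F]
          Henstock_Kurzweil_Integration.integral_combine[where a="-real (Suc N)" and c="real (Suc N)" and b="real (Suc N) + 1" and f=F]
 i
    by (simp add: algebra_simps)
  finally show ?case .
qed auto

lemma filterlim_int_interval: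
  "filterlim (\<lambda>N. {-int N..int N}) (finite_subsets_at_top UNIV) sequentially"
proof (subst filterlim_finite_subsets_at_top, intro allI impI)
  fix X :: "int set" assume X: "finite X \<and> X \<subseteq> UNIV"
  define B where "B = nat (\<Sum>x\<in>X. \<bar>x\<bar>)"
  have "X \<subseteq> {-int N..int N}" if "N \<ge> B" for N
  proof
    fix x assume "x \<in> X"
    hence "\<bar>x\<bar> \<le> (\<Sum>x\<in>X. \<bar>x\<bar>)" using X by (intro member_le_sum) auto
    thus "x \<in> {-int N..int N}" using that unfolding B_def by auto
  qed
  thus "\<forall>\<^sub>F N in sequentially. finite {-int N..int N} \<and> X \<subseteq> {-int N..int N} \<and> {-int N..int N} \<subseteq> UNIV"
    by (intro eventually_mono[OF eventually_ge_at_top[of B]]) auto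
qed

lemma exp_shift_bound:
  fixes a x :: real and n :: int
  assumes "a > 0" "0 \<le> x" "x \<le> 1"
  shows "exp (- a * (real_of_int n + x)\<^sup>2) \<le> exp a * exp (- (a/2) * (real_of_int n)\<^sup>2)"
proof -
  have "(real_of_int n)\<^sup>2 / 2 \<le> (real_of_int n + x)\<^sup>2 + x\<^sup>2"
    using zero_le_power2[of "real_of_int n + 2 * x"] by (simp add: power2_eq_square algebra_simps)
  moreover have "x\<^sup>2 \<le> 1" using assms by (simp add: power_le_one)
  ultimately have "(real_of_int n)\<^sup>2 / 2 \<le> (real_of_int n + x)\<^sup>2 + 1" by linarith
  hence "a * ((real_of_int n)\<^sup>2 / 2) \<le> a * ((real_of_int n + x)\<^sup>2 + 1)" using assms by (intro mult_left_mono) auto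
  thus ?thesis unfolding exp_add[symmetric] by (simp add: algebra_simps)
qed

text \<open>By the Weierstrass test the finite partial sums converge uniformly along the filter of
  finite sets, so continuity and the integral pass to the limit.\<close>

lemma has_sum_integral_unit:
  fixes f :: "'i \<Rightarrow> real \<Rightarrow> real"
  assumes c: "\<And>i. continuous_on {0..1} (f i)"
    and M: "\<And>i x. 0 \<le> x \<Longrightarrow> x \<le> 1 \<Longrightarrow> \<bar>f i x\<bar> \<le> M i" "M summable_on UNIV"
  shows "continuous_on {0..1} (\<lambda>x. \<Sum>\<^sub>\<infinity>i. f i x)"
    and "((\<lambda>i. integral {0..1} (f i)) has_sum integral {0..1} (\<lambda>x. \<Sum>\<^sub>\<infinity>i. f i x)) UNIV"
proof -
  have u: "uniform_limit {0..1} (\<lambda>X x. \<Sum>i\<in>X. f i x) (\<lambda>x. \<Sum>\<^sub>\<infinity>i. f i x) (finite_subsets_at_top UNIV)"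
    by (rule Weierstrass_m_test_general[OF _ M(2)]) (use M(1) in auto)
  have cs: "continuous_on {0..1} (\<lambda>x. \<Sum>i\<in>X. f i x)" for X
    by (intro continuous_on_sum c)
  show "continuous_on {0..1} (\<lambda>x. \<Sum>\<^sub>\<infinity>i. f i x)"
    by (rule uniform_limit_theorem[OF _ u]) (use cs in auto)
  obtain I J where IJ: "\<And>X. ((\<lambda>x. \<Sum>i\<in>X. f i x) has_integral I X) {0..1}"
    "((\<lambda>x. \<Sum>\<^sub>\<infinity>i. f i x) has_integral J) {0..1}" "(I \<longlongrightarrow> J) (finite_subsets_at_top UNIV)"
    using uniform_limit_integral[OF u cs] by auto
  have "I X = (\<Sum>i\<in>X. integral {0..1} (f i))" if "finite X" for X
  proof -
    have "I X = integral {0..1} (\<lambda>x. \<Sum>i\<in>X. f i x)" using IJ(1)[of X] by (simp add: has_integral_iff)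
    also have "\<dots> = (\<Sum>i\<in>X. integral {0..1} (f i))"
      by (rule integral_sum) (use that c in \<open>auto intro: integrable_continuous_interval\<close>)
    finally show ?thesis .
  qed
  hence "eventually (\<lambda>X. I X = (\<Sum>i\<in>X. integral {0..1} (f i))) (finite_subsets_at_top UNIV)"
    by (auto intro!: eventually_finite_subsets_at_top_weakI)
  with IJ(3) have "((\<lambda>X. (\<Sum>i\<in>X. integral {0..1} (f i))) \<longlongrightarrow> J) (finite_subsets_at_top UNIV)"
    by (rule Lim_transform_eventually)
  thus "((\<lambda>i. integral {0..1} (f i)) has_sum integral {0..1} (\<lambda>x. \<Sum>\<^sub>\<infinity>i. f i x)) UNIV"
    using IJ(2) by (simp add: has_sum_def has_integral_iff)
qed

text \<open>Unfolding: the cosine has period one, so the integrals over the unit intervals add up to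
  the integral over the whole line, which is the Fourier transform of the Gaussian.\<close>

lemma gauss_periodized:
  fixes a :: real and j :: int
  assumes a: "a > 0"
  shows "continuous_on {0..1} (\<lambda>x. \<Sum>\<^sub>\<infinity>n::int. exp (- a * (real_of_int n + x)\<^sup>2))"
    and "integral {0..1} (\<lambda>x. (\<Sum>\<^sub>\<infinity>n::int. exp (- a * (real_of_int n + x)\<^sup>2)) * cos (2 * pi * j * x))
       = sqrt (pi / a) * exp (- (pi\<^sup>2 / a) * (real_of_int j)\<^sup>2)"
proof -
  define F where "F = (\<lambda>x. exp (- a * x\<^sup>2) * cos (2 * pi * j * x))"
  have cF: "continuous_on UNIV F" unfolding F_def by (intro continuous_intros)
  have per: "cos (2 * pi * j * (n + x)) = cos (2 * pi * j * x)" for n :: int and x :: real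
  proof -
    have "2 * pi * j * (n + x) = 2 * pi * j * x + 2 * pi * real_of_int (j * n)" by (simp add: algebra_simps)
    thus ?thesis by (simp only: cos_add sin_int_2pin cos_int_2pin mult_zero_right diff_zero mult_1_right)
  qed
  define M where "M = (\<lambda>n::int. exp a * exp (- (a/2) * (real_of_int n)\<^sup>2))"
  have M: "M summable_on UNIV"
    unfolding M_def by (intro summable_on_cmult_right summable_gauss_int) (use a in auto)
  have b: "\<bar>exp (- a * (real_of_int n + x)\<^sup>2)\<bar> \<le> M n" if "0 \<le> x" "x \<le> 1" for n x
    unfolding M_def using exp_shift_bound[OF a that] by simp
  show "continuous_on {0..1} (\<lambda>x. \<Sum>\<^sub>\<infinity>n::int. exp (- a * (real_of_int n + x)\<^sup>2))"
    by (rule has_sum_integral_unit(1)[OF _ b M]) (intro continuous_intros)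
  have bF: "\<bar>F (real_of_int n + x)\<bar> \<le> M n" if "0 \<le> x" "x \<le> 1" for n x
  proof -
    have "\<bar>F (real_of_int n + x)\<bar> \<le> exp (- a * (real_of_int n + x)\<^sup>2) * 1"
      unfolding F_def abs_mult by (intro mult_mono) auto
    thus ?thesis using b[OF that, of n] by simp
  qed
  have hs: "((\<lambda>n. integral {0..1} (\<lambda>x. F (real_of_int n + x))) has_sum integral {0..1} (\<lambda>x. \<Sum>\<^sub>\<infinity>n::int. F (real_of_int n + x))) UNIV"
    by (rule has_sum_integral_unit(2)[OF _ bF M]) (unfold F_def, intro continuous_intros)
  have sh: "integral {0..1} (\<lambda>x. F (real_of_int n + x)) = integral {real_of_int n..real_of_int n + 1} F" for n :: int
    using integral_shift_Icc_real[of 0 1 F "real_of_int n"] by (simp add: comp_def add.commute)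
  have "(\<lambda>N. \<Sum>n\<in>{-int N..int N}. integral {real_of_int n..real_of_int n + 1} F) \<longlonglongrightarrow> integral {0..1} (\<lambda>x. \<Sum>\<^sub>\<infinity>n::int. F (real_of_int n + x))"
    using filterlim_compose[OF hs[unfolded has_sum_def] filterlim_int_interval] unfolding sh .
  hence l1: "(\<lambda>N. integral {-real N..real N + 1} F) \<longlonglongrightarrow> integral {0..1} (\<lambda>x. \<Sum>\<^sub>\<infinity>n::int. F (real_of_int n + x))"
    by (simp add: integral_sum_unit_intervals[OF cF])
  have gi: "integrable lborel (\<lambda>x. exp (- a * x\<^sup>2) * cos (0 * x))" by (rule gauss_fourier(1)[OF a])
  have hi: "(\<lambda>x. exp (- a * x\<^sup>2)) integrable_on UNIV"
    using has_integral_integral_lborel[OF gi] by (simp add: integrable_on_def) blast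
  have Fi: "integrable lborel F" unfolding F_def by (rule gauss_fourier(1)[OF a])
  have l2: "(\<lambda>N. integral UNIV (\<lambda>x. if x \<in> {-real N..real N + 1} then F x else 0)) \<longlonglongrightarrow> integral UNIV F"
  proof (rule dominated_convergence(2)[OF _ hi])
    fix k :: nat
    show "(\<lambda>x. if x \<in> {-real k..real k + 1} then F x else 0) integrable_on UNIV"
      unfolding integrable_restrict_UNIV
      by (rule integrable_continuous_interval) (use cF continuous_on_subset in blast)
    fix x :: real
    have "\<bar>F x\<bar> \<le> exp (- a * x\<^sup>2) * 1"
      unfolding F_def abs_mult by (intro mult_mono) auto
    thus "norm (if x \<in> {-real k..real k + 1} then F x else 0) \<le> exp (- a * x\<^sup>2)" by auto
  next
    fix x :: real
    obtain K :: nat where K: "\<bar>x\<bar> \<le> real K" using real_arch_simple by blast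
    have "eventually (\<lambda>k. (if x \<in> {-real k..real k + 1} then F x else 0) = F x) sequentially"
      using eventually_ge_at_top[of K] by eventually_elim (use K in auto)
    thus "(\<lambda>k. if x \<in> {-real k..real k + 1} then F x else 0) \<longlonglongrightarrow> F x"
      by (simp add: tendsto_eventually)
  qed
  have "integral {0..1} (\<lambda>x. \<Sum>\<^sub>\<infinity>n::int. F (real_of_int n + x)) = integral UNIV F"
    using LIMSEQ_unique[OF l1] l2 by (simp only: integral_restrict_UNIV)
  also have "\<dots> = (LINT x|lborel. F x)"
    using has_integral_integral_lborel[OF Fi] by (rule integral_unique)
  also have "\<dots> = sqrt (pi / a) * exp (- (2 * pi * j)\<^sup>2 / (4 * a))"
    unfolding F_def by (rule gauss_fourier(2)[OF a])
  also have "- (2 * pi * j)\<^sup>2 / (4 * a) = - (pi\<^sup>2 / a) * (real_of_int j)\<^sup>2" by (simp add: power_mult_distrib)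
  finally have "integral {0..1} (\<lambda>x. \<Sum>\<^sub>\<infinity>n::int. F (real_of_int n + x)) = sqrt (pi / a) * exp (- (pi\<^sup>2 / a) * (real_of_int j)\<^sup>2)" .
  moreover have "(\<Sum>\<^sub>\<infinity>n::int. F (real_of_int n + x)) = (\<Sum>\<^sub>\<infinity>n::int. exp (- a * (real_of_int n + x)\<^sup>2)) * cos (2 * pi * j * x)" for x
    unfolding F_def per by (rule infsum_cmult_left')
  ultimately show "integral {0..1} (\<lambda>x. (\<Sum>\<^sub>\<infinity>n::int. exp (- a * (real_of_int n + x)\<^sup>2)) * cos (2 * pi * j * x))
       = sqrt (pi / a) * exp (- (pi\<^sup>2 / a) * (real_of_int j)\<^sup>2)" by simp
qed

text \<open>The symmetry makes \<open>d\<close> a continuous function \<open>psi\<close> of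
  \<open>cos (2 * pi * x)\<close>. Vanishing cosine coefficients make \<open>d\<close> orthogonal to
  every polynomial in this cosine, and uniform polynomial approximation of \<open>psi\<close> forces
  the integral of \<open>d * d\<close> to vanish.\<close>

lemma even_fourier_zero:
  fixes d :: "real \<Rightarrow> real"
  assumes cont: "continuous_on {0..1} d"
    and sym: "\<And>x. 0 \<le> x \<Longrightarrow> x \<le> 1 \<Longrightarrow> d (1 - x) = d x"
    and coef: "\<And>j::int. integral {0..1} (\<lambda>x. d x * cos (2 * pi * j * x)) = 0"
    and x: "0 \<le> x" "x \<le> 1"
  shows "d x = 0"
proof -
  have int: "f integrable_on {0..1}" if "continuous_on {0..1} f" for f :: "real \<Rightarrow> real"
    using that by (rule integrable_continuous_interval)
  have pw: "integral {0..1} (\<lambda>x. d x * cos (2 * pi * x) ^ k * cos (2 * pi * j * x)) = 0" for k and j :: int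
  proof (induction k arbitrary: j)
    case (Suc k)
    have "d x * cos (2 * pi * x) ^ Suc k * cos (2 * pi * j * x)
       = (1/2) * (d x * cos (2 * pi * x) ^ k * cos (2 * pi * (j + 1 :: int) * x))
         + (1/2) * (d x * cos (2 * pi * x) ^ k * cos (2 * pi * (j - 1 :: int) * x))" for x
    proof -
      have "cos (2 * pi * x) * cos (2 * pi * j * x) =
            (cos (2 * pi * (j + 1 :: int) * x) + cos (2 * pi * (j - 1 :: int) * x)) / 2"
        by (simp add: algebra_simps cos_add cos_diff)
      moreover have "d x * cos (2 * pi * x) ^ Suc k * cos (2 * pi * j * x)
         = d x * cos (2 * pi * x) ^ k * (cos (2 * pi * x) * cos (2 * pi * j * x))" by simp
      ultimately show ?thesis by (simp only: distrib_left add_divide_distrib times_divide_eq_right mult_1_left mult.assoc)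
    qed
    thus ?case
      using Suc[of "j + 1"] Suc[of "j - 1"]
      by (simp only: ) (subst integral_add; (intro int continuous_intros cont)?; simp)
  qed (simp add: coef)
  define psi where "psi = (\<lambda>u. d (arccos u / (2 * pi)))"
  have dpsi: "d x = psi (cos (2 * pi * x))" if x: "0 \<le> x" "x \<le> 1" for x
  proof (cases "x \<le> 1/2")
    case True
    thus ?thesis using x by (simp add: psi_def arccos_cos)
  next
    case False
    have "cos (2 * pi * x) = cos (2 * pi * (1 - x))" by (simp add: algebra_simps cos_diff)
    hence "psi (cos (2 * pi * x)) = d (1 - x)"
      using x False by (simp add: psi_def arccos_cos)
    thus ?thesis using sym x by simp
  qed
  have cpsi: "continuous_on {-1..1} psi"
    unfolding psi_def
  proof (rule continuous_on_compose2[OF cont])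
    show "continuous_on {-1..1} (\<lambda>u. arccos u / (2 * pi))" by (intro continuous_intros) auto
    show "(\<lambda>u. arccos u / (2 * pi)) ` {-1..1} \<subseteq> {0..1}"
    proof
      fix v assume "v \<in> (\<lambda>u. arccos u / (2 * pi)) ` {-1..1}"
      then obtain u where u: "-1 \<le> u" "u \<le> 1" "v = arccos u / (2 * pi)" by auto
      have "arccos u \<le> 2 * pi" using arccos_ubound[OF u(1,2)] pi_gt_zero by linarith
      thus "v \<in> {0..1}" using arccos_lbound[OF u(1,2)] u(3) by simp
    qed
  qed
  obtain B where B: "\<And>x. x \<in> {0..1} \<Longrightarrow> \<bar>d x\<bar> \<le> B"
    using compact_imp_bounded[OF compact_continuous_image[OF cont compact_Icc]]
    unfolding bounded_iff by (metis imageI real_norm_def)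
  have B0: "B \<ge> 0" using B[of 0] by auto
  have "integral {0..1} (\<lambda>x. d x * d x) \<le> e" if e: "e > 0" for e :: real
  proof -
    \<comment> \<open>\<open>B + 1\<close> keeps the denominator positive when the bound
      \<open>B\<close> is zero.\<close>
    define e' where "e' = e / (B + 1)"
    have e': "e' > 0" unfolding e'_def using e B0 by simp
    obtain g where g: "real_polynomial_function g" "\<And>u. u \<in> {-1..1} \<Longrightarrow> \<bar>psi u - g u\<bar> < e'"
      using Stone_Weierstrass_real_polynomial_function[OF compact_Icc cpsi e'] by blast
    obtain a n where gs: "g = (\<lambda>x. \<Sum>i\<le>(n::nat). a i * x ^ i)"
      using real_polynomial_function_imp_sum[OF g(1)] by blast
    have "integral {0..1} (\<lambda>x. d x * g (cos (2 * pi * x))) = (\<Sum>i\<le>n. a i * integral {0..1} (\<lambda>x. d x * cos (2 * pi * x) ^ i))"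
      unfolding gs sum_distrib_left
      by (subst integral_sum; (intro int continuous_intros cont)?; simp add: mult.left_commute)
    also have "\<dots> = 0" using pw[of _ 0] by simp
    finally have "integral {0..1} (\<lambda>x. d x * d x) = integral {0..1} (\<lambda>x. d x * d x) - integral {0..1} (\<lambda>x. d x * g (cos (2 * pi * x)))"
      by simp
    also have "\<dots> = integral {0..1} (\<lambda>x. d x * d x - d x * g (cos (2 * pi * x)))"
      unfolding gs by (rule integral_diff[symmetric]; intro int continuous_intros cont)
    also have "\<dots> \<le> integral {0..1} (\<lambda>x::real. B * e')"
    proof (rule integral_le)
      fix x :: real assume x: "x \<in> {0..1}"
      have "d x * d x - d x * g (cos (2 * pi * x)) = d x * (psi (cos (2 * pi * x)) - g (cos (2 * pi * x)))"
        using x dpsi[of x] by (simp add: algebra_simps)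
      also have "\<dots> \<le> \<bar>d x\<bar> * \<bar>psi (cos (2 * pi * x)) - g (cos (2 * pi * x))\<bar>"
        by (metis abs_ge_self abs_mult)
      also have "\<dots> \<le> B * e'"
        using B[OF x] B0 g(2)[of "cos (2 * pi * x)"] by (intro mult_mono) auto
      finally show "d x * d x - d x * g (cos (2 * pi * x)) \<le> B * e'" .
    qed ((unfold gs)?, intro int continuous_intros cont)+
    also have "\<dots> = B * e'" by simp
    also have "\<dots> \<le> e" unfolding e'_def using e B0 by (simp add: field_simps)
    finally show ?thesis .
  qed
  hence "integral {0..1} (\<lambda>x. d x * d x) \<le> 0" by (rule field_le_epsilon[of _ 0, simplified])
  moreover have "integral {0..1} (\<lambda>x. d x * d x) \<ge> 0"
    by (rule integral_nonneg) (intro int continuous_intros cont, auto)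
  ultimately have "integral {0..1} (\<lambda>x. d x * d x) = 0" by simp
  hence "\<forall>x\<in>{0..1}. d x * d x = 0"
    using integral_eq_0_iff[of 0 1 "\<lambda>x. d x * d x", OF continuous_on_mult[OF cont cont]] by simp
  thus ?thesis using x by auto
qed

lemma integral_cos_int:
  "integral {0..1} (\<lambda>x. cos (2 * pi * real_of_int l * x)) = (if l = 0 then 1 else 0)"
proof (cases "l = 0")
  case False
  have "((\<lambda>x. cos (2 * pi * real_of_int l * x)) has_integral
     (sin (2 * pi * real_of_int l * 1) / (2 * pi * real_of_int l) - sin (2 * pi * real_of_int l * 0) / (2 * pi * real_of_int l))) {0..1}"
    using False
    by (intro fundamental_theorem_of_calculus)
       (auto intro!: derivative_eq_intros simp: has_real_derivative_iff_has_vector_derivative[symmetric])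
  thus ?thesis using False by (simp add: integral_unique)
qed simp

text \<open>Both sides are continuous and symmetric under \<open>x \<mapsto> 1 - x\<close>, so equal
  cosine coefficients give equality on the unit interval; periodicity extends it to all
  \<open>x\<close>.\<close>

theorem poisson_gauss:
  fixes a x :: real
  assumes a: "a > 0"
  shows "(\<Sum>\<^sub>\<infinity>n::int. exp (- a * (real_of_int n + x)\<^sup>2))
       = (\<Sum>\<^sub>\<infinity>k::int. sqrt (pi / a) * exp (- (pi\<^sup>2 / a) * (real_of_int k)\<^sup>2) * cos (2 * pi * real_of_int k * x))"
proof -
  define f where "f = (\<lambda>x. \<Sum>\<^sub>\<infinity>n::int. exp (- a * (real_of_int n + x)\<^sup>2))"
  define c where "c = (\<lambda>k::int. sqrt (pi / a) * exp (- (pi\<^sup>2 / a) * (real_of_int k)\<^sup>2))"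
  define g where "g = (\<lambda>x. \<Sum>\<^sub>\<infinity>k::int. c k * cos (2 * pi * real_of_int k * x))"
  have c0: "c k \<ge> 0" and cm: "c (-k) = c k" for k using a by (auto simp: c_def intro!: mult_nonneg_nonneg)
  have c: "c summable_on UNIV"
    unfolding c_def by (intro summable_on_cmult_right summable_gauss_int) (use a in auto)
  have bc: "\<bar>c k * cos y\<bar> \<le> c k" for k y
    using c0 by (simp add: abs_mult mult_left_le)
  have bcc: "\<bar>c k * cos y * cos z\<bar> \<le> c k" for k y z
    using mult_mono[OF bc[of k y], of "\<bar>cos z\<bar>" 1] c0 by (simp add: abs_mult)
  have cg: "continuous_on {0..1} g"
    unfolding g_def by (rule has_sum_integral_unit(1)[OF _ bc c]) (intro continuous_intros)
  have cf: "continuous_on {0..1} f" unfolding f_def by (rule gauss_periodized(1)[OF a])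
  have gcoef: "integral {0..1} (\<lambda>x. g x * cos (2 * pi * j * x)) = c j" for j :: int
  proof -
    have "((\<lambda>k. integral {0..1} (\<lambda>x. c k * cos (2 * pi * real_of_int k * x) * cos (2 * pi * j * x))) has_sum
      integral {0..1} (\<lambda>x. \<Sum>\<^sub>\<infinity>k::int. c k * cos (2 * pi * real_of_int k * x) * cos (2 * pi * j * x))) UNIV"
      by (rule has_sum_integral_unit(2)[OF _ bcc c]) (intro continuous_intros)
    moreover have "(\<Sum>\<^sub>\<infinity>k::int. c k * cos (2 * pi * real_of_int k * x) * cos (2 * pi * j * x)) = g x * cos (2 * pi * j * x)" for x
      unfolding g_def by (rule infsum_cmult_left')
    \<comment> \<open>The product formula for cosines picks the indices \<open>j\<close> and
      \<open>- j\<close> with weight one half each. For \<open>j = 0\<close> the two indicators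
      coincide and together give full weight.\<close>
    moreover have "integral {0..1} (\<lambda>x. c k * cos (2 * pi * real_of_int k * x) * cos (2 * pi * j * x))
       = c k / 2 * (if k = j then 1 else 0) + c k / 2 * (if k = -j then 1 else 0)" for k
    proof -
      have e: "c k * cos (2 * pi * real_of_int k * x) * cos (2 * pi * j * x) =
         c k / 2 * cos (2 * pi * real_of_int (k - j) * x) + c k / 2 * cos (2 * pi * real_of_int (k + j) * x)" for x
        by (simp add: algebra_simps cos_add cos_diff)
      have "integral {0..1} (\<lambda>x. c k / 2 * cos (2 * pi * real_of_int (k - j) * x) + c k / 2 * cos (2 * pi * real_of_int (k + j) * x))
         = integral {0..1} (\<lambda>x. c k / 2 * cos (2 * pi * real_of_int (k - j) * x)) + integral {0..1} (\<lambda>x. c k / 2 * cos (2 * pi * real_of_int (k + j) * x))"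
        by (rule integral_add; intro integrable_continuous_interval continuous_intros)
      also have "\<dots> = c k / 2 * (if k - j = 0 then 1 else 0) + c k / 2 * (if k + j = 0 then 1 else 0)"
        by (simp only: integral_mult_right integral_cos_int)
      also have "\<dots> = c k / 2 * (if k = j then 1 else 0) + c k / 2 * (if k = -j then 1 else 0)"
        by auto
      finally show ?thesis unfolding e .
    qed
    ultimately have 1: "((\<lambda>k. c k / 2 * (if k = j then 1 else 0) + c k / 2 * (if k = -j then 1 else 0)) has_sum
       integral {0..1} (\<lambda>x. g x * cos (2 * pi * j * x))) UNIV" by simp
    have s: "((\<lambda>k. c k / 2 * (if k = i then 1 else 0)) has_sum c i / 2) UNIV" for i :: int
      by (rule has_sum_finite_neutralI[of "{i}"]) auto
    have "((\<lambda>k. c k / 2 * (if k = j then 1 else 0) + c k / 2 * (if k = -j then 1 else 0)) has_sum (c j / 2 + c (-j) / 2)) UNIV"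
      by (intro has_sum_add s)
    from has_sum_unique[OF 1 this] show ?thesis by (simp add: cm)
  qed
  have main: "f x = g x" if x: "0 \<le> x" "x \<le> 1" for x
  proof -
    define d where "d = (\<lambda>x. f x - g x)"
    have "d x = 0"
    proof (rule even_fourier_zero[OF _ _ _ x])
      show "continuous_on {0..1} d" unfolding d_def by (intro continuous_intros cf cg)
      fix y :: real
      have "f (1 - y) = f y"
        unfolding f_def
        by (rule infsum_reindex_bij_witness[of _ "\<lambda>n. -n - 1" "\<lambda>n. -n - 1"])
           (auto simp: power2_eq_square algebra_simps)
      moreover have "g (1 - y) = g y"
      proof -
        have "cos (2 * pi * real_of_int k * (1 - y)) = cos (2 * pi * real_of_int k * y)" for k :: int
        proof -
          have "2 * pi * real_of_int k * (1 - y) = 2 * pi * real_of_int k - 2 * pi * real_of_int k * y" by (simp add: algebra_simps)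
          thus ?thesis by (simp only: cos_diff sin_int_2pin cos_int_2pin mult_1_left mult_zero_left add_0_right)
        qed
        thus ?thesis unfolding g_def by simp
      qed
      ultimately show "d (1 - y) = d y" by (simp add: d_def)
    next
      fix j :: int
      have "integral {0..1} (\<lambda>x. d x * cos (2 * pi * j * x)) =
         integral {0..1} (\<lambda>x. f x * cos (2 * pi * j * x)) - integral {0..1} (\<lambda>x. g x * cos (2 * pi * j * x))"
        unfolding d_def left_diff_distrib
        by (rule integral_diff; intro integrable_continuous_interval continuous_intros cf cg)
      also have "\<dots> = 0"
        unfolding gcoef unfolding f_def gauss_periodized(2)[OF a] c_def by simp
      finally show "integral {0..1} (\<lambda>x. d x * cos (2 * pi * j * x)) = 0" .
    qed
    thus ?thesis by (simp add: d_def)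
  qed
  have "f x = f (frac x)"
    unfolding f_def
    by (rule infsum_reindex_bij_witness[of _ "\<lambda>n. n - \<lfloor>x\<rfloor>" "\<lambda>n. n + \<lfloor>x\<rfloor>"]) (auto simp: frac_def)
  also have "\<dots> = g (frac x)" by (rule main) (auto simp: less_imp_le[OF frac_lt_1])
  also have "\<dots> = g x"
  proof -
    have "cos (2 * pi * real_of_int k * frac x) = cos (2 * pi * real_of_int k * x)" for k :: int
    proof -
      have "2 * pi * real_of_int k * frac x = 2 * pi * real_of_int k * x - 2 * pi * real_of_int (k * \<lfloor>x\<rfloor>)"
        by (simp add: frac_def algebra_simps)
      thus ?thesis by (simp only: cos_diff sin_int_2pin cos_int_2pin mult_1_right mult_zero_right add_0_right)
    qed
    thus ?thesis unfolding g_def by simp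
  qed
  finally show ?thesis unfolding f_def g_def c_def .
qed

section \<open>The theta function and its logarithmic derivatives in the parameter\<close>

lemma half_mult_le: "a * b \<le> c \<Longrightarrow> a / 2 * b \<le> c / 2" for a b c :: real
  by simp

definition lat_form :: "real \<Rightarrow> real \<Rightarrow> real \<Rightarrow> int \<times> int \<Rightarrow> real" where
  "lat_form x y s = (\<lambda>(m, n). pi * s * ((m * x + n)\<^sup>2 + (m * y)\<^sup>2) / y)"

text \<open>The exponent that Poisson summation in \<open>n\<close> produces, with \<open>k\<close>
  dual to \<open>n\<close>. At \<open>s = exp t\<close> its derivative in \<open>t\<close> is
  \<open>dual_diff\<close>, whose derivative is \<open>dual_sum\<close> again; \<open>cosmk\<close>
  is the accompanying phase.\<close>

definition dual_sum :: "real \<Rightarrow> real \<Rightarrow> int \<times> int \<Rightarrow> real" where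
  "dual_sum y s = (\<lambda>(m, k). pi * y * (s * m\<^sup>2 + k\<^sup>2 / s))"

definition dual_diff :: "real \<Rightarrow> real \<Rightarrow> int \<times> int \<Rightarrow> real" where
  "dual_diff y s = (\<lambda>(m, k). pi * y * (s * m\<^sup>2 - k\<^sup>2 / s))"

definition cosmk :: "real \<Rightarrow> int \<times> int \<Rightarrow> real" where
  "cosmk x = (\<lambda>(m, k). cos (2 * pi * m * k * x))"

abbreviation sqn :: "int \<times> int \<Rightarrow> real" where
  "sqn i \<equiv> (real_of_int (fst i))\<^sup>2 + (real_of_int (snd i))\<^sup>2"

text \<open>The smaller eigenvalue of a positive binary form is at least its determinant divided by
  its trace; here these are \<open>y\<^sup>2\<close> and \<open>1 + x\<^sup>2 + y\<^sup>2\<close>,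
  and the gap is an explicit sum of two squares.\<close>

lemma lat_form_ge:
  assumes "y > 0" "s \<ge> 0"
  shows "pi * s * y / (1 + x\<^sup>2 + y\<^sup>2) * sqn i \<le> lat_form x y s i"
proof (cases i)
  case (Pair m n)
  let ?m = "real_of_int m" and ?n = "real_of_int n"
  have T: "1 + x\<^sup>2 + y\<^sup>2 > 0" by (intro add_pos_nonneg) auto
  have "(1 + x\<^sup>2 + y\<^sup>2) * ((?m * x + ?n)\<^sup>2 + (?m * y)\<^sup>2) - y\<^sup>2 * (?m\<^sup>2 + ?n\<^sup>2)
      = ((x\<^sup>2 + y\<^sup>2) * ?m + x * ?n)\<^sup>2 + (x * ?m + ?n)\<^sup>2"
    by (simp add: power2_eq_square algebra_simps)
  also have "\<dots> \<ge> 0" by simp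
  finally have "y\<^sup>2 * (?m\<^sup>2 + ?n\<^sup>2) \<le> (1 + x\<^sup>2 + y\<^sup>2) * ((?m * x + ?n)\<^sup>2 + (?m * y)\<^sup>2)" by simp
  hence "y\<^sup>2 * (?m\<^sup>2 + ?n\<^sup>2) / (1 + x\<^sup>2 + y\<^sup>2) \<le> (?m * x + ?n)\<^sup>2 + (?m * y)\<^sup>2"
    using T by (simp add: divide_le_eq mult.commute)
  hence "pi * s / y * (y\<^sup>2 * (?m\<^sup>2 + ?n\<^sup>2) / (1 + x\<^sup>2 + y\<^sup>2)) \<le> pi * s / y * ((?m * x + ?n)\<^sup>2 + (?m * y)\<^sup>2)"
    using assms by (intro mult_left_mono) auto
  moreover have "pi * s / y * (y\<^sup>2 * (?m\<^sup>2 + ?n\<^sup>2) / (1 + x\<^sup>2 + y\<^sup>2)) = pi * s * y / (1 + x\<^sup>2 + y\<^sup>2) * sqn i"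
    using assms by (simp add: Pair power2_eq_square)
  ultimately show ?thesis by (simp add: Pair lat_form_def)
qed

lemma lat_form_nonneg: "y > 0 \<Longrightarrow> s \<ge> 0 \<Longrightarrow> lat_form x y s i \<ge> 0"
  by (auto simp: lat_form_def split: prod.splits)

lemma dual_sum_nonneg: "y > 0 \<Longrightarrow> s \<ge> 0 \<Longrightarrow> dual_sum y s i \<ge> 0"
  by (auto simp: dual_sum_def split: prod.splits)

lemma dual_diff_le: 
  assumes "y > 0" "s \<ge> 0"
  shows "\<bar>dual_diff y s i\<bar> \<le> dual_sum y s i"
proof (cases i)
  case (Pair m k)
  have "\<bar>s * (real_of_int m)\<^sup>2 - (real_of_int k)\<^sup>2 / s\<bar> \<le> s * (real_of_int m)\<^sup>2 + (real_of_int k)\<^sup>2 / s"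
    using assms by (simp add: abs_le_iff)
  thus ?thesis using assms by (simp add: Pair dual_diff_def dual_sum_def abs_mult)
qed

lemma dual_sum_ge:
  assumes "y > 0"
  shows "pi * y * exp (-\<bar>t\<bar>) * sqn i \<le> dual_sum y (exp t) i"
proof (cases i)
  case (Pair m k)
  have "exp (-\<bar>t\<bar>) * (real_of_int m)\<^sup>2 \<le> exp t * (real_of_int m)\<^sup>2"
       "exp (-\<bar>t\<bar>) * (real_of_int k)\<^sup>2 \<le> exp (-t) * (real_of_int k)\<^sup>2"
    by (intro mult_right_mono; simp)+
  hence "pi * y * (exp (-\<bar>t\<bar>) * sqn i) \<le> pi * y * (exp t * (real_of_int m)\<^sup>2 + exp (-t) * (real_of_int k)\<^sup>2)"
    using assms unfolding distrib_left Pair by (intro add_mono mult_left_mono) auto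
  thus ?thesis by (simp add: Pair dual_sum_def exp_minus field_simps)
qed

text \<open>\<open>59 = 1 + 2 + 8 + 48\<close> adds the bounds
  \<open>w ^ k \<le> 2 ^ k * fact k * exp (w / 2)\<close> for \<open>k \<le> 3\<close>.\<close>

lemma cubic_le_exp:
  fixes w :: real
  assumes "w \<ge> 0"
  shows "1 + w + w\<^sup>2 + w ^ 3 \<le> 59 * exp (w / 2)"
proof -
  have e: "(w / 2) ^ k / fact k \<le> exp (w / 2)" for k :: nat
  proof -
    have "(\<Sum>n\<in>{k}. (w/2) ^ n /\<^sub>R fact n) \<le> (\<Sum>n. (w/2) ^ n /\<^sub>R fact n)"
    proof (rule sum_le_suminf[OF summable_exp_generic])
      show "0 \<le> (w/2) ^ n /\<^sub>R fact n" for n :: nat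
        unfolding real_scaleR_def using assms by (intro mult_nonneg_nonneg zero_le_power) auto
    qed simp
    thus ?thesis unfolding exp_def real_scaleR_def by (simp only: sum.insert finite.emptyI empty_iff sum.empty not_False_eq_True add_0_right divide_inverse mult.commute)
  qed
  have "1 \<le> exp (w/2)" "w \<le> 2 * exp (w/2)" "w\<^sup>2 \<le> 8 * exp (w/2)" "w ^ 3 \<le> 48 * exp (w/2)"
    using assms e[of 1] e[of 2] e[of 3] by (simp_all add: power_divide fact_numeral)
  thus ?thesis by linarith
qed

text \<open>Half of the exponent absorbs the polynomial, the other half remains as decay.\<close>

lemma poly_exp_bound:
  fixes w p K :: real
  assumes "w \<ge> 0" "\<bar>p\<bar> \<le> K * (1 + w + w\<^sup>2 + w ^ 3)" "c \<le> w / 2" "K \<ge> 0"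
  shows "\<bar>p * exp (-w)\<bar> \<le> 59 * K * exp (-c)"
proof -
  have "\<bar>p * exp (-w)\<bar> \<le> K * (59 * exp (w/2)) * exp (-w)"
    unfolding abs_mult using assms(2) mult_left_mono[OF cubic_le_exp[OF assms(1)] assms(4)]
    by (intro mult_mono) auto
  also have "\<dots> = 59 * K * exp (- (w/2))"
    using exp_add[of "w/2" "-w"] by simp
  also have "\<dots> \<le> 59 * K * exp (-c)" using assms by (intro mult_left_mono) auto
  finally show ?thesis .
qed

lemma summable_on_poly_exp:
  fixes w p :: "int \<times> int \<Rightarrow> real"
  assumes c: "c > 0" and w: "\<And>i. c * sqn i \<le> w i"
    and p: "\<And>i. i \<in> A \<Longrightarrow> \<bar>p i\<bar> \<le> K * (1 + w i + (w i)\<^sup>2 + (w i) ^ 3)" and K: "K \<ge> 0"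
  shows "(\<lambda>i. p i * exp (- w i)) summable_on A"
proof -
  have w0: "w i \<ge> 0" for i using w[of i] c by (meson add_nonneg_nonneg mult_nonneg_nonneg order_trans less_imp_le zero_le_power2)
  have "(\<lambda>i. exp (- (c/2) * sqn i)) summable_on UNIV"
    using summable_gauss_int2[of "c/2"] c by (simp add: case_prod_unfold)
  hence "(\<lambda>i. 59 * K * exp (- (c/2) * sqn i)) summable_on A"
    by (intro summable_on_cmult_right) (rule summable_on_subset_banach[of _ UNIV], auto)
  moreover have "norm (p i * exp (- w i)) \<le> 59 * K * exp (- (c/2) * sqn i)" if "i \<in> A" for i
  proof -
    have "(c/2) * sqn i \<le> w i / 2" using w[of i] by (rule half_mult_le)
    from poly_exp_bound[OF w0 p[OF that] this K] show ?thesis by (simp only: real_norm_def mult_minus_left)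
  qed
  ultimately have "(\<lambda>i. norm (p i * exp (- w i))) summable_on A"
    by (intro summable_on_comparison_test[of _ A "\<lambda>i. norm (p i * exp (- w i))"]) auto
  thus ?thesis by (rule abs_summable_summable)
qed

lemma summable_lat:
  assumes "y > 0" "s > 0"
    and "\<And>i. i \<in> A \<Longrightarrow> \<bar>p i\<bar> \<le> K * (1 + lat_form x y s i + (lat_form x y s i)\<^sup>2 + (lat_form x y s i) ^ 3)" "K \<ge> 0"
  shows "(\<lambda>i. p i * exp (- lat_form x y s i)) summable_on A"
proof (rule summable_on_poly_exp[OF _ _ assms(3,4)])
  show "0 < pi * s * y / (1 + x\<^sup>2 + y\<^sup>2)"
    using assms by (intro divide_pos_pos mult_pos_pos add_pos_nonneg) auto
  show "pi * s * y / (1 + x\<^sup>2 + y\<^sup>2) * sqn i \<le> lat_form x y s i" for i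
    using assms by (intro lat_form_ge) auto
qed

lemma summable_dual:
  assumes "y > 0" "s > 0"
    and "\<And>i. i \<in> A \<Longrightarrow> \<bar>p i\<bar> \<le> K * (1 + dual_sum y s i + (dual_sum y s i)\<^sup>2 + (dual_sum y s i) ^ 3)" "K \<ge> 0"
  shows "(\<lambda>i. p i * exp (- dual_sum y s i)) summable_on A"
proof (rule summable_on_poly_exp[OF _ _ assms(3,4)])
  show "0 < pi * y * exp (-\<bar>ln s\<bar>)" using assms by auto
  show "pi * y * exp (-\<bar>ln s\<bar>) * sqn i \<le> dual_sum y s i" for i
    using dual_sum_ge[of y "ln s" i] assms by simp
qed

text \<open>\<open>Gsum\<close> is \<open>sqrt s * theta s (x + iy)\<close> at \<open>s = exp t\<close>; \<open>exp (t/2) * Usum\<close> and \<open>exp (t/2) * Vsum\<close> are its first two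
  derivatives in \<open>t\<close>.\<close>

definition Gsum :: "(int \<times> int) set \<Rightarrow> real \<Rightarrow> real \<Rightarrow> real \<Rightarrow> real" where
  "Gsum A x y t = (\<Sum>\<^sub>\<infinity>i\<in>A. exp (t/2) * exp (- lat_form x y (exp t) i))"

definition Usum :: "(int \<times> int) set \<Rightarrow> real \<Rightarrow> real \<Rightarrow> real \<Rightarrow> real" where
  "Usum A x y s = (\<Sum>\<^sub>\<infinity>i\<in>A. (1/2 - lat_form x y s i) * exp (- lat_form x y s i))"

definition Vsum :: "(int \<times> int) set \<Rightarrow> real \<Rightarrow> real \<Rightarrow> real \<Rightarrow> real" where
  "Vsum A x y s = (\<Sum>\<^sub>\<infinity>i\<in>A. ((lat_form x y s i)\<^sup>2 - 2 * lat_form x y s i + 1/4) * exp (- lat_form x y s i))"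

lemma lat_form_scale: "lat_form x y s i = s * lat_form x y 1 i"
  by (auto simp: lat_form_def split: prod.splits)

lemma lat_form_exp_deriv:
  "((\<lambda>t. lat_form x y (exp t) i) has_real_derivative lat_form x y (exp t) i) (at t)"
  by (subst (1 2) lat_form_scale) (auto intro!: derivative_eq_intros)

lemma dual_sum_exp: "dual_sum y (exp t) (m, k) = pi * y * (exp t * (real_of_int m)\<^sup>2 + exp (-t) * (real_of_int k)\<^sup>2)"
  and dual_diff_exp: "dual_diff y (exp t) (m, k) = pi * y * (exp t * (real_of_int m)\<^sup>2 - exp (-t) * (real_of_int k)\<^sup>2)"
  by (simp_all add: dual_sum_def dual_diff_def exp_minus field_simps)

lemma dual_sum_exp_deriv:
  "((\<lambda>t. dual_sum y (exp t) i) has_real_derivative dual_diff y (exp t) i) (at t)"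
  by (cases i) (auto simp: dual_sum_exp dual_diff_exp intro!: derivative_eq_intros)

lemma dual_diff_exp_deriv:
  "((\<lambda>t. dual_diff y (exp t) i) has_real_derivative dual_sum y (exp t) i) (at t)"
  by (cases i) (auto simp: dual_sum_exp dual_diff_exp intro!: derivative_eq_intros)

lemma summable_majorant:
  fixes c K :: real
  assumes "c > 0"
  shows "(\<lambda>i::int \<times> int. K * exp (- (c * sqn i))) summable_on A"
proof -
  have "(\<lambda>i::int \<times> int. exp (- (c * sqn i))) summable_on UNIV"
    using summable_gauss_int2[of c] assms by (simp add: case_prod_unfold)
  thus ?thesis
    by (intro summable_on_cmult_right) (rule summable_on_subset_banach[of _ UNIV], auto)
qed

text \<open>Uniform for \<open>t\<close> within distance one of \<open>t0\<close>, as termwise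
  differentiation requires: the decay is taken at \<open>t0 - 1\<close> and the prefactor at
  \<open>t0 + 1\<close>.\<close>

lemma lat_poly_majorant:
  fixes t t0 :: real
  assumes y: "y > 0" and t: "\<bar>t - t0\<bar> < 1"
    and p: "\<bar>p\<bar> \<le> K * (1 + lat_form x y (exp t) i + (lat_form x y (exp t) i)\<^sup>2 + (lat_form x y (exp t) i) ^ 3)" "K \<ge> 0"
  shows "\<bar>exp (t/2) * (p * exp (- lat_form x y (exp t) i))\<bar>
     \<le> exp ((t0 + 1)/2) * (59 * K) * exp (- (pi * exp (t0 - 1) * y / (1 + x\<^sup>2 + y\<^sup>2) / 2 * sqn i))"
proof -
  have T: "1 + x\<^sup>2 + y\<^sup>2 > 0" by (intro add_pos_nonneg) auto
  have "pi * exp (t0 - 1) * y / (1 + x\<^sup>2 + y\<^sup>2) * sqn i \<le> pi * exp t * y / (1 + x\<^sup>2 + y\<^sup>2) * sqn i"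
    using y t T by (intro mult_right_mono divide_right_mono mult_left_mono) auto
  also have "\<dots> \<le> lat_form x y (exp t) i" using y by (intro lat_form_ge) auto
  finally have "pi * exp (t0 - 1) * y / (1 + x\<^sup>2 + y\<^sup>2) / 2 * sqn i \<le> lat_form x y (exp t) i / 2"
    by (rule half_mult_le)
  from poly_exp_bound[OF _ p(1) this p(2)] y
  have 1: "\<bar>p * exp (- lat_form x y (exp t) i)\<bar> \<le> 59 * K * exp (- (pi * exp (t0 - 1) * y / (1 + x\<^sup>2 + y\<^sup>2) / 2 * sqn i))"
    by (simp add: lat_form_nonneg)
  have 2: "exp (t/2) \<le> exp ((t0 + 1)/2)" using t by auto
  show ?thesis
    using mult_mono[OF 2 1] by (simp add: abs_mult mult.assoc)
qed

lemma dual_poly_majorant: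
  fixes t t0 :: real
  assumes y: "y > 0" and t: "\<bar>t - t0\<bar> < 1"
    and p: "\<bar>p\<bar> \<le> K * (1 + dual_sum y (exp t) i + (dual_sum y (exp t) i)\<^sup>2 + (dual_sum y (exp t) i) ^ 3)" "K \<ge> 0"
  shows "\<bar>p * exp (- dual_sum y (exp t) i)\<bar>
     \<le> 59 * K * exp (- (pi * y * exp (-\<bar>t0\<bar> - 1) / 2 * sqn i))"
proof -
  have "pi * y * exp (-\<bar>t0\<bar> - 1) * sqn i \<le> pi * y * exp (-\<bar>t\<bar>) * sqn i"
    using y t by (intro mult_right_mono mult_left_mono) auto
  also have "\<dots> \<le> dual_sum y (exp t) i" using y by (intro dual_sum_ge) auto
  finally have "pi * y * exp (-\<bar>t0\<bar> - 1) / 2 * sqn i \<le> dual_sum y (exp t) i / 2"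
    by (rule half_mult_le)
  from poly_exp_bound[OF _ p(1) this p(2)] y show ?thesis by (simp add: dual_sum_nonneg)
qed

text \<open>The polynomials are the weights of \<open>exp (- w)\<close> in the first three
  derivatives of \<open>exp (t/2) * exp (- w)\<close> when \<open>w\<close> is proportional to
  \<open>exp t\<close>; one constant serves them all.\<close>

lemma cubic_dominates:
  fixes w :: real
  assumes "w \<ge> 0"
  shows "\<bar>1/2 - w\<bar> \<le> 5 * (1 + w + w\<^sup>2 + w ^ 3)"
    and "\<bar>w\<^sup>2 - 2 * w + 1/4\<bar> \<le> 5 * (1 + w + w\<^sup>2 + w ^ 3)"
    and "\<bar>9/2 * w\<^sup>2 - 13/4 * w + 1/8 - w ^ 3\<bar> \<le> 5 * (1 + w + w\<^sup>2 + w ^ 3)"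
    and "1 \<le> 5 * (1 + w + w\<^sup>2 + w ^ 3)"
proof -
  define a b where ab: "a = w\<^sup>2" "b = w ^ 3"
  have "a \<ge> 0" "b \<ge> 0" "w\<^sup>2 \<le> 1 + w ^ 3"
  proof -
    show "w\<^sup>2 \<le> 1 + w ^ 3"
    proof (cases "w \<le> 1")
      case True thus ?thesis using assms power_le_one[of w 2] zero_le_power[of w 3] by linarith
    next
      case False
      hence "w\<^sup>2 \<le> w ^ 3" by (intro power_increasing) auto
      thus ?thesis by simp
    qed
  qed (use assms ab in auto)
  hence *: "a \<ge> 0" "b \<ge> 0" "a \<le> 1 + b" by (auto simp: ab)
  show "\<bar>1/2 - w\<bar> \<le> 5 * (1 + w + w\<^sup>2 + w ^ 3)"
    "\<bar>w\<^sup>2 - 2 * w + 1/4\<bar> \<le> 5 * (1 + w + w\<^sup>2 + w ^ 3)"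
    "\<bar>9/2 * w\<^sup>2 - 13/4 * w + 1/8 - w ^ 3\<bar> \<le> 5 * (1 + w + w\<^sup>2 + w ^ 3)"
    "1 \<le> 5 * (1 + w + w\<^sup>2 + w ^ 3)"
    using assms * unfolding abs_le_iff ab[symmetric] distrib_left by linarith+
qed

lemma cubic_dominates_dual:
  fixes w z c :: real
  assumes "\<bar>z\<bar> \<le> w" "\<bar>c\<bar> \<le> 1"
  shows "\<bar>c\<bar> \<le> 5 * (1 + w + w\<^sup>2 + w ^ 3)"
    and "\<bar>c * z\<bar> \<le> 5 * (1 + w + w\<^sup>2 + w ^ 3)"
    and "\<bar>c * (z\<^sup>2 - w)\<bar> \<le> 5 * (1 + w + w\<^sup>2 + w ^ 3)"
    and "\<bar>c * (3 * z * w - z - z ^ 3)\<bar> \<le> 5 * (1 + w + w\<^sup>2 + w ^ 3)"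
proof -
  have w: "w \<ge> 0" using assms by linarith
  define a b where ab: "a = w\<^sup>2" "b = w ^ 3"
  have w2: "a \<ge> 0" "b \<ge> 0" using w by (auto simp: ab)
  have z2: "z\<^sup>2 \<le> w\<^sup>2" using power_mono[OF assms(1), of 2] by simp
  have z3: "\<bar>z ^ 3\<bar> \<le> w ^ 3" using power_mono[OF assms(1), of 3] by (simp add: power_abs)
  have zw: "\<bar>z * w\<bar> \<le> w\<^sup>2" using mult_right_mono[OF assms(1) w] w by (simp add: abs_mult power2_eq_square)
  have red: "\<bar>c * u\<bar> \<le> B" if "\<bar>u\<bar> \<le> B" for u B
    using mult_mono[OF assms(2) that] by (simp add: abs_mult)
  show "\<bar>c\<bar> \<le> 5 * (1 + w + w\<^sup>2 + w ^ 3)" unfolding ab[symmetric] distrib_left using assms w w2 by linarith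
  show "\<bar>c * z\<bar> \<le> 5 * (1 + w + w\<^sup>2 + w ^ 3)" unfolding ab[symmetric] distrib_left by (rule red) (use assms w w2 in linarith)
  show "\<bar>c * (z\<^sup>2 - w)\<bar> \<le> 5 * (1 + w + w\<^sup>2 + w ^ 3)"
    using z2 zero_le_power2[of z] unfolding ab[symmetric] distrib_left by (intro red) (use w w2 in linarith)
  have "\<bar>3 * z * w - z - z ^ 3\<bar> \<le> 3 * \<bar>z * w\<bar> + \<bar>z\<bar> + \<bar>z ^ 3\<bar>"
    unfolding mult.assoc by linarith
  thus "\<bar>c * (3 * z * w - z - z ^ 3)\<bar> \<le> 5 * (1 + w + w\<^sup>2 + w ^ 3)"
    using zw z3 unfolding ab[symmetric] distrib_left by (intro red) (use assms(1) w w2 in linarith)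
qed

lemma lat_summable_basic:
  assumes "y > 0" "s > 0"
  shows "(\<lambda>i. exp (- lat_form x y s i)) summable_on A"
    and "(\<lambda>i. (1/2 - lat_form x y s i) * exp (- lat_form x y s i)) summable_on A"
    and "(\<lambda>i. ((lat_form x y s i)\<^sup>2 - 2 * lat_form x y s i + 1/4) * exp (- lat_form x y s i)) summable_on A"
proof -
  have w: "lat_form x y s i \<ge> 0" for i using assms by (intro lat_form_nonneg) auto
  show "(\<lambda>i. exp (- lat_form x y s i)) summable_on A"
    using summable_lat[OF assms, of A "\<lambda>_. 1" 5 x] cubic_dominates(4)[OF w] by simp
  show "(\<lambda>i. (1/2 - lat_form x y s i) * exp (- lat_form x y s i)) summable_on A"
    by (rule summable_lat[OF assms, of A _ 5]) (use cubic_dominates(1)[OF w] in auto)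
  show "(\<lambda>i. ((lat_form x y s i)\<^sup>2 - 2 * lat_form x y s i + 1/4) * exp (- lat_form x y s i)) summable_on A"
    by (rule summable_lat[OF assms, of A _ 5]) (use cubic_dominates(2)[OF w] in auto)
qed

lemma abs_cosmk: "\<bar>cosmk x i\<bar> \<le> 1"
  by (auto simp: cosmk_def split: prod.splits)

lemma dual_summable_basic:
  assumes "y > 0" "s > 0" "\<And>i. \<bar>c i\<bar> \<le> 1"
  shows "(\<lambda>i. c i * exp (- dual_sum y s i)) summable_on A"
    and "(\<lambda>i. c i * dual_diff y s i * exp (- dual_sum y s i)) summable_on A"
    and "(\<lambda>i. c i * ((dual_diff y s i)\<^sup>2 - dual_sum y s i) * exp (- dual_sum y s i)) summable_on A"
proof -
  note [simp] = dual_diff_le[OF assms(1) less_imp_le[OF assms(2)]]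
  show "(\<lambda>i. c i * exp (- dual_sum y s i)) summable_on A"
    by (rule summable_dual[OF assms(1,2), of A _ 5]) (use cubic_dominates_dual(1)[OF dual_diff_le assms(3)] assms in auto)
  show "(\<lambda>i. c i * dual_diff y s i * exp (- dual_sum y s i)) summable_on A"
    by (rule summable_dual[OF assms(1,2), of A _ 5]) (use cubic_dominates_dual(2)[OF dual_diff_le assms(3)] assms in auto)
  show "(\<lambda>i. c i * ((dual_diff y s i)\<^sup>2 - dual_sum y s i) * exp (- dual_sum y s i)) summable_on A"
    by (rule summable_dual[OF assms(1,2), of A _ 5]) (use cubic_dominates_dual(3)[OF dual_diff_le assms(3)] assms in auto)
qed

lemma Gsum_deriv:
  assumes y: "y > 0"
  shows "(Gsum A x y has_real_derivative exp (t/2) * Usum A x y (exp t)) (at t)"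
proof -
  let ?w = "\<lambda>t i. lat_form x y (exp t) i"
  have c: "pi * exp (t - 1) * y / (1 + x\<^sup>2 + y\<^sup>2) / 2 > 0"
    using y by (intro divide_pos_pos mult_pos_pos add_pos_nonneg) auto
  have w: "?w t i \<ge> 0" for t i using y by (intro lat_form_nonneg) auto
  have "((\<lambda>t. \<Sum>\<^sub>\<infinity>i\<in>A. exp (t/2) * exp (- ?w t i)) has_real_derivative
          (\<Sum>\<^sub>\<infinity>i\<in>A. exp (t/2) * ((1/2 - ?w t i) * exp (- ?w t i)))) (at t)"
  proof (rule has_derivative_infsum_real[where r=1])
    fix i t' assume t': "\<bar>t' - t\<bar> < 1"
    show "((\<lambda>t. exp (t/2) * exp (- ?w t i)) has_real_derivative exp (t'/2) * ((1/2 - ?w t' i) * exp (- ?w t' i))) (at t')"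
      by (auto intro!: derivative_eq_intros lat_form_exp_deriv simp: field_simps)
    show "((\<lambda>t. exp (t/2) * ((1/2 - ?w t i) * exp (- ?w t i))) has_real_derivative
       exp (t'/2) * (((?w t' i)\<^sup>2 - 2 * ?w t' i + 1/4) * exp (- ?w t' i))) (at t')"
      by (auto intro!: derivative_eq_intros lat_form_exp_deriv simp: field_simps power2_eq_square)
    show "\<bar>exp (t'/2) * (((?w t' i)\<^sup>2 - 2 * ?w t' i + 1/4) * exp (- ?w t' i))\<bar> \<le>
       exp ((t + 1)/2) * (59 * 5) * exp (- (pi * exp (t - 1) * y / (1 + x\<^sup>2 + y\<^sup>2) / 2 * sqn i))"
      by (rule lat_poly_majorant[OF y t' cubic_dominates(2)[OF w]]) auto
  next
    show "(\<lambda>i. exp (t/2) * exp (- ?w t i)) summable_on A" for t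
      by (intro summable_on_cmult_right lat_summable_basic) (use y in auto)
    show "(\<lambda>i. exp (t/2) * ((1/2 - ?w t i) * exp (- ?w t i))) summable_on A"
      by (intro summable_on_cmult_right lat_summable_basic) (use y in auto)
  qed (use summable_majorant[OF c] in auto)
  thus ?thesis unfolding Gsum_def Usum_def by (simp add: infsum_cmult_right')
qed

lemma Usum_deriv:
  assumes y: "y > 0"
  shows "((\<lambda>t. exp (t/2) * Usum A x y (exp t)) has_real_derivative exp (t/2) * Vsum A x y (exp t)) (at t)"
proof -
  let ?w = "\<lambda>t i. lat_form x y (exp t) i"
  have c: "pi * exp (t - 1) * y / (1 + x\<^sup>2 + y\<^sup>2) / 2 > 0"
    using y by (intro divide_pos_pos mult_pos_pos add_pos_nonneg) auto
  have w: "?w t i \<ge> 0" for t i using y by (intro lat_form_nonneg) auto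
  have "((\<lambda>t. \<Sum>\<^sub>\<infinity>i\<in>A. exp (t/2) * ((1/2 - ?w t i) * exp (- ?w t i))) has_real_derivative
          (\<Sum>\<^sub>\<infinity>i\<in>A. exp (t/2) * (((?w t i)\<^sup>2 - 2 * ?w t i + 1/4) * exp (- ?w t i)))) (at t)"
  proof (rule has_derivative_infsum_real[where r=1])
    fix i t' assume t': "\<bar>t' - t\<bar> < 1"
    show "((\<lambda>t. exp (t/2) * ((1/2 - ?w t i) * exp (- ?w t i))) has_real_derivative
       exp (t'/2) * (((?w t' i)\<^sup>2 - 2 * ?w t' i + 1/4) * exp (- ?w t' i))) (at t')"
      by (auto intro!: derivative_eq_intros lat_form_exp_deriv simp: field_simps power2_eq_square)
    show "((\<lambda>t. exp (t/2) * (((?w t i)\<^sup>2 - 2 * ?w t i + 1/4) * exp (- ?w t i))) has_real_derivative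
       exp (t'/2) * ((9/2 * (?w t' i)\<^sup>2 - 13/4 * ?w t' i + 1/8 - (?w t' i) ^ 3) * exp (- ?w t' i))) (at t')"
      by (auto intro!: derivative_eq_intros lat_form_exp_deriv simp: field_simps power2_eq_square power3_eq_cube)
    show "\<bar>exp (t'/2) * ((9/2 * (?w t' i)\<^sup>2 - 13/4 * ?w t' i + 1/8 - (?w t' i) ^ 3) * exp (- ?w t' i))\<bar> \<le>
       exp ((t + 1)/2) * (59 * 5) * exp (- (pi * exp (t - 1) * y / (1 + x\<^sup>2 + y\<^sup>2) / 2 * sqn i))"
      by (rule lat_poly_majorant[OF y t' cubic_dominates(3)[OF w]]) auto
  next
    show "(\<lambda>i. exp (t/2) * ((1/2 - ?w t i) * exp (- ?w t i))) summable_on A" for t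
      by (intro summable_on_cmult_right lat_summable_basic) (use y in auto)
    show "(\<lambda>i. exp (t/2) * (((?w t i)\<^sup>2 - 2 * ?w t i + 1/4) * exp (- ?w t i))) summable_on A"
      by (intro summable_on_cmult_right lat_summable_basic) (use y in auto)
  qed (use summable_majorant[OF c] in auto)
  thus ?thesis unfolding Usum_def Vsum_def by (simp add: infsum_cmult_right')
qed

lemma dual_deriv1:
  assumes y: "y > 0" and c: "\<And>i. \<bar>c i\<bar> \<le> 1"
  shows "((\<lambda>t. \<Sum>\<^sub>\<infinity>i\<in>A. c i * exp (- dual_sum y (exp t) i)) has_real_derivative
          (\<Sum>\<^sub>\<infinity>i\<in>A. - (c i * dual_diff y (exp t) i * exp (- dual_sum y (exp t) i)))) (at t)"
proof (rule has_derivative_infsum_real[where r=1])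
  let ?X = "\<lambda>t i. dual_sum y (exp t) i" and ?Z = "\<lambda>t i. dual_diff y (exp t) i"
  fix i t' assume t': "\<bar>t' - t\<bar> < 1"
  show "((\<lambda>t. c i * exp (- ?X t i)) has_real_derivative - (c i * ?Z t' i * exp (- ?X t' i))) (at t')"
    by (auto intro!: derivative_eq_intros dual_sum_exp_deriv)
  show "((\<lambda>t. - (c i * ?Z t i * exp (- ?X t i))) has_real_derivative (c i * ((?Z t' i)\<^sup>2 - ?X t' i)) * exp (- ?X t' i)) (at t')"
    by (auto intro!: derivative_eq_intros dual_sum_exp_deriv dual_diff_exp_deriv simp: algebra_simps power2_eq_square)
  show "\<bar>(c i * ((?Z t' i)\<^sup>2 - ?X t' i)) * exp (- ?X t' i)\<bar> \<le> 59 * 5 * exp (- (pi * y * exp (-\<bar>t\<bar> - 1) / 2 * sqn i))"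
    by (rule dual_poly_majorant[OF y t' cubic_dominates_dual(3)[OF dual_diff_le c]]) (use y in auto)
next
  show "(\<lambda>i. c i * exp (- dual_sum y (exp t) i)) summable_on A" for t
    by (intro dual_summable_basic y c) auto
  show "(\<lambda>i. - (c i * dual_diff y (exp t) i * exp (- dual_sum y (exp t) i))) summable_on A"
    by (intro summable_on_uminus[THEN iffD2] dual_summable_basic y c) auto
qed (use summable_majorant[of "pi * y * exp (-\<bar>t\<bar> - 1) / 2"] y in auto)

lemma dual_deriv2:
  assumes y: "y > 0" and c: "\<And>i. \<bar>c i\<bar> \<le> 1"
  shows "((\<lambda>t. \<Sum>\<^sub>\<infinity>i\<in>A. - (c i * dual_diff y (exp t) i * exp (- dual_sum y (exp t) i))) has_real_derivative
          (\<Sum>\<^sub>\<infinity>i\<in>A. c i * ((dual_diff y (exp t) i)\<^sup>2 - dual_sum y (exp t) i) * exp (- dual_sum y (exp t) i))) (at t)"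
proof (rule has_derivative_infsum_real[where r=1])
  let ?X = "\<lambda>t i. dual_sum y (exp t) i" and ?Z = "\<lambda>t i. dual_diff y (exp t) i"
  fix i t' assume t': "\<bar>t' - t\<bar> < 1"
  show "((\<lambda>t. - (c i * ?Z t i * exp (- ?X t i))) has_real_derivative (c i * ((?Z t' i)\<^sup>2 - ?X t' i)) * exp (- ?X t' i)) (at t')"
    by (auto intro!: derivative_eq_intros dual_sum_exp_deriv dual_diff_exp_deriv simp: algebra_simps power2_eq_square)
  show "((\<lambda>t. (c i * ((?Z t i)\<^sup>2 - ?X t i)) * exp (- ?X t i)) has_real_derivative
     (c i * (3 * ?Z t' i * ?X t' i - ?Z t' i - (?Z t' i) ^ 3)) * exp (- ?X t' i)) (at t')"
    by (auto intro!: derivative_eq_intros dual_sum_exp_deriv dual_diff_exp_deriv simp: algebra_simps power2_eq_square power3_eq_cube)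
  show "\<bar>(c i * (3 * ?Z t' i * ?X t' i - ?Z t' i - (?Z t' i) ^ 3)) * exp (- ?X t' i)\<bar> \<le> 59 * 5 * exp (- (pi * y * exp (-\<bar>t\<bar> - 1) / 2 * sqn i))"
    by (rule dual_poly_majorant[OF y t' cubic_dominates_dual(4)[OF dual_diff_le c]]) (use y in auto)
next
  show "(\<lambda>i. - (c i * dual_diff y (exp t) i * exp (- dual_sum y (exp t) i))) summable_on A" for t
    by (intro summable_on_uminus[THEN iffD2] dual_summable_basic y c) auto
  show "(\<lambda>i. c i * ((dual_diff y (exp t) i)\<^sup>2 - dual_sum y (exp t) i) * exp (- dual_sum y (exp t) i)) summable_on A"
    by (intro dual_summable_basic y c) auto
qed (use summable_majorant[of "pi * y * exp (-\<bar>t\<bar> - 1) / 2"] y in auto)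

text \<open>Poisson summation acts in each row \<open>m\<close> separately, so any set
  \<open>M\<close> of rows is allowed. This permits treating the rows with
  \<open>\<bar>m\<bar> \<ge> 2\<close> in dual form while the rows \<open>\<plusminus>1\<close> stay
  spatial.\<close>

lemma Gsum_dual:
  assumes y: "y > 0"
  shows "Gsum (M \<times> UNIV) x y t = sqrt y * (\<Sum>\<^sub>\<infinity>i\<in>M \<times> UNIV. cosmk x i * exp (- dual_sum y (exp t) i))"
proof -
  have row: "(\<Sum>\<^sub>\<infinity>n. exp (t/2) * exp (- lat_form x y (exp t) (m, n))) =
             (\<Sum>\<^sub>\<infinity>k. sqrt y * (cosmk x (m, k) * exp (- dual_sum y (exp t) (m, k))))" for m :: int
  proof -
    define a where "a = pi * exp t / y"
    have a: "a > 0" using y by (simp add: a_def)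
    have q: "sqrt (pi / a) = sqrt y * exp (-(t/2))"
    proof -
      have "pi / a = y * (exp (-(t/2)))\<^sup>2"
        using y by (simp add: a_def field_simps exp_minus power2_eq_square flip: exp_add)
      thus ?thesis by (simp add: real_sqrt_mult)
    qed
    have "exp (t/2) * exp (- lat_form x y (exp t) (m, n)) =
       (exp (t/2) * exp (- (pi * exp t * (real_of_int m)\<^sup>2 * y))) * exp (- a * (real_of_int n + m * x)\<^sup>2)" for n :: int
      using y by (simp add: a_def lat_form_def field_simps power2_eq_square flip: exp_add)
    moreover have "sqrt y * (cosmk x (m, k) * exp (- dual_sum y (exp t) (m, k))) =
       (exp (t/2) * exp (- (pi * exp t * (real_of_int m)\<^sup>2 * y))) *
       (sqrt (pi / a) * exp (- (pi\<^sup>2 / a) * (real_of_int k)\<^sup>2) * cos (2 * pi * real_of_int k * (m * x)))" for k :: int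
    proof -
      have "exp (- dual_sum y (exp t) (m, k)) = exp (- (pi * exp t * (real_of_int m)\<^sup>2 * y)) * exp (- (pi\<^sup>2 / a) * (real_of_int k)\<^sup>2)"
        using y by (simp add: a_def dual_sum_def field_simps power2_eq_square flip: exp_add)
      moreover have "exp (t/2) * exp (-(t/2)) = (1::real)" by (simp flip: exp_add)
      ultimately show ?thesis unfolding q by (simp add: cosmk_def mult_ac)
    qed
    ultimately show ?thesis
      by (simp only: infsum_cmult_right' poisson_gauss[OF a])
  qed
  have "Gsum (M \<times> UNIV) x y t = (\<Sum>\<^sub>\<infinity>m\<in>M. \<Sum>\<^sub>\<infinity>n. exp (t/2) * exp (- lat_form x y (exp t) (m, n)))"
    unfolding Gsum_def
    by (rule infsum_Sigma_banach[symmetric]) (intro summable_on_cmult_right lat_summable_basic, use y in auto)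
  also have "\<dots> = (\<Sum>\<^sub>\<infinity>m\<in>M. \<Sum>\<^sub>\<infinity>k. sqrt y * (cosmk x (m, k) * exp (- dual_sum y (exp t) (m, k))))"
    by (simp only: row)
  also have "\<dots> = (\<Sum>\<^sub>\<infinity>i\<in>M \<times> UNIV. sqrt y * (cosmk x i * exp (- dual_sum y (exp t) i)))"
    by (rule infsum_Sigma_banach) (intro summable_on_cmult_right dual_summable_basic abs_cosmk, use y in auto)
  finally show ?thesis by (simp add: infsum_cmult_right')
qed

text \<open>Differentiating the identity for \<open>Gsum\<close> replaces a second Poisson summation
  with polynomial weights.\<close>

lemma Usum_dual:
  assumes y: "y > 0"
  shows "exp (t/2) * Usum (M \<times> UNIV) x y (exp t) =
     sqrt y * (\<Sum>\<^sub>\<infinity>i\<in>M \<times> UNIV. - (cosmk x i * dual_diff y (exp t) i * exp (- dual_sum y (exp t) i)))"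
proof -
  have e: "Gsum (M \<times> UNIV) x y = (\<lambda>t. sqrt y * (\<Sum>\<^sub>\<infinity>i\<in>M \<times> UNIV. cosmk x i * exp (- dual_sum y (exp t) i)))"
    using Gsum_dual[OF y] by auto
  show ?thesis
    by (rule DERIV_unique[OF Gsum_deriv[OF y]], unfold e, rule DERIV_cmult, rule dual_deriv1[OF y abs_cosmk])
qed

lemma Vsum_dual:
  assumes y: "y > 0"
  shows "exp (t/2) * Vsum (M \<times> UNIV) x y (exp t) =
     sqrt y * (\<Sum>\<^sub>\<infinity>i\<in>M \<times> UNIV. cosmk x i * ((dual_diff y (exp t) i)\<^sup>2 - dual_sum y (exp t) i) * exp (- dual_sum y (exp t) i))"
proof -
  have e: "(\<lambda>t. exp (t/2) * Usum (M \<times> UNIV) x y (exp t)) =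
     (\<lambda>t. sqrt y * (\<Sum>\<^sub>\<infinity>i\<in>M \<times> UNIV. - (cosmk x i * dual_diff y (exp t) i * exp (- dual_sum y (exp t) i))))"
    using Usum_dual[OF y] by auto
  show ?thesis
    by (rule DERIV_unique[OF Usum_deriv[OF y]], unfold e, rule DERIV_cmult, rule dual_deriv2[OF y abs_cosmk])
qed

section \<open>Moving to the line of real part one half\<close>

lemma exp_ge_taylor6:
  fixes x :: real
  assumes "x \<ge> 0"
  shows "1 + x + x\<^sup>2/2 + x^3/6 + x^4/24 + x^5/120 + x^6/720 \<le> exp x"
proof -
  have "(\<Sum>n\<in>{..6}. x ^ n /\<^sub>R fact n) \<le> (\<Sum>n. x ^ n /\<^sub>R fact n)"
  proof (rule sum_le_suminf[OF summable_exp_generic])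
    show "0 \<le> x ^ n /\<^sub>R fact n" for n :: nat
      unfolding real_scaleR_def using assms by (intro mult_nonneg_nonneg zero_le_power) auto
  qed simp
  thus ?thesis unfolding exp_def by (simp add: eval_nat_numeral field_simps fact_numeral)
qed

text \<open>The successive signed Taylor remainders of \<open>exp (-x)\<close> vanish at 0 and each
  is the derivative of the next, so nonnegativity climbs from one order to the next.\<close>

lemma exp_minus_taylor:
  fixes x :: real
  assumes x: "x \<ge> 0"
  shows "exp (-x) \<le> 1 - x + x\<^sup>2/2 - x^3/6 + x^4/24"
    and "1 - x + x\<^sup>2/2 - x^3/6 + x^4/24 - x^5/120 \<le> exp (-x)"
proof -
  have step: "f 0 \<le> f x" if "\<And>t. 0 \<le> t \<Longrightarrow> (f has_real_derivative f' t) (at t)" "\<And>t. 0 \<le> t \<Longrightarrow> f' t \<ge> 0" "x \<ge> 0"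
    for f f' :: "real \<Rightarrow> real" and x
    by (rule DERIV_nonneg_imp_nondecreasing[OF that(3)]) (use that(1,2) in blast)
  have 1: "exp (-x) \<ge> 1 - x" for x :: real using exp_ge_add_one_self[of "-x"] by simp
  have 2: "1 - x + x\<^sup>2/2 - exp (-x) \<ge> 0" if "x \<ge> 0" for x :: real
  proof -
    have "(\<lambda>x. 1 - x + x\<^sup>2/2 - exp (-x)) 0 \<le> (\<lambda>x. 1 - x + x\<^sup>2/2 - exp (-x)) x"
    proof (rule step[where f' = "\<lambda>x. -1 + x + exp (-x)"])
      show "((\<lambda>x. 1 - x + x\<^sup>2/2 - exp (-x)) has_real_derivative (-1 + t + exp (-t))) (at t)" for t :: real
        by (auto intro!: derivative_eq_intros simp: field_simps eval_nat_numeral)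
      show "-1 + t + exp (-t) \<ge> 0" if "0 \<le> t" for t :: real
        using 1[of t] that by simp
    qed (use that in auto)
    thus ?thesis by simp
  qed
  have 3: "exp (-x) - (1 - x + x\<^sup>2/2 - x^3/6) \<ge> 0" if "x \<ge> 0" for x :: real
  proof -
    have "(\<lambda>x. exp (-x) - (1 - x + x\<^sup>2/2 - x^3/6)) 0 \<le> (\<lambda>x. exp (-x) - (1 - x + x\<^sup>2/2 - x^3/6)) x"
    proof (rule step[where f' = "\<lambda>x. 1 - x + x\<^sup>2/2 - exp (-x)"])
      show "((\<lambda>x. exp (-x) - (1 - x + x\<^sup>2/2 - x^3/6)) has_real_derivative (1 - t + t\<^sup>2/2 - exp (-t))) (at t)" for t :: real
        by (auto intro!: derivative_eq_intros simp: field_simps eval_nat_numeral)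
      show "1 - t + t\<^sup>2/2 - exp (-t) \<ge> 0" if "0 \<le> t" for t :: real
        using 2[of t] that by simp
    qed (use that in auto)
    thus ?thesis by simp
  qed
  have 4: "1 - x + x\<^sup>2/2 - x^3/6 + x^4/24 - exp (-x) \<ge> 0" if "x \<ge> 0" for x :: real
  proof -
    have "(\<lambda>x. 1 - x + x\<^sup>2/2 - x^3/6 + x^4/24 - exp (-x)) 0 \<le> (\<lambda>x. 1 - x + x\<^sup>2/2 - x^3/6 + x^4/24 - exp (-x)) x"
    proof (rule step[where f' = "\<lambda>x. exp (-x) - (1 - x + x\<^sup>2/2 - x^3/6)"])
      show "((\<lambda>x. 1 - x + x\<^sup>2/2 - x^3/6 + x^4/24 - exp (-x)) has_real_derivative (exp (-t) - (1 - t + t\<^sup>2/2 - t^3/6))) (at t)" for t :: real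
        by (auto intro!: derivative_eq_intros simp: field_simps eval_nat_numeral)
      show "exp (-t) - (1 - t + t\<^sup>2/2 - t^3/6) \<ge> 0" if "0 \<le> t" for t :: real
        using 3[of t] that by simp
    qed (use that in auto)
    thus ?thesis by simp
  qed
  have 5: "exp (-x) - (1 - x + x\<^sup>2/2 - x^3/6 + x^4/24 - x^5/120) \<ge> 0" if "x \<ge> 0" for x :: real
  proof -
    have "(\<lambda>x. exp (-x) - (1 - x + x\<^sup>2/2 - x^3/6 + x^4/24 - x^5/120)) 0 \<le> (\<lambda>x. exp (-x) - (1 - x + x\<^sup>2/2 - x^3/6 + x^4/24 - x^5/120)) x"
    proof (rule step[where f' = "\<lambda>x. 1 - x + x\<^sup>2/2 - x^3/6 + x^4/24 - exp (-x)"])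
      show "((\<lambda>x. exp (-x) - (1 - x + x\<^sup>2/2 - x^3/6 + x^4/24 - x^5/120)) has_real_derivative (1 - t + t\<^sup>2/2 - t^3/6 + t^4/24 - exp (-t))) (at t)" for t :: real
        by (auto intro!: derivative_eq_intros simp: field_simps eval_nat_numeral)
      show "1 - t + t\<^sup>2/2 - t^3/6 + t^4/24 - exp (-t) \<ge> 0" if "0 \<le> t" for t :: real
        using 4[of t] that by simp
    qed (use that in auto)
    thus ?thesis by simp
  qed
  show "exp (-x) \<le> 1 - x + x\<^sup>2/2 - x^3/6 + x^4/24"
    and "1 - x + x\<^sup>2/2 - x^3/6 + x^4/24 - x^5/120 \<le> exp (-x)"
    using 4[OF x] 5[OF x] by linarith+
qed

text \<open>Dividing the argument by 16 makes a quartic Taylor polynomial accurate enough; what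
  remains is an inequality between rationals.\<close>

lemma exp_minus_le_taylor16:
  fixes x b :: real
  assumes "0 \<le> x" "(1 - x/16 + (x/16)\<^sup>2/2 - (x/16)^3/6 + (x/16)^4/24) ^ 16 \<le> b"
  shows "exp (-x) \<le> b"
proof -
  have "exp (-x) = exp (-(x/16)) ^ 16" by (simp flip: exp_of_nat_mult)
  also have "\<dots> \<le> (1 - x/16 + (x/16)\<^sup>2/2 - (x/16)^3/6 + (x/16)^4/24) ^ 16"
    using assms by (intro power_mono exp_minus_taylor) auto
  finally show ?thesis using assms by simp
qed

lemma abs_sin_int_mult: "\<bar>sin (real n * a)\<bar> \<le> real n * \<bar>sin a\<bar>"
proof (induction n)
  case (Suc n)
  have "\<bar>sin (real (Suc n) * a)\<bar> = \<bar>sin (real n * a) * cos a + cos (real n * a) * sin a\<bar>"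
    by (simp add: sin_add algebra_simps)
  also have "\<dots> \<le> \<bar>sin (real n * a)\<bar> * \<bar>cos a\<bar> + \<bar>cos (real n * a)\<bar> * \<bar>sin a\<bar>"
    using abs_triangle_ineq[of "sin (real n * a) * cos a" "cos (real n * a) * sin a"] by (simp add: abs_mult)
  also have "\<dots> \<le> \<bar>sin (real n * a)\<bar> * 1 + 1 * \<bar>sin a\<bar>"
    by (intro add_mono mult_mono) auto
  finally show ?case using Suc by (simp add: algebra_simps)
qed simp

lemma one_minus_cos_half: "1 - cos (v::real) = 2 * (sin (v/2))\<^sup>2"
  using cos_double_sin[of "v/2"] by simp

lemma one_minus_cos_int_mult: "1 - cos (real_of_int N * v) \<le> (real_of_int N)\<^sup>2 * (1 - cos v)"
proof -
  have "\<bar>sin (real_of_int N * v / 2)\<bar> = \<bar>sin (real (nat \<bar>N\<bar>) * (v/2))\<bar>"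
    by (cases "N \<ge> 0") auto
  also have "\<dots> \<le> real (nat \<bar>N\<bar>) * \<bar>sin (v/2)\<bar>" by (rule abs_sin_int_mult)
  finally have "(sin (real_of_int N * v / 2))\<^sup>2 \<le> (real_of_int N)\<^sup>2 * (sin (v/2))\<^sup>2"
    using power_mono[of "\<bar>sin (real_of_int N * v / 2)\<bar>" "real (nat \<bar>N\<bar>) * \<bar>sin (v/2)\<bar>" 2]
    by (simp add: power_mult_distrib)
  thus ?thesis by (simp add: one_minus_cos_half)
qed

text \<open>With \<open>2 * pi * x = pi - v\<close> the deviation of the phase from its value at
  \<open>x = 1/2\<close> is \<open>1 - cos (N * v)\<close> up to sign, \<open>N = m * k\<close>,
  hence at most \<open>N\<^sup>2\<close> times the deviation for \<open>N = 1\<close>. Every term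
  thus carries the common factor \<open>1 + cos (2 * pi * x)\<close>.\<close>

lemma cosmk_half_diff:
  "\<bar>cosmk x (m, k) - cosmk (1/2) (m, k)\<bar> \<le> (real_of_int m)\<^sup>2 * (real_of_int k)\<^sup>2 * (1 + cos (2 * pi * x))"
proof -
  define N where "N = m * k"
  define v where "v = pi - 2 * pi * x"
  have "cos (2 * pi * m * k * x) = cos (real_of_int N * pi - real_of_int N * v)"
    by (simp add: N_def v_def algebra_simps)
  also have "\<dots> = cos (real_of_int N * pi) * cos (real_of_int N * v)"
    by (simp add: cos_diff sin_zero_iff_int2)
  finally have e: "cosmk x (m, k) - cosmk (1/2) (m, k) = cos (real_of_int N * pi) * (cos (real_of_int N * v) - 1)"
    by (simp add: cosmk_def N_def algebra_simps)
  have "\<bar>cosmk x (m, k) - cosmk (1/2) (m, k)\<bar> \<le> 1 * (1 - cos (real_of_int N * v))"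
    unfolding e abs_mult by (intro mult_mono) auto
  also have "\<dots> \<le> (real_of_int N)\<^sup>2 * (1 - cos v)" using one_minus_cos_int_mult[of N v] by simp
  also have "cos v = - cos (2 * pi * x)" by (simp add: v_def cos_diff)
  finally show ?thesis by (simp add: N_def power_mult_distrib)
qed

lemma cosmk_half_diff_1:
  assumes "\<bar>m\<bar> = 1" "\<bar>k\<bar> = 1"
  shows "cosmk x (m, k) - cosmk (1/2) (m, k) = 1 + cos (2 * pi * x)"
  using assms by (auto simp: cosmk_def abs_if split: if_splits)

section \<open>Weighted Gaussian sums over the integers\<close>

lemma infsum_int_le_head:
  fixes f :: "int \<Rightarrow> real"
  assumes f0: "\<And>m. 0 \<le> f m" and even: "\<And>m. f (-m) = f m" and "f 0 = 0"
    and tail: "\<And>n::nat. n \<ge> 2 \<Longrightarrow> f (int (Suc n)) \<le> f (int n) / 50"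
  shows "f summable_on UNIV" "infsum f UNIV \<le> 2 * f 1 + 2 * (50/49) * f 2"
proof -
  have t: "f (int n) \<le> f 2 * (1/50) ^ (n - 2)" if "n \<ge> 2" for n :: nat
    using that
  proof (induction n rule: dec_induct)
    case (step n)
    have "f (int (Suc n)) \<le> f (int n) / 50" using step tail by auto
    also have "\<dots> \<le> f 2 * (1/50) ^ (n - 2) / 50" using step by simp
    also have "\<dots> = f 2 * (1/50) ^ (Suc n - 2)" 
    proof -
      have "Suc n - 2 = Suc (n - 2)" using step by simp
      thus ?thesis by (simp only: power_Suc)
    qed
    finally show ?case .
  qed auto
  define g where "g = (\<lambda>n::nat. if n = 0 then f 1 else f 2 * (1/50) ^ (n - 1))"
  have gs: "g sums (f 1 + f 2 * (50/49))"
  proof -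
    have "(\<lambda>n. f 2 * (1/50) ^ n) sums (f 2 * (1 / (1 - 1/50)))"
      by (intro sums_mult geometric_sums) auto
    hence "(\<lambda>n. g (Suc n)) sums (f 2 * (50/49))" by (simp add: g_def)
    thus ?thesis by (subst (asm) sums_Suc_iff) (simp add: g_def add.commute)
  qed
  have g0: "g n \<ge> 0" for n using f0 by (auto simp: g_def)
  have ghs: "(g has_sum (f 1 + f 2 * (50/49))) UNIV"
    by (rule sums_nonneg_imp_has_sum[OF gs g0])
  have fg: "f (int (Suc n)) \<le> g n" for n
    using t[of "Suc n"] by (cases "n = 0") (auto simp: g_def)
  have sS: "(\<lambda>n. f (int (Suc n))) summable_on UNIV"
    by (rule summable_on_comparison_test[of g]) (use ghs fg f0 in \<open>auto simp: summable_on_def\<close>)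
  have "infsum (\<lambda>n. f (int (Suc n))) UNIV \<le> f 1 + f 2 * (50/49)"
    using infsum_mono[OF sS, of g] ghs fg by (auto simp: infsumI summable_on_def)
  then obtain P where P: "((\<lambda>n. f (int (Suc n))) has_sum P) UNIV" "P \<le> f 1 + f 2 * (50/49)"
    using has_sum_infsum[OF sS] by blast
  have p: "(f has_sum P) {0<..}"
    using P(1) has_sum_reindex_bij_witness[of UNIV "\<lambda>m. nat m - 1" "\<lambda>n. int (Suc n)" "{0<..}" f "\<lambda>n. f (int (Suc n))" P P]
    by auto
  have n: "(f has_sum P) {..<0}"
    using p has_sum_reindex_bij_witness[of "{..<0}" uminus uminus "{0<..}" f f P P] even by auto
  have "(f has_sum (P + P)) ({0<..} \<union> {..<0})"
    by (intro has_sum_Un_disjoint p n) auto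
  hence all: "(f has_sum (P + P)) UNIV"
  proof (rule iffD1[OF has_sum_cong_neutral, rotated -1])
    fix m :: int assume "m \<in> UNIV - ({0<..} \<union> {..<0})"
    hence "m = 0" by auto
    thus "f m = 0" using \<open>f 0 = 0\<close> by simp
  qed auto
  thus "f summable_on UNIV" "infsum f UNIV \<le> 2 * f 1 + 2 * (50/49) * f 2"
    using P(2) by (auto simp: summable_on_def infsumI)
qed

lemma infsum_product_real:
  fixes f g :: "int \<Rightarrow> real"
  assumes "f summable_on UNIV" "g summable_on UNIV" "\<And>m. f m \<ge> 0" "\<And>m. g m \<ge> 0"
  shows "((\<lambda>(m, k). f m * g k) has_sum (infsum f UNIV * infsum g UNIV)) UNIV"
proof -
  have 1: "((\<lambda>k. case (m, k) of (m, k) \<Rightarrow> f m * g k) has_sum f m * infsum g UNIV) UNIV" for m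
    using assms by (auto intro!: has_sum_cmult_right has_sum_infsum)
  have 2: "((\<lambda>m. f m * infsum g UNIV) has_sum infsum f UNIV * infsum g UNIV) UNIV"
    using assms by (intro has_sum_cmult_left has_sum_infsum)
  have s: "(\<lambda>(m, k). f m * g k) summable_on (UNIV \<times> UNIV)"
    by (rule summable_on_SigmaI[OF 1]) (use 2 assms in \<open>auto simp: summable_on_def\<close>)
  have "((\<lambda>(m, k). f m * g k) has_sum (infsum f UNIV * infsum g UNIV)) (UNIV \<times> UNIV)"
    by (rule has_sum_SigmaI[OF 1 2 s])
  thus ?thesis by simp
qed

lemma power_ratio_le:
  fixes n :: nat
  assumes "n \<ge> 2"
  shows "real (Suc n) \<le> 3/2 * real n"
  using assms by simp

text \<open>The exponent is normalised by \<open>m\<^sup>2 - 1\<close> so that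
  \<open>m = \<plusminus>1\<close> contribute exactly 1 each. From \<open>m = 2\<close> on the terms
  shrink by at least 50 at each step, whence the factor 50/49.\<close>

lemma quartic_gauss_sum:
  fixes c :: real
  assumes c: "c \<ge> 5/4"
  defines "f \<equiv> \<lambda>m::int. (real_of_int m) ^ 4 * exp (- c * ((real_of_int m)\<^sup>2 - 1))"
    and "g \<equiv> \<lambda>m::int. (real_of_int m)\<^sup>2 * exp (- c * ((real_of_int m)\<^sup>2 - 1))"
  shows "f summable_on UNIV" "infsum f UNIV \<le> 2 + 32 * (50/49) * exp (- 3 * c)"
    and "g summable_on UNIV" "infsum g UNIV \<le> 2 + 8 * (50/49) * exp (- 3 * c)"
proof -
  have e: "exp (- c * ((real (Suc n))\<^sup>2 - 1)) \<le> exp (- c * ((real n)\<^sup>2 - 1)) * (39/10000)" if n: "n \<ge> 2" for n :: nat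
  proof -
    have "exp (- c * ((real (Suc n))\<^sup>2 - 1)) = exp (- c * ((real n)\<^sup>2 - 1)) * exp (- (c * (2 * real n + 1)))"
      by (simp add: power2_eq_square algebra_simps flip: exp_add)
    also have "exp (- (c * (2 * real n + 1))) \<le> exp (-(25/4))"
      using mult_mono[of "5/4" c 5 "2 * real n + 1"] c n by auto
    also have "\<dots> \<le> 39/10000" by (rule exp_minus_le_taylor16) (simp_all add: power_divide)
    finally show ?thesis by simp
  qed
  have r: "f (int (Suc n)) \<le> f (int n) / 50" if n: "n \<ge> 2" for n :: nat
  proof -
    have "(real (Suc n)) ^ 4 \<le> (3/2 * real n) ^ 4" by (intro power_mono) (use power_ratio_le[OF n] in auto)
    hence "f (int (Suc n)) \<le> (3/2 * real n) ^ 4 * (exp (- c * ((real n)\<^sup>2 - 1)) * (39/10000))"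
      unfolding f_def using e[OF n] by (simp only: of_int_of_nat_eq, intro mult_mono) auto
    also have "\<dots> = ((81/16) * (39/10000)) * f (int n)" by (simp add: f_def power_mult_distrib power_divide)
    also have "\<dots> \<le> (1/50) * f (int n)" by (intro mult_right_mono) (auto simp: f_def)
    finally show ?thesis by simp
  qed
  have r2: "g (int (Suc n)) \<le> g (int n) / 50" if n: "n \<ge> 2" for n :: nat
  proof -
    have "(real (Suc n))\<^sup>2 \<le> (3/2 * real n)\<^sup>2" by (intro power_mono) (use power_ratio_le[OF n] in auto)
    hence "g (int (Suc n)) \<le> (3/2 * real n)\<^sup>2 * (exp (- c * ((real n)\<^sup>2 - 1)) * (39/10000))"
      unfolding g_def using e[OF n] by (simp only: of_int_of_nat_eq, intro mult_mono) auto
    also have "\<dots> = ((9/4) * (39/10000)) * g (int n)" by (simp add: g_def power_mult_distrib power_divide)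
    also have "\<dots> \<le> (1/50) * g (int n)" by (intro mult_right_mono) (auto simp: g_def)
    finally show ?thesis by simp
  qed
  have f0: "f m \<ge> 0" "g m \<ge> 0" for m by (auto simp: f_def g_def)
  have f1: "f 1 = 1" "g 1 = 1" "f 2 = 16 * exp (-3 * c)" "g 2 = 4 * exp (-3 * c)" by (auto simp: f_def g_def)
  have zero: "f 0 = 0" "g 0 = 0" and ev: "f (-m) = f m" "g (-m) = g m" for m by (auto simp: f_def g_def)
  show "f summable_on UNIV" "infsum f UNIV \<le> 2 + 32 * (50/49) * exp (- 3 * c)"
    using infsum_int_le_head[of f, OF f0(1) ev(1) zero(1) r] unfolding f1 by simp_all
  show "g summable_on UNIV" "infsum g UNIV \<le> 2 + 8 * (50/49) * exp (- 3 * c)"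
    using infsum_int_le_head[of g, OF f0(2) ev(2) zero(2) r2] unfolding f1 by simp_all
qed

text \<open>The factor \<open>m\<^sup>2 - 1\<close> removes \<open>m = \<plusminus>1\<close>, so the
  sum starts at \<open>m = \<plusminus>2\<close> and is small.\<close>

lemma sextic_gauss_sum:
  fixes c :: real
  assumes c: "c \<ge> 5/4"
  defines "f \<equiv> \<lambda>m::int. (real_of_int m) ^ 4 * ((real_of_int m)\<^sup>2 - 1) * exp (- c * ((real_of_int m)\<^sup>2 - 1))"
  assumes c2: "c \<ge> 2"
  shows "f summable_on UNIV" "infsum f UNIV \<le> 96 * (50/49) * exp (- 3 * c)"
proof -
  have f0: "f m \<ge> 0" for m
  proof (cases "m = 0")
    case False
    hence "1 \<le> \<bar>real_of_int m\<bar>" by linarith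
    hence "1 \<le> (real_of_int m)\<^sup>2" by (metis one_le_power power2_abs)
    thus ?thesis by (simp add: f_def)
  qed (simp add: f_def)
  have r: "f (int (Suc n)) \<le> f (int n) / 50" if n: "n \<ge> 2" for n :: nat
  proof -
    have n2: "real n \<ge> 2" using n by simp
    have "exp (- c * ((real (Suc n))\<^sup>2 - 1)) = exp (- c * ((real n)\<^sup>2 - 1)) * exp (- (c * (2 * real n + 1)))"
      by (simp add: power2_eq_square algebra_simps flip: exp_add)
    also have "exp (- (c * (2 * real n + 1))) \<le> exp (-10)"
      using mult_mono[of 2 c 5 "2 * real n + 1"] c2 n2 by auto
    also have "\<dots> \<le> 1/1000" by (rule exp_minus_le_taylor16) (simp_all add: power_divide)
    finally have e: "exp (- c * ((real (Suc n))\<^sup>2 - 1)) \<le> exp (- c * ((real n)\<^sup>2 - 1)) * (1/1000)" by simp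
    have p: "(real (Suc n)) ^ 4 \<le> (3/2 * real n) ^ 4" by (intro power_mono) (use power_ratio_le[OF n] in auto)
    have "2 * 2 \<le> real n * real n" "2 * real n \<le> real n * real n" using n2 mult_mono[of 2 "real n" 2 "real n"] by (auto intro!: mult_right_mono)
    hence q: "(real (Suc n))\<^sup>2 - 1 \<le> 8/3 * ((real n)\<^sup>2 - 1)" "(real n)\<^sup>2 - 1 \<ge> 0" "(real (Suc n))\<^sup>2 - 1 \<ge> 0"
      using n2 unfolding power2_eq_square of_nat_Suc distrib_left distrib_right right_diff_distrib by linarith+
    have "f (int (Suc n)) \<le> (3/2 * real n) ^ 4 * (8/3 * ((real n)\<^sup>2 - 1)) * (exp (- c * ((real n)\<^sup>2 - 1)) * (1/1000))"
      unfolding f_def of_int_of_nat_eq by (intro mult_mono p q e mult_nonneg_nonneg) (use q in auto)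
    also have "\<dots> = ((81/16) * (8/3) * (1/1000)) * f (int n)" by (simp add: f_def power_mult_distrib power_divide)
    also have "\<dots> \<le> (1/50) * f (int n)" by (intro mult_right_mono f0) auto
    finally show ?thesis by simp
  qed
  have f1: "f 1 = 0" "f 2 = 48 * exp (-3 * c)" by (auto simp: f_def)
  have zero: "f 0 = 0" and ev: "f (-m) = f m" for m by (auto simp: f_def)
  show "f summable_on UNIV" "infsum f UNIV \<le> 96 * (50/49) * exp (- 3 * c)"
    using infsum_int_le_head[of f, OF f0 ev zero r] unfolding f1 by simp_all
qed

section \<open>Comparison with the line in the dual representation\<close>

lemma Usum_half_diff_dual:
  assumes y: "y > 0" and s: "s > 0"
  shows "sqrt s * (Usum (M \<times> UNIV) (1/2) y s - Usum (M \<times> UNIV) x y s) =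
     sqrt y * (\<Sum>\<^sub>\<infinity>i\<in>M \<times> UNIV. (cosmk x i - cosmk (1/2) i) * dual_diff y s i * exp (- dual_sum y s i))"
    and "(\<lambda>i. (cosmk x i - cosmk (1/2) i) * dual_diff y s i * exp (- dual_sum y s i)) summable_on M \<times> UNIV"
proof -
  have t: "exp (ln s / 2) = sqrt s"
    using s exp_ln[of "sqrt s"] by (simp add: ln_sqrt)
  let ?f = "\<lambda>x i. cosmk x i * dual_diff y s i * exp (- dual_sum y s i)"
  have sm: "?f x summable_on A" for x A by (intro dual_summable_basic y s abs_cosmk)
  have U: "sqrt s * Usum (M \<times> UNIV) x y s = - (sqrt y * infsum (?f x) (M \<times> UNIV))" for x
    using Usum_dual[OF y, of "ln s" M x] s by (simp add: t infsum_uminus)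
  have e: "(\<lambda>i. (cosmk x i - cosmk (1/2) i) * dual_diff y s i * exp (- dual_sum y s i)) = (\<lambda>i. ?f x i - ?f (1/2) i)"
    by (auto simp: algebra_simps)
  show "(\<lambda>i. (cosmk x i - cosmk (1/2) i) * dual_diff y s i * exp (- dual_sum y s i)) summable_on M \<times> UNIV"
    unfolding e by (intro summable_on_diff_real sm)
  show "sqrt s * (Usum (M \<times> UNIV) (1/2) y s - Usum (M \<times> UNIV) x y s) =
     sqrt y * (\<Sum>\<^sub>\<infinity>i\<in>M \<times> UNIV. (cosmk x i - cosmk (1/2) i) * dual_diff y s i * exp (- dual_sum y s i))"
    unfolding e by (simp add: infsum_diff_real[OF sm sm] right_diff_distrib U)
qed

text \<open>Among the indices with \<open>m * k \<noteq> 0\<close>, the only ones whose phase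
  depends on \<open>x\<close>, these have the smallest dual exponent.\<close>

abbreviation unit_indices :: "(int \<times> int) set" where
  "unit_indices \<equiv> {(1, 1), (1, -1), (-1, 1), (-1, -1)}"

lemma unit_indices_iff: "(m, k) \<in> unit_indices \<longleftrightarrow> \<bar>m\<bar> = 1 \<and> \<bar>k\<bar> = 1"
  by auto

lemma has_sum_unit_indices:
  "((\<lambda>i. if i \<in> unit_indices then c else 0) has_sum (4 * c :: real)) UNIV"
  by (rule has_sum_finite_neutralI[of unit_indices]) auto

lemma int_sq_ge: "m \<noteq> 0 \<Longrightarrow> 1 \<le> (real_of_int m)\<^sup>2"
proof -
  assume "m \<noteq> 0"
  hence "1 \<le> \<bar>real_of_int m\<bar>" by linarith
  thus ?thesis by (metis one_le_power power2_abs)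
qed

lemma sqrt3_bounds: "173205/100000 \<le> sqrt 3" "sqrt 3 \<le> 173206/100000"
  by (rule real_le_rsqrt real_le_lsqrt; simp add: power_divide)+

lemma pi_sqrt3_bound:
  assumes "y \<ge> sqrt 3 / 2"
  shows "pi * y \<ge> 68/25"
proof -
  have "sqrt 3 / 2 \<ge> 866/1000" using sqrt3_bounds by simp
  hence y: "y \<ge> 866/1000" using assms by simp
  have "68/25 \<le> 314159/100000 * (866/1000 :: real)" by simp
  also have "\<dots> \<le> pi * y" using pi_approx y by (intro mult_mono) auto
  finally show ?thesis .
qed

text \<open>Three regimes: in the dual representation the four indices with \<open>\<bar>m\<bar> = \<bar>k\<bar> = 1\<close> dominate unless \<open>y\<close> is small
  compared with \<open>s\<close>, where convexity of the rows \<open>m = \<plusminus>1\<close> of the spatial representation takes over.\<close>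

lemma Usum_less_half_dual_large:
  fixes x y s :: real
  assumes y: "y \<ge> sqrt 3 / 2" and s: "s \<ge> 13/10" and ys: "y \<ge> 2/5 * s"
    and x: "1 + cos (2 * pi * x) > 0"
  shows "Usum UNIV x y s < Usum UNIV (1/2) y s"
proof -
  have y0: "y > 0" using y by (metis half_gt_zero less_le_trans real_sqrt_gt_zero zero_less_numeral)
  have s0: "s > 0" using s by simp
  define d where "d = 1 + cos (2 * pi * x)"
  \<comment> \<open>\<open>E\<close> and \<open>F\<close> carry the decay in \<open>m\<close> and in
    \<open>k\<close>: here \<open>pi * y * s\<close> is at least 7/2 and \<open>pi * y / s\<close>
    at least 5/4.\<close>
  define E F where "E = (\<lambda>m::int. exp (- (7/2) * ((real_of_int m)\<^sup>2 - 1)))"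
    and "F = (\<lambda>m::int. exp (- (5/4) * ((real_of_int m)\<^sup>2 - 1)))"
  define W where "W = (\<lambda>(m, k). 49/20 * (((real_of_int m) ^ 4 * E m) * ((real_of_int k)\<^sup>2 * F k))
                     + 29/20 * (((real_of_int m)\<^sup>2 * E m) * ((real_of_int k) ^ 4 * F k)))"
  define K where "K = d * (pi * y) * (s - 1/s) * exp (- (pi * y * (s + 1/s)))"
  define T where "T = (\<lambda>i. (cosmk x i - cosmk (1/2) i) * dual_diff y s i * exp (- dual_sum y s i))"
  have "1/s < 1" using s by simp
  hence s1: "s - 1/s > 0" using s by linarith
  have K: "K > 0" unfolding K_def d_def using x y0 s1 by simp
  have s2: "s * s \<ge> 169/100" using mult_mono[OF s s] s by simp
  \<comment> \<open>Both inequalities amount to \<open>s\<^sup>2 \<ge> 49/29\<close>, slightly less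
    than the square of 13/10; this ties the weights 49/20 and 29/20 to the lower end of the range of
    \<open>s\<close>.\<close>
  have sa: "s \<le> 49/20 * (s - 1/s)" and sb: "1/s \<le> 29/20 * (s - 1/s)"
    using s2 s0 by (simp_all add: field_simps)
  \<comment> \<open>At the unit indices \<open>W\<close> equals
    \<open>49/20 + 29/20 = 39/10\<close>, so the head 49/10 leaves exactly one \<open>K\<close>
    there; elsewhere \<open>K * W\<close> majorises the term.\<close>
  have le: "K * ((if i \<in> unit_indices then 49/10 else 0) - W i) \<le> T i" for i
  proof (cases i)
    case (Pair m k)
    let ?m = "real_of_int m" and ?k = "real_of_int k"
    consider "m = 0 \<or> k = 0" | "\<bar>m\<bar> = 1" "\<bar>k\<bar> = 1" | "m \<noteq> 0" "k \<noteq> 0" "i \<notin> unit_indices"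
      using Pair unit_indices_iff[of m k] by blast
    thus ?thesis
    proof cases
      case 1
      thus ?thesis by (auto simp: Pair T_def W_def cosmk_def)
    next
      case 2
      hence q: "?m\<^sup>2 = 1" "?k\<^sup>2 = 1" by (auto simp: abs_if split: if_splits)
      hence q4: "?m ^ 4 = 1" "?k ^ 4 = 1" by (metis numeral_Bit0 power_add mult_1_left)+
      have "T i = K"
        using cosmk_half_diff_1[OF 2, of x] q by (simp add: T_def Pair K_def d_def dual_diff_def dual_sum_def)
      moreover have "W i = 39/10" using q q4 by (simp add: W_def Pair E_def F_def)
      moreover have "i \<in> unit_indices" using 2 Pair unit_indices_iff by blast
      ultimately show ?thesis by (simp only: if_True) simp
    next
      case 3
      have m1: "?m\<^sup>2 \<ge> 1" and k1: "?k\<^sup>2 \<ge> 1" using 3 int_sq_ge by auto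
      have "\<bar>dual_diff y s i\<bar> = pi * y * \<bar>s * ?m\<^sup>2 - ?k\<^sup>2 / s\<bar>"
        using y0 by (simp add: dual_diff_def Pair abs_mult)
      also have "\<bar>s * ?m\<^sup>2 - ?k\<^sup>2 / s\<bar> \<le> s * ?m\<^sup>2 + (1/s) * ?k\<^sup>2"
        using s0 by (simp add: abs_le_iff)
      also have "\<dots> \<le> 49/20 * (s - 1/s) * ?m\<^sup>2 + 29/20 * (s - 1/s) * ?k\<^sup>2"
        by (intro add_mono mult_right_mono sa sb) auto
      finally have Z: "\<bar>dual_diff y s i\<bar> \<le> pi * y * (s - 1/s) * (49/20 * ?m\<^sup>2 + 29/20 * ?k\<^sup>2)"
        using y0 by (simp add: algebra_simps)
      have py: "pi * y * s \<ge> 7/2"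
        using mult_mono[OF pi_sqrt3_bound[OF y] s] y0 s0 by simp
      have pys: "pi * y / s \<ge> 5/4"
      proof -
        have "pi * (2/5) \<le> pi * (y / s)" using ys s0 by (intro mult_left_mono) (auto simp: field_simps)
        thus ?thesis using pi_approx by simp
      qed
      have "7/2 * (?m\<^sup>2 - 1) + 5/4 * (?k\<^sup>2 - 1) \<le> pi * y * s * (?m\<^sup>2 - 1) + pi * y / s * (?k\<^sup>2 - 1)"
        using py pys m1 k1 by (intro add_mono mult_right_mono) auto
      also have "\<dots> = dual_sum y s i - pi * y * (s + 1/s)"
        using s0 by (simp add: dual_sum_def Pair field_simps)
      finally have "exp (- dual_sum y s i) \<le> exp (- (pi * y * (s + 1/s))) * (E m * F k)"
        unfolding E_def F_def exp_add[symmetric] by simp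
      hence "\<bar>T i\<bar> \<le> (?m\<^sup>2 * ?k\<^sup>2 * d) * (pi * y * (s - 1/s) * (49/20 * ?m\<^sup>2 + 29/20 * ?k\<^sup>2)) * (exp (- (pi * y * (s + 1/s))) * (E m * F k))"
        unfolding T_def abs_mult abs_exp_cancel
        using cosmk_half_diff[of x m k] Z x unfolding d_def Pair
        by (intro mult_mono) auto
      also have "\<dots> = K * W i"
      proof -
        have alg: "(A * B * d) * (p * w * (49/20 * A + 29/20 * B)) * (e * (E' * F'))
            = d * p * w * e * (49/20 * ((A * A * E') * (B * F')) + 29/20 * ((A * E') * (B * B * F')))"
          for A B d p w e E' F' :: real by algebra
        have four: "z ^ 4 = z\<^sup>2 * z\<^sup>2" for z :: real by simp
        show ?thesis unfolding K_def W_def Pair prod.case four by (rule alg)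
      qed
      finally show ?thesis using 3(3) by simp
    qed
  qed
  have qE: "exp (- 3 * (7/2 :: real)) \<le> 3/100000" using exp_minus_le_taylor16[of "21/2" "3/100000"] by (simp add: power_divide)
  have qF: "exp (- 3 * (5/4 :: real)) \<le> 236/10000" using exp_minus_le_taylor16[of "15/4" "236/10000"] by (simp add: power_divide)
  have EF: "exp (- (7/2) * ((real_of_int m)\<^sup>2 - 1)) = E m" "exp (- (5/4) * ((real_of_int m)\<^sup>2 - 1)) = F m" for m
    by (simp_all only: E_def F_def)
  note sE = quartic_gauss_sum[of "7/2", unfolded EF]
  note sF = quartic_gauss_sum[of "5/4", unfolded EF]
  define e4 e2 f4 f2 where "e4 = (\<Sum>\<^sub>\<infinity>m::int. (real_of_int m) ^ 4 * E m)" and "e2 = (\<Sum>\<^sub>\<infinity>m::int. (real_of_int m)\<^sup>2 * E m)"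
    and "f4 = (\<Sum>\<^sub>\<infinity>m::int. (real_of_int m) ^ 4 * F m)" and "f2 = (\<Sum>\<^sub>\<infinity>m::int. (real_of_int m)\<^sup>2 * F m)"
  have b: "e4 \<le> 2001/1000" "e2 \<le> 2001/1000" "f4 \<le> 2772/1000" "f2 \<le> 2193/1000"
    using sE(2,4) sF(2,4) qE qF unfolding e4_def e2_def f4_def f2_def by simp_all
  have nn: "E m \<ge> 0" "F m \<ge> 0" for m by (auto simp: E_def F_def)
  have pos: "e4 \<ge> 0" "e2 \<ge> 0" "f4 \<ge> 0" "f2 \<ge> 0"
    unfolding e4_def e2_def f4_def f2_def by (intro infsum_nonneg mult_nonneg_nonneg nn; simp)+
  have Ws: "(W has_sum (49/20 * (e4 * f2) + 29/20 * (e2 * f4))) UNIV"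
  proof -
    have "((\<lambda>i. 49/20 * (case i of (m, k) \<Rightarrow> ((real_of_int m) ^ 4 * E m) * ((real_of_int k)\<^sup>2 * F k))
              + 29/20 * (case i of (m, k) \<Rightarrow> ((real_of_int m)\<^sup>2 * E m) * ((real_of_int k) ^ 4 * F k))) has_sum
           (49/20 * (e4 * f2) + 29/20 * (e2 * f4))) UNIV"
      unfolding e4_def e2_def f4_def f2_def
      by (intro has_sum_add has_sum_cmult_right infsum_product_real mult_nonneg_nonneg nn sE(1,3) sF(1,3)) simp_all
    thus ?thesis unfolding W_def by (simp add: case_prod_unfold)
  qed
  \<comment> \<open>The right-hand side is about 18.8, below the head total
    \<open>4 * (49/10) = 19.6\<close>.\<close>
  have Wb: "49/20 * (e4 * f2) + 29/20 * (e2 * f4) \<le> 49/20 * (2001/1000 * (2193/1000)) + 29/20 * (2001/1000 * (2772/1000))"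
    by (intro add_mono mult_left_mono mult_mono b pos) auto
  have "((\<lambda>i. K * ((if i \<in> unit_indices then 49/10 else 0) - W i)) has_sum K * (4 * (49/10) - (49/20 * (e4 * f2) + 29/20 * (e2 * f4)))) UNIV"
    by (intro has_sum_cmult_right has_sum_diff has_sum_unit_indices Ws)
  moreover have "T summable_on UNIV" using Usum_half_diff_dual(2)[OF y0 s0, of x UNIV] unfolding T_def by simp
  ultimately have "K * (4 * (49/10) - (49/20 * (e4 * f2) + 29/20 * (e2 * f4))) \<le> infsum T UNIV"
    using le by (intro has_sum_mono[OF _ has_sum_infsum]) auto
  moreover have "K * (4 * (49/10) - (49/20 * (e4 * f2) + 29/20 * (e2 * f4))) > 0"
    using K Wb by (intro mult_pos_pos) auto
  ultimately have "infsum T UNIV > 0" by linarith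
  hence "sqrt s * (Usum UNIV (1/2) y s - Usum UNIV x y s) > 0"
    using Usum_half_diff_dual(1)[OF y0 s0, of UNIV x] y0 unfolding T_def by simp
  thus ?thesis using s0 by (simp add: zero_less_mult_iff)
qed

text \<open>With \<open>a\<close> and \<open>b\<close> the squares of the two indices, the terms of
  \<open>(m, k)\<close> and \<open>(k, m)\<close> cancel at \<open>s = 1\<close>. Regrouped as
  \<open>(P - R) * E1 - R * (E2 - E1)\<close>, their sum shows the factor \<open>s - 1/s\<close> in
  \<open>P - R\<close> and in the difference of the exponentials.\<close>

lemma paired_bracket_bound:
  fixes a b s p :: real
  assumes ab: "a \<ge> b" "b \<ge> 1" and s: "1 \<le> s" "s \<le> 2" and p: "p \<ge> 0"
  shows "\<bar>(s * a - b / s) * exp (- (p * (s * a + b / s))) + (s * b - a / s) * exp (- (p * (s * b + a / s)))\<bar>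
     \<le> (s - 1/s) * (a + b) * (1 + p * (a + b - 2)) * exp (- (p * (s + 1/s + (a + b - 2) / s)))"
proof -
  define P R where "P = s * a - b / s" and "R = a / s - s * b"
  define X1 X2 where "X1 = s * a + b / s" and "X2 = s * b + a / s"
  define E1 E2 where "E1 = exp (- (p * X1))" and "E2 = exp (- (p * X2))"
  have s1: "1/s \<le> 1" using s by simp
  hence s2: "s - 1/s \<ge> 0" using s by linarith
  have PR: "P - R = (a + b) * (s - 1/s)" by (simp add: P_def R_def algebra_simps diff_divide_distrib add_divide_distrib)
  have X12: "X1 - X2 = (a - b) * (s - 1/s)" by (simp add: X1_def X2_def algebra_simps diff_divide_distrib)
  hence X12': "X1 - X2 \<ge> 0" using ab s2 by simp
  have E12: "0 \<le> E2 - E1" using X12' p unfolding E1_def E2_def by (simp add: mult_left_mono)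
  have "E2 - E1 = E2 * (1 - exp (- (p * (X1 - X2))))"
    by (simp add: E1_def E2_def algebra_simps flip: exp_add)
  also have "\<dots> \<le> E2 * (p * (X1 - X2))"
    using exp_ge_add_one_self[of "- (p * (X1 - X2))"] by (intro mult_left_mono) (auto simp: E2_def)
  finally have E12b: "E2 - E1 \<le> E2 * (p * ((a - b) * (s - 1/s)))" by (simp only: X12)
  have "a / s \<le> a" "0 \<le> a / s" using s ab by (auto simp: field_simps intro: mult_left_mono)
  moreover have "s * b \<le> 2 * b" "0 \<le> s * b" using ab s by (auto intro!: mult_right_mono)
  ultimately have Rb: "\<bar>R\<bar> \<le> a + b" unfolding R_def using ab by linarith
  have "(s * a - b / s) * E1 + (s * b - a / s) * E2 = (P - R) * E1 - R * (E2 - E1)"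
    by (simp add: P_def R_def algebra_simps diff_divide_distrib add_divide_distrib)
  also have "\<bar>\<dots>\<bar> \<le> \<bar>(P - R) * E1\<bar> + \<bar>R * (E2 - E1)\<bar>" by (rule abs_triangle_ineq4)
  also have "\<dots> = (P - R) * E1 + \<bar>R\<bar> * (E2 - E1)"
    using E12 PR ab s2 by (simp add: abs_mult E1_def)
  also have "\<dots> \<le> (P - R) * E2 + (a + b) * (E2 * (p * ((a - b) * (s - 1/s))))"
    using E12 E12b Rb PR ab s2 by (intro add_mono mult_mono mult_left_mono) auto
  also have "\<dots> = (s - 1/s) * (a + b) * (1 + p * (a - b)) * E2"
  proof -
    have "(a + b) * w * E2 + (a + b) * (E2 * (p * ((a - b) * w))) = w * (a + b) * (1 + p * (a - b)) * E2" for w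
      by algebra
    thus ?thesis unfolding PR .
  qed
  also have "\<dots> \<le> (s - 1/s) * (a + b) * (1 + p * (a + b - 2)) * exp (- (p * (s + 1/s + (a + b - 2) / s)))"
  proof (intro mult_mono mult_left_mono)
    have "(b - 1) / s \<le> (b - 1) * s" using ab s by (simp add: divide_le_eq mult_le_cancel_left1) (smt (verit) mult_le_cancel_left1 mult_mono)
    hence "s + 1/s + (a + b - 2) / s \<le> X2"
      by (simp add: X2_def algebra_simps diff_divide_distrib add_divide_distrib)
    thus "E2 \<le> exp (- (p * (s + 1/s + (a + b - 2) / s)))" unfolding E2_def using p by (simp add: mult_left_mono)
    show "1 + p * (a - b) \<le> 1 + p * (a + b - 2)" using ab p by (simp add: mult_left_mono)
  qed (use ab s2 p in \<open>auto simp: E2_def\<close>)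
  finally show ?thesis unfolding E1_def E2_def X1_def X2_def .
qed

text \<open>The condition \<open>c \<le> 1 + z0 * d\<close> says that the logarithmic derivative in
  \<open>z\<close> is nonpositive from \<open>z0\<close> on; \<open>1 + x \<le> exp x\<close>
  expresses this without differentiation.\<close>

lemma linear_exp_decreasing:
  fixes z z0 d c :: real
  assumes "z0 \<le> z" "d \<ge> 0" "c > 0" "c \<le> 1 + z0 * d" "z0 \<ge> 0"
  shows "(1 + z * d) * exp (- (z * d) / c) \<le> (1 + z0 * d) * exp (- (z0 * d) / c)"
proof -
  have pos: "1 + z0 * d > 0" using assms by (smt (verit) mult_nonneg_nonneg)
  have zd: "(z - z0) * d \<ge> 0" using assms by simp
  have "1 + z * d = (1 + z0 * d) * (1 + (z - z0) * d / (1 + z0 * d))" using pos by (simp add: field_simps)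
  also have "\<dots> \<le> (1 + z0 * d) * (1 + (z - z0) * d / c)"
    using assms pos zd by (intro mult_left_mono add_left_mono divide_left_mono) auto
  also have "\<dots> \<le> (1 + z0 * d) * exp ((z - z0) * d / c)"
    using pos exp_ge_add_one_self[of "(z - z0) * d / c"] by (intro mult_left_mono) auto
  finally have "(1 + z * d) * exp (- (z * d) / c) \<le> (1 + z0 * d) * exp ((z - z0) * d / c) * exp (- (z * d) / c)"
    by (intro mult_right_mono) auto
  also have "\<dots> = (1 + z0 * d) * exp (- (z0 * d) / c)"
    by (simp add: algebra_simps diff_divide_distrib flip: exp_add)
  finally show ?thesis .
qed

text \<open>As \<open>s\<close> tends to 1 the unit terms shrink like \<open>s - 1/s\<close>, while
  a general single term does not. Adding each term to its transpose restores the factor, so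
  everything is again measured in units of \<open>K\<close>.\<close>

lemma Usum_less_half_dual_small:
  fixes x y s :: real
  assumes y: "y \<ge> sqrt 3 / 2" and s: "1 < s" "s \<le> 13/10"
    and x: "1 + cos (2 * pi * x) > 0"
  shows "Usum UNIV x y s < Usum UNIV (1/2) y s"
proof -
  have y0: "y > 0" using y by (metis half_gt_zero less_le_trans real_sqrt_gt_zero zero_less_numeral)
  have s0: "s > 0" using s by simp
  define d where "d = 1 + cos (2 * pi * x)"
  define E where "E = (\<lambda>m::int. exp (- (209/100) * ((real_of_int m)\<^sup>2 - 1)))"
  define u2 u4 v4 where "u2 = (\<lambda>m::int. (real_of_int m)\<^sup>2 * E m)" and "u4 = (\<lambda>m::int. (real_of_int m) ^ 4 * E m)"
    and "v4 = (\<lambda>m::int. (real_of_int m) ^ 4 * ((real_of_int m)\<^sup>2 - 1) * E m)"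
  define W where "W = (\<lambda>(m, k). 307/100 * (v4 m * u2 k + v4 m * u4 k + (u2 m * v4 k + u4 m * v4 k)))"
  define K where "K = d * (pi * y) * (s - 1/s) * exp (- (pi * y * (s + 1/s)))"
  define T where "T = (\<lambda>i. (cosmk x i - cosmk (1/2) i) * dual_diff y s i * exp (- dual_sum y s i))"
  have "1/s < 1" using s by simp
  hence s1: "s - 1/s > 0" using s by linarith
  have K: "K > 0" unfolding K_def d_def using x y0 s1 by simp
  have nnE: "E m \<ge> 0" for m by (auto simp: E_def)
  have nn: "u2 m \<ge> 0" "u4 m \<ge> 0" "v4 m \<ge> 0" for m
    using int_sq_ge[of m] by (cases "m = 0"; auto simp: u2_def u4_def v4_def nnE)+
  have le: "K * ((if i \<in> unit_indices then 2 else 0) - W i) \<le> T i + T (prod.swap i)" for i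
  proof (cases i)
    case (Pair m k)
    let ?m = "real_of_int m" and ?k = "real_of_int k"
    have sw: "cosmk z (k, m) = cosmk z (m, k)" for z by (simp add: cosmk_def mult_ac)
    consider "m = 0 \<or> k = 0" | "\<bar>m\<bar> = 1" "\<bar>k\<bar> = 1" | "m \<noteq> 0" "k \<noteq> 0" "i \<notin> unit_indices"
      using Pair unit_indices_iff[of m k] by blast
    thus ?thesis
    proof cases
      case 1
      thus ?thesis using nn K by (auto simp: Pair T_def W_def cosmk_def u2_def u4_def v4_def)
    next
      case 2
      hence q: "?m\<^sup>2 = 1" "?k\<^sup>2 = 1" by (auto simp: abs_if split: if_splits)
      have "T i = K" "T (prod.swap i) = K"
        using cosmk_half_diff_1[OF 2, of x] q sw by (simp_all add: T_def Pair K_def d_def dual_diff_def dual_sum_def)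
      moreover have "0 \<le> K * W i" using nn K by (simp add: W_def Pair)
      moreover have "i \<in> unit_indices" using 2 Pair unit_indices_iff by blast
      ultimately show ?thesis by (simp only: if_True right_diff_distrib)
    next
      case 3
      have m1: "?m\<^sup>2 \<ge> 1" and k1: "?k\<^sup>2 \<ge> 1" using 3 int_sq_ge by auto
      define D where "D = ?m\<^sup>2 + ?k\<^sup>2 - 2"
      have D3: "D \<ge> 3"
      proof -
        have "\<not> (\<bar>m\<bar> = 1 \<and> \<bar>k\<bar> = 1)" using 3(3) Pair unit_indices_iff[of m k] by blast
        hence "\<bar>m\<bar> \<ge> 2 \<or> \<bar>k\<bar> \<ge> 2" using 3(1,2) by arith
        moreover have "(real_of_int j)\<^sup>2 \<ge> 4" if "\<bar>j\<bar> \<ge> 2" for j :: int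
          using power_mono[of 2 "\<bar>real_of_int j\<bar>" 2] that by simp
        ultimately have "?m\<^sup>2 \<ge> 4 \<or> ?k\<^sup>2 \<ge> 4" by blast
        thus ?thesis unfolding D_def using m1 k1 by linarith
      qed
      define Br where "Br = (s * ?m\<^sup>2 - ?k\<^sup>2 / s) * exp (- (pi * y * (s * ?m\<^sup>2 + ?k\<^sup>2 / s)))
             + (s * ?k\<^sup>2 - ?m\<^sup>2 / s) * exp (- (pi * y * (s * ?k\<^sup>2 + ?m\<^sup>2 / s)))"
      have TT: "T i + T (prod.swap i) = (cosmk x (m, k) - cosmk (1/2) (m, k)) * (pi * y * Br)"
      proof -
        have "c * (p * u) * e + c * (p * v) * e' = c * (p * (u * e + v * e'))" for c p u v e e' :: real
          by algebra
        thus ?thesis unfolding T_def Pair swap_simp sw dual_diff_def dual_sum_def prod.case Br_def .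
      qed
      have B1: "\<bar>Br\<bar> \<le> (s - 1/s) * (?m\<^sup>2 + ?k\<^sup>2) * (1 + pi * y * D) * exp (- (pi * y * (s + 1/s + D / s)))"
      proof (cases "?k\<^sup>2 \<le> ?m\<^sup>2")
        case True
        thus ?thesis using paired_bracket_bound[OF True k1, of s "pi * y"] s y0 unfolding Br_def D_def by simp
      next
        case False
        hence "?m\<^sup>2 \<le> ?k\<^sup>2" by simp
        from paired_bracket_bound[OF this m1, of s "pi * y"] s y0 show ?thesis
          unfolding Br_def D_def by (simp add: add.commute)
      qed
      \<comment> \<open>\<open>pi * y \<ge> 68/25\<close> and \<open>s \<le> 13/10\<close> give the
        rate 209/100, and \<open>1 + 68/25 * D \<le> 307/100 * D\<close> because
        \<open>D \<ge> 3\<close>.\<close>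
      have e1: "(1 + pi * y * D) * exp (- (pi * y * D / s)) \<le> 307/100 * D * (E m * E k)"
      proof -
        have "(1 + pi * y * D) * exp (- (pi * y * D / s)) \<le> (1 + pi * y * D) * exp (- (pi * y * D) / (13/10))"
        proof (intro mult_left_mono)
          have "pi * y * D / (13/10) \<le> pi * y * D / s"
            using s y0 D3 by (intro divide_left_mono mult_nonneg_nonneg mult_pos_pos) auto
          thus "exp (- (pi * y * D / s)) \<le> exp (- (pi * y * D) / (13/10))" by simp
        qed (use y0 D3 in auto)
        also have "\<dots> \<le> (1 + 68/25 * D) * exp (- (68/25 * D) / (13/10))"
          by (rule linear_exp_decreasing) (use pi_sqrt3_bound[OF y] D3 in auto)
        also have "\<dots> \<le> (307/100 * D) * exp (- (209/100) * D)"
          using D3 by (intro mult_mono) auto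
        also have "exp (- (209/100) * D) = E m * E k"
          unfolding E_def D_def by (simp add: field_simps flip: exp_add)
        finally show ?thesis .
      qed
      have "\<bar>T i + T (prod.swap i)\<bar> \<le> (?m\<^sup>2 * ?k\<^sup>2 * d) * (pi * y * ((s - 1/s) * (?m\<^sup>2 + ?k\<^sup>2) * (1 + pi * y * D) * exp (- (pi * y * (s + 1/s + D / s)))))"
        unfolding TT abs_mult using cosmk_half_diff[of x m k] B1 x y0 unfolding d_def
        by (intro mult_mono) auto
      also have "exp (- (pi * y * (s + 1/s + D / s))) = exp (- (pi * y * (s + 1/s))) * exp (- (pi * y * D / s))"
        by (simp add: algebra_simps flip: exp_add)
      also have "(?m\<^sup>2 * ?k\<^sup>2 * d) * (pi * y * ((s - 1/s) * (?m\<^sup>2 + ?k\<^sup>2) * (1 + pi * y * D) * (exp (- (pi * y * (s + 1/s))) * exp (- (pi * y * D / s)))))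
         = K * (?m\<^sup>2 * ?k\<^sup>2 * (?m\<^sup>2 + ?k\<^sup>2)) * ((1 + pi * y * D) * exp (- (pi * y * D / s)))"
        by (simp add: K_def)
      also have "\<dots> \<le> K * (?m\<^sup>2 * ?k\<^sup>2 * (?m\<^sup>2 + ?k\<^sup>2)) * (307/100 * D * (E m * E k))"
        using K by (intro mult_left_mono e1) auto
      also have "\<dots> \<le> K * W i"
      proof -
        have "?m\<^sup>2 * ?k\<^sup>2 * (?m\<^sup>2 + ?k\<^sup>2) * D
           = ?m ^ 4 * (?m\<^sup>2 - 1) * ?k\<^sup>2 + ?m\<^sup>2 * (?m\<^sup>2 - 1) * ?k ^ 4 + ?k\<^sup>2 * (?k\<^sup>2 - 1) * ?m ^ 4 + ?k ^ 4 * (?k\<^sup>2 - 1) * ?m\<^sup>2"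
          by (simp add: D_def power2_eq_square eval_nat_numeral algebra_simps)
        also have "\<dots> \<le> ?m ^ 4 * (?m\<^sup>2 - 1) * ?k\<^sup>2 + ?m ^ 4 * (?m\<^sup>2 - 1) * ?k ^ 4 + ?k ^ 4 * (?k\<^sup>2 - 1) * ?m ^ 4 + ?k ^ 4 * (?k\<^sup>2 - 1) * ?m\<^sup>2"
        proof -
          have "z\<^sup>2 \<le> z ^ 4" if "z\<^sup>2 \<ge> 1" for z :: real
            using mult_left_mono[OF that, of "z\<^sup>2"] by (simp add: eval_nat_numeral algebra_simps)
          thus ?thesis using m1 k1 by (intro add_mono mult_right_mono) auto
        qed
        finally have "?m\<^sup>2 * ?k\<^sup>2 * (?m\<^sup>2 + ?k\<^sup>2) * D * (307/100 * (E m * E k)) \<le>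
           (?m ^ 4 * (?m\<^sup>2 - 1) * ?k\<^sup>2 + ?m ^ 4 * (?m\<^sup>2 - 1) * ?k ^ 4 + ?k ^ 4 * (?k\<^sup>2 - 1) * ?m ^ 4 + ?k ^ 4 * (?k\<^sup>2 - 1) * ?m\<^sup>2) * (307/100 * (E m * E k))"
          using nnE by (intro mult_right_mono) auto
        hence "?m\<^sup>2 * ?k\<^sup>2 * (?m\<^sup>2 + ?k\<^sup>2) * (307/100 * D * (E m * E k)) \<le> W i"
          by (simp add: W_def Pair u2_def u4_def v4_def algebra_simps)
        from mult_left_mono[OF this, of K] K show ?thesis by (simp add: mult.assoc)
      qed
      finally show ?thesis using 3(3) by simp
    qed
  qed
  have qE: "exp (- 3 * (209/100 :: real)) \<le> 19/10000" using exp_minus_le_taylor16[of "627/100" "19/10000"] by (simp add: power_divide)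
  have E: "exp (- (209/100) * ((real_of_int m)\<^sup>2 - 1)) = E m" for m
    by (simp only: E_def)
  note sE = quartic_gauss_sum[of "209/100", unfolded E, folded u4_def u2_def]
  note sV = sextic_gauss_sum[of "209/100", unfolded E, folded v4_def]
  define S2 S4 V4 where "S2 = infsum u2 UNIV" and "S4 = infsum u4 UNIV" and "V4 = infsum v4 UNIV"
  have b: "S2 \<le> 21/10" "S4 \<le> 21/10" "V4 \<le> 2/10"
    using sE(2,4) sV(2) qE unfolding S2_def S4_def V4_def by simp_all
  have pos: "S2 \<ge> 0" "S4 \<ge> 0" "V4 \<ge> 0"
    unfolding S2_def S4_def V4_def by (intro infsum_nonneg nn; simp)+
  have Ws: "(W has_sum (307/100 * (V4 * S2 + V4 * S4 + (S2 * V4 + S4 * V4)))) UNIV"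
  proof -
    have "((\<lambda>i. 307/100 * ((case i of (m, k) \<Rightarrow> v4 m * u2 k) + (case i of (m, k) \<Rightarrow> v4 m * u4 k)
        + ((case i of (m, k) \<Rightarrow> u2 m * v4 k) + (case i of (m, k) \<Rightarrow> u4 m * v4 k)))) has_sum
           (307/100 * (V4 * S2 + V4 * S4 + (S2 * V4 + S4 * V4)))) UNIV"
      unfolding S2_def S4_def V4_def
      by (intro has_sum_add has_sum_cmult_right infsum_product_real nn sE(1,3) sV(1)) simp_all
    thus ?thesis unfolding W_def by (simp add: case_prod_unfold)
  qed
  have Wb: "307/100 * (V4 * S2 + V4 * S4 + (S2 * V4 + S4 * V4)) \<le>
     307/100 * (2/10 * (21/10) + 2/10 * (21/10) + (21/10 * (2/10) + 21/10 * (2/10)))"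
    by (intro add_mono mult_left_mono mult_mono b pos) auto
  have L: "((\<lambda>i. K * ((if i \<in> unit_indices then 2 else 0) - W i)) has_sum K * (4 * 2 - (307/100 * (V4 * S2 + V4 * S4 + (S2 * V4 + S4 * V4))))) UNIV"
    by (intro has_sum_cmult_right has_sum_diff has_sum_unit_indices Ws)
  have Ts: "(T has_sum infsum T UNIV) UNIV" using Usum_half_diff_dual(2)[OF y0 s0, of x UNIV] unfolding T_def by simp
  \<comment> \<open>Transposing the indices preserves the total, so the paired sum is twice the
    wanted one; accordingly each unit index contributes \<open>2 * K\<close>.\<close>
  have Tw: "((\<lambda>i. T (prod.swap i)) has_sum infsum T UNIV) UNIV"
    using Ts has_sum_swap[where f=T and S="infsum T UNIV" and A=UNIV and B=UNIV] by (simp add: case_prod_unfold prod.swap_def)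
  have "K * (4 * 2 - (307/100 * (V4 * S2 + V4 * S4 + (S2 * V4 + S4 * V4)))) \<le> infsum T UNIV + infsum T UNIV"
    by (rule has_sum_mono[OF L has_sum_add[OF Ts Tw]]) (rule le)
  moreover have "K * (4 * 2 - (307/100 * (V4 * S2 + V4 * S4 + (S2 * V4 + S4 * V4)))) > 0"
    using K Wb by (intro mult_pos_pos) auto
  ultimately have "infsum T UNIV > 0" by linarith
  hence "sqrt s * (Usum UNIV (1/2) y s - Usum UNIV x y s) > 0"
    using Usum_half_diff_dual(1)[OF y0 s0, of UNIV x] y0 unfolding T_def by simp
  thus ?thesis using s0 by (simp add: zero_less_mult_iff)
qed

section \<open>Comparison with the line in the spatial representation\<close>

definition row_profile :: "real \<Rightarrow> real \<Rightarrow> real \<Rightarrow> real" where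
  "row_profile a b r = (a + b * r\<^sup>2 - 1/2) * exp (- (a + b * r\<^sup>2))"

lemma row_profile_minus [simp]: "row_profile a b (-r) = row_profile a b r"
  by (simp add: row_profile_def)

text \<open>\<open>row_profile\<close> is minus the summand of \<open>Usum\<close> in the row
  \<open>m = 1\<close>, with \<open>a = pi * y * s\<close>, \<open>b = pi * s / y\<close> and
  \<open>r = n + x\<close>. Convexity for \<open>r \<ge> 1\<close> settles all shifts of at most 1/2
  around half-integers other than \<open>\<plusminus>1/2\<close>.\<close>

lemma row_profile_convex:
  assumes b: "b \<ge> 785/100" and a: "a \<ge> 3/4 * b"
  shows "convex_on {1..} (row_profile a b)"
proof (rule f''_ge0_imp_convex)
  fix r :: real assume "r \<in> {1..}"
  hence r: "r \<ge> 1" by simp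
  let ?e = "exp (- (a + b * r\<^sup>2))"
  show "(row_profile a b has_real_derivative (-2 * b * r * (a + b * r\<^sup>2 - 3/2) * ?e)) (at r)"
    unfolding row_profile_def by (auto intro!: derivative_eq_intros simp: algebra_simps power2_eq_square)
  show "((\<lambda>r. -2 * b * r * (a + b * r\<^sup>2 - 3/2) * exp (- (a + b * r\<^sup>2))) has_real_derivative
     (2 * b * ((2 * b * r\<^sup>2 - 1) * (a + b * r\<^sup>2 - 3/2) - 2 * b * r\<^sup>2) * ?e)) (at r)"
    by (auto intro!: derivative_eq_intros simp: algebra_simps power2_eq_square)
  have r2: "r\<^sup>2 \<ge> 1" using r by simp
  hence br: "b * r\<^sup>2 \<ge> b" using b by simp
  have "1 \<le> b * r\<^sup>2" using br b by linarith
  hence "2 * b * r\<^sup>2 \<le> (2 * b * r\<^sup>2 - 1) * 2" by (simp add: mult.assoc)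
  also have "\<dots> \<le> (2 * b * r\<^sup>2 - 1) * (a + b * r\<^sup>2 - 3/2)"
  proof (rule mult_left_mono)
    show "2 \<le> a + b * r\<^sup>2 - 3/2" using br b a by linarith
    show "0 \<le> 2 * b * r\<^sup>2 - 1" using \<open>1 \<le> b * r\<^sup>2\<close> unfolding mult.assoc by linarith
  qed
  finally show "2 * b * ((2 * b * r\<^sup>2 - 1) * (a + b * r\<^sup>2 - 3/2) - 2 * b * r\<^sup>2) * ?e \<ge> 0"
    using b by simp
qed simp

lemma row_profile_pair_ge:
  assumes b: "b \<ge> 785/100" and a: "a \<ge> 3/4 * b" and e: "0 \<le> e" "e \<le> 1/2" and r: "\<bar>r\<bar> \<ge> 3/2"
  shows "2 * row_profile a b r \<le> row_profile a b (r - e) + row_profile a b (r + e)"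
proof -
  have *: "2 * row_profile a b r \<le> row_profile a b (r - e) + row_profile a b (r + e)" if "r \<ge> 3/2" for r
    using convex_onD[OF row_profile_convex[OF b a], of "1/2" "r - e" "r + e"] that e
    by (simp add: field_simps)
  show ?thesis
  proof (cases "r \<ge> 0")
    case True thus ?thesis using * r by simp
  next
    case False
    have "row_profile a b (-r - e) = row_profile a b (r + e)" "row_profile a b (-r + e) = row_profile a b (r - e)"
      using row_profile_minus[of a b "r + e"] row_profile_minus[of a b "r - e"] by simp_all
    moreover have "-r \<ge> 3/2" using r False by simp
    ultimately show ?thesis using *[of "-r"] by (simp only: row_profile_minus add.commute)
  qed
qed

text \<open>The second difference of the profile at \<open>r = 1/2\<close>, divided by
  \<open>exp (- (a + b/4))\<close>: a shift by \<open>e\<close> changes the exponent by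
  \<open>- E + q\<close> and \<open>E + q\<close>, where \<open>E = b * e\<close> and
  \<open>q = b * e\<^sup>2\<close>. For \<open>E \<ge> 2\<close> the growing exponential alone is
  enough; for smaller \<open>E\<close> Taylor polynomials in \<open>E\<^sup>2\<close> are
  compared.\<close>

lemma exp_pair_lower:
  fixes b c E :: real
  assumes b: "b \<ge> 785/100" and c: "c \<ge> b - 1/2" and E: "0 \<le> E" "E \<le> b/2"
  defines "q \<equiv> E\<^sup>2 / b"
  shows "E\<^sup>2 / 10 \<le> (c - E + q) * exp (E - q) + (c + E + q) * exp (- E - q) - 2 * c"
proof (cases "E \<ge> 2")
  case True
  define psi where "psi = E - q"
  have q0: "q \<ge> 0" using b by (simp add: q_def)
  have bq: "b * q = E\<^sup>2" using b by (simp add: q_def)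
  \<comment> \<open>The product is \<open>b\<close> times the increase of
    \<open>E - E\<^sup>2 / b\<close> over its value at \<open>E = 2\<close>.\<close>
  have "(E - 2) * (b - (E + 2)) \<ge> 0" using True E b by (intro mult_nonneg_nonneg) auto
  hence "b * psi \<ge> 2 * b - 4" unfolding psi_def right_diff_distrib bq by (simp add: power2_eq_square algebra_simps)
  hence "b * (psi - 149/100) \<ge> 0" unfolding right_diff_distrib using b by linarith
  hence p1: "psi \<ge> 149/100" using b by (simp add: zero_le_mult_iff)
  have "E * E \<le> E * (b/2)" using E by (intro mult_left_mono) auto
  hence "b * (E/2) \<le> b * psi" unfolding psi_def right_diff_distrib bq by (simp add: power2_eq_square algebra_simps)
  hence p2: "E / 2 \<le> psi" using b by simp
  have "0 \<le> (E - b/2)\<^sup>2" by simp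
  hence "b * psi \<le> b * (b/4)" unfolding psi_def right_diff_distrib bq by (simp add: power2_eq_square algebra_simps)
  hence p3: "psi \<le> b/4" using b by simp
  have cpsi: "c - psi \<ge> 73/100 * c" using p3 c b by simp
  have cp: "c \<ge> 735/100" using b c by simp
  have ex: "exp psi \<ge> 1 + psi + psi\<^sup>2/2"
    using p1 exp_lower_Taylor_quadratic[of psi] by simp
  have p12: "psi\<^sup>2 \<ge> 22/10" using mult_mono[OF p1 p1] p1 by (simp add: power2_eq_square)
  have "E\<^sup>2 \<le> (2 * psi)\<^sup>2" using p2 E by (intro power_mono) auto
  hence "E\<^sup>2 / 10 \<le> 4/10 * psi\<^sup>2" by simp
  also have "\<dots> \<le> 735/100 * (73/100 * (1 + psi + psi\<^sup>2/2) - 2)"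
  proof -
    have "735/100 * (73/100 * (1 + psi + psi\<^sup>2/2) - 2) = 53655/10000 + 53655/10000 * psi + 53655/20000 * psi\<^sup>2 - 147/10"
      by (simp add: field_simps)
    thus ?thesis using p12 p1 by linarith
  qed
  also have "\<dots> \<le> c * (73/100 * (1 + psi + psi\<^sup>2/2) - 2)"
    using cp p12 p1 by (intro mult_right_mono) auto
  also have "\<dots> = (73/100 * c) * (1 + psi + psi\<^sup>2/2) - 2 * c" by (simp add: algebra_simps)
  also have "\<dots> \<le> (c - psi) * exp psi - 2 * c"
    using cpsi ex cp p1 by (intro diff_right_mono mult_mono) auto
  also have "\<dots> \<le> (c - E + q) * exp (E - q) + (c + E + q) * exp (- E - q) - 2 * c"
    using cp E q0 by (simp add: psi_def algebra_simps)
  finally show ?thesis .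
next
  case False
  define t where "t = E\<^sup>2"
  have cp: "c \<ge> 735/100" using b c by simp
  have t: "0 \<le> t" "t \<le> 4" using False E power_mono[of E 2 2] by (auto simp: t_def)
  have q: "0 \<le> q" "q \<le> 1274/10000 * t"
  proof -
    show "0 \<le> q" using b by (simp add: q_def)
    have "t * 1 \<le> t * (1274/10000 * b)" using b t by (intro mult_left_mono) auto
    thus "q \<le> 1274/10000 * t" using b by (simp add: q_def t_def[symmetric] divide_le_eq mult_ac)
  qed
  \<comment> \<open>\<open>(c - E) * exp E + (c + E) * exp (- E)\<close> with both exponentials
    replaced by their degree five Taylor polynomials; odd powers of \<open>E\<close> cancel, leaving
    a polynomial in \<open>t\<close>.\<close>
  define G where "G = c * (2 + t + t\<^sup>2/12) - t * (2 + t/3 + t\<^sup>2/60)"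
  have G0: "G \<le> (c - E + q) * exp E + (c + E + q) * exp (- E)"
  proof -
    have e1: "1 + E + E\<^sup>2/2 + E^3/6 + E^4/24 + E^5/120 \<le> exp E"
      using exp_ge_taylor6[OF E(1)] zero_le_power[OF E(1), of 6] by linarith
    have e2: "1 - E + E\<^sup>2/2 - E^3/6 + E^4/24 - E^5/120 \<le> exp (-E)"
      using exp_minus_taylor(2)[OF E(1)] .
    have "G = (c - E) * (1 + E + E\<^sup>2/2 + E^3/6 + E^4/24 + E^5/120) + (c + E) * (1 - E + E\<^sup>2/2 - E^3/6 + E^4/24 - E^5/120)"
      by (simp add: G_def t_def power2_eq_square eval_nat_numeral field_simps)
    also have "\<dots> \<le> (c - E) * exp E + (c + E) * exp (-E)"
      using cp False E by (intro add_mono mult_left_mono e1 e2) auto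
    also have "\<dots> \<le> (c - E) * exp E + (c + E) * exp (-E) + q * (exp E + exp (-E))"
      using q by simp
    also have "\<dots> = (c - E + q) * exp E + (c + E + q) * exp (- E)" by (simp add: algebra_simps)
    finally show ?thesis .
  qed
  have t2: "t\<^sup>2 \<le> 4 * t" "t ^ 3 \<le> 16 * t" "0 \<le> t^4"
    using t mult_right_mono[of t 4 t] mult_right_mono[of "t * t" "4 * 4" t] mult_mono[of t 4 t 4]
    by (auto simp: power2_eq_square power3_eq_cube)
  have lin: "(1 - 1274/10000 * t) * (2 + t + t\<^sup>2/12) - 2 \<ge> 0"
  proof -
    have "(1 - 1274/10000 * t) * (2 + t + t\<^sup>2/12) - 2 = 7452/10000 * t + (1/12 - 1274/10000) * t\<^sup>2 - 1274/120000 * t^3"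
      by (simp add: power2_eq_square power3_eq_cube algebra_simps)
    thus ?thesis using t t2 by simp
  qed
  have Gnn: "G \<ge> 0"
  proof -
    have "t * (2 + t/3 + t\<^sup>2/60) \<le> 4 * (2 + 4/3 + 16/60)"
      using t t2 by (intro mult_mono add_mono) auto
    moreover have "735/100 * 2 \<le> c * (2 + t + t\<^sup>2/12)" using cp t by (intro mult_mono) auto
    ultimately show ?thesis unfolding G_def by simp
  qed
  have "t / 10 + 2 * c \<le> (1 - 1274/10000 * t) * G"
  proof -
    have "(1 - 1274/10000 * t) * G - 2 * c = c * ((1 - 1274/10000 * t) * (2 + t + t\<^sup>2/12) - 2)
        - (1 - 1274/10000 * t) * (t * (2 + t/3 + t\<^sup>2/60))"
      by (simp add: G_def algebra_simps)
    also have "\<dots> \<ge> 735/100 * ((1 - 1274/10000 * t) * (2 + t + t\<^sup>2/12) - 2)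
        - (1 - 1274/10000 * t) * (t * (2 + t/3 + t\<^sup>2/60))"
      by (intro diff_right_mono mult_right_mono cp lin)
    also have "735/100 * ((1 - 1274/10000 * t) * (2 + t + t\<^sup>2/12) - 2)
        - (1 - 1274/10000 * t) * (t * (2 + t/3 + t\<^sup>2/60))
      = 347722/100000 * t + (735/1200 - 735*1274/1000000 - 1/3 + 2548/10000) * t\<^sup>2
         + (1274/30000 - 1/60 - 735*1274/12000000) * t^3 + 1274/600000 * t^4"
      by (simp add: power2_eq_square power3_eq_cube eval_nat_numeral field_simps)
    finally have "(1 - 1274/10000 * t) * G - 2 * c \<ge> 347722/100000 * t + (735/1200 - 735*1274/1000000 - 1/3 + 2548/10000) * t\<^sup>2
         + (1274/30000 - 1/60 - 735*1274/12000000) * t^3 + 1274/600000 * t^4" .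
    hence "173861/50000 * t - 120727/300000 * t\<^sup>2 - 20893/400000 * t^3 + 637/300000 * t^4 \<le> (1 - 1274/10000 * t) * G - 2 * c"
      by simp
    thus ?thesis using t t2 by linarith
  qed
  also have "(1 - 1274/10000 * t) * G \<le> (1 - q) * G"
    using q Gnn by (intro mult_right_mono) auto
  also have "\<dots> \<le> exp (-q) * G" using exp_ge_add_one_self[of "-q"] Gnn by (intro mult_right_mono) auto
  also have "\<dots> \<le> exp (-q) * ((c - E + q) * exp E + (c + E + q) * exp (- E))"
    using G0 by (intro mult_left_mono) auto
  also have "\<dots> = (c - E + q) * exp (E - q) + (c + E + q) * exp (- E - q)"
    by (simp add: algebra_simps flip: exp_add)
  finally show ?thesis by (simp add: t_def)
qed

lemma row_profile_main:
  assumes b: "b \<ge> 785/100" and a: "a \<ge> 3/4 * b" and e: "0 \<le> e" "e \<le> 1/2"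
  shows "(b * e)\<^sup>2 / 10 * exp (- (a + b/4)) \<le> row_profile a b (1/2 - e) + row_profile a b (1/2 + e) - 2 * row_profile a b (1/2)"
proof -
  define E c q where "E = b * e" and "c = a + b/4 - 1/2" and "q = E\<^sup>2 / b"
  have q: "q = b * e\<^sup>2" using b by (simp add: q_def E_def power2_eq_square)
  have "E\<^sup>2 / 10 \<le> (c - E + q) * exp (E - q) + (c + E + q) * exp (- E - q) - 2 * c"
    unfolding q_def by (rule exp_pair_lower[OF b]) (use a b e in \<open>auto simp: E_def c_def\<close>)
  from mult_right_mono[OF this, of "exp (- (a + b/4))"]
  have "E\<^sup>2 / 10 * exp (- (a + b/4)) \<le> (c - E + q) * (exp (E - q) * exp (- (a + b/4))) + (c + E + q) * (exp (- E - q) * exp (- (a + b/4))) - 2 * (c * exp (- (a + b/4)))"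
    by (simp add: algebra_simps)
  also have "exp (E - q) * exp (- (a + b/4)) = exp (- (a + b * (1/2 - e)\<^sup>2))"
    by (simp add: E_def q power2_eq_square algebra_simps flip: exp_add)
  also have "exp (- E - q) * exp (- (a + b/4)) = exp (- (a + b * (1/2 + e)\<^sup>2))"
    by (simp add: E_def q power2_eq_square algebra_simps flip: exp_add)
  also have "c - E + q = a + b * (1/2 - e)\<^sup>2 - 1/2" by (simp add: c_def E_def q power2_eq_square algebra_simps)
  also have "c + E + q = a + b * (1/2 + e)\<^sup>2 - 1/2" by (simp add: c_def E_def q power2_eq_square algebra_simps)
  finally show ?thesis by (simp add: row_profile_def E_def c_def power_divide algebra_simps)
qed

lemma infsum_gauss_le_geometric:
  fixes c r :: real
  assumes c: "c > 0" and r: "exp (-c) \<le> r" "r < 1"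
  shows "infsum (\<lambda>m::int. exp (- c * (real_of_int m)\<^sup>2)) UNIV \<le> (1 + r) / (1 - r)"
proof (rule has_sum_mono[OF has_sum_infsum[OF summable_gauss_int[OF c]] has_sum_int_geometric])
  fix m :: int
  have "exp (- c * (real_of_int m)\<^sup>2) \<le> exp (-c) ^ nat \<bar>m\<bar>" using c by (intro exp_le_power_abs_int) auto
  also have "\<dots> \<le> r ^ nat \<bar>m\<bar>" using r by (intro power_mono) auto
  finally show "exp (- c * (real_of_int m)\<^sup>2) \<le> r ^ nat \<bar>m\<bar>" .
qed (use r exp_gt_zero[of "-c"] in linarith)+

lemma infsum_gauss_le:
  fixes c :: real
  assumes c: "c > 0"
  shows "infsum (\<lambda>m::int. exp (- c * (real_of_int m)\<^sup>2)) UNIV \<le> 1 + 2 / c"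
proof -
  have "exp (-c) < 1" using c by simp
  hence "infsum (\<lambda>m::int. exp (- c * (real_of_int m)\<^sup>2)) UNIV \<le> (1 + exp (-c)) / (1 - exp (-c))"
    by (intro infsum_gauss_le_geometric c) auto
  also have "\<dots> \<le> 1 + 2 / c"
  proof -
    have "(1 + c) * exp (-c) \<le> exp c * exp (-c)" by (intro mult_right_mono) (auto simp: exp_ge_add_one_self)
    hence "(1 + c) * exp (-c) \<le> 1" by (simp flip: exp_add)
    thus ?thesis using c \<open>exp (-c) < 1\<close> by (simp add: field_simps)
  qed
  finally show ?thesis .
qed

text \<open>The rows with \<open>\<bar>m\<bar> \<ge> 2\<close> are estimated in dual form because
  there every term shows the factor \<open>d\<close>, of second order in \<open>1/2 - x\<close> like
  the gain from the rows \<open>\<plusminus>1\<close>.\<close>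

lemma Usum_less_half_outer_rows:
  fixes x y s :: real
  assumes y: "y \<ge> sqrt 3 / 2" and ys: "y \<le> 2/5 * s"
  defines "d \<equiv> 1 + cos (2 * pi * x)" and "a \<equiv> pi * y * s" and "b \<equiv> pi * s / y"
  shows "\<bar>sqrt s * (Usum ({m. \<bar>m\<bar> \<ge> 2} \<times> UNIV) (1/2) y s - Usum ({m. \<bar>m\<bar> \<ge> 2} \<times> UNIV) x y s)\<bar>
     \<le> sqrt y * (146 * d * b * exp (- (14/5 * a)))"
proof -
  let ?M = "{m::int. \<bar>m\<bar> \<ge> 2}"
  have y0: "y > 0" using y by (metis half_gt_zero less_le_trans real_sqrt_gt_zero zero_less_numeral)
  have y1: "y \<ge> 866/1000" using y sqrt3_bounds by simp
  have s0: "s \<ge> 2165/1000" using ys y1 by simp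
  have d0: "d \<ge> 0" using cos_ge_minus_one[of "2 * pi * x"] unfolding d_def by linarith
  have a: "a \<ge> 588/100"
    using mult_mono[OF pi_sqrt3_bound[OF y] s0] y0 s0 by (simp add: a_def)
  have b: "b \<ge> 785/100"
  proof -
    have "s / y \<ge> 5/2" using ys y0 by (simp add: field_simps)
    hence "314159/100000 * (5/2) \<le> pi * (s / y)" using pi_approx by (intro mult_mono) auto
    moreover have "b = pi * (s / y)" by (simp add: b_def)
    ultimately show ?thesis by linarith
  qed
  define T where "T = (\<lambda>i. (cosmk x i - cosmk (1/2) i) * dual_diff y s i * exp (- dual_sum y s i))"
  \<comment> \<open>A quarter of the exponent pays for its cube. Of the remaining
    \<open>3/4 * a * m\<^sup>2\<close>, the part \<open>a/20 * m\<^sup>2\<close> is kept for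
    summation over \<open>m\<close>, and \<open>7/10 * a * m\<^sup>2 \<ge> 14/5 * a\<close> is the
    decay claimed.\<close>
  define c1 c2 where "c1 = a / 20" and "c2 = 3/4 * (pi * y / s)"
  have c: "c1 > 0" "c2 > 0" using a y0 s0 by (auto simp: c1_def c2_def)
  define P where "P = (\<lambda>(m::int, k::int). exp (- c1 * (real_of_int m)\<^sup>2) * exp (- c2 * (real_of_int k)\<^sup>2))"
  define S1 S2 where "S1 = infsum (\<lambda>m::int. exp (- c1 * (real_of_int m)\<^sup>2)) UNIV" and "S2 = infsum (\<lambda>k::int. exp (- c2 * (real_of_int k)\<^sup>2)) UNIV"
  have Phs: "(P has_sum (S1 * S2)) UNIV"
    unfolding P_def S1_def S2_def by (rule infsum_product_real) (use summable_gauss_int c in auto)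
  have Ps: "P summable_on A" for A
    by (rule summable_on_subset_banach[OF has_sum_imp_summable[OF Phs]]) simp
  have Tb: "\<bar>T i\<bar> \<le> 52 * d * exp (- (14/5 * a)) * P i" if i: "i \<in> ?M \<times> UNIV" for i
  proof (cases i)
    case (Pair m k)
    let ?m = "real_of_int m" and ?k = "real_of_int k"
    have m: "\<bar>m\<bar> \<ge> 2" using i Pair by auto
    hence m4: "?m\<^sup>2 \<ge> 4" using power_mono[of 2 "\<bar>?m\<bar>" 2] by simp
    define X where "X = dual_sum y s i"
    have X: "X = a * ?m\<^sup>2 + pi * y / s * ?k\<^sup>2"
      using s0 by (simp add: X_def Pair dual_sum_def a_def field_simps)
    have X0: "X \<ge> 0" unfolding X using a y0 s0 by (intro add_nonneg_nonneg mult_nonneg_nonneg) auto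
    \<comment> \<open>The two summands of \<open>X\<close> multiply to
      \<open>(pi * y)\<^sup>2 * m\<^sup>2 * k\<^sup>2\<close>, which bounds the weight from the
      phase by a multiple of \<open>X\<^sup>2\<close>.\<close>
    have "(a * ?m\<^sup>2) * (pi * y / s * ?k\<^sup>2) \<le> X * X"
      unfolding X using a y0 s0 by (intro mult_mono) auto
    moreover have "(a * ?m\<^sup>2) * (pi * y / s * ?k\<^sup>2) = (pi * y)\<^sup>2 * (?m\<^sup>2 * ?k\<^sup>2)"
      using s0 by (simp add: a_def power2_eq_square)
    moreover have "739/100 * (?m\<^sup>2 * ?k\<^sup>2) \<le> (pi * y)\<^sup>2 * (?m\<^sup>2 * ?k\<^sup>2)"
      using power_mono[OF pi_sqrt3_bound[OF y], of 2] by (intro mult_right_mono) (auto simp: power_divide)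
    ultimately have mk: "?m\<^sup>2 * ?k\<^sup>2 \<le> X\<^sup>2 / (739/100)" by (simp add: power2_eq_square)
    have x3: "X ^ 3 \<le> 384 * exp (X / 4)"
    proof -
      have "(X/4) ^ 3 / 6 \<le> exp (X/4)"
        using exp_ge_taylor6[of "X/4"] X0 zero_le_power[of "X/4" 2] zero_le_power[of "X/4" 4] zero_le_power[of "X/4" 5] zero_le_power[of "X/4" 6]
        by linarith
      thus ?thesis by (simp add: power_divide)
    qed
    have dd: "\<bar>dual_diff y s i\<bar> \<le> X" unfolding X_def using y0 s0 by (intro dual_diff_le) auto
    have "\<bar>T i\<bar> \<le> (?m\<^sup>2 * ?k\<^sup>2 * d) * X * exp (-X)"
      unfolding T_def abs_mult abs_exp_cancel X_def[symmetric]
      using cosmk_half_diff[of x m k] dd d0 unfolding Pair d_def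
      by (intro mult_mono) auto
    also have "\<dots> \<le> (X\<^sup>2 / (739/100) * d) * X * exp (-X)"
      using mk d0 X0 by (intro mult_right_mono) auto
    also have "\<dots> = (100/739 * d) * (X ^ 3 * exp (-X))" by (simp add: power2_eq_square power3_eq_cube)
    also have "\<dots> \<le> (100/739 * d) * ((384 * exp (X/4)) * exp (-X))"
      using x3 d0 by (intro mult_left_mono mult_right_mono) auto
    also have "\<dots> = (38400/739 * d) * exp (- (3/4 * X))" by (simp flip: exp_add)
    also have "\<dots> \<le> (52 * d) * (exp (- (14/5 * a)) * P i)"
    proof (intro mult_mono)
      have "14/5 * a + c1 * ?m\<^sup>2 \<le> 3/4 * a * ?m\<^sup>2"
      proof -
        have "3/4 * a * ?m\<^sup>2 = c1 * ?m\<^sup>2 + 7/10 * (a * ?m\<^sup>2)" by (simp add: c1_def)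
        moreover have "a * 4 \<le> a * ?m\<^sup>2" using m4 a by (intro mult_left_mono) auto
        ultimately show ?thesis by linarith
      qed
      hence "14/5 * a + c1 * ?m\<^sup>2 + c2 * ?k\<^sup>2 \<le> 3/4 * X" by (simp add: X c2_def)
      thus "exp (- (3/4 * X)) \<le> exp (- (14/5 * a)) * P i"
        unfolding P_def Pair by (simp flip: exp_add)
    qed (use d0 in auto)
    finally show ?thesis by (simp add: mult.assoc)
  qed
  have Ts: "T summable_on (?M \<times> UNIV)" using Usum_half_diff_dual(2)[OF y0, of s x ?M] s0 unfolding T_def by simp
  have "norm (infsum T (?M \<times> UNIV)) \<le> infsum (\<lambda>i. 52 * d * exp (- (14/5 * a)) * P i) (?M \<times> UNIV)"
  proof (rule norm_infsum_le)
    show "((\<lambda>i. 52 * d * exp (- (14/5 * a)) * P i) has_sum infsum (\<lambda>i. 52 * d * exp (- (14/5 * a)) * P i) (?M \<times> UNIV)) (?M \<times> UNIV)"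
      by (rule has_sum_infsum[OF summable_on_cmult_right[OF Ps]])
    show "(T has_sum infsum T (?M \<times> UNIV)) (?M \<times> UNIV)" using Ts by (rule has_sum_infsum)
  qed (use Tb in auto)
  also have "\<dots> \<le> infsum (\<lambda>i. 52 * d * exp (- (14/5 * a)) * P i) UNIV"
  proof (rule infsum_mono2)
    show "(\<lambda>i. 52 * d * exp (- (14/5 * a)) * P i) summable_on UNIV"
      "(\<lambda>i. 52 * d * exp (- (14/5 * a)) * P i) summable_on (?M \<times> UNIV)"
      by (rule summable_on_cmult_right[OF Ps])+
  qed (use d0 in \<open>auto simp: P_def\<close>)
  also have "\<dots> = 52 * d * exp (- (14/5 * a)) * (S1 * S2)"
    using Phs by (simp add: infsum_cmult_right' infsumI)
  also have "\<dots> \<le> 52 * d * exp (- (14/5 * a)) * (7 * (2/5 * b))"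
  proof (intro mult_left_mono mult_mono)
    have "exp (- c1) \<le> exp (-(294/1000))" using a by (simp add: c1_def)
    also have "\<dots> \<le> 747/1000" by (rule exp_minus_le_taylor16) (simp_all add: power_divide)
    finally show "S1 \<le> 7" unfolding S1_def
      using infsum_gauss_le_geometric[OF c(1), of "747/1000"] by simp
    have "S2 \<le> 1 + 2 / c2" unfolding S2_def by (rule infsum_gauss_le[OF c(2)])
    also have "2 / c2 = 8/3 * (b / pi\<^sup>2)" using y0 s0 by (simp add: c2_def b_def power2_eq_square field_simps)
    also have "b / pi\<^sup>2 \<le> b / (98/10)"
      using b mult_mono[of "314/100" pi "314/100" pi] pi_approx by (intro divide_left_mono) (auto simp: power2_eq_square)
    finally show "S2 \<le> 2/5 * b" using b by simp
    show "0 \<le> S2" unfolding S2_def by (rule infsum_nonneg) auto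
  qed (use d0 in auto)
  also have "\<dots> \<le> 146 * d * b * exp (- (14/5 * a))"
  proof -
    have "728/5 * (d * b * exp (- (14/5 * a))) \<le> 146 * (d * b * exp (- (14/5 * a)))"
      using d0 b by (intro mult_right_mono) auto
    thus ?thesis by (simp add: mult_ac)
  qed
  finally have "\<bar>infsum T (?M \<times> UNIV)\<bar> \<le> 146 * d * b * exp (- (14/5 * a))" by simp
  thus ?thesis
    using Usum_half_diff_dual(1)[OF y0, of s ?M x] s0 y0 unfolding T_def
    by (simp add: abs_mult)
qed

text \<open>The reflection \<open>n \<mapsto> - n - 1\<close> shows that the shifts by
  \<open>e\<close> and \<open>- e\<close> have the same row sum. Twice the difference is therefore a
  sum of second differences at half-integers: \<open>n = 0\<close> and \<open>n = -1\<close> supply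
  the gain, the others are nonnegative by convexity.\<close>

lemma Usum_less_half_inner_row:
  fixes x y s :: real
  assumes y: "y > 0" and s: "s > 0" and x: "0 \<le> x" "x \<le> 1/2"
  defines "a \<equiv> pi * y * s" and "b \<equiv> pi * s / y"
  assumes b: "b \<ge> 785/100" and a: "a \<ge> 3/4 * b"
  shows "(b * (1/2 - x))\<^sup>2 / 10 * exp (- (a + b/4)) \<le> Usum ({1} \<times> UNIV) (1/2) y s - Usum ({1} \<times> UNIV) x y s"
proof -
  define e where "e = 1/2 - x"
  have e: "0 \<le> e" "e \<le> 1/2" using x by (auto simp: e_def)
  define H where "H = row_profile a b"
  have lf: "(1/2 - lat_form z y s (1, n)) * exp (- lat_form z y s (1, n)) = - H (real_of_int n + z)" for n z
  proof -
    have "lat_form z y s (1, n) = a + b * (real_of_int n + z)\<^sup>2"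
      using y by (simp add: lat_form_def a_def b_def field_simps power2_eq_square)
    thus ?thesis by (simp add: H_def row_profile_def algebra_simps)
  qed
  have Us: "((\<lambda>n. H (real_of_int n + z)) has_sum - Usum ({1} \<times> UNIV) z y s) UNIV" for z
  proof -
    have "((\<lambda>i. (1/2 - lat_form z y s i) * exp (- lat_form z y s i)) has_sum Usum ({1} \<times> UNIV) z y s) ({1} \<times> UNIV)"
      unfolding Usum_def by (intro has_sum_infsum lat_summable_basic y s)
    hence "((\<lambda>n. (1/2 - lat_form z y s (1, n)) * exp (- lat_form z y s (1, n))) has_sum Usum ({1} \<times> UNIV) z y s) UNIV"
      by (subst (asm) has_sum_reindex_bij_witness[of _ "\<lambda>n. (1, n)" snd]) auto
    hence "((\<lambda>n. - H (real_of_int n + z)) has_sum Usum ({1} \<times> UNIV) z y s) UNIV" by (simp only: lf)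
    from has_sum_uminusI[OF this] show ?thesis by simp
  qed
  define U0 U1 where "U0 = Usum ({1} \<times> UNIV) (1/2) y s" and "U1 = Usum ({1} \<times> UNIV) x y s"
  have h0: "((\<lambda>n. H (real_of_int n + 1/2)) has_sum - U0) UNIV" using Us[of "1/2"] by (simp add: U0_def)
  have h1: "((\<lambda>n. H (real_of_int n + 1/2 - e)) has_sum - U1) UNIV" using Us[of x] by (simp add: U1_def e_def algebra_simps)
  have h2: "((\<lambda>n. H (real_of_int n + 1/2 + e)) has_sum - U1) UNIV"
  proof -
    have "((\<lambda>n. H (real_of_int (-n - 1) + 1/2 - e)) has_sum - U1) UNIV"
      using h1 by (subst (asm) has_sum_reindex_bij_witness[of _ "\<lambda>n. -n - 1" "\<lambda>n. -n - 1"]) (auto simp: algebra_simps)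
    moreover have "H (real_of_int (-n - 1) + 1/2 - e) = H (real_of_int n + 1/2 + e)" for n
    proof -
      have "real_of_int (-n - 1) + 1/2 - e = - (real_of_int n + 1/2 + e)" by simp
      thus ?thesis unfolding H_def by (simp only: row_profile_minus)
    qed
    ultimately show ?thesis by simp
  qed
  define K where "K = (b * e)\<^sup>2 / 10 * exp (- (a + b/4))"
  have Kb: "K \<le> H (1/2 - e) + H (1/2 + e) - 2 * H (1/2)"
    unfolding K_def H_def by (rule row_profile_main[OF b a e])
  have s1: "((\<lambda>n. H (real_of_int n + 1/2 - e) + H (real_of_int n + 1/2 + e) - 2 * H (real_of_int n + 1/2)) has_sum (- U1 + - U1 - 2 * (- U0))) UNIV"
    by (intro has_sum_diff has_sum_add has_sum_cmult_right h0 h1 h2)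
  have s2: "((\<lambda>n. if n \<in> {0, -1::int} then K else 0) has_sum (2 * K)) UNIV"
    by (rule has_sum_finite_neutralI[of "{0, -1}"]) auto
  have "2 * K \<le> - U1 + - U1 - 2 * (- U0)"
  proof (rule has_sum_mono[OF s2 s1])
    fix n :: int
    consider "n = 0" | "n = -1" | "\<bar>real_of_int n + 1/2\<bar> \<ge> 3/2" by (cases "n \<ge> 0"; force)
    thus "(if n \<in> {0, -1} then K else 0) \<le> H (real_of_int n + 1/2 - e) + H (real_of_int n + 1/2 + e) - 2 * H (real_of_int n + 1/2)"
    proof cases
      case 1 thus ?thesis using Kb by simp
    next
      case 2
      have "H (-1 + 1/2 - e) = H (1/2 + e)" "H (-1 + 1/2 + e) = H (1/2 - e)" "H (-1 + 1/2) = H (1/2)"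
      proof -
        have "-1 + 1/2 - e = - (1/2 + e)" "-1 + 1/2 + e = - (1/2 - e)" "-1 + 1/2 = - (1/2 :: real)" by simp_all
        thus "H (-1 + 1/2 - e) = H (1/2 + e)" "H (-1 + 1/2 + e) = H (1/2 - e)" "H (-1 + 1/2) = H (1/2)"
          unfolding H_def by (simp_all only: row_profile_minus)
      qed
      thus ?thesis using Kb 2 by simp
    next
      case 3
      have "n \<noteq> 0" "n \<noteq> -1" using 3 by auto
      thus ?thesis using row_profile_pair_ge[OF b a e 3] by (simp add: H_def)
    qed
  qed
  hence "K \<le> U0 - U1" by simp
  thus ?thesis unfolding U0_def[symmetric] U1_def[symmetric] K_def e_def .
qed

text \<open>The row \<open>m = 0\<close> does not depend on \<open>x\<close> and the rows
  \<open>\<plusminus>1\<close> agree, so a gain of order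
  \<open>(b * e)\<^sup>2 * exp (- (a + b/4))\<close> competes with outer rows of order
  \<open>b * e\<^sup>2 * exp (- (14/5 * a))\<close>.\<close>

lemma Usum_less_half_spatial:
  fixes x y s :: real
  assumes y: "y \<ge> sqrt 3 / 2" and ys: "y \<le> 2/5 * s" and x: "0 \<le> x" "x < 1/2"
  shows "Usum UNIV x y s < Usum UNIV (1/2) y s"
proof -
  define a b d e where "a = pi * y * s" and "b = pi * s / y" and "d = 1 + cos (2 * pi * x)" and "e = 1/2 - x"
  have y0: "y > 0" using y by (metis half_gt_zero less_le_trans real_sqrt_gt_zero zero_less_numeral)
  have s0: "s > 0" using ys y0 by linarith
  have e: "e > 0" using x by (simp add: e_def)
  have b: "b \<ge> 785/100"
  proof -
    have "s / y \<ge> 5/2" using ys y0 by (simp add: field_simps)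
    hence "314159/100000 * (5/2) \<le> pi * (s / y)" using pi_approx by (intro mult_mono) auto
    moreover have "b = pi * (s / y)" by (simp add: b_def)
    ultimately show ?thesis by linarith
  qed
  have y2: "y\<^sup>2 \<ge> 3/4" using power_mono[OF y, of 2] by (simp add: power_divide)
  have "a = b * y\<^sup>2" using y0 by (simp add: a_def b_def power2_eq_square)
  hence a: "a \<ge> 3/4 * b" using y2 b mult_left_mono[of "3/4" "y\<^sup>2" b] by simp
  define D where "D = (\<lambda>A. Usum A (1/2) y s - Usum A x y s)"
  have Uu: "D (A \<union> B) = D A + D B" if "A \<inter> B = {}" for A B
    unfolding D_def Usum_def using that by (simp add: infsum_Un_disjoint lat_summable_basic[OF y0 s0])
  have "UNIV = ({0} \<times> UNIV) \<union> (({1} \<times> UNIV) \<union> (({-1} \<times> UNIV) \<union> ({m. \<bar>m\<bar> \<ge> 2} \<times> UNIV)) :: (int \<times> int) set)"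
  proof (intro equalityI subsetI)
    fix i :: "int \<times> int"
    have "fst i = 0 \<or> fst i = 1 \<or> fst i = -1 \<or> \<bar>fst i\<bar> \<ge> 2" by arith
    thus "i \<in> ({0} \<times> UNIV) \<union> (({1} \<times> UNIV) \<union> (({-1} \<times> UNIV) \<union> ({m. \<bar>m\<bar> \<ge> 2} \<times> UNIV)))"
      by (cases i) auto
  qed auto
  hence split: "D UNIV = D ({0} \<times> UNIV) + (D ({1} \<times> UNIV) + (D ({-1} \<times> UNIV) + D ({m. \<bar>m\<bar> \<ge> 2} \<times> UNIV)))"
    by (subst Uu[symmetric], force)+ simp
  have D0: "D ({0} \<times> UNIV) = 0"
    unfolding D_def Usum_def by (auto intro!: infsum_cong simp: lat_form_def)
  have Dm: "D ({-1} \<times> UNIV) = D ({1} \<times> UNIV)"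
  proof -
    have "Usum ({-1} \<times> UNIV) z y s = Usum ({1} \<times> UNIV) z y s" for z
      unfolding Usum_def
      by (rule infsum_reindex_bij_witness[of _ "\<lambda>(m, n). (-m, -n)" "\<lambda>(m, n). (-m, -n)"])
         (auto simp: lat_form_def power2_eq_square algebra_simps)
    thus ?thesis by (simp add: D_def)
  qed
  have D1: "(b * e)\<^sup>2 / 10 * exp (- (a + b/4)) \<le> D ({1} \<times> UNIV)"
    unfolding D_def e_def a_def b_def
    by (rule Usum_less_half_inner_row) (use y0 s0 x b a in \<open>auto simp: a_def b_def\<close>)
  define R where "R = D ({m. \<bar>m\<bar> \<ge> 2} \<times> UNIV)"
  have "\<bar>sqrt s * R\<bar> \<le> sqrt y * (146 * d * b * exp (- (14/5 * a)))"
    using Usum_less_half_outer_rows[OF y ys, of x] unfolding R_def D_def d_def b_def a_def .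
  also have "\<dots> \<le> sqrt s * (146 * d * b * exp (- (14/5 * a)))"
  proof (rule mult_right_mono)
    have "d \<ge> 0" using cos_ge_minus_one[of "2 * pi * x"] unfolding d_def by linarith
    thus "0 \<le> 146 * d * b * exp (- (14/5 * a))" using b by simp
    show "sqrt y \<le> sqrt s" using ys y0 by simp
  qed
  finally have R: "\<bar>R\<bar> \<le> 146 * d * b * exp (- (14/5 * a))" using s0 by (simp add: abs_mult)
  have d: "d \<le> 20 * e\<^sup>2"
  proof -
    have "cos (2 * pi * x) = - cos (2 * pi * e)"
      by (simp add: e_def algebra_simps cos_diff)
    hence "d = 2 * (sin (pi * e))\<^sup>2" using one_minus_cos_half[of "2 * pi * e"] by (simp add: d_def)
    moreover have "\<bar>sin (pi * e)\<bar> \<le> pi * e" using abs_sin_x_le_abs_x[of "pi * e"] e by simp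
    hence "(sin (pi * e))\<^sup>2 \<le> (pi * e)\<^sup>2" using power_mono[of "\<bar>sin (pi * e)\<bar>" "pi * e" 2] by simp
    moreover have "pi\<^sup>2 \<le> 10" using mult_mono[of pi "31416/10000" pi "31416/10000"] pi_approx by (simp add: power2_eq_square)
    hence "(pi * e)\<^sup>2 \<le> 10 * e\<^sup>2" by (simp add: power_mult_distrib mult_right_mono)
    ultimately show ?thesis by linarith
  qed
  have "146 * d * b * exp (- (14/5 * a)) \<le> 146 * (20 * e\<^sup>2) * b * exp (- (14/5 * a))"
    by (intro mult_right_mono mult_left_mono d) (use b in auto)
  with R have "\<bar>R\<bar> \<le> 146 * (20 * e\<^sup>2) * b * exp (- (14/5 * a))" by linarith
  also have "exp (- (14/5 * a)) \<le> exp (- (a + b/4)) * (1/5000)"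
  proof -
    \<comment> \<open>By \<open>a \<ge> 3/4 * b\<close> the gap between the exponents is at least
      \<open>11/10 * b\<close>, and \<open>b \<ge> 785/100\<close>.\<close>
    have "a + b/4 + 86/10 \<le> 14/5 * a" using a b by simp
    hence "exp (- (14/5 * a)) \<le> exp (- (a + b/4) + - (86/10))" by simp
    also have "\<dots> = exp (- (a + b/4)) * exp (- (86/10))" by (rule exp_add)
    also have "exp (- (86/10) :: real) \<le> 1/5000" by (rule exp_minus_le_taylor16) (simp_all add: power_divide)
    finally show ?thesis by simp
  qed
  hence "146 * (20 * e\<^sup>2) * b * exp (- (14/5 * a)) \<le> 146 * (20 * e\<^sup>2) * b * (exp (- (a + b/4)) * (1/5000))"
    using b by (intro mult_left_mono) auto
  also have "\<dots> = (e\<^sup>2 * b * exp (- (a + b/4))) * (2920/5000)" by simp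
  also have "\<dots> < (e\<^sup>2 * b * exp (- (a + b/4))) * (b / 5)"
    using e b by (intro mult_strict_left_mono) auto
  also have "\<dots> = 2 * ((b * e)\<^sup>2 / 10 * exp (- (a + b/4)))" by (simp add: power2_eq_square)
  finally have "\<bar>R\<bar> < 2 * ((b * e)\<^sup>2 / 10 * exp (- (a + b/4)))" .
  hence "D UNIV > 0" using D1 unfolding split D0 Dm R_def[symmetric] by linarith
  thus ?thesis by (simp add: D_def)
qed

theorem Usum_less_half:
  fixes x y s :: real
  assumes y: "y \<ge> sqrt 3 / 2" and s: "s > 1" and x: "0 \<le> x" "x < 1/2"
  shows "Usum UNIV x y s < Usum UNIV (1/2) y s"
proof -
  have "cos (2 * pi * x) > cos pi"
    using x by (intro cos_monotone_0_pi) auto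
  hence c: "1 + cos (2 * pi * x) > 0" by simp
  show ?thesis
    using Usum_less_half_dual_small[OF y s _ c] Usum_less_half_dual_large[OF y _ _ c] Usum_less_half_spatial[OF y _ x]
    by (meson linear)
qed

section \<open>The hexagonal form and its deformations\<close>

definition hexN :: "int \<times> int \<Rightarrow> real" where
  "hexN = (\<lambda>(m, n). (real_of_int m)\<^sup>2 + real_of_int m * real_of_int n + (real_of_int n)\<^sup>2)"

text \<open>The exponent on the line of real part 1/2 at height \<open>sqrt 3 / 2 * u\<close>, with
  \<open>\<omega> = 2 * pi * s / sqrt 3\<close>; diagonal in \<open>m\<close> and
  \<open>2 * n + m\<close>.\<close>

definition hex_form :: "real \<Rightarrow> real \<Rightarrow> int \<times> int \<Rightarrow> real" where
  "hex_form \<omega> u = (\<lambda>(m, n). \<omega> * (3 * (real_of_int m)\<^sup>2 * u + (2 * real_of_int n + real_of_int m)\<^sup>2 / u) / 4)"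

text \<open>As functions of the exponent, \<open>gfun\<close> is the summand of \<open>Vsum\<close>
  and \<open>hfun\<close> is minus the summand of \<open>Usum\<close>.\<close>

definition gfun :: "real \<Rightarrow> real" where "gfun w = (w\<^sup>2 - 2 * w + 1/4) * exp (-w)"
definition hfun :: "real \<Rightarrow> real" where "hfun w = (w - 1/2) * exp (-w)"

lemma lat_form_half:
  assumes "u > 0"
  shows "lat_form (1/2) (sqrt 3 / 2 * u) s = hex_form (2 * pi * s / sqrt 3) u"
proof
  fix i :: "int \<times> int"
  obtain m n where i: "i = (m, n)" by (cases i)
  have s3: "sqrt 3 * sqrt 3 = (3::real)" by simp
  have "lat_form (1/2) (sqrt 3 / 2 * u) s i = pi * s * ((real_of_int m / 2 + n)\<^sup>2 + (real_of_int m)\<^sup>2 * ((sqrt 3 * sqrt 3) / 4 * u\<^sup>2)) / (sqrt 3 / 2 * u)"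
    by (simp add: lat_form_def i power2_eq_square)
  also have "\<dots> = hex_form (2 * pi * s / sqrt 3) u i"
    unfolding s3 using assms by (simp add: hex_form_def i power2_eq_square field_simps)
  finally show "lat_form (1/2) (sqrt 3 / 2 * u) s i = hex_form (2 * pi * s / sqrt 3) u i" .
qed

lemma hex_form_1: "hex_form \<omega> 1 i = \<omega> * hexN i"
  by (auto simp: hex_form_def hexN_def power2_eq_square algebra_simps split: prod.splits)

lemma hexN_ge_half: "hexN i \<ge> sqn i / 2"
proof (cases i)
  case (Pair m n)
  have "(real_of_int m + real_of_int n)\<^sup>2 \<ge> 0" by simp
  thus ?thesis by (simp add: Pair hexN_def power2_eq_square algebra_simps)
qed

lemma hexN_ge_fst: "hexN (m, n) \<ge> 3/4 * (real_of_int m)\<^sup>2"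
proof -
  have "(real_of_int m / 2 + real_of_int n)\<^sup>2 \<ge> 0" by simp
  thus ?thesis by (simp add: hexN_def power2_eq_square algebra_simps)
qed

text \<open>Invariance of the hexagonal form under its rotation group kills the terms of first order in the deformation.\<close>

lemma hex_linear_term:
  fixes \<psi> :: "real \<Rightarrow> real"
  assumes S: "((\<lambda>i. \<psi> (hexN i) * (real_of_int (fst i))\<^sup>2) has_sum S) UNIV" and u: "u > 0"
  shows "((\<lambda>i. \<psi> (hexN i) * hexN i) has_sum (3/2 * S)) UNIV"
    and "((\<lambda>i. \<psi> (hexN i) * (hex_form \<omega> u i - \<omega> * hexN i)) has_sum (3/4 * \<omega> * S * ((u - 1)\<^sup>2 / u))) UNIV"
proof -
  \<comment> \<open>The swap and the map \<open>(m, n) \<mapsto> (m + n, - n)\<close> preserve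
    \<open>hexN\<close> and carry \<open>m\<^sup>2\<close> to \<open>n\<^sup>2\<close> and
    \<open>(m + n)\<^sup>2\<close>, so all three weights have the same sum.\<close>
  have S2: "((\<lambda>i. \<psi> (hexN i) * (real_of_int (snd i))\<^sup>2) has_sum S) UNIV"
    using S
    by (subst (asm) has_sum_reindex_bij_witness[of UNIV "\<lambda>(m, n). (n, m)" "\<lambda>(m, n). (n, m)" UNIV
          "\<lambda>i. \<psi> (hexN i) * (real_of_int (snd i))\<^sup>2" "\<lambda>i. \<psi> (hexN i) * (real_of_int (fst i))\<^sup>2"])
       (auto simp: hexN_def algebra_simps)
  have S3: "((\<lambda>i. \<psi> (hexN i) * (real_of_int (fst i + snd i))\<^sup>2) has_sum S) UNIV"
    using S
    by (subst (asm) has_sum_reindex_bij_witness[of UNIV "\<lambda>(m, n). (m + n, - n)" "\<lambda>(m, n). (m + n, - n)" UNIV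
          "\<lambda>i. \<psi> (hexN i) * (real_of_int (fst i + snd i))\<^sup>2" "\<lambda>i. \<psi> (hexN i) * (real_of_int (fst i))\<^sup>2"])
       (auto simp: hexN_def algebra_simps power2_eq_square)
  let ?f1 = "\<lambda>i. \<psi> (hexN i) * (real_of_int (fst i))\<^sup>2" and ?f2 = "\<lambda>i. \<psi> (hexN i) * (real_of_int (snd i))\<^sup>2"
    and ?f3 = "\<lambda>i. \<psi> (hexN i) * (real_of_int (fst i + snd i))\<^sup>2"
  have "((\<lambda>i. 1/2 * (?f1 i + ?f2 i + ?f3 i)) has_sum (1/2 * (S + S + S))) UNIV"
    by (intro has_sum_cmult_right has_sum_add S S2 S3)
  moreover have "1/2 * (?f1 i + ?f2 i + ?f3 i) = \<psi> (hexN i) * hexN i" for i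
  proof -
    have "hexN i = 1/2 * ((real_of_int (fst i))\<^sup>2 + (real_of_int (snd i))\<^sup>2 + (real_of_int (fst i + snd i))\<^sup>2)"
      by (cases i) (simp add: hexN_def power2_eq_square algebra_simps)
    thus ?thesis by (simp add: algebra_simps)
  qed
  ultimately show N: "((\<lambda>i. \<psi> (hexN i) * hexN i) has_sum (3/2 * S)) UNIV" by simp
  \<comment> \<open>The deformed form sums to \<open>3/4 * \<omega> * (u + 1/u) * S\<close>; the
    first order in \<open>u - 1\<close> drops out because
    \<open>u + 1/u - 2 = (u - 1)\<^sup>2 / u\<close>.\<close>
  have "((\<lambda>i. \<omega> * (3/4 * u * ?f1 i + 1/(4*u) * (2 * ?f3 i + 2 * ?f2 i - ?f1 i)) - \<omega> * (\<psi> (hexN i) * hexN i)) has_sum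
      (\<omega> * (3/4 * u * S + 1/(4*u) * (2 * S + 2 * S - S)) - \<omega> * (3/2 * S))) UNIV"
    by (intro has_sum_diff has_sum_cmult_right has_sum_add S S2 S3 N)
  moreover have "\<omega> * (3/4 * u * ?f1 i + 1/(4*u) * (2 * ?f3 i + 2 * ?f2 i - ?f1 i)) - \<omega> * (\<psi> (hexN i) * hexN i)
     = \<psi> (hexN i) * (hex_form \<omega> u i - \<omega> * hexN i)" for i
  proof -
    obtain m n where i: "i = (m, n)" by (cases i)
    have "hex_form \<omega> u i = \<omega> * (3/4 * u * (real_of_int m)\<^sup>2 + 1/(4*u) * (2 * (real_of_int (m + n))\<^sup>2 + 2 * (real_of_int n)\<^sup>2 - (real_of_int m)\<^sup>2))"
    proof -
      have e: "(2 * real_of_int n + real_of_int m)\<^sup>2 = 2 * (real_of_int (m + n))\<^sup>2 + 2 * (real_of_int n)\<^sup>2 - (real_of_int m)\<^sup>2"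
        by (simp add: power2_eq_square algebra_simps)
      have "\<omega> * (3 * A * u + B / u) / 4 = \<omega> * (3/4 * u * A + 1/(4*u) * B)" for A B
        using u by (simp add: field_simps)
      thus ?thesis unfolding hex_form_def i prod.case e .
    qed
    moreover have "\<omega> * (a * (p * A) + b * (2 * (p * B) + 2 * (p * C) - p * A)) - \<omega> * (p * N) = p * (\<omega> * (a * A + b * (2 * B + 2 * C - A)) - \<omega> * N)"
      for a b p A B C N by algebra
    ultimately show ?thesis by (simp only: i fst_conv snd_conv)
  qed
  moreover have "\<omega> * (3/4 * u * S + 1/(4*u) * (2 * S + 2 * S - S)) - \<omega> * (3/2 * S) = 3/4 * \<omega> * S * ((u - 1)\<^sup>2 / u)"
    using u by (simp add: power2_eq_square field_simps)
  ultimately show "((\<lambda>i. \<psi> (hexN i) * (hex_form \<omega> u i - \<omega> * hexN i)) has_sum (3/4 * \<omega> * S * ((u - 1)\<^sup>2 / u))) UNIV" by simp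
qed

section \<open>Taylor bounds for the profile of the second derivative\<close>

lemma nonneg_by_second_derivative:
  fixes f f' f'' :: "real \<Rightarrow> real"
  assumes d1: "\<And>x. min w q \<le> x \<Longrightarrow> x \<le> max w q \<Longrightarrow> (f has_real_derivative f' x) (at x)"
    and d2: "\<And>x. min w q \<le> x \<Longrightarrow> x \<le> max w q \<Longrightarrow> (f' has_real_derivative f'' x) (at x)"
    and p: "\<And>x. min w q \<le> x \<Longrightarrow> x \<le> max w q \<Longrightarrow> f'' x \<ge> 0"
    and z: "f w = 0" "f' w = 0"
  shows "f q \<ge> 0"
proof (cases "w \<le> q")
  case True
  have fx: "f' w \<le> f' x" if x: "w \<le> x" "x \<le> q" for x
  proof (rule DERIV_nonneg_imp_nondecreasing[OF x(1)])
    fix v assume "w \<le> v" "v \<le> x"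
    hence "min w q \<le> v" "v \<le> max w q" using x by auto
    thus "\<exists>d. (f' has_real_derivative d) (at v) \<and> 0 \<le> d" using d2 p by blast
  qed
  have "f w \<le> f q"
  proof (rule DERIV_nonneg_imp_nondecreasing[OF True])
    fix v assume v: "w \<le> v" "v \<le> q"
    hence "min w q \<le> v" "v \<le> max w q" by auto
    thus "\<exists>d. (f has_real_derivative d) (at v) \<and> 0 \<le> d" using d1 fx[OF v] z by auto
  qed
  thus ?thesis using z by simp
next
  case False
  hence qw: "q \<le> w" by simp
  have fx: "f' x \<le> f' w" if x: "q \<le> x" "x \<le> w" for x
  proof (rule DERIV_nonneg_imp_nondecreasing[OF x(2)])
    fix v assume "x \<le> v" "v \<le> w"
    hence "min w q \<le> v" "v \<le> max w q" using x by auto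
    thus "\<exists>d. (f' has_real_derivative d) (at v) \<and> 0 \<le> d" using d2 p by blast
  qed
  have "f w \<le> f q"
  proof (rule DERIV_nonpos_imp_nonincreasing[OF qw])
    fix v assume v: "q \<le> v" "v \<le> w"
    hence "min w q \<le> v" "v \<le> max w q" by auto
    thus "\<exists>d. (f has_real_derivative d) (at v) \<and> d \<le> 0" using d1 fx[OF v] z by auto
  qed
  thus ?thesis using z by simp
qed

definition gfun' :: "real \<Rightarrow> real" where "gfun' w = - (w\<^sup>2 - 4 * w + 9/4) * exp (-w)"

lemma gfun_deriv: "(gfun has_real_derivative gfun' w) (at w)"
  unfolding gfun_def gfun'_def by (auto intro!: derivative_eq_intros simp: algebra_simps power2_eq_square)

lemma gfun'_deriv: "(gfun' has_real_derivative (w\<^sup>2 - 6 * w + 25/4) * exp (-w)) (at w)"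
  unfolding gfun'_def by (auto intro!: derivative_eq_intros simp: algebra_simps power2_eq_square)

lemma sq_shift_exp_decreasing:
  fixes x y :: real
  assumes "5 \<le> x" "x \<le> y"
  shows "(y - 3)\<^sup>2 * exp (-y) \<le> (x - 3)\<^sup>2 * exp (-x)"
proof (rule DERIV_nonpos_imp_nonincreasing[OF assms(2)])
  fix z assume "x \<le> z" "z \<le> y"
  hence z: "z \<ge> 5" using assms by simp
  have "((\<lambda>z. (z - 3)\<^sup>2 * exp (-z)) has_real_derivative ((z - 3) * (5 - z) * exp (-z))) (at z)"
    by (auto intro!: derivative_eq_intros simp: algebra_simps power2_eq_square)
  moreover have "(z - 3) * (5 - z) * exp (-z) \<le> 0"
    using z by (intro mult_nonpos_nonneg mult_nonneg_nonpos) auto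
  ultimately show "\<exists>d. ((\<lambda>z. (z - 3)\<^sup>2 * exp (-z)) has_real_derivative d) (at z) \<and> d \<le> 0" by blast
qed

text \<open>The second derivative of \<open>gfun\<close> is at most
  \<open>(x - 3)\<^sup>2 * exp (-x)\<close>, which decreases from 5 on; its value at a common lower
  bound \<open>\<mu>\<close> of both points therefore controls the remainder.\<close>

lemma gfun_taylor:
  assumes "5 \<le> \<mu>" "\<mu> \<le> w" "\<mu> \<le> q"
  shows "gfun q \<le> gfun w + gfun' w * (q - w) + (q - w)\<^sup>2 / 2 * ((\<mu> - 3)\<^sup>2 * exp (-\<mu>))"
proof -
  define B where "B = (\<mu> - 3)\<^sup>2 * exp (-\<mu>)"
  define f f1 f2 where "f = (\<lambda>x. gfun w + gfun' w * (x - w) + (x - w)\<^sup>2 / 2 * B - gfun x)"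
    and "f1 = (\<lambda>x. gfun' w + (x - w) * B - gfun' x)"
    and "f2 = (\<lambda>x. B - (x\<^sup>2 - 6 * x + 25/4) * exp (-x))"
  have "0 \<le> f q"
  proof (rule nonneg_by_second_derivative[of w q f f1 f2])
    fix x assume x: "min w q \<le> x" "x \<le> max w q"
    hence x5: "\<mu> \<le> x" using assms by auto
    show "(f has_real_derivative f1 x) (at x)"
      unfolding f_def f1_def by (auto intro!: derivative_eq_intros gfun_deriv)
    show "(f1 has_real_derivative f2 x) (at x)"
      unfolding f1_def f2_def by (auto intro!: derivative_eq_intros gfun'_deriv)
    have "(x\<^sup>2 - 6 * x + 25/4) * exp (-x) \<le> (x - 3)\<^sup>2 * exp (-x)"
      by (intro mult_right_mono) (auto simp: power2_eq_square algebra_simps)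
    also have "\<dots> \<le> B" unfolding B_def by (rule sq_shift_exp_decreasing) (use x5 assms in auto)
    finally show "0 \<le> f2 x" by (simp add: f2_def)
  qed (auto simp: f_def f1_def)
  thus ?thesis by (simp add: B_def f_def)
qed

text \<open>Reduces the remainder estimates to the smallest \<open>\<omega>\<close>. The condition
  on \<open>k\<close> is that the logarithmic derivative at \<open>\<omega>0\<close> is
  nonpositive.\<close>

lemma quartic_factor_decreasing:
  fixes \<omega> \<omega>0 a c k :: real
  assumes w: "0 < \<omega>0" "\<omega>0 \<le> \<omega>" and a: "a > 0" "c < a * \<omega>0" and k: "2 / \<omega>0 + 2 * a / (a * \<omega>0 - c) \<le> k"
  shows "\<omega>\<^sup>2 * (a * \<omega> - c)\<^sup>2 * exp (- k * \<omega>) \<le> \<omega>0\<^sup>2 * (a * \<omega>0 - c)\<^sup>2 * exp (- k * \<omega>0)"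
proof -
  define d where "d = \<omega> - \<omega>0"
  have d: "d \<ge> 0" using w by (simp add: d_def)
  have p: "a * \<omega>0 - c > 0" using a by simp
  have 1: "\<omega> \<le> \<omega>0 * exp (d / \<omega>0)"
  proof -
    have "\<omega> = \<omega>0 * (1 + d / \<omega>0)" using w by (simp add: d_def field_simps)
    also have "\<dots> \<le> \<omega>0 * exp (d / \<omega>0)" using w exp_ge_add_one_self[of "d / \<omega>0"] by (intro mult_left_mono) auto
    finally show ?thesis .
  qed
  have 2: "a * \<omega> - c \<le> (a * \<omega>0 - c) * exp (a * d / (a * \<omega>0 - c))"
  proof -
    have "a * \<omega> - c = (a * \<omega>0 - c) * (1 + a * d / (a * \<omega>0 - c))" using p by (simp add: d_def field_simps)
    also have "\<dots> \<le> (a * \<omega>0 - c) * exp (a * d / (a * \<omega>0 - c))"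
      using p exp_ge_add_one_self[of "a * d / (a * \<omega>0 - c)"] by (intro mult_left_mono) auto
    finally show ?thesis .
  qed
  have 3: "a * \<omega> - c \<ge> 0" using p a(1) mult_left_mono[OF w(2), of a] by linarith
  have "\<omega>\<^sup>2 * (a * \<omega> - c)\<^sup>2 * exp (- k * \<omega>) \<le>
     (\<omega>0 * exp (d / \<omega>0))\<^sup>2 * ((a * \<omega>0 - c) * exp (a * d / (a * \<omega>0 - c)))\<^sup>2 * exp (- k * \<omega>)"
    using 1 2 3 w by (intro mult_right_mono mult_mono power_mono) auto
  also have "\<dots> = \<omega>0\<^sup>2 * (a * \<omega>0 - c)\<^sup>2 * exp (- k * \<omega>0) * exp (d * (2 / \<omega>0 + 2 * a / (a * \<omega>0 - c) - k))"
  proof -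
    have "(exp (d / \<omega>0))\<^sup>2 * (exp (a * d / (a * \<omega>0 - c)))\<^sup>2 * exp (- k * \<omega>)
       = exp (- k * \<omega>0) * exp (d * (2 / \<omega>0 + 2 * a / (a * \<omega>0 - c) - k))"
      unfolding power2_eq_square by (simp add: d_def algebra_simps add_divide_distrib flip: exp_add)
    thus ?thesis by (simp add: power_mult_distrib mult_ac)
  qed
  also have "\<dots> \<le> \<omega>0\<^sup>2 * (a * \<omega>0 - c)\<^sup>2 * exp (- k * \<omega>0) * 1"
  proof (intro mult_left_mono)
    have "d * (2 / \<omega>0 + 2 * a / (a * \<omega>0 - c) - k) \<le> 0" using d k by (intro mult_nonneg_nonpos) auto
    thus "exp (d * (2 / \<omega>0 + 2 * a / (a * \<omega>0 - c) - k)) \<le> 1" by simp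
  qed auto
  finally show ?thesis by simp
qed

text \<open>The bounds lie just inside the zeros \<open>3 - sqrt 11 / 2\<close> and
  \<open>3 + sqrt 11 / 2\<close> of the second derivative of \<open>gfun\<close>.\<close>

lemma gfun'_antimono:
  fixes w w' :: real
  assumes "135/100 \<le> w" "w \<le> w'" "w' \<le> 465/100"
  shows "gfun' w' \<le> gfun' w"
proof (rule DERIV_nonpos_imp_nonincreasing[OF assms(2)])
  fix z assume "w \<le> z" "z \<le> w'"
  hence z: "135/100 \<le> z" "z \<le> 465/100" using assms by auto
  have "(z - 135/100) * (465/100 - z) \<ge> 0" using z by simp
  moreover have "(z - 135/100) * (465/100 - z) = 6 * z - 62775/10000 - z\<^sup>2" by (simp add: power2_eq_square field_simps)
  ultimately have "z\<^sup>2 - 6 * z + 25/4 \<le> 0" by linarith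
  hence "(z\<^sup>2 - 6 * z + 25/4) * exp (-z) \<le> 0" by (intro mult_nonpos_nonneg) auto
  thus "\<exists>d. (gfun' has_real_derivative d) (at z) \<and> d \<le> 0" using gfun'_deriv by blast
qed

text \<open>The rounded intermediate value \<open>c\<close> keeps the sixteenth power that of a
  short fraction.\<close>

lemma exp_minus_le_power16:
  fixes x b c :: real
  assumes "0 \<le> x" "1 - x/16 + (x/16)\<^sup>2/2 - (x/16)^3/6 + (x/16)^4/24 \<le> c" "c ^ 16 \<le> b"
  shows "exp (-x) \<le> b"
proof -
  have "exp (-(x/16)) \<le> c" using exp_minus_taylor(1)[of "x/16"] assms by simp
  hence "exp (-(x/16)) ^ 16 \<le> c ^ 16" by (intro power_mono) auto
  moreover have "exp (-x) = exp (-(x/16)) ^ 16" by (simp flip: exp_of_nat_mult)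
  ultimately show ?thesis using assms by simp
qed

text \<open>\<open>gfun'\<close> rises again beyond about 466/100, but the exponents of four minimal
  vectors can come close to 487/100; there it is compared directly with its value at
  418/100.\<close>

lemma gfun'_max_at_left:
  fixes w q :: real
  assumes w: "135/100 \<le> w" "w \<le> 418/100" and q: "w \<le> q" "q \<le> 487/100"
  shows "gfun' q \<le> gfun' w"
proof (cases "q \<le> 465/100")
  case True
  thus ?thesis using gfun'_antimono w q by simp
next
  case False
  define t where "t = q - 465/100"
  have t: "0 \<le> t" "t \<le> 22/100" using False q by (auto simp: t_def)
  have e: "625/1000 - 1/10000 \<le> exp (-(47/100) :: real)"
    using exp_minus_taylor(2)[of "47/100"] by (simp add: power_divide)
  have "gfun' (418/100) \<ge> gfun' q"
  proof -
    have "(t::real) * t \<le> 22/100 * (22/100)" using t by (intro mult_mono) auto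
    hence p: "5015/1000 \<le> (52725/10000 + 53/10 * t) * (1 - t)"
    proof -
      have "(52725/10000 + 53/10 * t) * (1 - t) = 52725/10000 + 275/10000 * t - 53/10 * (t * t)" by (simp add: field_simps)
      thus ?thesis using t \<open>t * t \<le> _\<close> by linarith
    qed
    have "30024/10000 * exp (-(418/100 :: real)) \<le> 5015/1000 * (625/1000 - 1/10000) * exp (-(418/100))" by simp
    also have "\<dots> \<le> 5015/1000 * exp (-(47/100)) * exp (-(418/100))"
      using e by (intro mult_left_mono mult_right_mono) auto
    also have "\<dots> = 5015/1000 * exp (-(465/100))" by (simp flip: exp_add)
    also have "\<dots> \<le> ((52725/10000 + 53/10 * t) * (1 - t)) * exp (-(465/100))"
      using p by (intro mult_right_mono) auto
    also have "\<dots> \<le> ((52725/10000 + 53/10 * t) * exp (-t)) * exp (-(465/100))"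
      using t exp_ge_add_one_self[of "-t"] by (intro mult_right_mono mult_left_mono) auto
    also have "\<dots> = (52725/10000 + 53/10 * t) * exp (-q)" by (simp add: t_def flip: exp_add)
    also have "\<dots> \<le> (q\<^sup>2 - 4 * q + 9/4) * exp (-q)"
    proof (intro mult_right_mono)
      have "q\<^sup>2 - 4 * q + 9/4 = 52725/10000 + 53/10 * t + t\<^sup>2" by (simp add: t_def power2_eq_square field_simps)
      thus "52725/10000 + 53/10 * t \<le> q\<^sup>2 - 4 * q + 9/4" by simp
    qed auto
    finally have "30024/10000 * exp (-(418/100)) \<le> (q\<^sup>2 - 4 * q + 9/4) * exp (-q)" .
    moreover have "gfun' z = - ((z\<^sup>2 - 4 * z + 9/4) * exp (-z))" for z by (simp only: gfun'_def mult_minus_left)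
    ultimately show ?thesis by (simp add: power_divide)
  qed
  moreover have "gfun' (418/100) \<le> gfun' w" by (rule gfun'_antimono) (use w in auto)
  ultimately show ?thesis by simp
qed

text \<open>Two minimal vectors get the exponent \<open>\<omega> / u\<close> and four get
  \<open>\<omega> * (3 * u + 1 / u) / 4\<close>. In the derivative with respect to \<open>u\<close>,
  the second kind is bounded through \<open>gfun' \<omega>\<close> and the first by a linear
  function; then a factor \<open>v - 1\<close> splits off and its coefficient is estimated over the
  range.\<close>

lemma gfun_min_vecs_gap:
  fixes \<omega> u :: real
  assumes w: "362/100 \<le> \<omega>" "\<omega> \<le> 418/100" and u: "1 \<le> u" "u \<le> 12935/10000"
  shows "20 * (u - 1)\<^sup>2 * exp (-\<omega>) \<le> 6 * gfun \<omega> - 2 * gfun (\<omega> / u) - 4 * gfun (\<omega> * (3 * u + 1 / u) / 4)"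
proof -
  define f where "f = (\<lambda>u. 6 * gfun \<omega> - 2 * gfun (\<omega> / u) - 4 * gfun (\<omega> * (3 * u + 1 / u) / 4) - 20 * (u - 1)\<^sup>2 * exp (-\<omega>))"
  have "f 1 \<le> f u"
  proof (rule DERIV_nonneg_imp_nondecreasing[OF u(1)])
    fix v assume v: "1 \<le> v" "v \<le> u"
    hence v': "v \<le> 12935/10000" using u by simp
    define q where "q = \<omega> * (3 * v + 1 / v) / 4"
    define p r where "p = \<omega>\<^sup>2 - 4 * \<omega> + 9/4" and "r = - \<omega>\<^sup>2 + 6 * \<omega> - 25/4"
    have D: "(f has_real_derivative (2 * gfun' (\<omega> / v) * (\<omega> / v\<^sup>2) - gfun' q * (\<omega> * (3 - 1 / v\<^sup>2)) - 40 * (v - 1) * exp (-\<omega>))) (at v)"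
      unfolding f_def q_def using v
      by (auto intro!: derivative_eq_intros DERIV_chain2[OF gfun_deriv] simp: field_simps power2_eq_square)
    have v2: "v\<^sup>2 \<ge> 1" using v by simp
    have q1: "\<omega> \<le> q" and q2: "q \<le> 487/100"
    proof -
      have "(3 * v - 1) * (v - 1) \<ge> 0" using v by simp
      hence "4 \<le> 3 * v + 1 / v" using v by (simp add: field_simps)
      thus "\<omega> \<le> q" using mult_left_mono[of 4 "3 * v + 1 / v" \<omega>] w by (simp add: q_def)
      have "(v - 1) * (12935/10000 - v) \<ge> 0" using v v' by simp
      hence "1 / v \<le> 22935/12935 - v * (10000/12935)" using v by (simp add: field_simps)
      moreover have "22935/12935 - v * (10000/12935) + 3 * v \<le> 22935/12935 + (3 - 10000/12935) * (12935/10000)" using v' by simp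
      ultimately have "3 * v + 1 / v \<le> 4654/1000" by simp
      hence "\<omega> * (3 * v + 1 / v) \<le> 418/100 * (4654/1000)" using w v by (intro mult_mono) auto
      moreover have "4 * q = \<omega> * (3 * v + 1 / v)" by (simp add: q_def)
      ultimately show "q \<le> 487/100" by linarith
    qed
    have gq: "gfun' q \<le> gfun' \<omega>" by (rule gfun'_max_at_left) (use w q1 q2 in auto)
    have gw: "gfun' \<omega> = - p * exp (-\<omega>)" by (simp add: gfun'_def p_def)
    \<comment> \<open>A chord of the concave \<open>r\<close> over the range of
      \<open>\<omega>\<close>; the bound for the convex \<open>p\<close> below is its tangent at
      362/100, rounded down.\<close>
    have r0: "r \<ge> 88816/10000 - 18/10 * \<omega>"
    proof -
      have "(\<omega> - 362/100) * (418/100 - \<omega>) \<ge> 0" using w by simp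
      thus ?thesis by (simp add: r_def power2_eq_square field_simps)
    qed
    have r00: "r \<ge> 0" using r0 w by linarith
    have p0: "p \<ge> 324/100 * \<omega> - 108588/10000"
    proof -
      have "(\<omega> - 362/100)\<^sup>2 \<ge> 0" by simp
      thus ?thesis by (simp add: p_def power2_eq_square field_simps)
    qed
    have p00: "p \<ge> 0" using p0 w by linarith
    \<comment> \<open>\<open>- r * exp (-\<omega>)\<close> is the second derivative of
      \<open>gfun\<close> at \<open>\<omega>\<close>, and between \<open>\<omega> / v\<close> and
      \<open>\<omega>\<close> that derivative does not exceed this value.\<close>
    have gu: "gfun' (\<omega> / v) \<ge> - p * exp (-\<omega>) + r * exp (-\<omega>) * (\<omega> - \<omega> / v)"
    proof -
      have le: "\<omega> / v \<le> \<omega>" using v w by (simp add: field_simps mult_left_le)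
      have ge: "\<omega> / v \<ge> 279/100"
      proof -
        have "279/100 * v \<le> 279/100 * (12935/10000)" using v' by simp
        thus ?thesis using v w by (simp add: field_simps)
      qed
      have "(\<lambda>z. gfun' z + r * exp (-\<omega>) * z) (\<omega> / v) \<ge> (\<lambda>z. gfun' z + r * exp (-\<omega>) * z) \<omega>"
      proof (rule DERIV_nonpos_imp_nonincreasing[OF le])
        fix z assume z: "\<omega> / v \<le> z" "z \<le> \<omega>"
        have d: "((\<lambda>z. gfun' z + r * exp (-\<omega>) * z) has_real_derivative ((z\<^sup>2 - 6 * z + 25/4) * exp (-z) + r * exp (-\<omega>))) (at z)"
          by (auto intro!: derivative_eq_intros gfun'_deriv)
        have "(\<omega> - z) * (\<omega> + z - 6) \<ge> 0" using z ge w by (intro mult_nonneg_nonneg) linarith+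
        hence "r \<le> -(z\<^sup>2 - 6 * z + 25/4)" by (simp add: r_def power2_eq_square algebra_simps)
        hence "r * exp (-\<omega>) \<le> -(z\<^sup>2 - 6 * z + 25/4) * exp (-z)"
          using r00 z by (intro mult_mono) auto
        thus "\<exists>y. ((\<lambda>z. gfun' z + r * exp (-\<omega>) * z) has_real_derivative y) (at z) \<and> y \<le> 0"
          using d by (intro exI conjI) (auto simp: algebra_simps)
      qed
      thus ?thesis by (simp add: gw algebra_simps)
    qed
    have "0 \<le> exp (-\<omega>) * ((v - 1) * (\<omega> * (3 * p * ((v + 1) / v\<^sup>2) + 2 * r * \<omega> * (1 / v ^ 3)) - 40))"
    proof (intro mult_nonneg_nonneg)
      have a1: "(v + 1) / v\<^sup>2 \<ge> 137/100"
      proof -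
        have "(12935/10000 - v) * (v * (137/100) + 7719/10000) \<ge> 0" using v v' by (intro mult_nonneg_nonneg) auto
        hence "137/100 * v\<^sup>2 \<le> v + 1" using v v' by (simp add: power2_eq_square field_simps)
        thus ?thesis using v by (simp add: field_simps)
      qed
      have a2: "1 / v ^ 3 \<ge> 462/1000"
      proof -
        have "v ^ 3 \<le> (12935/10000) ^ 3" using v v' by (intro power_mono) auto
        hence "462/1000 * v ^ 3 \<le> 1" by (simp add: power_divide)
        thus ?thesis using v by (simp add: field_simps)
      qed
      have "362/100 * (3 * p * (137/100) + 2 * r * (362/100) * (462/1000)) \<ge> 40"
        using p0 r0 w unfolding distrib_left by linarith
      also have "362/100 * (3 * p * (137/100) + 2 * r * (362/100) * (462/1000)) \<le> \<omega> * (3 * p * ((v + 1) / v\<^sup>2) + 2 * r * \<omega> * (1 / v ^ 3))"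
        using a1 a2 w p00 r00 v by (intro mult_mono add_mono mult_left_mono) auto
      finally show "0 \<le> \<omega> * (3 * p * ((v + 1) / v\<^sup>2) + 2 * r * \<omega> * (1 / v ^ 3)) - 40" by simp
    qed (use v in auto)
    also have "\<dots> = 2 * (- p * exp (-\<omega>) + r * exp (-\<omega>) * (\<omega> - \<omega> / v)) * (\<omega> / v\<^sup>2) - (- p * exp (-\<omega>)) * (\<omega> * (3 - 1 / v\<^sup>2)) - 40 * (v - 1) * exp (-\<omega>)"
      using v by (simp add: field_simps power2_eq_square power3_eq_cube)
    also have "\<dots> \<le> 2 * gfun' (\<omega> / v) * (\<omega> / v\<^sup>2) - gfun' q * (\<omega> * (3 - 1 / v\<^sup>2)) - 40 * (v - 1) * exp (-\<omega>)"
    proof -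
      have "1 / v\<^sup>2 \<le> 1 / 1" using v2 by (intro divide_left_mono) auto
      hence "0 \<le> \<omega> * (3 - 1 / v\<^sup>2)" using w by (intro mult_nonneg_nonneg) auto
      hence "gfun' q * (\<omega> * (3 - 1 / v\<^sup>2)) \<le> (- p * exp (-\<omega>)) * (\<omega> * (3 - 1 / v\<^sup>2))"
        using gq unfolding gw by (intro mult_right_mono) auto
      moreover have "2 * (- p * exp (-\<omega>) + r * exp (-\<omega>) * (\<omega> - \<omega> / v)) * (\<omega> / v\<^sup>2) \<le> 2 * gfun' (\<omega> / v) * (\<omega> / v\<^sup>2)"
        using gu w by (intro mult_right_mono mult_left_mono) auto
      ultimately show ?thesis by (intro diff_right_mono diff_mono)
    qed
    finally show "\<exists>y. (f has_real_derivative y) (at v) \<and> 0 \<le> y" using D by blast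
  qed
  thus ?thesis by (simp add: f_def)
qed

section \<open>Short vectors of the hexagonal lattice\<close>

abbreviation intN :: "int \<Rightarrow> int \<Rightarrow> int" where "intN m n \<equiv> m * m + m * n + n * n"

lemma hexN_intN: "hexN (m, n) = real_of_int (intN m n)"
  by (simp add: hexN_def power2_eq_square)

lemma intN_small_box:
  assumes "intN m n \<le> 11"
  shows "m \<in> {-3..3}" "n \<in> {-3..3}"
proof -
  have a: "m \<in> {-3..3}" if "intN m n \<le> 11" for m n
  proof (rule ccontr)
    assume "m \<notin> {-3..3}"
    hence "\<bar>m\<bar> \<ge> 4" by auto
    hence "m * m \<ge> 16" using mult_mono[of 4 "\<bar>m\<bar>" 4 "\<bar>m\<bar>"] by (simp add: abs_mult_self_eq)
    moreover have "(m + 2 * n) * (m + 2 * n) \<ge> 0" by simp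
    ultimately show False using that by (simp add: algebra_simps)
  qed
  show "m \<in> {-3..3}" by (rule a[OF assms])
  have "intN n m \<le> 11" using assms by (simp add: algebra_simps)
  thus "n \<in> {-3..3}" by (rule a)
qed

lemma int_interval_3: "{-3..3} = {-3, -2, -1, 0, 1, 2, 3 :: int}" by auto

text \<open>A finite check over the box containing all vectors of norm at most 11. For norms 3 and 4
  it records \<open>m * m\<close> and \<open>(2 * n + m) * (2 * n + m)\<close>, the quantities on
  which the deformed form depends.\<close>

lemma intN_classification:
  "intN m n = 0 \<or> intN m n = 1 \<or> intN m n = 3 \<or> intN m n = 4 \<or> intN m n \<ge> 7"
  "intN m n = 0 \<Longrightarrow> m = 0 \<and> n = 0"
  "intN m n = 1 \<Longrightarrow> (m, n) \<in> {(0, 1), (0, -1), (1, 0), (-1, 0), (1, -1), (-1, 1)}"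
  "intN m n = 3 \<Longrightarrow> (2 * n + m = 0 \<and> m * m = 4) \<or> (2 * n + m \<noteq> 0 \<and> m * m = 1 \<and> (2 * n + m) * (2 * n + m) = 9)"
  "intN m n = 4 \<Longrightarrow> (m = 0 \<and> (2 * n + m) * (2 * n + m) = 16) \<or> (m \<noteq> 0 \<and> m * m = 4 \<and> (2 * n + m) * (2 * n + m) = 4)"
proof -
  have P: "(intN m n = 0 \<or> intN m n = 1 \<or> intN m n = 3 \<or> intN m n = 4 \<or> intN m n \<ge> 7) \<and>
     (intN m n = 0 \<longrightarrow> m = 0 \<and> n = 0) \<and>
     (intN m n = 1 \<longrightarrow> (m, n) \<in> {(0, 1), (0, -1), (1, 0), (-1, 0), (1, -1), (-1, 1)}) \<and>
     (intN m n = 3 \<longrightarrow> (2 * n + m = 0 \<and> m * m = 4) \<or> (2 * n + m \<noteq> 0 \<and> m * m = 1 \<and> (2 * n + m) * (2 * n + m) = 9)) \<and>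
     (intN m n = 4 \<longrightarrow> (m = 0 \<and> (2 * n + m) * (2 * n + m) = 16) \<or> (m \<noteq> 0 \<and> m * m = 4 \<and> (2 * n + m) * (2 * n + m) = 4))"
  proof (cases "intN m n \<le> 11")
    case True
    note b = intN_small_box[OF True, unfolded int_interval_3]
    from b(1) show ?thesis
      by (elim insertE emptyE; use b(2) in \<open>elim insertE emptyE; simp\<close>)
  qed auto
  show "intN m n = 0 \<or> intN m n = 1 \<or> intN m n = 3 \<or> intN m n = 4 \<or> intN m n \<ge> 7"
  "intN m n = 0 \<Longrightarrow> m = 0 \<and> n = 0"
  "intN m n = 1 \<Longrightarrow> (m, n) \<in> {(0, 1), (0, -1), (1, 0), (-1, 0), (1, -1), (-1, 1)}"
  "intN m n = 3 \<Longrightarrow> (2 * n + m = 0 \<and> m * m = 4) \<or> (2 * n + m \<noteq> 0 \<and> m * m = 1 \<and> (2 * n + m) * (2 * n + m) = 9)"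
  "intN m n = 4 \<Longrightarrow> (m = 0 \<and> (2 * n + m) * (2 * n + m) = 16) \<or> (m \<noteq> 0 \<and> m * m = 4 \<and> (2 * n + m) * (2 * n + m) = 4)"
    using P by blast+
qed

lemma hex_form_intN: "hex_form \<omega> u (m, n) = \<omega> * (3 * real_of_int (m * m) * u + real_of_int ((2 * n + m) * (2 * n + m)) / u) / 4"
  by (simp add: hex_form_def power2_eq_square)

text \<open>Bounds for the second order remainders of the lattice vectors of norm at least three, in units of
  \<open>(u - 1)\<^sup>2 * exp (- \<omega>)\<close>; beyond the box a Gaussian takes over.\<close>

definition remainder_table :: "int \<times> int \<Rightarrow> real" where
  "remainder_table = (\<lambda>(m, n). if intN m n = 3 then (if 2 * n + m = 0 then 263/100 else 143/100)
      else if intN m n = 4 then (if m = 0 then 366/100 else 90/1000)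
      else if 7 \<le> intN m n \<and> intN m n < 12 then 1/50 else 0)"

text \<open>Two and four vectors of norm 3, two and four of norm 4, and eighteen of norms 7 and 9:
  \<open>5.26 + 5.72 + 7.32 + 0.36 + 0.36\<close>.\<close>

lemma remainder_table_sum: "(remainder_table has_sum (1902/100)) UNIV"
proof (rule has_sum_finite_neutralI[of "{-3..3} \<times> {-3..3}"])
  fix i :: "int \<times> int" assume "i \<in> UNIV - {-3..3} \<times> {-3..3}"
  moreover obtain m n where i: "i = (m, n)" by (cases i)
  ultimately have "\<not> (m \<in> {-3..3} \<and> n \<in> {-3..3})" by auto
  hence "intN m n > 11" using intN_small_box[of m n] by force
  thus "remainder_table i = 0" by (simp add: i remainder_table_def)
next
  have "(\<Sum>i\<in>{-3..3} \<times> {-3..3}. remainder_table i) = (\<Sum>m\<in>{-3, -2, -1, 0, 1, 2, 3}. \<Sum>n\<in>{-3, -2, -1, 0, 1, 2, 3}. remainder_table (m, n))"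
    unfolding int_interval_3 by (subst sum.cartesian_product) simp
  also have "\<dots> = 1902/100" by (simp add: remainder_table_def)
  finally show "1902/100 = (\<Sum>i\<in>{-3..3} \<times> {-3..3}. remainder_table i)" by simp
qed auto

text \<open>The deformed exponent of a long vector keeps at least 773/1000 of its original size, as
  \<open>10000/12935 > 773/1000\<close>. The rate 173/1000 spent here leaves decay at rate
  3/5.\<close>

lemma pow4_le_exp: 
  fixes x :: real
  assumes "x \<ge> 0"
  shows "x ^ 4 \<le> 5240 * exp (173/1000 * x)"
proof -
  have "173/4000 * x \<le> exp (173/4000 * x - 1)" using exp_ge_add_one_self[of "173/4000 * x - 1"] by simp
  also have "\<dots> = exp (-1) * exp (173/4000 * x)" by (simp flip: exp_add)
  also have "exp (-1::real) \<le> 36795/100000" by (rule exp_minus_le_power16[of _ "46971/50000"]) (simp_all add: power_divide)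
  finally have "173/4000 * x \<le> 36795/100000 * exp (173/4000 * x)" by simp
  hence "x \<le> 8508/1000 * exp (173/4000 * x)" using exp_gt_zero[of "173/4000 * x"] by linarith
  hence "x ^ 4 \<le> (8508/1000 * exp (173/4000 * x)) ^ 4" using assms by (intro power_mono) auto
  also have "\<dots> = (8508/1000) ^ 4 * exp (173/1000 * x)" unfolding power_mult_distrib using exp_of_nat_mult[of 4 "173/4000 * x"] by simp
  also have "\<dots> \<le> 5240 * exp (173/1000 * x)" by (intro mult_right_mono) (simp_all add: power_divide)
  finally show ?thesis .
qed

text \<open>In each class of norm 3 or 4 the exponent moves by at most
  \<open>(u - 1) * \<omega> * b\<close> and stays above \<open>\<mu> = a * \<omega>\<close>, so the
  Taylor remainder reduces to a function decreasing in \<open>\<omega>\<close>, evaluated at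
  362/100. From norm 7 on the crude bound \<open>(u - 1) * W\<close> for the movement is
  enough.\<close>

lemma gfun_remainder_le:
  fixes \<omega> u :: real
  assumes w: "362/100 \<le> \<omega>" and u: "1 \<le> u" "u \<le> 12935/10000" and N: "hexN i \<ge> 2"
  shows "gfun (hex_form \<omega> u i) \<le> gfun (\<omega> * hexN i) + gfun' (\<omega> * hexN i) * (hex_form \<omega> u i - \<omega> * hexN i)
     + (u - 1)\<^sup>2 * exp (-\<omega>) * (remainder_table i + 1/1000 * (exp (- (8/25) * (real_of_int (fst i))\<^sup>2) * exp (- (8/25) * (real_of_int (snd i))\<^sup>2)))"
proof -
  obtain m n where i: "i = (m, n)" by (cases i)
  define q W where "q = hex_form \<omega> u i" and "W = \<omega> * hexN i"
  define j where "j = 2 * n + m"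
  have wW: "W = \<omega> * (3 * real_of_int (m * m) + real_of_int (j * j)) / 4"
    by (simp add: W_def i j_def hexN_intN algebra_simps)
  have qq: "q = \<omega> * (3 * real_of_int (m * m) * u + real_of_int (j * j) / u) / 4"
    by (simp add: q_def i hex_form_intN j_def)
  have red: ?thesis if "5 \<le> \<mu>" "\<mu> \<le> W" "\<mu> \<le> q"
     "(q - W)\<^sup>2 / 2 * ((\<mu> - 3)\<^sup>2 * exp (-\<mu>)) \<le> (u - 1)\<^sup>2 * exp (-\<omega>) * C"
     "C \<le> remainder_table i + 1/1000 * (exp (- (8/25) * (real_of_int (fst i))\<^sup>2) * exp (- (8/25) * (real_of_int (snd i))\<^sup>2))" for \<mu> C
  proof -
    have "(u - 1)\<^sup>2 * exp (-\<omega>) * C \<le> (u - 1)\<^sup>2 * exp (-\<omega>) * (remainder_table i + 1/1000 * (exp (- (8/25) * (real_of_int (fst i))\<^sup>2) * exp (- (8/25) * (real_of_int (snd i))\<^sup>2)))"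
      using that(5) by (intro mult_left_mono) auto
    thus ?thesis using gfun_taylor[OF that(1-3)] that(4) unfolding q_def W_def by linarith
  qed
  have tail0: "0 \<le> 1/1000 * (exp (- (8/25) * (real_of_int (fst i))\<^sup>2) * exp (- (8/25) * (real_of_int (snd i))\<^sup>2))" by simp
  have form: "(q - W)\<^sup>2 / 2 * ((\<mu> - 3)\<^sup>2 * exp (-\<mu>)) \<le> (u - 1)\<^sup>2 * exp (-\<omega>) * C"
    if "\<bar>q - W\<bar> \<le> (u - 1) * (\<omega> * b)" "\<mu> = a * \<omega>" "\<omega>\<^sup>2 * (a * \<omega> - 3)\<^sup>2 * exp (- k * \<omega>) \<le> X" "k = a - 1" "b\<^sup>2 / 2 * X \<le> C" for a b k X \<mu> C
  proof -
    have "(q - W)\<^sup>2 \<le> ((u - 1) * (\<omega> * b))\<^sup>2" using power_mono[OF that(1), of 2] by simp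
    hence "(q - W)\<^sup>2 / 2 * ((\<mu> - 3)\<^sup>2 * exp (-\<mu>)) \<le> ((u - 1) * (\<omega> * b))\<^sup>2 / 2 * ((\<mu> - 3)\<^sup>2 * exp (-\<mu>))"
      by (intro mult_right_mono divide_right_mono) auto
    also have "\<dots> = (u - 1)\<^sup>2 * exp (-\<omega>) * (b\<^sup>2 / 2 * (\<omega>\<^sup>2 * (a * \<omega> - 3)\<^sup>2 * exp (- k * \<omega>)))"
    proof -
      have "exp (-\<mu>) = exp (-\<omega>) * exp (- k * \<omega>)" by (simp add: that(2,4) algebra_simps flip: exp_add)
      thus ?thesis by (simp add: that(2) power_mult_distrib)
    qed
    also have "\<dots> \<le> (u - 1)\<^sup>2 * exp (-\<omega>) * (b\<^sup>2 / 2 * X)" using that(3) by (intro mult_left_mono) auto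
    also have "\<dots> \<le> (u - 1)\<^sup>2 * exp (-\<omega>) * C" using that(5) by (intro mult_left_mono) auto
    finally show ?thesis .
  qed
  have iu: "1 / u \<ge> 10000/12935" using u by (simp add: field_simps)
  have iu1: "1 / u \<le> 1" using u by simp
  have uu: "0 \<le> u - 1" "u > 0" using u by auto
  have cl: "intN m n = 3 \<or> intN m n = 4 \<or> intN m n \<ge> 7"
  proof -
    have "2 \<le> intN m n" using N unfolding i hexN_intN by linarith
    thus ?thesis using intN_classification(1)[of m n] by linarith
  qed
  consider "intN m n = 3" "j = 0" "m * m = 4" | "intN m n = 3" "j \<noteq> 0" "m * m = 1" "j * j = 9"
    | "intN m n = 4" "m = 0" "j * j = 16" | "intN m n = 4" "m \<noteq> 0" "m * m = 4" "j * j = 4" | "intN m n \<ge> 7"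
    using cl intN_classification(4,5)[of m n, folded j_def] by blast
  thus ?thesis
  proof cases
    case 1
    have W: "W = 3 * \<omega>" and q: "q = 3 * \<omega> * u" using 1 by (simp_all add: wW qq)
    have "\<omega>\<^sup>2 * (3 * \<omega> - 3)\<^sup>2 * exp (- 2 * \<omega>) \<le> (362/100)\<^sup>2 * (3 * (362/100) - 3)\<^sup>2 * exp (- 2 * (362/100))"
      by (rule quartic_factor_decreasing) (use w in auto)
    also have "\<dots> \<le> (362/100)\<^sup>2 * (3 * (362/100) - 3)\<^sup>2 * (721/1000000)"
    proof (intro mult_left_mono)
      have "exp (- 2 * (362/100) :: real) \<le> exp (- (724/100))" by simp
      also have "\<dots> \<le> 721/1000000" by (rule exp_minus_le_power16[of _ "63619/100000"]) (simp_all add: power_divide)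
      finally show "exp (- 2 * (362/100) :: real) \<le> 721/1000000" .
    qed auto
    also have "\<dots> \<le> 584/1000" by (simp add: power_divide)
    finally have c: "\<omega>\<^sup>2 * (3 * \<omega> - 3)\<^sup>2 * exp (- 2 * \<omega>) \<le> 584/1000" .
    have d: "q - W = \<omega> * ((u - 1) * 3)" by (simp add: q W algebra_simps)
    have d2: "\<bar>q - W\<bar> \<le> (u - 1) * (\<omega> * 3)" unfolding d abs_mult using w uu by simp
    show ?thesis
    proof (rule red[of "3 * \<omega>" "263/100"])
      show "3 * \<omega> \<le> q" using mult_left_mono[OF u(1), of "3 * \<omega>"] w by (simp add: q)
      show "(q - W)\<^sup>2 / 2 * ((3 * \<omega> - 3)\<^sup>2 * exp (- (3 * \<omega>))) \<le> (u - 1)\<^sup>2 * exp (-\<omega>) * (263/100)"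
        by (rule form[OF d2 refl c]) (simp_all add: power_divide)
      show "263/100 \<le> remainder_table i + 1/1000 * (exp (- (8/25) * (real_of_int (fst i))\<^sup>2) * exp (- (8/25) * (real_of_int (snd i))\<^sup>2))"
        using tail0 1 by (simp add: remainder_table_def i j_def)
    qed (use w W in auto)
  next
    case 2
    have W: "W = 3 * \<omega>" and q: "q = 3/4 * \<omega> * (u + 3 / u)" using 2 by (simp_all add: wW qq field_simps)
    have "\<omega>\<^sup>2 * (2709/1000 * \<omega> - 3)\<^sup>2 * exp (- (1709/1000) * \<omega>) \<le> (362/100)\<^sup>2 * (2709/1000 * (362/100) - 3)\<^sup>2 * exp (- (1709/1000) * (362/100))"
      by (rule quartic_factor_decreasing) (use w in auto)
    also have "\<dots> \<le> (362/100)\<^sup>2 * (2709/1000 * (362/100) - 3)\<^sup>2 * (2080/1000000)"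
    proof (intro mult_left_mono)
      have "exp (- (1709/1000) * (362/100) :: real) \<le> exp (- (618/100))" by simp
      also have "\<dots> \<le> 2080/1000000" by (rule exp_minus_le_power16[of _ "67967/100000"]) (simp_all add: power_divide)
      finally show "exp (- (1709/1000) * (362/100) :: real) \<le> 2080/1000000" .
    qed auto
    also have "\<dots> \<le> 1263/1000" by (simp add: power_divide)
    finally have c: "\<omega>\<^sup>2 * (2709/1000 * \<omega> - 3)\<^sup>2 * exp (- (1709/1000) * \<omega>) \<le> 1263/1000" .
    \<comment> \<open>Up to rounding this is the value at the right end of the range of
      \<open>u\<close>; three quarters of it is the factor 2709/1000 in
      \<open>\<mu>\<close>.\<close>
    have s: "u + 3 / u \<ge> 3612/1000"
    proof -
      have "(12944/10000 - u) * (23176/10000 - u) \<ge> 0" using u by (intro mult_nonneg_nonneg) auto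
      moreover have "(12944/10000 - u) * (23176/10000 - u) = 299990144/100000000 - 3612/1000 * u + u * u" by (simp add: field_simps)
      ultimately have "3612/1000 * u \<le> u * u + 3" by linarith
      thus ?thesis using u by (simp add: field_simps)
    qed
    have d: "q - W = - (3/4 * \<omega> * ((u - 1) * (3 / u - 1)))" using uu by (simp add: q W field_simps)
    have "3 / u \<le> 3" "3 / u \<ge> 1" using u by (simp_all add: field_simps)
    hence "\<bar>q - W\<bar> \<le> 3/4 * \<omega> * ((u - 1) * 2)" 
      unfolding d abs_minus_cancel abs_mult using w uu by (intro mult_mono) auto
    hence d2: "\<bar>q - W\<bar> \<le> (u - 1) * (\<omega> * (3/2))" by (simp add: algebra_simps)
    show ?thesis
    proof (rule red[of "2709/1000 * \<omega>" "143/100"])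
      show "2709/1000 * \<omega> \<le> q" using mult_left_mono[OF s, of "3/4 * \<omega>"] w by (simp add: q)
      show "(q - W)\<^sup>2 / 2 * ((2709/1000 * \<omega> - 3)\<^sup>2 * exp (- (2709/1000 * \<omega>))) \<le> (u - 1)\<^sup>2 * exp (-\<omega>) * (143/100)"
        by (rule form[OF d2 refl c]) (simp_all add: power_divide)
      show "143/100 \<le> remainder_table i + 1/1000 * (exp (- (8/25) * (real_of_int (fst i))\<^sup>2) * exp (- (8/25) * (real_of_int (snd i))\<^sup>2))"
        using tail0 2 by (simp add: remainder_table_def i j_def)
    qed (use w W in auto)
  next
    case 3
    have W: "W = 4 * \<omega>" and q: "q = 4 * \<omega> / u" using 3 by (simp_all add: wW qq)
    have "\<omega>\<^sup>2 * (3092/1000 * \<omega> - 3)\<^sup>2 * exp (- (2092/1000) * \<omega>) \<le> (362/100)\<^sup>2 * (3092/1000 * (362/100) - 3)\<^sup>2 * exp (- (2092/1000) * (362/100))"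
      by (rule quartic_factor_decreasing) (use w in auto)
    also have "\<dots> \<le> (362/100)\<^sup>2 * (3092/1000 * (362/100) - 3)\<^sup>2 * (519/1000000)"
    proof (intro mult_left_mono)
      have "exp (- (2092/1000) * (362/100) :: real) \<le> exp (- (757/100))" by simp
      also have "\<dots> \<le> 519/1000000" by (rule exp_minus_le_power16[of _ "15581/25000"]) (simp_all add: power_divide)
      finally show "exp (- (2092/1000) * (362/100) :: real) \<le> 519/1000000" .
    qed auto
    also have "\<dots> \<le> 457/1000" by (simp add: power_divide)
    finally have c: "\<omega>\<^sup>2 * (3092/1000 * \<omega> - 3)\<^sup>2 * exp (- (2092/1000) * \<omega>) \<le> 457/1000" .
    have d: "q - W = - (4 * \<omega> * ((u - 1) * (1 / u)))" using uu by (simp add: q W field_simps)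
    have "\<bar>q - W\<bar> \<le> 4 * \<omega> * ((u - 1) * 1)" 
      unfolding d abs_minus_cancel abs_mult using w uu iu1 by (intro mult_mono) auto
    hence d2: "\<bar>q - W\<bar> \<le> (u - 1) * (\<omega> * 4)" by (simp add: algebra_simps)
    show ?thesis
    proof (rule red[of "3092/1000 * \<omega>" "366/100"])
      show "3092/1000 * \<omega> \<le> q" using mult_left_mono[OF iu, of "4 * \<omega>"] w by (simp add: q)
      show "(q - W)\<^sup>2 / 2 * ((3092/1000 * \<omega> - 3)\<^sup>2 * exp (- (3092/1000 * \<omega>))) \<le> (u - 1)\<^sup>2 * exp (-\<omega>) * (366/100)"
        by (rule form[OF d2 refl c]) (simp_all add: power_divide)
      show "366/100 \<le> remainder_table i + 1/1000 * (exp (- (8/25) * (real_of_int (fst i))\<^sup>2) * exp (- (8/25) * (real_of_int (snd i))\<^sup>2))"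
        using tail0 3 by (simp add: remainder_table_def i j_def)
    qed (use w W in auto)
  next
    case 4
    have W: "W = 4 * \<omega>" and q: "q = \<omega> * (3 * u + 1 / u)" using 4 by (simp_all add: wW qq field_simps)
    have "\<omega>\<^sup>2 * (4 * \<omega> - 3)\<^sup>2 * exp (- 3 * \<omega>) \<le> (362/100)\<^sup>2 * (4 * (362/100) - 3)\<^sup>2 * exp (- 3 * (362/100))"
      by (rule quartic_factor_decreasing) (use w in auto)
    also have "\<dots> \<le> (362/100)\<^sup>2 * (4 * (362/100) - 3)\<^sup>2 * (200/10000000)"
    proof (intro mult_left_mono)
      have "exp (- 3 * (362/100) :: real) \<le> exp (- (1086/100))" by simp
      also have "\<dots> \<le> 200/10000000" by (rule exp_minus_le_power16[of _ "50833/100000"]) (simp_all add: power_divide)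
      finally show "exp (- 3 * (362/100) :: real) \<le> 200/10000000" .
    qed auto
    also have "\<dots> \<le> 173/5000" by (simp add: power_divide)
    finally have c: "\<omega>\<^sup>2 * (4 * \<omega> - 3)\<^sup>2 * exp (- 3 * \<omega>) \<le> 173/5000" .
    have d: "q - W = \<omega> * ((u - 1) * (3 - 1 / u))" using uu by (simp add: q W field_simps)
    have "\<bar>3 - 1 / u\<bar> \<le> 9/4" using iu iu1 by linarith
    hence "\<bar>q - W\<bar> \<le> \<omega> * ((u - 1) * (9/4))" 
      unfolding d abs_mult using w uu by (intro mult_mono) auto
    hence d2: "\<bar>q - W\<bar> \<le> (u - 1) * (\<omega> * (9/4))" by (simp add: algebra_simps)
    have "0 \<le> 3 - 1 / u" using iu1 by linarith
    hence d3: "0 \<le> q - W" unfolding d using w uu by (intro mult_nonneg_nonneg) auto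
    show ?thesis
    proof (rule red[of "4 * \<omega>" "90/1000"])
      show "4 * \<omega> \<le> q" using d3 W by simp
      show "(q - W)\<^sup>2 / 2 * ((4 * \<omega> - 3)\<^sup>2 * exp (- (4 * \<omega>))) \<le> (u - 1)\<^sup>2 * exp (-\<omega>) * (90/1000)"
        by (rule form[OF d2 refl c]) (simp_all add: power_divide)
      show "90/1000 \<le> remainder_table i + 1/1000 * (exp (- (8/25) * (real_of_int (fst i))\<^sup>2) * exp (- (8/25) * (real_of_int (snd i))\<^sup>2))"
        using tail0 4 by (simp add: remainder_table_def i j_def)
    qed (use w W in auto)
  next
    case 5
    define Nr where "Nr = hexN i"
    have Nr7: "Nr \<ge> 7" using 5 by (simp add: Nr_def i hexN_intN del: of_int_add of_int_mult)
    have W: "W = \<omega> * Nr" by (simp add: W_def Nr_def)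
    have W0: "W \<ge> 25" using mult_mono[OF w Nr7] w by (simp add: W)
    have A0: "3 * real_of_int (m * m) \<ge> 0" "real_of_int (j * j) \<ge> 0" by auto
    have qlow: "773/1000 * W \<le> q"
    proof -
      have "773/1000 * (3 * real_of_int (m * m)) \<le> 3 * real_of_int (m * m) * u"
        using mult_left_mono[OF _ A0(1), of "773/1000" u] u by (simp add: mult.commute)
      moreover have "773/1000 * real_of_int (j * j) \<le> real_of_int (j * j) / u"
        using mult_left_mono[OF _ A0(2), of "773/1000" "1/u"] iu by simp
      ultimately have "773/1000 * (3 * real_of_int (m * m) + real_of_int (j * j)) \<le> 3 * real_of_int (m * m) * u + real_of_int (j * j) / u"
        by (simp add: algebra_simps)
      from mult_left_mono[OF this, of "\<omega>/4"] w show ?thesis unfolding wW qq by (simp add: mult_ac)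
    qed
    have qd: "\<bar>q - W\<bar> \<le> (u - 1) * W"
    proof -
      have e: "q - W = \<omega>/4 * (u - 1) * (3 * real_of_int (m * m) - real_of_int (j * j) / u)"
        using uu by (simp add: wW qq field_simps)
      have "real_of_int (j * j) / u \<le> real_of_int (j * j)" "0 \<le> real_of_int (j * j) / u"
        using mult_left_mono[OF iu1 A0(2)] A0 uu by simp_all
      hence "\<bar>3 * real_of_int (m * m) - real_of_int (j * j) / u\<bar> \<le> 3 * real_of_int (m * m) + real_of_int (j * j)"
        using A0 by linarith
      hence "\<bar>q - W\<bar> \<le> \<omega>/4 * (u - 1) * (3 * real_of_int (m * m) + real_of_int (j * j))"
        unfolding e abs_mult using w uu by (intro mult_mono) auto
      thus ?thesis unfolding wW by (simp add: mult_ac)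
    qed
    define \<mu> where "\<mu> = 773/1000 * W"
    have mu: "\<mu> \<ge> 19" using W0 by (simp add: \<mu>_def)
    have "(q - W)\<^sup>2 \<le> ((u - 1) * W)\<^sup>2" using power_mono[OF qd, of 2] by simp
    moreover have "(\<mu> - 3)\<^sup>2 \<le> \<mu>\<^sup>2" using mu by (intro power_mono) auto
    ultimately have "(q - W)\<^sup>2 / 2 * ((\<mu> - 3)\<^sup>2 * exp (-\<mu>)) \<le> ((u - 1) * W)\<^sup>2 / 2 * (\<mu>\<^sup>2 * exp (-\<mu>))"
      by (intro mult_mono divide_right_mono) auto
    also have "\<dots> = (u - 1)\<^sup>2 * ((773/1000)\<^sup>2 / 2 * (W ^ 4 * exp (-\<mu>)))"
      by (simp add: \<mu>_def power_mult_distrib eval_nat_numeral)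
    also have "\<dots> \<le> (u - 1)\<^sup>2 * ((773/1000)\<^sup>2 / 2 * ((5240 * exp (173/1000 * W)) * exp (-\<mu>)))"
      using pow4_le_exp[of W] W0 by (intro mult_left_mono mult_right_mono) auto
    also have "\<dots> = (u - 1)\<^sup>2 * exp (-\<omega>) * ((773/1000)\<^sup>2 / 2 * 5240 * exp (\<omega> - 3/5 * W))"
      by (simp add: \<mu>_def algebra_simps flip: exp_add)
    also have "\<dots> \<le> (u - 1)\<^sup>2 * exp (-\<omega>) * (1566 * exp (\<omega> - 3/5 * W))"
      by (intro mult_left_mono mult_right_mono) (auto simp: power_divide)
    finally have bound: "(q - W)\<^sup>2 / 2 * ((\<mu> - 3)\<^sup>2 * exp (-\<mu>)) \<le> (u - 1)\<^sup>2 * exp (-\<omega>) * (1566 * exp (\<omega> - 3/5 * W))" .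
    have C: "1566 * exp (\<omega> - 3/5 * W) \<le> remainder_table i + 1/1000 * (exp (- (8/25) * (real_of_int (fst i))\<^sup>2) * exp (- (8/25) * (real_of_int (snd i))\<^sup>2))"
    proof (cases "intN m n < 12")
      case True
      have "W \<ge> 7 * \<omega>" using mult_left_mono[OF Nr7, of \<omega>] w by (simp add: W)
      hence "exp (\<omega> - 3/5 * W) \<le> exp (- (1158/100))" using w by simp
      also have "\<dots> \<le> 100/10000000" by (rule exp_minus_le_power16[of _ "4865/10000"]) (simp_all add: power_divide)
      finally have "1566 * exp (\<omega> - 3/5 * W) \<le> 1/50" by simp
      also have "\<dots> = remainder_table i" using True 5 by (simp add: remainder_table_def i)
      finally show ?thesis using tail0 by linarith
    next
      case False
      have N12: "Nr \<ge> 12" using False by (simp add: Nr_def i hexN_intN del: of_int_add of_int_mult)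
      have "sqn i / 2 \<le> Nr" unfolding Nr_def by (rule hexN_ge_half)
      define \<rho> where "\<rho> = sqn i"
      have rho: "\<rho> \<ge> 0" by (simp add: \<rho>_def)
      \<comment> \<open>Seven tenths of \<open>12 \<le> Nr\<close> plus three tenths of
        \<open>\<rho> / 2 \<le> Nr\<close>: one share beats the numerical constants, the other gives
        a summable Gaussian.\<close>
      have "84/10 + 3/20 * \<rho> \<le> Nr" using \<open>sqn i / 2 \<le> Nr\<close> N12 unfolding \<rho>_def[symmetric] by linarith
      hence "\<omega> * (84/10 + 3/20 * \<rho>) \<le> W" using w unfolding W by (intro mult_left_mono) auto
      hence "84/10 * \<omega> + 3/20 * (\<omega> * \<rho>) \<le> W" by (simp add: algebra_simps)
      moreover have "362/100 * \<rho> \<le> \<omega> * \<rho>" using w rho by (intro mult_right_mono) auto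
      ultimately have "\<omega> - 3/5 * W \<le> - (1462/100) - 8/25 * \<rho>"
        using w rho by linarith
      hence "\<omega> - 3/5 * W \<le> - (1462/100) + - (8/25) * (real_of_int (fst i))\<^sup>2 + - (8/25) * (real_of_int (snd i))\<^sup>2"
        unfolding \<rho>_def distrib_left by linarith
      hence "exp (\<omega> - 3/5 * W) \<le> exp (- (1462/100)) * (exp (- (8/25) * (real_of_int (fst i))\<^sup>2) * exp (- (8/25) * (real_of_int (snd i))\<^sup>2))"
        by (simp flip: exp_add)
      also have "\<dots> \<le> 6/10000000 * (exp (- (8/25) * (real_of_int (fst i))\<^sup>2) * exp (- (8/25) * (real_of_int (snd i))\<^sup>2))"
      proof (intro mult_right_mono)
        show "exp (- (1462/100) :: real) \<le> 6/10000000" by (rule exp_minus_le_power16[of _ "20281/50000"]) (simp_all add: power_divide)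
      qed auto
      finally have "1566 * exp (\<omega> - 3/5 * W) \<le> 1/1000 * (exp (- (8/25) * (real_of_int (fst i))\<^sup>2) * exp (- (8/25) * (real_of_int (snd i))\<^sup>2))"
        using tail0 by linarith
      moreover have "remainder_table i \<ge> 0" by (simp add: remainder_table_def i)
      ultimately show ?thesis by linarith
    qed
    show ?thesis
      by (rule red[OF _ _ _ bound C]) (use mu qlow W0 in \<open>auto simp: \<mu>_def\<close>)
  qed
qed

section \<open>Lattice sums on the line and small deformations for small parameter\<close>

lemma Vsum_hex:
  assumes "u > 0" "s > 0"
  shows "((\<lambda>i. gfun (hex_form (2 * pi * s / sqrt 3) u i)) has_sum Vsum UNIV (1/2) (sqrt 3 / 2 * u) s) UNIV"
proof -
  have y: "sqrt 3 / 2 * u > 0" using assms by simp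
  show ?thesis
    unfolding Vsum_def gfun_def lat_form_half[OF assms(1), of s, symmetric]
    using lat_summable_basic(3)[OF y assms(2)] by (rule has_sum_infsum)
qed

lemma Usum_hex:
  assumes "u > 0" "s > 0"
  shows "((\<lambda>i. - hfun (hex_form (2 * pi * s / sqrt 3) u i)) has_sum Usum UNIV (1/2) (sqrt 3 / 2 * u) s) UNIV"
proof -
  have y: "sqrt 3 / 2 * u > 0" using assms by simp
  have e: "- hfun w = (1/2 - w) * exp (-w)" for w by (simp add: hfun_def algebra_simps)
  show ?thesis
    unfolding Usum_def e lat_form_half[OF assms(1), of s, symmetric]
    using lat_summable_basic(2)[OF y assms(2)] by (rule has_sum_infsum)
qed

definition min_vecs :: "(int \<times> int) set" where
  "min_vecs = {(0, 1), (0, -1), (1, 0), (-1, 0), (1, -1), (-1, 1)}"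

lemma min_vecs_sum:
  "((\<lambda>i. if i \<in> min_vecs then f (hex_form \<omega> u i) - f (\<omega> * hexN i) else 0) has_sum
     (2 * f (\<omega> / u) + 4 * f (\<omega> * (3 * u + 1 / u) / 4) - 6 * (f \<omega> :: real))) UNIV"
proof (rule has_sum_finite_neutralI[of min_vecs])
  have "(\<Sum>i\<in>min_vecs. if i \<in> min_vecs then f (hex_form \<omega> u i) - f (\<omega> * hexN i) else 0)
      = (\<Sum>i\<in>min_vecs. f (hex_form \<omega> u i) - f (\<omega> * hexN i))" by simp
  also have "\<dots> = 2 * f (\<omega> / u) + 4 * f (\<omega> * (3 * u + 1 / u) / 4) - 6 * f \<omega>"
    by (simp add: min_vecs_def hex_form_def hexN_def)
  finally show "2 * f (\<omega> / u) + 4 * f (\<omega> * (3 * u + 1 / u) / 4) - 6 * f \<omega> =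
     (\<Sum>i\<in>min_vecs. if i \<in> min_vecs then f (hex_form \<omega> u i) - f (\<omega> * hexN i) else 0)" by simp
qed (auto simp: min_vecs_def)

lemma hexN_cases:
  obtains "i = (0, 0)" | "i \<in> min_vecs" "hexN i = 1" | "i \<notin> min_vecs" "i \<noteq> (0,0)" "hexN i \<ge> 3"
proof (cases i)
  case (Pair m n)
  have "intN m n = 0 \<or> intN m n = 1 \<or> intN m n \<ge> 3" using intN_classification(1)[of m n] by linarith
  then consider "intN m n = 0" | "intN m n = 1" | "intN m n \<ge> 3" by blast
  thus thesis
  proof cases
    case 1
    thus ?thesis using that(1) intN_classification(2)[of m n] Pair by simp
  next
    case 2
    have "i \<in> min_vecs" using intN_classification(3)[OF 2] unfolding Pair min_vecs_def .
    moreover have "hexN i = 1" unfolding Pair hexN_intN 2 by simp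
    ultimately show ?thesis using that(2) by blast
  next
    case 3
    have "i \<notin> min_vecs" using 3 by (auto simp: Pair min_vecs_def)
    moreover have "i \<noteq> (0, 0)" using 3 by (auto simp: Pair)
    moreover have "hexN i \<ge> 3" using 3 unfolding Pair hexN_intN by linarith
    ultimately show ?thesis using that(3) by blast
  qed
qed

lemma hex_weight_summable:
  fixes p :: "real \<Rightarrow> real"
  assumes w: "\<omega> > 0" and p: "\<And>x. x \<ge> 0 \<Longrightarrow> \<bar>p x\<bar> \<le> K * (1 + x + x\<^sup>2)" and K: "K \<ge> 0"
  shows "(\<lambda>i. (if hexN i \<ge> 2 then p (\<omega> * hexN i) * exp (- (\<omega> * hexN i)) else 0) * (real_of_int (fst i))\<^sup>2) summable_on UNIV"
proof -
  let ?q = "\<lambda>i. (if hexN i \<ge> 2 then p (\<omega> * hexN i) * (real_of_int (fst i))\<^sup>2 else 0)"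
  have "(\<lambda>i. ?q i * exp (- (\<omega> * hexN i))) summable_on UNIV"
  proof (rule summable_on_poly_exp[where c = "\<omega>/2" and K = "4 * K / \<omega>"])
    fix i :: "int \<times> int"
    show "\<omega> / 2 * sqn i \<le> \<omega> * hexN i"
      using mult_left_mono[OF hexN_ge_half[of i], of \<omega>] w by simp
    have n: "0 \<le> hexN i" by (rule order_trans[OF _ hexN_ge_half]) simp
    define x where "x = \<omega> * hexN i"
    have x: "x \<ge> 0" using n w by (simp add: x_def)
    have f: "(real_of_int (fst i))\<^sup>2 \<le> 4 / 3 * hexN i" using hexN_ge_fst[of "fst i" "snd i"] by simp
    have "\<bar>p x * (real_of_int (fst i))\<^sup>2\<bar> \<le> (K * (1 + x + x\<^sup>2)) * (2 * hexN i)"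
      unfolding abs_mult using p[OF x] f n by (intro mult_mono) auto
    also have "\<dots> = 2 * K / \<omega> * (x + x\<^sup>2 + x ^ 3)" using w by (simp add: x_def power2_eq_square power3_eq_cube field_simps)
    also have "\<dots> \<le> 4 * K / \<omega> * (1 + x + x\<^sup>2 + x ^ 3)"
      using w K x by (intro mult_mono divide_right_mono) auto
    finally have "\<bar>p x * (real_of_int (fst i))\<^sup>2\<bar> \<le> 4 * K / \<omega> * (1 + x + x\<^sup>2 + x ^ 3)" .
    moreover have "0 \<le> 4 * K / \<omega> * (1 + x + x\<^sup>2 + x ^ 3)" using w K x by simp
    ultimately show "\<bar>?q i\<bar> \<le> 4 * K / \<omega> * (1 + \<omega> * hexN i + (\<omega> * hexN i)\<^sup>2 + (\<omega> * hexN i) ^ 3)"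
      unfolding x_def by simp
  qed (use w K in auto)
  moreover have "?q i * exp (- (\<omega> * hexN i)) = (if hexN i \<ge> 2 then p (\<omega> * hexN i) * exp (- (\<omega> * hexN i)) else 0) * (real_of_int (fst i))\<^sup>2" for i
    by simp
  ultimately show ?thesis by simp
qed

lemma exp_gauss_pair_sum:
  fixes c :: real
  assumes "c > 0"
  obtains T where "((\<lambda>i. exp (- c * (real_of_int (fst i))\<^sup>2) * exp (- c * (real_of_int (snd i))\<^sup>2)) has_sum T) UNIV"
    "0 \<le> T" "T \<le> (1 + 2 / c)\<^sup>2"
proof -
  let ?f = "\<lambda>m::int. exp (- c * (real_of_int m)\<^sup>2)"
  have "((\<lambda>(m, k). ?f m * ?f k) has_sum (infsum ?f UNIV * infsum ?f UNIV)) UNIV"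
    by (intro infsum_product_real summable_gauss_int assms) auto
  moreover have g: "0 \<le> infsum ?f UNIV" by (intro infsum_nonneg) auto
  moreover have "infsum ?f UNIV * infsum ?f UNIV \<le> (1 + 2 / c) * (1 + 2 / c)"
    using infsum_gauss_le[OF assms] g assms by (intro mult_mono) auto
  ultimately show thesis by (intro that) (auto simp: case_prod_unfold power2_eq_square)
qed

text \<open>Truncating \<open>\<psi>\<close> at norm 2 respects the hexagonal symmetry and takes the
  minimal vectors out of the linear term; they are compared exactly. The surviving linear term is
  nonpositive since \<open>S \<le> 0\<close>, and the gain 20 exceeds the remainder total, at most
  19.08.\<close>

lemma Vsum_near:
  assumes s: "1 \<le> s" "s \<le> 115/100" and u: "1 < u" "u \<le> 12935/10000"
  shows "Vsum UNIV (1/2) (sqrt 3 / 2 * u) s < Vsum UNIV (1/2) (sqrt 3 / 2) s"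
proof -
  define \<omega> where "\<omega> = 2 * pi * s / sqrt 3"
  define \<psi> where "\<psi> = (\<lambda>N. if N \<ge> 2 then - ((\<omega> * N)\<^sup>2 - 4 * (\<omega> * N) + 9/4) * exp (- (\<omega> * N)) else 0)"
  define K where "K = (u - 1)\<^sup>2 * exp (-\<omega>)"
  have w: "362/100 \<le> \<omega>" "\<omega> \<le> 418/100"
  proof -
    have "2 * pi * s / sqrt 3 = (pi / sqrt 3) * (2 * s)" by simp
    have a: "362/200 * sqrt 3 \<le> pi" "pi \<le> 3637/2000 * sqrt 3"
      using pi_less_4 sqrt3_bounds pi_approx by (simp_all)
    have "362/100 * sqrt 3 \<le> 2 * pi * 1" using a by simp
    also have "\<dots> \<le> 2 * pi * s" using s by (intro mult_left_mono) auto
    finally show "362/100 \<le> \<omega>" by (simp add: \<omega>_def field_simps)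
    have "2 * pi * s \<le> 2 * pi * (115/100)" using s by (intro mult_left_mono) auto
    also have "\<dots> \<le> 418/100 * sqrt 3" using pi_approx sqrt3_bounds by simp
    finally show "\<omega> \<le> 418/100" by (simp add: \<omega>_def field_simps)
  qed
  have K: "K > 0" using u by (simp add: K_def)
  have "\<bar>- (x\<^sup>2 - 4 * x + 9/4)\<bar> \<le> 4 * (1 + x + x\<^sup>2)" if "x \<ge> 0" for x :: real
    unfolding abs_le_iff distrib_left using that zero_le_power2[of x] by (intro conjI) linarith+
  from hex_weight_summable[OF _ this, of \<omega>] w
  have "(\<lambda>i. \<psi> (hexN i) * (real_of_int (fst i))\<^sup>2) summable_on UNIV" unfolding \<psi>_def by simp
  then obtain S where S: "((\<lambda>i. \<psi> (hexN i) * (real_of_int (fst i))\<^sup>2) has_sum S) UNIV"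
    by (auto simp: summable_on_def)
  have "S \<le> 0"
  proof (rule has_sum_mono[OF S, of "\<lambda>_. 0" 0])
    fix i :: "int \<times> int"
    have "(\<omega> * N)\<^sup>2 - 4 * (\<omega> * N) + 9/4 \<ge> 0" if "N \<ge> 2" for N
    proof -
      have "\<omega> * N \<ge> 4" using mult_mono[OF w(1) that] w by simp
      hence "(\<omega> * N) * (\<omega> * N - 4) \<ge> 0" by simp
      thus ?thesis by (simp add: power2_eq_square algebra_simps)
    qed
    hence "\<psi> (hexN i) \<le> 0" by (cases "hexN i \<ge> 2") (simp_all only: \<psi>_def if_True if_False mult_minus_left neg_le_0_iff_le zero_le_mult_iff exp_ge_zero simp_thms order_refl)
    thus "\<psi> (hexN i) * (real_of_int (fst i))\<^sup>2 \<le> 0" by (intro mult_nonpos_nonneg) auto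
  qed simp
  hence S0: "3/4 * \<omega> * S * ((u - 1)\<^sup>2 / u) \<le> 0"
    using w u by (intro mult_nonpos_nonneg mult_nonneg_nonpos divide_nonneg_pos) auto
  obtain T where T: "((\<lambda>i. exp (- (8/25) * (real_of_int (fst i))\<^sup>2) * exp (- (8/25) * (real_of_int (snd i))\<^sup>2)) has_sum T) UNIV"
     "0 \<le> T" "T \<le> (1 + 2 / (8/25))\<^sup>2"
    by (rule exp_gauss_pair_sum[of "8/25"]) auto
  have A: "((\<lambda>i. gfun (hex_form \<omega> u i)) has_sum Vsum UNIV (1/2) (sqrt 3 / 2 * u) s) UNIV"
    using Vsum_hex[of u s] u s by (simp add: \<omega>_def)
  have B: "((\<lambda>i. gfun (\<omega> * hexN i)) has_sum Vsum UNIV (1/2) (sqrt 3 / 2) s) UNIV"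
    using Vsum_hex[of 1 s] s by (simp add: \<omega>_def hex_form_1)
  have C: "((\<lambda>i. gfun (\<omega> * hexN i) + (if i \<in> min_vecs then gfun (hex_form \<omega> u i) - gfun (\<omega> * hexN i) else 0)
       + \<psi> (hexN i) * (hex_form \<omega> u i - \<omega> * hexN i)
       + K * (remainder_table i + 1/1000 * (exp (- (8/25) * (real_of_int (fst i))\<^sup>2) * exp (- (8/25) * (real_of_int (snd i))\<^sup>2))))
     has_sum (Vsum UNIV (1/2) (sqrt 3 / 2) s + (2 * gfun (\<omega> / u) + 4 * gfun (\<omega> * (3 * u + 1 / u) / 4) - 6 * gfun \<omega>)
       + 3/4 * \<omega> * S * ((u - 1)\<^sup>2 / u) + K * (1902/100 + 1/1000 * T))) UNIV"
    using u by (intro has_sum_add has_sum_cmult_right B min_vecs_sum hex_linear_term(2)[OF S] remainder_table_sum T) auto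
  have "Vsum UNIV (1/2) (sqrt 3 / 2 * u) s \<le> Vsum UNIV (1/2) (sqrt 3 / 2) s + (2 * gfun (\<omega> / u) + 4 * gfun (\<omega> * (3 * u + 1 / u) / 4) - 6 * gfun \<omega>)
       + 3/4 * \<omega> * S * ((u - 1)\<^sup>2 / u) + K * (1902/100 + 1/1000 * T)"
  proof (rule has_sum_mono[OF A C])
    fix i :: "int \<times> int"
    let ?E = "K * (remainder_table i + 1/1000 * (exp (- (8/25) * (real_of_int (fst i))\<^sup>2) * exp (- (8/25) * (real_of_int (snd i))\<^sup>2)))"
    have "remainder_table i \<ge> 0" by (simp add: remainder_table_def split: prod.splits)
    hence E: "?E \<ge> 0" using K by (intro mult_nonneg_nonneg add_nonneg_nonneg) auto
    show "gfun (hex_form \<omega> u i) \<le> gfun (\<omega> * hexN i) + (if i \<in> min_vecs then gfun (hex_form \<omega> u i) - gfun (\<omega> * hexN i) else 0)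
       + \<psi> (hexN i) * (hex_form \<omega> u i - \<omega> * hexN i) + ?E"
    proof (cases rule: hexN_cases[of i])
      case 1
      hence "hexN i = 0" "hex_form \<omega> u i = 0" by (simp_all add: hexN_def hex_form_def)
      thus ?thesis using E 1 by (simp add: \<psi>_def min_vecs_def)
    next
      case 2
      thus ?thesis using E by (simp add: \<psi>_def)
    next
      case 3
      have "gfun (hex_form \<omega> u i) \<le> gfun (\<omega> * hexN i) + gfun' (\<omega> * hexN i) * (hex_form \<omega> u i - \<omega> * hexN i) + ?E"
        using gfun_remainder_le[OF w(1) _ u(2), of i] u 3 unfolding K_def by simp
      moreover have "\<psi> (hexN i) = gfun' (\<omega> * hexN i)" using 3 by (simp add: \<psi>_def gfun'_def)
      ultimately show ?thesis using 3 by simp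
    qed
  qed
  moreover have "20 * K \<le> 6 * gfun \<omega> - 2 * gfun (\<omega> / u) - 4 * gfun (\<omega> * (3 * u + 1 / u) / 4)"
    using gfun_min_vecs_gap[OF w, of u] u by (simp add: K_def)
  moreover have "K * (1902/100 + 1/1000 * T) < K * 20"
  proof (rule mult_strict_left_mono[OF _ K])
    have "(1 + 2 / (8/25))\<^sup>2 < (100::real)" by (simp add: power2_eq_square)
    thus "1902/100 + 1/1000 * T < 20" using T(3) by linarith
  qed
  ultimately show ?thesis using S0 by linarith
qed

section \<open>Deformations far from the hexagonal point, small parameter\<close>

lemma exp_minus_ge_power16:
  fixes x b c :: real
  assumes "0 \<le> x" "x \<le> 16" "0 \<le> c" "c \<le> 1 - x/16 + (x/16)\<^sup>2/2 - (x/16)^3/6" "b \<le> c ^ 16"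
  shows "b \<le> exp (-x)"
proof -
  have "(x/16) ^ 5 \<le> (x/16) ^ 4" using assms by (intro power_decreasing) auto
  moreover have "0 \<le> (x/16) ^ 4" using assms by simp
  ultimately have "c \<le> exp (-(x/16))" using exp_minus_taylor(2)[of "x/16"] assms by linarith
  hence "c ^ 16 \<le> exp (-(x/16)) ^ 16" using assms by (intro power_mono) auto
  moreover have "exp (-x) = exp (-(x/16)) ^ 16" by (simp flip: exp_of_nat_mult)
  ultimately show ?thesis using assms(5) by linarith
qed

lemma power_exp_decreasing:
  fixes x y :: real
  assumes "real n \<le> x" "x \<le> y" "0 < x"
  shows "y ^ n * exp (-y) \<le> x ^ n * exp (-x)"
proof -
  have "y = x * (1 + (y - x) / x)" using assms by (simp add: field_simps)
  also have "\<dots> \<le> x * exp ((y - x) / x)" using assms exp_ge_add_one_self[of "(y - x) / x"] by (intro mult_left_mono) auto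
  finally have "y ^ n \<le> (x * exp ((y - x) / x)) ^ n" using assms by (intro power_mono) auto
  also have "\<dots> = x ^ n * exp (real n * ((y - x) / x))" by (simp only: power_mult_distrib exp_of_nat_mult)
  also have "\<dots> \<le> x ^ n * exp (y - x)"
  proof -
    have "real n * ((y - x) / x) \<le> x * ((y - x) / x)" using assms by (intro mult_right_mono) auto
    thus ?thesis using assms by simp
  qed
  finally have "y ^ n * exp (-y) \<le> x ^ n * exp (y - x) * exp (-y)" by (intro mult_right_mono) auto
  also have "\<dots> = x ^ n * exp (-x)" by (simp flip: exp_add)
  finally show ?thesis .
qed

text \<open>The contribution of the dual index \<open>(0, 1)\<close> to \<open>Vsum\<close> as a
  function of its exponent \<open>w = pi * y / s\<close>: there \<open>dual_diff\<close> is
  \<open>- w\<close> and \<open>sqrt (y / s)\<close> is \<open>sqrt (w / pi)\<close>.\<close>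

definition Qfun :: "real \<Rightarrow> real" where "Qfun w = sqrt (w / pi) * (w\<^sup>2 - w) * exp (-w)"

text \<open>The derivative has the sign of \<open>- (z - 3) * (z - 1/2)\<close>.\<close>

lemma Qfun_decreasing:
  assumes "3 \<le> a" "a \<le> b"
  shows "Qfun b \<le> Qfun a"
proof -
  have "sqrt b * (b\<^sup>2 - b) * exp (-b) \<le> sqrt a * (a\<^sup>2 - a) * exp (-a)"
  proof (rule DERIV_nonpos_imp_nonincreasing[OF assms(2)])
    fix z assume "a \<le> z" "z \<le> b"
    hence z: "z \<ge> 3" using assms by simp
    have "((\<lambda>w. sqrt w * (w\<^sup>2 - w) * exp (-w)) has_real_derivative
        ((inverse (sqrt z) / 2) * (z\<^sup>2 - z) * exp (-z) + sqrt z * (2 * z - 1) * exp (-z) - sqrt z * (z\<^sup>2 - z) * exp (-z))) (at z)"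
      using z by (auto intro!: derivative_eq_intros simp: field_simps)
    moreover
    have "inverse (sqrt z) * (z\<^sup>2 - z) = sqrt z * (z - 1)"
    proof -
      have "sqrt z * (sqrt z * (z - 1)) = (sqrt z * sqrt z) * (z - 1)" by (simp only: mult.assoc)
      also have "\<dots> = z\<^sup>2 - z" using z by (simp add: power2_eq_square algebra_simps)
      finally show ?thesis using z by (simp add: field_simps)
    qed
    have "(i / 2) * (z\<^sup>2 - z) * e + r * (2 * z - 1) * e - r * (z\<^sup>2 - z) * e = - (r * e * ((z - 3) * (z - 1/2)))"
      if "i * (z\<^sup>2 - z) = r * (z - 1)" for i e r :: real
    proof -
      have "(i / 2) * (z\<^sup>2 - z) * e + r * (2 * z - 1) * e - r * (z\<^sup>2 - z) * e = e * ((i * (z\<^sup>2 - z)) / 2 + r * (2 * z - 1) - r * (z\<^sup>2 - z))"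
        by (simp add: field_simps)
      also have "\<dots> = - (r * e * ((z - 3) * (z - 1/2)))" unfolding that by (simp add: field_simps power2_eq_square)
      finally show ?thesis .
    qed
    note this[OF \<open>inverse (sqrt z) * (z\<^sup>2 - z) = sqrt z * (z - 1)\<close>, of "exp (-z)"]
    moreover have "0 \<le> sqrt z * exp (-z) * ((z - 3) * (z - 1/2))" using z by (intro mult_nonneg_nonneg) auto
    ultimately show "\<exists>d. ((\<lambda>w. sqrt w * (w\<^sup>2 - w) * exp (-w)) has_real_derivative d) (at z) \<and> d \<le> 0" by auto
  qed
  from divide_right_mono[OF this, of "sqrt pi"] show ?thesis by (simp add: Qfun_def real_sqrt_divide)
qed

text \<open>A rational certificate: \<open>\<rho>\<close> bounds \<open>sqrt (r / pi)\<close> and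
  \<open>b\<close> bounds \<open>exp (-r)\<close> at the left end \<open>r\<close>.\<close>

lemma Qfun_bound:
  fixes r w \<rho> c b :: real
  assumes "3 \<le> r" "r \<le> w" "r \<le> \<rho>\<^sup>2 * (31415/10000)" "0 \<le> \<rho>" "exp (-r) \<le> b" "\<rho> * (r\<^sup>2 - r) * b \<le> B"
  shows "Qfun w \<le> B"
proof -
  have "Qfun w \<le> Qfun r" using assms by (intro Qfun_decreasing)
  also have "\<dots> \<le> \<rho> * (r\<^sup>2 - r) * b"
  proof -
    have "r \<le> \<rho>\<^sup>2 * pi" using assms(3) mult_left_mono[of "31415/10000" pi "\<rho>\<^sup>2"] pi_approx by simp
    hence "sqrt (r / pi) \<le> \<rho>" using assms by (intro real_le_lsqrt) (auto simp: field_simps)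
    moreover have "r\<^sup>2 - r = r * (r - 1)" by (simp add: power2_eq_square algebra_simps)
    ultimately show ?thesis unfolding Qfun_def using assms by (intro mult_mono) auto
  qed
  finally show ?thesis using assms by simp
qed

abbreviation sqi :: "int \<Rightarrow> int \<Rightarrow> int" where "sqi m k \<equiv> m * m + k * k"

lemma sqi_small_box:
  assumes "sqi m k \<le> 8"
  shows "m \<in> {-2..2}" "k \<in> {-2..2}"
proof -
  have a: "m \<in> {-2..2}" if "sqi m k \<le> 8" for m k :: int
  proof (rule ccontr)
    assume "m \<notin> {-2..2}"
    hence "\<bar>m\<bar> \<ge> 3" by auto
    hence "m * m \<ge> 9" using mult_mono[of 3 "\<bar>m\<bar>" 3 "\<bar>m\<bar>"] by (simp add: abs_mult_self_eq)
    moreover have "k * k \<ge> 0" by simp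
    ultimately show False using that by linarith
  qed
  show "m \<in> {-2..2}" by (rule a[OF assms])
  have "sqi k m \<le> 8" using assms by (simp add: algebra_simps)
  thus "k \<in> {-2..2}" by (rule a)
qed

lemma int_interval_2: "{-2..2} = {-2, -1, 0, 1, 2 :: int}" by auto

lemma sqi_classification:
  "(m = 0 \<and> k = 0) \<or> (m = 0 \<and> k * k = 1) \<or> (m * m = 1 \<and> k = 0) \<or> (m * m = 1 \<and> k * k = 1) \<or> sqi m k = 4 \<or> sqi m k = 5 \<or> sqi m k \<ge> 8"
proof (cases "sqi m k \<le> 8")
  case True
  note b = sqi_small_box[OF True, unfolded int_interval_2]
  from b(1) show ?thesis
    by (elim insertE emptyE; use b(2) in \<open>elim insertE emptyE; simp\<close>)
qed auto

definition dual_V_table :: "real \<Rightarrow> real \<Rightarrow> int \<times> int \<Rightarrow> real" where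
  "dual_V_table a b = (\<lambda>(m, k). if m = 0 \<and> k * k = 1 then a else if m * m = 1 \<and> k = 0 then b
      else if m * m = 1 \<and> k * k = 1 then 73/10000
      else if sqi m k = 4 then 82/100000 else if sqi m k = 5 then 1/10000 else 0)"

lemma dual_V_table_sum: "(dual_V_table a b has_sum (2 * a + 2 * b + 3328/100000)) UNIV"
proof (rule has_sum_finite_neutralI[of "{-2..2} \<times> {-2..2}"])
  fix i :: "int \<times> int" assume "i \<in> UNIV - {-2..2} \<times> {-2..2}"
  moreover obtain m n where i: "i = (m, n)" by (cases i)
  ultimately have "\<not> (m \<in> {-2..2} \<and> n \<in> {-2..2})" by auto
  hence "sqi m n > 8" using sqi_small_box[of m n] by force
  thus "dual_V_table a b i = 0" by (auto simp: i dual_V_table_def)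
next
  have "(\<Sum>i\<in>{-2..2} \<times> {-2..2}. dual_V_table a b i) = (\<Sum>m\<in>{-2, -1, 0, 1, 2}. \<Sum>n\<in>{-2, -1, 0, 1, 2}. dual_V_table a b (m, n))"
    unfolding int_interval_2 by (subst sum.cartesian_product) simp
  also have "\<dots> = 2 * a + 2 * b + 3328/100000" by (simp add: dual_V_table_def)
  finally show "2 * a + 2 * b + 3328/100000 = (\<Sum>i\<in>{-2..2} \<times> {-2..2}. dual_V_table a b i)" by simp
qed auto

text \<open>Both \<open>pi * y / s\<close> and \<open>pi * y * s\<close> exceed 3, so the indices
  \<open>(0, \<plusminus>1)\<close> and \<open>(\<plusminus>1, 0)\<close> dominate; the table and a
  Gaussian tail bound all others together by 34/1000.\<close>

lemma Vsum_dual_upper: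
  assumes y: "112/100 \<le> y" and s: "1 \<le> s" "s \<le> 115/100"
  shows "Vsum UNIV (1/2) y s \<le> 2 * Qfun (pi * y / s) + 2 * (Qfun (pi * y * s) / s) + 34/1000"
proof -
  have y0: "y > 0" and s0: "s > 0" using y s by auto
  define w w' where "w = pi * y / s" and "w' = pi * y * s"
  define T where "T = (\<lambda>i. sqrt (y / s) * (cosmk (1/2) i * ((dual_diff y s i)\<^sup>2 - dual_sum y s i) * exp (- dual_sum y s i)))"
  have T: "(T has_sum Vsum UNIV (1/2) y s) UNIV"
  proof -
    have "(\<lambda>i. cosmk (1/2) i * ((dual_diff y s i)\<^sup>2 - dual_sum y s i) * exp (- dual_sum y s i)) summable_on UNIV"
      by (intro dual_summable_basic y0 s0 abs_cosmk)
    hence 1: "(T has_sum sqrt (y / s) * (\<Sum>\<^sub>\<infinity>i. cosmk (1/2) i * ((dual_diff y s i)\<^sup>2 - dual_sum y s i) * exp (- dual_sum y s i))) UNIV"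
      unfolding T_def by (intro has_sum_cmult_right has_sum_infsum)
    have "exp (ln s / 2) = sqrt s" using s0 by (simp add: ln_sqrt[symmetric])
    hence "sqrt s * Vsum UNIV (1/2) y s = sqrt y * (\<Sum>\<^sub>\<infinity>i. cosmk (1/2) i * ((dual_diff y s i)\<^sup>2 - dual_sum y s i) * exp (- dual_sum y s i))"
      using Vsum_dual[OF y0, of "ln s" UNIV "1/2"] s0 by simp
    hence "Vsum UNIV (1/2) y s = sqrt (y / s) * (\<Sum>\<^sub>\<infinity>i. cosmk (1/2) i * ((dual_diff y s i)\<^sup>2 - dual_sum y s i) * exp (- dual_sum y s i))"
      using s0 by (simp add: real_sqrt_divide field_simps)
    thus ?thesis using 1 by simp
  qed
  have w: "w \<ge> 305/100"
  proof -
    have "305/100 * s \<le> 305/100 * (115/100)" using s by simp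
    also have "\<dots> \<le> (314/100) * (112/100)" by simp
    also have "\<dots> \<le> pi * y" using y pi_approx by (intro mult_mono) auto
    finally show ?thesis using s0 by (simp add: w_def field_simps)
  qed
  have ww': "w \<le> w'"
  proof -
    have "pi * y / s \<le> pi * y / 1" using s y0 by (intro divide_left_mono) auto
    also have "\<dots> \<le> pi * y * s" using s y0 by simp
    finally show ?thesis by (simp add: w_def w'_def)
  qed
  have sw: "sqrt (y / s) = sqrt (w / pi)" by (simp add: w_def)
  have sw': "sqrt (y / s) = sqrt (w' / pi) / s"
  proof -
    have "w' / pi = (y / s) * s\<^sup>2" using s0 by (simp add: w'_def power2_eq_square)
    hence "sqrt (w' / pi) = sqrt (y / s) * sqrt (s\<^sup>2)" by (simp only: real_sqrt_mult)
    hence "sqrt (w' / pi) = sqrt (y / s) * s" using s0 by simp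
    thus ?thesis using s0 by simp
  qed
  \<comment> \<open>Trades the square root for one further power of the exponent, so that the far
    terms become multiples of \<open>x ^ n * exp (-x)\<close>.\<close>
  have sq: "sqrt (y / s) \<le> w / 3"
  proof -
    have "9 \<le> pi * w" using mult_mono[of 3 pi 3 w] pi_approx w by simp
    from mult_left_mono[OF this, of w] have "w / pi \<le> (w / 3)\<^sup>2" using w by (simp add: power2_eq_square field_simps)
    thus ?thesis unfolding sw using w by (intro real_le_lsqrt) auto
  qed
  have X: "dual_sum y s (m, k) = w' * real_of_int (m * m) + w * real_of_int (k * k)" for m k
    by (simp add: dual_sum_def w_def w'_def power2_eq_square algebra_simps)
  have Z: "dual_diff y s (m, k) = w' * real_of_int (m * m) - w * real_of_int (k * k)" for m k
    by (simp add: dual_diff_def w_def w'_def power2_eq_square algebra_simps)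
  have Xge: "w * real_of_int (sqi m k) \<le> dual_sum y s (m, k)" for m k
    unfolding X using ww' mult_right_mono[OF ww', of "real_of_int (m * m)"] by (simp add: algebra_simps)
  obtain \<tau> where tau: "((\<lambda>i. exp (- (2/5) * (real_of_int (fst i))\<^sup>2) * exp (- (2/5) * (real_of_int (snd i))\<^sup>2)) has_sum \<tau>) UNIV"
     "0 \<le> \<tau>" "\<tau> \<le> (1 + 2 / (2/5))\<^sup>2"
    by (rule exp_gauss_pair_sum[of "2/5"]) auto
  have far: "T (m, k) \<le> (dual_sum y s (m, k)) ^ 3 * exp (- dual_sum y s (m, k)) / 12" if q: "sqi m k \<ge> 4" for m k
  proof -
    define x where "x = dual_sum y s (m, k)"
    have "4 * w \<le> w * real_of_int (sqi m k)" using q w by (simp add: mult.commute del: of_int_add of_int_mult)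
    hence x: "4 * w \<le> x" using Xge[of m k] by (simp add: x_def)
    hence x1: "x \<ge> 1" using w by simp
    have "\<bar>dual_diff y s (m, k)\<bar> \<le> x" unfolding x_def using y0 s0 by (intro dual_diff_le) auto
    from power_mono[OF this, of 2] have z: "(dual_diff y s (m, k))\<^sup>2 \<le> x\<^sup>2" by simp
    have "x \<le> x\<^sup>2" using x1 by (simp add: power2_eq_square)
    hence "\<bar>(dual_diff y s (m, k))\<^sup>2 - x\<bar> \<le> x\<^sup>2"
      using z x1 zero_le_power2[of "dual_diff y s (m, k)"] by (intro abs_leI) linarith+
    hence "\<bar>cosmk (1/2) (m, k) * ((dual_diff y s (m, k))\<^sup>2 - x)\<bar> \<le> 1 * x\<^sup>2"
      unfolding abs_mult by (intro mult_mono abs_cosmk) auto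
    hence 1: "cosmk (1/2) (m, k) * ((dual_diff y s (m, k))\<^sup>2 - x) * exp (-x) \<le> x\<^sup>2 * exp (-x)"
      by (intro mult_right_mono) auto
    have "T (m, k) \<le> sqrt (y / s) * (x\<^sup>2 * exp (-x))"
      unfolding T_def x_def[symmetric] using 1 y0 s0 by (intro mult_left_mono) auto
    also have "\<dots> \<le> (x / 12) * (x\<^sup>2 * exp (-x))" using sq x by (intro mult_right_mono) auto
    also have "\<dots> = x ^ 3 * exp (-x) / 12" by (simp add: power2_eq_square power3_eq_cube)
    finally show ?thesis unfolding x_def .
  qed
  have "Vsum UNIV (1/2) y s \<le> 2 * Qfun w + 2 * (Qfun w' / s) + 3328/100000 + 1/100000 * \<tau>"
  proof (rule has_sum_mono[OF T has_sum_add[OF dual_V_table_sum has_sum_cmult_right[OF tau(1)]]])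
    fix i :: "int \<times> int"
    obtain m k where i: "i = (m, k)" by (cases i)
    let ?E = "1/100000 * (exp (- (2/5) * (real_of_int (fst i))\<^sup>2) * exp (- (2/5) * (real_of_int (snd i))\<^sup>2))"
    have E: "?E \<ge> 0" by simp
    define x where "x = dual_sum y s (m, k)"
    consider (a) "m = 0" "k = 0" | (b) "m = 0" "k * k = 1" | (c) "m * m = 1" "k = 0" | (d) "m * m = 1" "k * k = 1"
       | (e) "sqi m k = 4" | (f) "sqi m k = 5" | (g) "sqi m k \<ge> 8"
      using sqi_classification[of m k] by blast
    thus "T i \<le> dual_V_table (Qfun w) (Qfun w' / s) i + ?E"
    proof cases
      case a
      have "T i = 0" by (simp add: T_def i a dual_diff_def dual_sum_def)
      moreover have "dual_V_table (Qfun w) (Qfun w' / s) i = 0" by (simp add: dual_V_table_def i a)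
      ultimately show ?thesis using E by linarith
    next
      case b
      have "T i = Qfun w" by (simp add: T_def i X Z b cosmk_def Qfun_def sw del: of_int_mult)
      moreover have "dual_V_table (Qfun w) (Qfun w' / s) i = Qfun w" by (simp add: dual_V_table_def i b)
      ultimately show ?thesis using E by linarith
    next
      case c
      have "T i = Qfun w' / s" by (simp add: T_def i X Z c cosmk_def Qfun_def sw' del: of_int_mult)
      moreover have "dual_V_table (Qfun w) (Qfun w' / s) i = Qfun w' / s" using c by (auto simp add: dual_V_table_def i)
      ultimately show ?thesis using E by linarith
    next
      case d
      have "m = 1 \<or> m = -1" "k = 1 \<or> k = -1" using d zmult_eq_1_iff by auto
      \<comment> \<open>The phase is -1, so the square of \<open>dual_diff\<close> enters with the
        favourable sign and only \<open>x * exp (-x)\<close> has to be estimated.\<close>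
      hence co: "cosmk (1/2) (m, k) = -1" by (auto simp: cosmk_def)
      have xx: "x = w' + w" using d by (simp add: x_def X del: of_int_mult)
      have x2: "x \<ge> 7036/1000"
      proof -
        have "0 \<le> (s - 1)\<^sup>2" by simp
        hence "2 \<le> s + 1 / s" using s0 by (simp add: power2_eq_square field_simps)
        have "7036/1000 \<le> (31415/10000 * (112/100)) * (2::real)" by simp
        also have "\<dots> \<le> (pi * y) * (s + 1 / s)"
          using y pi_approx \<open>2 \<le> s + 1 / s\<close> by (intro mult_mono) auto
        also have "\<dots> = x" by (simp add: xx w_def w'_def algebra_simps)
        finally show ?thesis .
      qed
      have "T i = sqrt (y / s) * ((x - (w' - w)\<^sup>2) * exp (-x))"
        unfolding T_def i co x_def[symmetric] using d by (simp add: Z del: of_int_mult)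
      also have "\<dots> \<le> sqrt (y / s) * (x * exp (-x))"
        using y0 s0 by (intro mult_left_mono mult_right_mono) auto
      also have "\<dots> \<le> (x / 6) * (x * exp (-x))"
        using sq ww' xx w x2 by (intro mult_right_mono) auto
      also have "\<dots> = x ^ 2 * exp (-x) / 6" by (simp add: power2_eq_square)
      also have "\<dots> \<le> (7036/1000) ^ 2 * exp (- (7036/1000)) / 6"
        using x2 by (intro divide_right_mono power_exp_decreasing) auto
      also have "\<dots> \<le> (7036/1000) ^ 2 * (8826/10000000) / 6"
        by (intro divide_right_mono mult_left_mono exp_minus_le_power16[of _ "64433/100000"]) (simp_all add: power_divide)
      also have "\<dots> \<le> 73/10000" by (simp add: power_divide)
      finally have "T i \<le> 73/10000" .
      moreover have "dual_V_table (Qfun w) (Qfun w' / s) i = 73/10000" using d by (auto simp add: dual_V_table_def i)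
      ultimately show ?thesis using E by linarith
    next
      case e
      have "x \<ge> 122/10" using Xge[of m k] w unfolding e x_def by simp
      hence "x ^ 3 * exp (-x) / 12 \<le> (122/10) ^ 3 * exp (- (122/10)) / 12"
        by (intro divide_right_mono power_exp_decreasing) auto
      also have "\<dots> \<le> (122/10) ^ 3 * (5371/1000000000) / 12"
        by (intro divide_right_mono mult_left_mono exp_minus_le_power16[of _ "46841/100000"]) (simp_all add: power_divide)
      also have "\<dots> \<le> 82/100000" by (simp add: power_divide)
      finally have "T i \<le> 82/100000" using far[of m k] e unfolding i x_def by linarith
      moreover have "dual_V_table (Qfun w) (Qfun w' / s) i = 82/100000" using e by (auto simp add: dual_V_table_def i)
      ultimately show ?thesis using E by linarith
    next
      case f
      have "x \<ge> 1525/100" using Xge[of m k] w unfolding f x_def by simp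
      hence "x ^ 3 * exp (-x) / 12 \<le> (1525/100) ^ 3 * exp (- (1525/100)) / 12"
        by (intro divide_right_mono power_exp_decreasing) auto
      also have "\<dots> \<le> (1525/100) ^ 3 * (3007/10000000000) / 12"
        by (intro divide_right_mono mult_left_mono exp_minus_le_power16[of _ "39118/100000"]) (simp_all add: power_divide)
      also have "\<dots> \<le> 1/10000" by (simp add: power_divide)
      finally have "T i \<le> 1/10000" using far[of m k] f unfolding i x_def by linarith
      moreover have "dual_V_table (Qfun w) (Qfun w' / s) i = 1/10000" using f by (auto simp add: dual_V_table_def i)
      ultimately show ?thesis using E by linarith
    next
      case g
      define q where "q = real_of_int (sqi m k)"
      have q: "q \<ge> 8" using g unfolding q_def by linarith
      have "w * q \<le> x" using Xge[of m k] unfolding q_def x_def .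
      moreover have "305/100 * q \<le> w * q" using w q by (intro mult_right_mono) auto
      ultimately have x: "305/100 * q \<le> x" by simp
      hence x0: "x > 0" using q by simp
      have "x / 15 \<le> exp (x / 15 - 1)" using exp_ge_add_one_self[of "x/15 - 1"] by simp
      hence "(x / 15) ^ 3 \<le> exp (x / 15 - 1) ^ 3" using x0 by (intro power_mono) auto
      also have "\<dots> = exp (-3) * exp (x / 5)" by (simp flip: exp_of_nat_mult exp_add)
      also have "\<dots> \<le> 4981/100000 * exp (x / 5)"
        by (intro mult_right_mono exp_minus_le_power16[of _ "82904/100000"]) (simp_all add: power_divide)
      finally have "x ^ 3 / 3375 \<le> 4981/100000 * exp (x / 5)" by (simp add: power_divide)
      hence x3: "x ^ 3 \<le> 169 * exp (x / 5)" using exp_gt_zero[of "x / 5"] by linarith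
      have "x ^ 3 * exp (-x) / 12 \<le> 169 * exp (x / 5) * exp (-x) / 12"
        using x3 by (intro divide_right_mono mult_right_mono) auto
      also have "\<dots> = 169/12 * exp (- (4/5 * x))" by (simp flip: exp_add)
      also have "\<dots> \<le> 169/12 * (exp (- 16) * exp (- (2/5 * q)))"
        using x q by (intro mult_left_mono) (simp_all flip: exp_add)
      also have "\<dots> \<le> 169/12 * (2/10000000 * exp (- (2/5 * q)))"
        by (intro mult_left_mono mult_right_mono exp_minus_le_power16[of _ "37501/100000"]) (simp_all add: power_divide)
      also have "\<dots> \<le> 1/100000 * exp (- (2/5 * q))" by simp
      also have "exp (- (2/5 * q)) = exp (- (2/5) * (real_of_int (fst i))\<^sup>2) * exp (- (2/5) * (real_of_int (snd i))\<^sup>2)"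
        by (simp add: q_def i power2_eq_square add_divide_distrib flip: exp_add)
      finally have "T i \<le> ?E" using far[of m k] g unfolding i x_def by linarith
      moreover have "dual_V_table (Qfun w) (Qfun w' / s) i = 0" using g by (auto simp add: dual_V_table_def i)
      ultimately show ?thesis by linarith
    qed
  qed
  moreover have "\<tau> \<le> 36" using tau(3) by simp
  ultimately show ?thesis unfolding w_def w'_def by linarith
qed

lemma gfun_nonneg: "w \<ge> 2 \<Longrightarrow> gfun w \<ge> 0"
proof -
  assume "w \<ge> 2"
  hence "0 \<le> w * (w - 2)" by simp
  moreover have "w * (w - 2) = w\<^sup>2 - 2 * w" by (simp add: power2_eq_square algebra_simps)
  ultimately have "w\<^sup>2 - 2 * w + 1/4 \<ge> 0" by linarith
  thus ?thesis unfolding gfun_def by (rule mult_nonneg_nonneg) simp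
qed

lemma gfun_decreasing:
  assumes "36/10 \<le> a" "a \<le> b"
  shows "gfun b \<le> gfun a"
proof (rule DERIV_nonpos_imp_nonincreasing[OF assms(2)])
  fix z assume "a \<le> z" "z \<le> b"
  hence z: "z \<ge> 36/10" using assms by simp
  have "0 \<le> (z - 36/10) * (z - 4/10)" using z by simp
  moreover have "(z - 36/10) * (z - 4/10) = z\<^sup>2 - 4 * z + 144/100" by (simp add: power2_eq_square field_simps)
  ultimately have "- (z\<^sup>2 - 4 * z + 9/4) \<le> 0" by linarith
  hence "gfun' z \<le> 0" unfolding gfun'_def by (rule mult_nonpos_nonneg) simp
  thus "\<exists>d. (gfun has_real_derivative d) (at z) \<and> d \<le> 0" using gfun_deriv by blast
qed

lemma Vsum_hex_lower:
  assumes s: "1 \<le> s" and w: "2 * pi * s / sqrt 3 \<le> \<omega>1"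
  shows "1/4 + 6 * gfun \<omega>1 \<le> Vsum UNIV (1/2) (sqrt 3 / 2) s"
proof -
  define \<omega> where "\<omega> = 2 * pi * s / sqrt 3"
  have w0: "36/10 \<le> \<omega>"
  proof -
    have "36/10 * sqrt 3 \<le> 2 * pi * 1" using sqrt3_bounds pi_approx by simp
    also have "\<dots> \<le> 2 * pi * s" using s by (intro mult_left_mono) auto
    finally show ?thesis by (simp add: \<omega>_def field_simps)
  qed
  have B: "((\<lambda>i. gfun (\<omega> * hexN i)) has_sum Vsum UNIV (1/2) (sqrt 3 / 2) s) UNIV"
    using Vsum_hex[of 1 s] s by (simp add: \<omega>_def hex_form_1)
  have "((\<lambda>i. if i \<in> insert (0, 0) min_vecs then gfun (\<omega> * hexN i) else 0) has_sum (1/4 + 6 * gfun \<omega>)) UNIV"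
  proof (rule has_sum_finite_neutralI[of "insert (0, 0) min_vecs"])
    have "(\<Sum>i\<in>insert (0, 0) min_vecs. if i \<in> insert (0, 0) min_vecs then gfun (\<omega> * hexN i) else 0)
       = (\<Sum>i\<in>insert (0, 0) min_vecs. gfun (\<omega> * hexN i))" by simp
    also have "\<dots> = 1/4 + 6 * gfun \<omega>" by (simp add: min_vecs_def hexN_def gfun_def)
    finally show "1/4 + 6 * gfun \<omega> = (\<Sum>i\<in>insert (0, 0) min_vecs. if i \<in> insert (0, 0) min_vecs then gfun (\<omega> * hexN i) else 0)" by simp
  qed (auto simp: min_vecs_def)
  hence "1/4 + 6 * gfun \<omega> \<le> Vsum UNIV (1/2) (sqrt 3 / 2) s"
  proof (rule has_sum_mono[OF _ B])
    fix i
    show "(if i \<in> insert (0, 0) min_vecs then gfun (\<omega> * hexN i) else 0) \<le> gfun (\<omega> * hexN i)"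
    proof (cases rule: hexN_cases[of i])
      case 3
      have "2 \<le> \<omega> * hexN i" using mult_mono[OF w0 3(3)] w0 by simp
      thus ?thesis using gfun_nonneg by simp
    qed auto
  qed
  moreover have "gfun \<omega>1 \<le> gfun \<omega>" using w w0 by (intro gfun_decreasing) (auto simp: \<omega>_def)
  ultimately show ?thesis by linarith
qed

text \<open>On \<open>lo \<le> s \<le> hi\<close> the numbers \<open>r\<close> and \<open>r'\<close>
  are lower bounds for the two dual exponents and \<open>h\<close> is an upper bound for
  \<open>2 * pi * s / sqrt 3\<close>. Mixing both ends loses too much over the whole range of
  \<open>s\<close>, which is therefore cut into three pieces.\<close>

lemma Vsum_far:
  assumes s: "1 \<le> s" "s \<le> 115/100" and y: "112/100 \<le> y"
  shows "Vsum UNIV (1/2) y s < Vsum UNIV (1/2) (sqrt 3 / 2) s"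
proof -
  have y0: "y > 0" and s0: "s > 0" using y s by auto
  have red: ?thesis
    if br: "lo \<le> s" "s \<le> hi" "r * hi \<le> 31415/10000 * (112/100)" "r' \<le> 31415/10000 * (112/100) * lo" "1 \<le> lo"
      and h: "0 \<le> r" "0 \<le> r'" "2 * (31416/10000) * hi \<le> h * (173205/100000)"
      and Q: "\<And>w. r \<le> w \<Longrightarrow> Qfun w \<le> A" "\<And>w. r' \<le> w \<Longrightarrow> Qfun w \<le> B" "0 \<le> B"
      and g: "C \<le> exp (- h)" "2 \<le> h" "2 * A + 2 * B / lo + 34/1000 < 1/4 + 6 * ((h\<^sup>2 - 2 * h + 1/4) * C)"
    for lo hi r r' h A B C
  proof -
    have "r * s \<le> r * hi" using br h by (intro mult_left_mono) auto
    also have "\<dots> \<le> 31415/10000 * (112/100)" by fact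
    also have py: "\<dots> \<le> pi * y" using y pi_approx by (intro mult_mono) auto
    finally have 1: "Qfun (pi * y / s) \<le> A" using s0 by (intro Q) (simp add: field_simps)
    have "31415/10000 * (112/100) * lo \<le> pi * y * s" by (rule mult_mono[OF py br(1)]) (use y0 s0 br in auto)
    hence "Qfun (pi * y * s) \<le> B" using br by (intro Q) simp
    hence "Qfun (pi * y * s) / s \<le> B / lo" using Q(3) br by (intro frac_le) auto
    hence up: "Vsum UNIV (1/2) y s \<le> 2 * A + 2 * B / lo + 34/1000"
      using Vsum_dual_upper[OF y s] 1 by linarith
    have "2 * pi * s / sqrt 3 \<le> h"
    proof -
      have "2 * pi * s \<le> 2 * (31416/10000) * hi" using br s0 pi_approx by (intro mult_mono) auto
      also have "\<dots> \<le> h * sqrt 3" using h(3) mult_left_mono[OF sqrt3_bounds(1), of h] g(2) by linarith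
      finally show ?thesis by (simp add: field_simps)
    qed
    from Vsum_hex_lower[OF s(1) this] have "1/4 + 6 * gfun h \<le> Vsum UNIV (1/2) (sqrt 3 / 2) s" .
    moreover have "(h\<^sup>2 - 2 * h + 1/4) * C \<le> gfun h"
    proof -
      have "0 \<le> h * (h - 2)" using g(2) by simp
      moreover have "h * (h - 2) = h\<^sup>2 - 2 * h" by (simp add: power2_eq_square algebra_simps)
      ultimately have "h\<^sup>2 - 2 * h + 1/4 \<ge> 0" by linarith
      thus ?thesis unfolding gfun_def using g(1) by (intro mult_left_mono)
    qed
    ultimately show ?thesis using up g(3) by linarith
  qed
  have e335: "exp (- (335/100)) \<le> (3511/100000::real)" by (rule exp_minus_le_power16[of _ "8111/10000"]) (simp_all add: power_divide)
  have e319: "exp (- (319/100)) \<le> (4119/100000::real)" by (rule exp_minus_le_power16[of _ "81925/100000"]) (simp_all add: power_divide)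
  have e305: "exp (- (305/100)) \<le> (4738/100000::real)" by (rule exp_minus_le_power16[of _ "82645/100000"]) (simp_all add: power_divide)
  have e351: "exp (- (351/100)) \<le> (2992/100000::real)" by (rule exp_minus_le_power16[of _ "80303/100000"]) (simp_all add: power_divide)
  have e369: "exp (- (369/100)) \<le> (2499/100000::real)" by (rule exp_minus_le_power16[of _ "79405/100000"]) (simp_all add: power_divide)
  have e387: "exp (- (387/100)) \<le> (2088/100000::real)" by (rule exp_minus_le_power16[of _ "78517/100000"]) (simp_all add: power_divide)
  have l381: "2208/100000 \<le> exp (- (381/100) :: real)" by (rule exp_minus_ge_power16[of _ "78797/100000"]) (simp_all add: power_divide)
  have l399: "1842/100000 \<le> exp (- (3991/1000) :: real)" by (rule exp_minus_ge_power16[of _ "77908/100000"]) (simp_all add: power_divide)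
  have l417: "1536/100000 \<le> exp (- (4172/1000) :: real)" by (rule exp_minus_ge_power16[of _ "77029/100000"]) (simp_all add: power_divide)
  have q335: "Qfun w \<le> 2860/10000" if "335/100 \<le> w" for w
    by (rule Qfun_bound[OF _ that _ _ e335, of "10328/10000"]) (simp_all add: power_divide power2_eq_square)
  have q319: "Qfun w \<le> 2905/10000" if "319/100 \<le> w" for w
    by (rule Qfun_bound[OF _ that _ _ e319, of "10078/10000"]) (simp_all add: power_divide power2_eq_square)
  have q305: "Qfun w \<le> 2925/10000" if "305/100 \<le> w" for w
    by (rule Qfun_bound[OF _ that _ _ e305, of "9855/10000"]) (simp_all add: power_divide power2_eq_square)
  have q351: "Qfun w \<le> 2790/10000" if "351/100 \<le> w" for w
    by (rule Qfun_bound[OF _ that _ _ e351, of "10572/10000"]) (simp_all add: power_divide power2_eq_square)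
  have q369: "Qfun w \<le> 2695/10000" if "369/100 \<le> w" for w
    by (rule Qfun_bound[OF _ that _ _ e369, of "10839/10000"]) (simp_all add: power_divide power2_eq_square)
  have q387: "Qfun w \<le> 2580/10000" if "387/100 \<le> w" for w
    by (rule Qfun_bound[OF _ that _ _ e387, of "11101/10000"]) (simp_all add: power_divide power2_eq_square)
  consider "s \<le> 105/100" | "105/100 \<le> s" "s \<le> 110/100" | "110/100 \<le> s" by linarith
  thus ?thesis
  proof cases
    case 1
    show ?thesis
      by (rule red[where r = "335/100" and r' = "351/100", OF s(1) 1 _ _ _ _ _ _ q335 q351 _ l381]) (simp_all add: power2_eq_square)
  next
    case 2
    show ?thesis
      by (rule red[where r = "319/100" and r' = "369/100", OF 2 _ _ _ _ _ _ q319 q369 _ l399]) (simp_all add: power2_eq_square)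
  next
    case 3
    show ?thesis
      by (rule red[where r = "305/100" and r' = "387/100", OF 3 s(2) _ _ _ _ _ _ q305 q387 _ l417]) (simp_all add: power2_eq_square)
  qed
qed

text \<open>At \<open>s = 1\<close> the phase and the dual exponent are symmetric in
  \<open>m\<close> and \<open>k\<close>, while \<open>dual_diff\<close> is antisymmetric.\<close>

lemma Usum_at_1:
  assumes y: "y > 0"
  shows "Usum UNIV x y 1 = 0"
proof -
  define F where "F = (\<lambda>i. - (cosmk x i * dual_diff y 1 i * exp (- dual_sum y 1 i)))"
  have "bij (prod.swap :: int \<times> int \<Rightarrow> int \<times> int)" by simp
  from infsum_reindex_bij_betw[OF this, of F] have "(\<Sum>\<^sub>\<infinity>i. F (prod.swap i)) = infsum F UNIV" by simp
  moreover have "F (prod.swap i) = - F i" for i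
    by (cases i) (simp add: F_def cosmk_def dual_diff_def dual_sum_def algebra_simps)
  ultimately have "infsum F UNIV = 0" by (simp add: infsum_uminus)
  thus ?thesis using Usum_dual[OF y, of 0 UNIV x] y by (simp add: F_def)
qed

text \<open>Both sides vanish at \<open>s = 1\<close>, so it suffices to compare derivatives.\<close>

lemma Usum_small_s:
  assumes s: "1 < s" "s \<le> 115/100" and u: "1 < u"
  shows "Usum UNIV (1/2) (sqrt 3 / 2 * u) s < Usum UNIV (1/2) (sqrt 3 / 2) s"
proof -
  define y where "y = sqrt 3 / 2 * u"
  have y0: "y > 0" "(sqrt 3 / 2 :: real) > 0" using u by (auto simp: y_def)
  have V: "Vsum UNIV (1/2) y r < Vsum UNIV (1/2) (sqrt 3 / 2) r" if r: "1 \<le> r" "r \<le> 115/100" for r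
  proof (cases "u \<le> 12935/10000")
    case True
    thus ?thesis using Vsum_near[OF r u] by (simp add: y_def)
  next
    case False
    have "112/100 \<le> (173205/100000 / 2) * (12935/10000 :: real)" by simp
    also have "\<dots> \<le> y" unfolding y_def using False sqrt3_bounds by (intro mult_mono divide_right_mono) auto
    finally show ?thesis by (rule Vsum_far[OF r])
  qed
  define \<phi> where "\<phi> = (\<lambda>t. exp (t/2) * Usum UNIV (1/2) (sqrt 3 / 2) (exp t) - exp (t/2) * Usum UNIV (1/2) y (exp t))"
  have "\<phi> 0 < \<phi> (ln s)"
  proof (rule DERIV_pos_imp_increasing[of 0 "ln s" \<phi>])
    show "0 < ln s" using s by simp
    fix t assume t: "0 \<le> t" "t \<le> ln s"
    have r: "1 \<le> exp t" "exp t \<le> 115/100"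
    proof -
      show "1 \<le> exp t" using t by simp
      have "exp t \<le> exp (ln s)" using t by (simp only: exp_le_cancel_iff)
      thus "exp t \<le> 115/100" using s by simp
    qed
    have "(\<phi> has_real_derivative (exp (t/2) * Vsum UNIV (1/2) (sqrt 3 / 2) (exp t) - exp (t/2) * Vsum UNIV (1/2) y (exp t))) (at t)"
      unfolding \<phi>_def by (intro DERIV_diff Usum_deriv y0)
    moreover have "exp (t/2) * Vsum UNIV (1/2) (sqrt 3 / 2) (exp t) - exp (t/2) * Vsum UNIV (1/2) y (exp t) > 0"
      using V[OF r] by simp
    ultimately show "\<exists>d. (\<phi> has_real_derivative d) (at t) \<and> 0 < d" by blast
  qed
  moreover have "\<phi> 0 = 0" unfolding \<phi>_def by (simp add: Usum_at_1 y0)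
  ultimately have "0 < exp (ln s / 2) * (Usum UNIV (1/2) (sqrt 3 / 2) s - Usum UNIV (1/2) y s)"
    using s by (simp add: \<phi>_def algebra_simps)
  thus ?thesis by (simp add: zero_less_mult_iff y_def)
qed

section \<open>Large parameter\<close>

definition hex_sq_table :: "int \<times> int \<Rightarrow> real" where
  "hex_sq_table = (\<lambda>(m, n). if intN m n = 3 then 38/1000 else if intN m n = 4 then 112/100000 else 0)"

lemma hex_sq_table_sum: "(hex_sq_table has_sum (23472/100000)) UNIV"
proof (rule has_sum_finite_neutralI[of "{-3..3} \<times> {-3..3}"])
  fix i :: "int \<times> int" assume "i \<in> UNIV - {-3..3} \<times> {-3..3}"
  moreover obtain m n where i: "i = (m, n)" by (cases i)
  ultimately have "\<not> (m \<in> {-3..3} \<and> n \<in> {-3..3})" by auto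
  hence "intN m n > 11" using intN_small_box[of m n] by force
  thus "hex_sq_table i = 0" by (simp add: i hex_sq_table_def)
next
  have "(\<Sum>i\<in>{-3..3} \<times> {-3..3}. hex_sq_table i) = (\<Sum>m\<in>{-3, -2, -1, 0, 1, 2, 3}. \<Sum>n\<in>{-3, -2, -1, 0, 1, 2, 3}. hex_sq_table (m, n))"
    unfolding int_interval_3 by (subst sum.cartesian_product) simp
  also have "\<dots> = 23472/100000" by (simp add: hex_sq_table_def)
  finally show "23472/100000 = (\<Sum>i\<in>{-3..3} \<times> {-3..3}. hex_sq_table i)" by simp
qed auto

lemma sq_le_exp_fifth:
  fixes x :: real
  assumes "x \<ge> 0"
  shows "x\<^sup>2 \<le> 136/10 * exp (x / 5)"
proof -
  have "x / 10 \<le> exp (x / 10 - 1)" using exp_ge_add_one_self[of "x/10 - 1"] by simp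
  hence "(x / 10) ^ 2 \<le> exp (x / 10 - 1) ^ 2" using assms by (intro power_mono) auto
  also have "\<dots> = exp (-2) * exp (x / 5)" by (simp flip: exp_of_nat_mult exp_add)
  also have "\<dots> \<le> 1354/10000 * exp (x / 5)"
    by (intro mult_right_mono exp_minus_le_power16[of _ "88251/100000"]) (simp_all add: power_divide)
  finally have "x\<^sup>2 / 100 \<le> 1354/10000 * exp (x / 5)" by (simp add: power_divide)
  thus ?thesis using exp_gt_zero[of "x / 5"] by linarith
qed

text \<open>With \<open>W = \<omega> * N\<close>, the quantity
  \<open>W\<^sup>2 * exp (\<omega> - W)\<close> decreases in \<open>\<omega>\<close> and is
  evaluated at 417/100 for the six vectors each of norm 3 and 4; a Gaussian covers norms from 7 on.
  The total is controlled because both the linear term and the lower bound at the hexagonal point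
  need it.\<close>

lemma hex_sq_exp_majorant:
  fixes \<omega> :: real
  assumes w: "417/100 \<le> \<omega>"
  obtains D T where "(D has_sum T) UNIV" "T \<le> 24/100 * exp (-\<omega>)" "\<And>i. 0 \<le> D i"
    "\<And>i. hexN i \<ge> 3 \<Longrightarrow> (\<omega> * hexN i)\<^sup>2 * exp (- (\<omega> * hexN i)) \<le> D i"
proof -
  let ?G = "\<lambda>i::int \<times> int. exp (- (1/2) * (real_of_int (fst i))\<^sup>2) * exp (- (1/2) * (real_of_int (snd i))\<^sup>2)"
  obtain \<tau> where tau: "(?G has_sum \<tau>) UNIV" "0 \<le> \<tau>" "\<tau> \<le> (1 + 2 / (1/2))\<^sup>2"
    by (rule exp_gauss_pair_sum[of "1/2"]) auto
  define D where "D = (\<lambda>i. exp (-\<omega>) * (hex_sq_table i + 1/10000 * ?G i))"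
  have S: "(D has_sum (exp (-\<omega>) * (23472/100000 + 1/10000 * \<tau>))) UNIV"
    unfolding D_def by (intro has_sum_cmult_right has_sum_add hex_sq_table_sum tau)
  have ht: "hex_sq_table i \<ge> 0" for i by (simp add: hex_sq_table_def split: prod.splits)
  show thesis
  proof (rule that[OF S])
    have "23472/100000 + 1/10000 * \<tau> \<le> 24/100" using tau(3) by simp
    from mult_left_mono[OF this, of "exp (-\<omega>)"]
    show "exp (-\<omega>) * (23472/100000 + 1/10000 * \<tau>) \<le> 24/100 * exp (-\<omega>)" by (simp add: mult.commute)
    show "0 \<le> D i" for i unfolding D_def using ht by (intro mult_nonneg_nonneg add_nonneg_nonneg) auto
    fix i :: "int \<times> int" assume N: "hexN i \<ge> 3"
    obtain m n where i: "i = (m, n)" by (cases i)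
    have "3 \<le> intN m n" using N unfolding i hexN_intN by linarith
    hence "intN m n = 3 \<or> intN m n = 4 \<or> intN m n \<ge> 7" using intN_classification(1)[of m n] by linarith
    moreover have red: "W\<^sup>2 * exp (-W) \<le> D i" if "W\<^sup>2 * exp (\<omega> - W) \<le> hex_sq_table i + 1/10000 * ?G i" for W
    proof -
      have "W\<^sup>2 * exp (-W) = exp (-\<omega>) * (W\<^sup>2 * exp (\<omega> - W))" by (simp add: mult_ac flip: exp_add)
      also have "\<dots> \<le> D i" unfolding D_def using that by (intro mult_left_mono) auto
      finally show ?thesis .
    qed
    ultimately consider "intN m n = 3" | "intN m n = 4" | "intN m n \<ge> 7" by blast
    thus "(\<omega> * hexN i)\<^sup>2 * exp (- (\<omega> * hexN i)) \<le> D i"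
    proof cases
      case 1
      have h: "hexN i = 3" unfolding i hexN_intN 1 by simp
      have "(\<omega> * 3)\<^sup>2 * exp (\<omega> - \<omega> * 3) = 9/4 * ((2 * \<omega>) ^ 2 * exp (- (2 * \<omega>)))" by (simp add: power_mult_distrib)
      also have "\<dots> \<le> 9/4 * ((834/100) ^ 2 * exp (- (834/100)))"
        using w by (intro mult_left_mono power_exp_decreasing) auto
      also have "\<dots> \<le> 9/4 * ((834/100) ^ 2 * (24073/100000000))"
        by (intro mult_left_mono exp_minus_le_power16[of _ "59408/100000"]) (simp_all add: power_divide)
      also have "\<dots> \<le> hex_sq_table i" using 1 by (simp add: hex_sq_table_def i power_divide)
      finally show ?thesis unfolding h by (intro red) (simp add: add_increasing2)
    next
      case 2
      have h: "hexN i = 4" unfolding i hexN_intN 2 by simp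
      have "(\<omega> * 4)\<^sup>2 * exp (\<omega> - \<omega> * 4) = 16/9 * ((3 * \<omega>) ^ 2 * exp (- (3 * \<omega>)))" by (simp add: power_mult_distrib)
      also have "\<dots> \<le> 16/9 * ((1251/100) ^ 2 * exp (- (1251/100)))"
        using w by (intro mult_left_mono power_exp_decreasing) auto
      also have "\<dots> \<le> 16/9 * ((1251/100) ^ 2 * (398/100000000))"
        by (intro mult_left_mono exp_minus_le_power16[of _ "45970/100000"]) (simp_all add: power_divide)
      also have "\<dots> \<le> hex_sq_table i" using 2 by (simp add: hex_sq_table_def i power_divide)
      finally show ?thesis unfolding h by (intro red) (simp add: add_increasing2)
    next
      case 3
      define W where "W = \<omega> * hexN i"
      define \<rho> where "\<rho> = sqn i"
      have rho: "\<rho> \<ge> 0" by (simp add: \<rho>_def)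
      have N7: "hexN i \<ge> 7" using 3 unfolding i hexN_intN by linarith
      have "\<rho> / 2 \<le> hexN i" unfolding \<rho>_def by (rule hexN_ge_half)
      hence "49/10 + 3/20 * \<rho> \<le> hexN i" using N7 by linarith
      hence "\<omega> * (49/10 + 3/20 * \<rho>) \<le> W" using w unfolding W_def by (intro mult_left_mono) auto
      hence W1: "49/10 * \<omega> + 3/20 * (\<omega> * \<rho>) \<le> W" by (simp add: algebra_simps)
      have W2: "417/100 * \<rho> \<le> \<omega> * \<rho>" using w rho by (intro mult_right_mono) auto
      have W0: "W \<ge> 0" using w N7 by (simp add: W_def)
      have "W\<^sup>2 * exp (\<omega> - W) \<le> 136/10 * exp (W / 5) * exp (\<omega> - W)"
        by (intro mult_right_mono sq_le_exp_fifth W0) auto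
      also have "\<dots> = 136/10 * exp (\<omega> - 4/5 * W)" by (simp flip: exp_add)
      also have "\<dots> \<le> 136/10 * exp (- (1217/100) + - (1/2 * \<rho>))"
        using W1 W2 w rho by simp
      also have "\<dots> = 136/10 * (exp (- (1217/100)) * exp (- (1/2 * \<rho>)))" by (simp only: exp_add)
      also have "\<dots> \<le> 136/10 * (554/100000000 * exp (- (1/2 * \<rho>)))"
        by (intro mult_left_mono mult_right_mono exp_minus_le_power16[of _ "46930/100000"]) (simp_all add: power_divide)
      also have "\<dots> \<le> 1/10000 * exp (- (1/2 * \<rho>))" by simp
      also have "exp (- (1/2 * \<rho>)) = ?G i" by (simp add: \<rho>_def add_divide_distrib flip: exp_add)
      finally show ?thesis unfolding W_def[symmetric] using ht[of i] by (intro red) linarith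
    qed
  qed
qed

section \<open>Small deformations for large parameter\<close>

definition hfun' :: "real \<Rightarrow> real" where "hfun' w = (3/2 - w) * exp (-w)"

lemma hfun_deriv: "(hfun has_real_derivative hfun' w) (at w)"
  unfolding hfun_def hfun'_def by (auto intro!: derivative_eq_intros simp: algebra_simps)

lemma hfun'_deriv: "(hfun' has_real_derivative (w - 5/2) * exp (-w)) (at w)"
  unfolding hfun'_def by (auto intro!: derivative_eq_intros simp: algebra_simps)

text \<open>\<open>hfun\<close> is convex from 5/2 on.\<close>

lemma hfun_tangent:
  assumes "5/2 \<le> w" "5/2 \<le> q"
  shows "hfun w + hfun' w * (q - w) \<le> hfun q"
proof -
  have "0 \<le> (\<lambda>x. hfun x - hfun w - hfun' w * (x - w)) q"
  proof (rule nonneg_by_second_derivative[of w q "\<lambda>x. hfun x - hfun w - hfun' w * (x - w)" "\<lambda>x. hfun' x - hfun' w" "\<lambda>x. (x - 5/2) * exp (-x)"])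
    fix x assume x: "min w q \<le> x" "x \<le> max w q"
    show "((\<lambda>x. hfun x - hfun w - hfun' w * (x - w)) has_real_derivative hfun' x - hfun' w) (at x)"
      by (auto intro!: derivative_eq_intros hfun_deriv)
    show "((\<lambda>x. hfun' x - hfun' w) has_real_derivative (x - 5/2) * exp (-x)) (at x)"
      by (auto intro!: derivative_eq_intros hfun'_deriv)
    show "0 \<le> (x - 5/2) * exp (-x)" using x assms by auto
  qed auto
  thus ?thesis by simp
qed

lemma hfun_decreasing:
  assumes "3/2 \<le> a" "a \<le> b"
  shows "hfun b \<le> hfun a"
proof (rule DERIV_nonpos_imp_nonincreasing[OF assms(2)])
  fix z assume "a \<le> z" "z \<le> b"
  hence "hfun' z \<le> 0" unfolding hfun'_def using assms by (intro mult_nonpos_nonneg) auto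
  thus "\<exists>d. (hfun has_real_derivative d) (at z) \<and> d \<le> 0" using hfun_deriv by blast
qed

text \<open>Since \<open>31275/10000 = 3/4 * (417/100)\<close>, the exponential is
  \<open>exp (q - \<omega> / u)\<close> at \<open>\<omega> = 417/100\<close>, with
  \<open>q = \<omega> * (3 * u + 1 / u) / 4\<close>. This lemma and \<open>exp_cosh_value\<close>
  supply the slope in \<open>\<omega>\<close> and the value at 417/100 of one inequality that is
  affine in \<open>\<omega>\<close>.\<close>

lemma exp_cosh_slope:
  fixes u :: real
  assumes u: "1 \<le> u"
  shows "(9 * u ^ 4 - 1) / 8 \<le> exp (31275/10000 * (u - 1 / u))"
proof -
  define f where "f = (\<lambda>u::real. 31275/10000 * (u - 1 / u) - ln (9 * u ^ 4 - 1))"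
  have pos: "9 * v ^ 4 - 1 \<ge> 8" if "v \<ge> 1" for v :: real using one_le_power[OF that, of 4] by linarith
  have "f 1 \<le> f u"
  proof (rule DERIV_nonneg_imp_nondecreasing[OF u])
    fix v assume v: "1 \<le> v" "v \<le> u"
    have p: "9 * v ^ 4 - 1 > 0" using pos[OF v(1)] by linarith
    have D: "(f has_real_derivative (31275/10000 * (1 + 1 / v\<^sup>2) - 36 * v ^ 3 / (9 * v ^ 4 - 1))) (at v)"
      unfolding f_def using v p by (auto intro!: derivative_eq_intros simp: field_simps power2_eq_square)
    have "36 * v ^ 3 * v\<^sup>2 \<le> 31275/10000 * (v\<^sup>2 + 1) * (9 * v ^ 4 - 1)"
    proof -
      have v5: "v \<le> v ^ 5" using power_increasing[of 1 5 v] v by simp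
      have "2 * v \<le> v\<^sup>2 + 1" using zero_le_power2[of "v - 1"] by (simp add: power2_eq_square algebra_simps)
      hence "31275/10000 * (2 * v) * (9 * v ^ 4 - 1) \<le> 31275/10000 * (v\<^sup>2 + 1) * (9 * v ^ 4 - 1)"
        using p by (intro mult_right_mono mult_left_mono) auto
      moreover have "31275/10000 * (2 * v) * (9 * v ^ 4 - 1) = 56295/1000 * v ^ 5 - 6255/1000 * v"
        by (simp add: eval_nat_numeral field_simps)
      moreover have "36 * v ^ 3 * v\<^sup>2 = 36 * v ^ 5" by (simp add: eval_nat_numeral)
      ultimately show ?thesis using v5 v by linarith
    qed
    hence "36 * v ^ 3 / (9 * v ^ 4 - 1) \<le> 31275/10000 * (1 + 1 / v\<^sup>2)"
      using p v by (simp add: field_simps)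
    thus "\<exists>y. (f has_real_derivative y) (at v) \<and> 0 \<le> y" using D by (intro exI conjI) auto
  qed
  moreover have "f 1 = - ln 8" by (simp add: f_def)
  ultimately have "ln (9 * u ^ 4 - 1) - ln 8 \<le> 31275/10000 * (u - 1 / u)" unfolding f_def by linarith
  hence "exp (ln (9 * u ^ 4 - 1) - ln 8) \<le> exp (31275/10000 * (u - 1 / u))" by (simp only: exp_le_cancel_iff)
  thus ?thesis using pos[OF u] by (simp add: exp_diff)
qed

text \<open>The quotient of the two sides equals 1 at \<open>u = 1\<close> and increases: in
  \<open>z = u - 1\<close> the numerator of its derivative is a polynomial whose positive low order
  coefficients absorb the negative ones for \<open>z \<le> 1\<close>.\<close>

lemma exp_cosh_value:
  fixes u :: real
  assumes u: "1 \<le> u" "u \<le> 1963/1000"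
  shows "(31275/10000 * u\<^sup>2 - 3/2 * u + 10425/10000) * (3 * u\<^sup>2 - 1)
     \<le> exp (31275/10000 * (u - 1 / u)) * (834/100 - 3 * u - 3/100 * (u ^ 3 - u))"
proof -
  define A B where "A = (\<lambda>u::real. 834/100 - 3 * u - 3/100 * (u ^ 3 - u))"
    and "B = (\<lambda>u::real. (31275/10000 * u\<^sup>2 - 3/2 * u + 10425/10000) * (3 * u\<^sup>2 - 1))"
  define f where "f = (\<lambda>u. exp (31275/10000 * (u - 1 / u)) * A u / B u)"
  have Bp: "B v > 0" if "v \<ge> 1" for v
  proof -
    have v2: "v \<le> v\<^sup>2" using that by (simp add: power2_eq_square)
    show ?thesis unfolding B_def using that v2 by (intro mult_pos_pos) linarith+
  qed
  have "f 1 \<le> f u"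
  proof (rule DERIV_nonneg_imp_nondecreasing[OF u(1)])
    fix v assume v: "1 \<le> v" "v \<le> u"
    define E where "E = exp (31275/10000 * (v - 1 / v))"
    define A' B' where "A' = - 3 - 3/100 * (3 * v\<^sup>2 - 1)"
      and "B' = (6255/1000 * v - 3/2) * (3 * v\<^sup>2 - 1) + (31275/10000 * v\<^sup>2 - 3/2 * v + 10425/10000) * (6 * v)"
    have dE: "((\<lambda>u. exp (31275/10000 * (u - 1 / u))) has_real_derivative E * (31275/10000 * (1 + 1 / v\<^sup>2))) (at v)"
      unfolding E_def using v by (auto intro!: derivative_eq_intros simp: power2_eq_square)
    have dA: "(A has_real_derivative A') (at v)"
      unfolding A_def A'_def by (auto intro!: derivative_eq_intros)
    have dB: "(B has_real_derivative B') (at v)"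
      unfolding B_def B'_def by (auto intro!: derivative_eq_intros simp: field_simps eval_nat_numeral)
    have D: "(f has_real_derivative (((E * (31275/10000 * (1 + 1 / v\<^sup>2))) * A v + A' * E) * B v - (E * A v) * B') / (B v * B v)) (at v)"
      unfolding f_def using DERIV_divide[OF DERIV_mult[OF dE dA] dB] Bp[OF v(1)] by (simp add: E_def)
    define z where "z = v - 1"
    have z: "0 \<le> z" "z \<le> 1" using v u by (auto simp: z_def)
    have vz: "v = 1 + z" by (simp add: z_def)
    have "0 \<le> 31275/10000 * (v\<^sup>2 + 1) * A v * B v + v\<^sup>2 * (A' * B v - A v * B')"
    proof -
      have P: "z ^ a \<le> z ^ b" if "b \<le> a" for a b using z that by (intro power_decreasing) auto
      have "31275/10000 * (v\<^sup>2 + 1) * A v * B v + v\<^sup>2 * (A' * B v - A v * B') = 12847239/500000 + (165548277/1000000) * z + (123130431/400000) * z ^ 2 + (322068087/1000000) * z ^ 3 + (308884437/4000000) * z ^ 4 + (-(483970239/2000000)) * z ^ 5 + (-(2400452577/8000000)) * z ^ 6 + (-(228186153/2000000)) * z ^ 7 + (-(115506081/16000000)) * z ^ 8 + (-(14085009/16000000)) * z ^ 9"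
        unfolding A_def B_def A'_def B'_def vz by (simp add: eval_nat_numeral field_simps)
      moreover
      have "z ^ 5 \<le> z ^ 3" "z ^ 6 \<le> z ^ 3" "z ^ 6 \<le> z ^ 2" "z ^ 7 \<le> z ^ 1" "z ^ 8 \<le> z ^ 1" "z ^ 9 \<le> z ^ 1" "z ^ 6 \<le> z ^ 1"
        by (rule P, simp)+
      moreover have "0 \<le> z ^ 2" "0 \<le> z ^ 3" "0 \<le> z ^ 4" using z by auto
      ultimately show ?thesis using z unfolding power_one_right by linarith
    qed
    hence "0 \<le> E / (v\<^sup>2 * (B v * B v)) * (31275/10000 * (v\<^sup>2 + 1) * A v * B v + v\<^sup>2 * (A' * B v - A v * B'))"
      using Bp[OF v(1)] v by (intro mult_nonneg_nonneg) (auto simp: E_def)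
    also have "\<dots> = (((E * (31275/10000 * (1 + 1 / v\<^sup>2))) * A v + A' * E) * B v - (E * A v) * B') / (B v * B v)"
      using Bp[OF v(1)] v by (simp add: field_simps)
    finally show "\<exists>y. (f has_real_derivative y) (at v) \<and> 0 \<le> y" using D by (intro exI conjI)
  qed
  moreover have "f 1 = 1" by (simp add: f_def A_def B_def)
  ultimately have "1 \<le> f u" by simp
  hence "B u \<le> exp (31275/10000 * (u - 1 / u)) * A u" using Bp[OF u(1)] by (simp add: f_def field_simps)
  thus ?thesis by (simp add: A_def B_def)
qed

text \<open>Again the derivative in \<open>u\<close> is shown to be nonnegative. As
  \<open>\<omega>\<close> is unbounded, the exponential is first frozen at its value
  \<open>E\<close> for \<open>\<omega> = 417/100\<close>; the rest is affine in
  \<open>\<omega>\<close>.\<close>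

lemma hfun_min_vecs_gap:
  fixes \<omega> u :: real
  assumes w: "417/100 \<le> \<omega>" and u: "1 \<le> u" "u \<le> 1963/1000"
  shows "125/1000 * exp (-\<omega>) * ((u - 1)\<^sup>2 / u) \<le> 2 * hfun (\<omega> / u) + 4 * hfun (\<omega> * (3 * u + 1 / u) / 4) - 6 * hfun \<omega>"
proof -
  define f where "f = (\<lambda>u. 2 * hfun (\<omega> / u) + 4 * hfun (\<omega> * (3 * u + 1 / u) / 4) - 125/1000 * exp (-\<omega>) * (u - 2 + 1 / u))"
  have "f 1 \<le> f u"
  proof (rule DERIV_nonneg_imp_nondecreasing[OF u(1)])
    fix v assume v: "1 \<le> v" "v \<le> u"
    hence v0: "v > 0" and v': "v \<le> 1963/1000" using u by auto
    define q where "q = \<omega> * (3 * v + 1 / v) / 4"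
    define E where "E = exp (31275/10000 * (v - 1 / v))"
    define X where "X = q - \<omega> / v"
    \<comment> \<open>The reserve \<open>3/100 * (v\<^sup>2 - 1)\<close> pays for the quadratic gain
      on the left-hand side, because \<open>125/1000 / \<omega> \<le> 3/100\<close>.\<close>
    define a where "a = 2 * (\<omega> / v - 3/2) - 3/100 * (v\<^sup>2 - 1)"
    have D: "(f has_real_derivative (2 * (hfun' (\<omega> / v) * (- \<omega> / v\<^sup>2)) + 4 * (hfun' q * (\<omega> * (3 - 1 / v\<^sup>2) / 4)) - 125/1000 * exp (-\<omega>) * (1 - 1 / v\<^sup>2))) (at v)"
      unfolding f_def q_def using v0
      by (auto intro!: derivative_eq_intros DERIV_chain2[OF hfun_deriv] simp: field_simps power2_eq_square)
    have iv: "1 / v \<le> 1" using v by simp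
    have X: "31275/10000 * (v - 1 / v) \<le> X"
    proof -
      have "0 \<le> v - 1 / v" using order_trans[OF iv v(1)] by simp
      hence "3/4 * (417/100) * (v - 1 / v) \<le> 3/4 * \<omega> * (v - 1 / v)" using w by (intro mult_right_mono) auto
      also have "3/4 * \<omega> * (v - 1 / v) = X" using v0 by (simp add: X_def q_def field_simps)
      finally show ?thesis by simp
    qed
    have EX: "E \<le> exp X" using X by (simp add: E_def)
    have qX: "q - \<omega> \<le> X" using mult_left_mono[OF iv, of \<omega>] w by (simp add: X_def)
    have v2: "1 \<le> v\<^sup>2" using v by simp
    have v4: "v\<^sup>2 \<le> 4"
    proof -
      have "v\<^sup>2 \<le> 2\<^sup>2" using v' v0 by (intro power_mono) auto
      thus ?thesis by simp
    qed
    have ov: "\<omega> / v \<ge> 212/100"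
    proof -
      have "212/100 * v \<le> \<omega>" using v' w by simp
      thus ?thesis using v0 by (simp add: field_simps)
    qed
    have a0: "a \<ge> 0" using ov v4 by (simp add: a_def)
    have val: "(417/100 * (3 * v + 1 / v) / 4 - 3/2) * (3 * v\<^sup>2 - 1) \<le> E * (2 * (417/100 / v - 3/2) - 3/100 * (v\<^sup>2 - 1))"
    proof -
      have "v * ((417/100 * (3 * v + 1 / v) / 4 - 3/2) * (3 * v\<^sup>2 - 1)) = (31275/10000 * v\<^sup>2 - 3/2 * v + 10425/10000) * (3 * v\<^sup>2 - 1)"
        using v0 by (simp add: field_simps power2_eq_square)
      also have "\<dots> \<le> E * (834/100 - 3 * v - 3/100 * (v ^ 3 - v))"
        unfolding E_def by (rule exp_cosh_value[OF v(1) v'])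
      also have "\<dots> = v * (E * (2 * (417/100 / v - 3/2) - 3/100 * (v\<^sup>2 - 1)))"
        using v0 by (simp add: field_simps eval_nat_numeral)
      finally show ?thesis using v0 by simp
    qed
    have slope: "(3 * v + 1 / v) / 4 * (3 * v\<^sup>2 - 1) \<le> E * (2 / v)"
    proof -
      have "(3 * v + 1 / v) / 4 * (3 * v\<^sup>2 - 1) = (9 * v ^ 4 - 1) / 8 * (2 / v)"
        using v0 by (simp add: field_simps eval_nat_numeral)
      also have "\<dots> \<le> E * (2 / v)" unfolding E_def using exp_cosh_slope[OF v(1)] v0 by (intro mult_right_mono) auto
      finally show ?thesis .
    qed
    have main: "(q - 3/2) * (3 * v\<^sup>2 - 1) \<le> E * a"
    proof -
      have "(\<omega> - 417/100) * ((3 * v + 1 / v) / 4 * (3 * v\<^sup>2 - 1)) \<le> (\<omega> - 417/100) * (E * (2 / v))"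
        using w slope by (intro mult_left_mono) auto
      moreover have "(q - 3/2) * (3 * v\<^sup>2 - 1) = (\<omega> - 417/100) * ((3 * v + 1 / v) / 4 * (3 * v\<^sup>2 - 1)) + (417/100 * (3 * v + 1 / v) / 4 - 3/2) * (3 * v\<^sup>2 - 1)"
      proof -
        have "(\<omega> * P / 4 - 3/2) * R = (\<omega> - 417/100) * (P / 4 * R) + (417/100 * P / 4 - 3/2) * R" for P R :: real
          by (simp add: field_simps)
        thus ?thesis unfolding q_def .
      qed
      moreover have "E * a = (\<omega> - 417/100) * (E * (2 / v)) + E * (2 * (417/100 / v - 3/2) - 3/100 * (v\<^sup>2 - 1))"
        unfolding a_def using v0 by (simp add: field_simps)
      ultimately show ?thesis using val by linarith
    qed
    have "E * a \<le> exp X * a" using EX a0 by (intro mult_right_mono)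
    hence L: "(q - 3/2) * (3 * v\<^sup>2 - 1) \<le> exp X * a" using main by linarith
    have "exp X * a = 2 * (\<omega> / v - 3/2) * exp X - 3/100 * ((v\<^sup>2 - 1) * exp X)" 
    proof -
      have "e * (2 * p - c * R) = 2 * p * e - c * (R * e)" for e p c R :: real by (simp add: algebra_simps)
      thus ?thesis unfolding a_def .
    qed
    have "125/1000 / \<omega> * ((v\<^sup>2 - 1) * exp (q - \<omega>)) \<le> 3/100 * ((v\<^sup>2 - 1) * exp X)"
      using w qX v2 by (intro mult_mono) (auto simp: field_simps)
    hence "0 \<le> 2 * (\<omega> / v - 3/2) * exp X - (q - 3/2) * (3 * v\<^sup>2 - 1) - 125/1000 / \<omega> * ((v\<^sup>2 - 1) * exp (q - \<omega>))"
      using L \<open>exp X * a = _\<close> by linarith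
    hence "0 \<le> \<omega> / v\<^sup>2 * exp (-q) * (2 * (\<omega> / v - 3/2) * exp X - (q - 3/2) * (3 * v\<^sup>2 - 1) - 125/1000 / \<omega> * ((v\<^sup>2 - 1) * exp (q - \<omega>)))"
      using w by (intro mult_nonneg_nonneg) auto
    also have "\<dots> = \<omega> / v\<^sup>2 * (2 * (\<omega> / v - 3/2) * (exp (-q) * exp X) - (q - 3/2) * exp (-q) * (3 * v\<^sup>2 - 1) - 125/1000 / \<omega> * ((v\<^sup>2 - 1) * (exp (-q) * exp (q - \<omega>))))"
    proof -
      have "j * e * (P * x - Q * R - t * (S * g)) = j * (P * (e * x) - Q * e * R - t * (S * (e * g)))" for j e P x Q R t S g :: real
        by (simp add: algebra_simps)
      thus ?thesis .
    qed
    also have "exp (-q) * exp X = exp (- (\<omega> / v))" by (simp add: X_def flip: exp_add)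
    also have "exp (-q) * exp (q - \<omega>) = exp (- \<omega>)" by (simp flip: exp_add)
    also have "\<omega> / v\<^sup>2 * (2 * (\<omega> / v - 3/2) * exp (- (\<omega> / v)) - (q - 3/2) * exp (-q) * (3 * v\<^sup>2 - 1) - 125/1000 / \<omega> * ((v\<^sup>2 - 1) * exp (-\<omega>)))
      = 2 * (hfun' (\<omega> / v) * (- \<omega> / v\<^sup>2)) + 4 * (hfun' q * (\<omega> * (3 - 1 / v\<^sup>2) / 4)) - 125/1000 * exp (-\<omega>) * (1 - 1 / v\<^sup>2)"
    proof -
      have "\<omega> / v\<^sup>2 * (2 * (p - 3/2) * A - (q - 3/2) * B * (3 * v\<^sup>2 - 1) - 125/1000 / \<omega> * ((v\<^sup>2 - 1) * C))
        = 2 * ((3/2 - p) * A * (- \<omega> / v\<^sup>2)) + 4 * ((3/2 - q) * B * (\<omega> * (3 - 1 / v\<^sup>2) / 4)) - 125/1000 * C * (1 - 1 / v\<^sup>2)" for p A B C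
        using v0 w by (simp add: field_simps)
      thus ?thesis unfolding hfun'_def .
    qed
    finally show "\<exists>y. (f has_real_derivative y) (at v) \<and> 0 \<le> y" using D by (intro exI conjI)
  qed
  moreover have "f 1 = 6 * hfun \<omega>" by (simp add: f_def)
  moreover have e: "(u - 1)\<^sup>2 / u = u - 2 + 1 / u" using u by (simp add: power2_eq_square field_simps)
  moreover have "f u = 2 * hfun (\<omega> / u) + 4 * hfun (\<omega> * (3 * u + 1 / u) / 4) - 125/1000 * exp (-\<omega>) * (u - 2 + 1 / u)"
    by (simp only: f_def)
  ultimately show ?thesis unfolding e by linarith
qed

lemma omega_ge_417:
  assumes "115/100 \<le> s"
  shows "417/100 \<le> 2 * pi * s / sqrt 3"
proof -
  have "417/100 * sqrt 3 \<le> 2 * pi * (115/100)" using sqrt3_bounds pi_approx by simp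
  also have "\<dots> \<le> 2 * pi * s" using assms by (intro mult_left_mono) auto
  finally show ?thesis by (simp add: field_simps)
qed

lemma hex_form_ge:
  assumes "\<omega> \<ge> 0" "1 \<le> u"
  shows "\<omega> * hexN i / u \<le> hex_form \<omega> u i"
proof -
  obtain m n where i: "i = (m, n)" by (cases i)
  have "1 / u \<le> u" using assms by (simp add: field_simps) (metis mult_mono' mult_1 zero_le_one)
  have "hexN i = (3 * real_of_int (m * m) + real_of_int ((2 * n + m) * (2 * n + m))) / 4"
    by (simp add: i hexN_intN algebra_simps)
  hence "\<omega> * hexN i / u = \<omega> * (3 * real_of_int (m * m) * (1 / u) + real_of_int ((2 * n + m) * (2 * n + m)) / u) / 4"
    by (simp only:) (simp add: algebra_simps add_divide_distrib)
  also have "\<dots> \<le> \<omega> * (3 * real_of_int (m * m) * u + real_of_int ((2 * n + m) * (2 * n + m)) / u) / 4"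
    using assms \<open>1 / u \<le> u\<close> by (intro divide_right_mono mult_left_mono add_right_mono) auto
  finally show ?thesis by (simp only: i hex_form_intN)
qed

text \<open>For the longer vectors convexity of \<open>hfun\<close> makes the tangent bound
  sufficient, so they enter only through the linear term. Since
  \<open>- (3/2 * \<omega> * S)\<close> is at most \<open>24/100 * exp (-\<omega>)\<close>, they
  cost at most 12/100 against the gain 125/1000, in the common unit
  \<open>exp (-\<omega>) * ((u - 1)\<^sup>2 / u)\<close>.\<close>

lemma Usum_near:
  assumes s: "115/100 \<le> s" and u: "1 < u" "u \<le> 1963/1000"
  shows "Usum UNIV (1/2) (sqrt 3 / 2 * u) s < Usum UNIV (1/2) (sqrt 3 / 2) s"
proof -
  define \<omega> where "\<omega> = 2 * pi * s / sqrt 3"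
  define \<psi> where "\<psi> = (\<lambda>N. if N \<ge> 2 then (3/2 - \<omega> * N) * exp (- (\<omega> * N)) else 0)"
  have w: "417/100 \<le> \<omega>" unfolding \<omega>_def by (rule omega_ge_417[OF s])
  have u0: "u > 0" using u by simp
  obtain D T where T: "(D has_sum T) UNIV" "T \<le> 24/100 * exp (-\<omega>)" and D: "\<And>i. 0 \<le> D i"
    "\<And>i. hexN i \<ge> 3 \<Longrightarrow> (\<omega> * hexN i)\<^sup>2 * exp (- (\<omega> * hexN i)) \<le> D i"
    using hex_sq_exp_majorant[OF w] by blast
  have "\<bar>3/2 - x\<bar> \<le> 2 * (1 + x + x\<^sup>2)" if "x \<ge> 0" for x :: real
    unfolding abs_le_iff distrib_left using that zero_le_power2[of x] by (intro conjI) linarith+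
  from hex_weight_summable[OF _ this, of \<omega>] w
  have "(\<lambda>i. \<psi> (hexN i) * (real_of_int (fst i))\<^sup>2) summable_on UNIV" unfolding \<psi>_def by simp
  then obtain S where S: "((\<lambda>i. \<psi> (hexN i) * (real_of_int (fst i))\<^sup>2) has_sum S) UNIV"
    by (auto simp: summable_on_def)
  have "- \<omega> * (3/2 * S) \<le> T"
  proof (rule has_sum_mono[OF has_sum_cmult_right[OF hex_linear_term(1)[OF S u0]] T(1)])
    fix i
    show "- \<omega> * (\<psi> (hexN i) * hexN i) \<le> D i"
    proof (cases rule: hexN_cases[of i])
      case 3
      have W: "\<omega> * hexN i \<ge> 0" using w 3 by simp
      have "- \<omega> * (\<psi> (hexN i) * hexN i) = ((\<omega> * hexN i)\<^sup>2 - 3/2 * (\<omega> * hexN i)) * exp (- (\<omega> * hexN i))"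
        using 3 by (simp add: \<psi>_def power2_eq_square algebra_simps)
      also have "\<dots> \<le> (\<omega> * hexN i)\<^sup>2 * exp (- (\<omega> * hexN i))" using W by (intro mult_right_mono) auto
      also have "\<dots> \<le> D i" using D(2) 3 by simp
      finally show ?thesis .
    qed (auto simp: \<psi>_def hexN_def D)
  qed
  hence S2: "- (3/4 * \<omega> * S) \<le> 12/100 * exp (-\<omega>)" using T(2) by simp
  have pu: "(u - 1)\<^sup>2 / u > 0" using u by simp
  from mult_right_mono[OF S2, of "(u - 1)\<^sup>2 / u"] pu
  have S3: "- (3/4 * \<omega> * S * ((u - 1)\<^sup>2 / u)) \<le> 12/100 * exp (-\<omega>) * ((u - 1)\<^sup>2 / u)" by simp
  have A: "((\<lambda>i. - hfun (hex_form \<omega> u i)) has_sum Usum UNIV (1/2) (sqrt 3 / 2 * u) s) UNIV"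
    using Usum_hex[of u s] u s by (simp add: \<omega>_def)
  have B: "((\<lambda>i. - hfun (\<omega> * hexN i)) has_sum Usum UNIV (1/2) (sqrt 3 / 2) s) UNIV"
    using Usum_hex[of 1 s] s by (simp add: \<omega>_def hex_form_1)
  have C: "((\<lambda>i. - hfun (\<omega> * hexN i) - (if i \<in> min_vecs then hfun (hex_form \<omega> u i) - hfun (\<omega> * hexN i) else 0)
       - \<psi> (hexN i) * (hex_form \<omega> u i - \<omega> * hexN i))
     has_sum (Usum UNIV (1/2) (sqrt 3 / 2) s - (2 * hfun (\<omega> / u) + 4 * hfun (\<omega> * (3 * u + 1 / u) / 4) - 6 * hfun \<omega>)
       - 3/4 * \<omega> * S * ((u - 1)\<^sup>2 / u))) UNIV"
    using u by (intro has_sum_diff B min_vecs_sum hex_linear_term(2)[OF S]) auto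
  have "Usum UNIV (1/2) (sqrt 3 / 2 * u) s \<le> Usum UNIV (1/2) (sqrt 3 / 2) s - (2 * hfun (\<omega> / u) + 4 * hfun (\<omega> * (3 * u + 1 / u) / 4) - 6 * hfun \<omega>)
       - 3/4 * \<omega> * S * ((u - 1)\<^sup>2 / u)"
  proof (rule has_sum_mono[OF A C])
    fix i :: "int \<times> int"
    show "- hfun (hex_form \<omega> u i) \<le> - hfun (\<omega> * hexN i) - (if i \<in> min_vecs then hfun (hex_form \<omega> u i) - hfun (\<omega> * hexN i) else 0)
       - \<psi> (hexN i) * (hex_form \<omega> u i - \<omega> * hexN i)"
    proof (cases rule: hexN_cases[of i])
      case 1
      hence "hexN i = 0" "hex_form \<omega> u i = 0" by (simp_all add: hexN_def hex_form_def)
      thus ?thesis using 1 by (simp add: \<psi>_def min_vecs_def)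
    next
      case 2
      thus ?thesis by (simp add: \<psi>_def)
    next
      case 3
      have W: "1251/100 \<le> \<omega> * hexN i" using mult_mono[OF w 3(3)] w by simp
      have "5/2 * u \<le> \<omega> * hexN i" using W u by linarith
      hence "5/2 \<le> \<omega> * hexN i / u" using u0 by (simp add: field_simps)
      also have "\<dots> \<le> hex_form \<omega> u i" using w u by (intro hex_form_ge) auto
      finally have "hfun (\<omega> * hexN i) + hfun' (\<omega> * hexN i) * (hex_form \<omega> u i - \<omega> * hexN i) \<le> hfun (hex_form \<omega> u i)"
        using W by (intro hfun_tangent) auto
      moreover have "\<psi> (hexN i) = hfun' (\<omega> * hexN i)" using 3 by (simp add: \<psi>_def hfun'_def)
      ultimately show ?thesis using 3 by simp
    qed
  qed
  moreover have "125/1000 * exp (-\<omega>) * ((u - 1)\<^sup>2 / u) \<le> 2 * hfun (\<omega> / u) + 4 * hfun (\<omega> * (3 * u + 1 / u) / 4) - 6 * hfun \<omega>"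
    using hfun_min_vecs_gap[OF w, of u] u by simp
  moreover have "12/100 * exp (-\<omega>) * ((u - 1)\<^sup>2 / u) < 125/1000 * exp (-\<omega>) * ((u - 1)\<^sup>2 / u)"
    using pu by (intro mult_strict_right_mono) auto
  ultimately show ?thesis using S3 by linarith
qed

section \<open>Strong deformations for large parameter\<close>

lemma Usum_hex_lower:
  assumes s: "115/100 \<le> s" and w: "\<omega> = 2 * pi * s / sqrt 3"
  shows "1/2 - 6 * hfun \<omega> - 24/100 * exp (-\<omega>) \<le> Usum UNIV (1/2) (sqrt 3 / 2) s"
proof -
  have w0: "417/100 \<le> \<omega>" unfolding w by (rule omega_ge_417[OF s])
  obtain D T where T: "(D has_sum T) UNIV" "T \<le> 24/100 * exp (-\<omega>)" and D: "\<And>i. 0 \<le> D i"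
    "\<And>i. hexN i \<ge> 3 \<Longrightarrow> (\<omega> * hexN i)\<^sup>2 * exp (- (\<omega> * hexN i)) \<le> D i"
    using hex_sq_exp_majorant[OF w0] by blast
  have B: "((\<lambda>i. - hfun (\<omega> * hexN i)) has_sum Usum UNIV (1/2) (sqrt 3 / 2) s) UNIV"
    using Usum_hex[of 1 s] s by (simp add: w hex_form_1)
  have "((\<lambda>i. if i \<in> insert (0, 0) min_vecs then - hfun (\<omega> * hexN i) else 0) has_sum (1/2 - 6 * hfun \<omega>)) UNIV"
  proof (rule has_sum_finite_neutralI[of "insert (0, 0) min_vecs"])
    have "(\<Sum>i\<in>insert (0, 0) min_vecs. if i \<in> insert (0, 0) min_vecs then - hfun (\<omega> * hexN i) else 0)
       = (\<Sum>i\<in>insert (0, 0) min_vecs. - hfun (\<omega> * hexN i))" by simp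
    also have "\<dots> = 1/2 - 6 * hfun \<omega>" by (simp add: min_vecs_def hexN_def hfun_def)
    finally show "1/2 - 6 * hfun \<omega> = (\<Sum>i\<in>insert (0, 0) min_vecs. if i \<in> insert (0, 0) min_vecs then - hfun (\<omega> * hexN i) else 0)" by simp
  qed (auto simp: min_vecs_def)
  from has_sum_diff[OF this T(1)] have "1/2 - 6 * hfun \<omega> - T \<le> Usum UNIV (1/2) (sqrt 3 / 2) s"
  proof (rule has_sum_mono[OF _ B])
    fix i
    show "(if i \<in> insert (0, 0) min_vecs then - hfun (\<omega> * hexN i) else 0) - D i \<le> - hfun (\<omega> * hexN i)"
    proof (cases rule: hexN_cases[of i])
      case 3
      have W: "1 \<le> \<omega> * hexN i" using mult_mono[OF w0 3(3)] w0 by simp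
      have "\<omega> * hexN i \<le> (\<omega> * hexN i)\<^sup>2" using W by (rule self_le_power) simp
      hence "hfun (\<omega> * hexN i) \<le> (\<omega> * hexN i)\<^sup>2 * exp (- (\<omega> * hexN i))"
        unfolding hfun_def by (intro mult_right_mono) auto
      thus ?thesis using 3 D(2)[of i] by simp
    qed (use D in auto)
  qed
  thus ?thesis using T(2) by linarith
qed

text \<open>Besides the origin only \<open>(0, \<plusminus>1)\<close> are kept. Every other vector
  has exponent at least 1/2, so its summand in \<open>Usum\<close> is nonpositive.\<close>

lemma Usum_far_spatial:
  assumes s: "115/100 \<le> s" and u: "1963/1000 \<le> u" and w: "\<omega> = 2 * pi * s / sqrt 3" and w1: "22/10 \<le> \<omega> / u"
  shows "Usum UNIV (1/2) (sqrt 3 / 2 * u) s \<le> 1/2 - 2 * hfun (\<omega> / u)"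
proof -
  have w0: "417/100 \<le> \<omega>" unfolding w by (rule omega_ge_417[OF s])
  have u0: "u > 0" "1 \<le> u" using u by auto
  have A: "((\<lambda>i. - hfun (hex_form \<omega> u i)) has_sum Usum UNIV (1/2) (sqrt 3 / 2 * u) s) UNIV"
    using Usum_hex[of u s] u s by (simp add: w)
  let ?I = "{(0, 0), (0, 1), (0, -1)} :: (int \<times> int) set"
  have "((\<lambda>i. if i \<in> ?I then - hfun (hex_form \<omega> u i) else 0) has_sum (1/2 - 2 * hfun (\<omega> / u))) UNIV"
  proof (rule has_sum_finite_neutralI[of ?I])
    have "(\<Sum>i\<in>?I. if i \<in> ?I then - hfun (hex_form \<omega> u i) else 0) = (\<Sum>i\<in>?I. - hfun (hex_form \<omega> u i))" by simp
    also have "\<dots> = - hfun 0 - hfun (\<omega> / u) - hfun (\<omega> / u)" by (simp add: hex_form_def)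
    also have "\<dots> = 1/2 - 2 * hfun (\<omega> / u)" by (simp add: hfun_def)
    finally show "1/2 - 2 * hfun (\<omega> / u) = (\<Sum>i\<in>?I. if i \<in> ?I then - hfun (hex_form \<omega> u i) else 0)" by simp
  qed auto
  with A show ?thesis
  proof (rule has_sum_mono)
    fix i
    show "- hfun (hex_form \<omega> u i) \<le> (if i \<in> ?I then - hfun (hex_form \<omega> u i) else 0)"
    proof (cases "i \<in> ?I")
      case False
      have "1 \<le> hexN i" 
        by (cases rule: hexN_cases[of i]) (use False in auto)
      hence "\<omega> / u * 1 \<le> \<omega> / u * hexN i" using w1 by (intro mult_left_mono) linarith+
      also have "\<dots> = \<omega> * hexN i / u" by simp
      also have "\<dots> \<le> hex_form \<omega> u i" using w0 u0 by (intro hex_form_ge) auto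
      finally have "1/2 \<le> hex_form \<omega> u i" using w1 by simp
      thus ?thesis using False by (simp add: hfun_def)
    qed simp
  qed
qed

definition dual_U_table :: "real \<Rightarrow> int \<times> int \<Rightarrow> real" where
  "dual_U_table a = (\<lambda>(m, k). if m = 0 \<and> k * k = 1 then a else if m * m = 1 \<and> k * k = 1 then 18/10000 else 0)"

lemma dual_U_table_sum: "(dual_U_table a has_sum (2 * a + 72/10000)) UNIV"
proof (rule has_sum_finite_neutralI[of "{-2..2} \<times> {-2..2}"])
  fix i :: "int \<times> int" assume "i \<in> UNIV - {-2..2} \<times> {-2..2}"
  moreover obtain m n where i: "i = (m, n)" by (cases i)
  ultimately have "\<not> (m \<in> {-2..2} \<and> n \<in> {-2..2})" by auto
  hence "sqi m n > 8" using sqi_small_box[of m n] by force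
  thus "dual_U_table a i = 0" by (auto simp: i dual_U_table_def)
next
  have "(\<Sum>i\<in>{-2..2} \<times> {-2..2}. dual_U_table a i) = (\<Sum>m\<in>{-2, -1, 0, 1, 2}. \<Sum>n\<in>{-2, -1, 0, 1, 2}. dual_U_table a (m, n))"
    unfolding int_interval_2 by (subst sum.cartesian_product) simp
  also have "\<dots> = 2 * a + 72/10000" by (simp add: dual_U_table_def)
  finally show "2 * a + 72/10000 = (\<Sum>i\<in>{-2..2} \<times> {-2..2}. dual_U_table a i)" by simp
qed auto

text \<open>The indices \<open>(\<plusminus>1, 0)\<close> contribute negatively and are dropped;
  \<open>(0, \<plusminus>1)\<close> contribute at most 61/1000 each, and the remaining ones are
  tiny.\<close>

lemma Usum_dual_upper:
  assumes y0: "y > 0" and s: "1 \<le> s" and w: "w = pi * y / s" "448/100 \<le> w"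
  shows "Usum UNIV (1/2) y s \<le> 132/1000"
proof -
  have s0: "s > 0" using s by auto
  define w' where "w' = pi * y * s"
  define T where "T = (\<lambda>i. sqrt (y / s) * (- (cosmk (1/2) i * dual_diff y s i * exp (- dual_sum y s i))))"
  have T: "(T has_sum Usum UNIV (1/2) y s) UNIV"
  proof -
    have "(\<lambda>i. - 1 * (cosmk (1/2) i * dual_diff y s i * exp (- dual_sum y s i))) summable_on UNIV"
      by (intro summable_on_cmult_right dual_summable_basic y0 s0 abs_cosmk)
    hence 1: "(T has_sum sqrt (y / s) * (\<Sum>\<^sub>\<infinity>i. - (cosmk (1/2) i * dual_diff y s i * exp (- dual_sum y s i)))) UNIV"
      unfolding T_def by (intro has_sum_cmult_right has_sum_infsum) simp
    have "exp (ln s / 2) = sqrt s" using s0 by (simp add: ln_sqrt[symmetric])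
    hence "sqrt s * Usum UNIV (1/2) y s = sqrt y * (\<Sum>\<^sub>\<infinity>i. - (cosmk (1/2) i * dual_diff y s i * exp (- dual_sum y s i)))"
      using Usum_dual[OF y0, of "ln s" UNIV "1/2"] s0 by simp
    hence "Usum UNIV (1/2) y s = sqrt (y / s) * (\<Sum>\<^sub>\<infinity>i. - (cosmk (1/2) i * dual_diff y s i * exp (- dual_sum y s i)))"
      using s0 by (simp add: real_sqrt_divide field_simps)
    thus ?thesis using 1 by simp
  qed
  have ww': "w \<le> w'"
  proof -
    have "pi * y / s \<le> pi * y / 1" using s y0 by (intro divide_left_mono) auto
    also have "\<dots> \<le> pi * y * s" using s y0 by simp
    finally show ?thesis by (simp add: w w'_def)
  qed
  have sw: "y / s = w / pi" by (simp add: w)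
  have sq: "sqrt (y / s) \<le> w / 3"
  proof -
    have "9 \<le> pi * w" using mult_mono[of 3 pi 3 w] pi_approx w by simp
    from mult_left_mono[OF this, of w] have "w / pi \<le> (w / 3)\<^sup>2" using w(2) by (simp add: power2_eq_square field_simps)
    thus ?thesis unfolding sw using w(2) by (intro real_le_lsqrt) auto
  qed
  \<comment> \<open>The tangent of the square root at 144/100, close to the smallest value of
    \<open>w / pi\<close>; it turns the main term into multiples of
    \<open>w ^ n * exp (-w)\<close>.\<close>
  have sq2: "sqrt (y / s) \<le> 1328/10000 * w + 6/10"
  proof -
    have "0 \<le> (w / pi / (12/10) - 12/10)\<^sup>2" by simp
    hence "w / pi \<le> ((w / pi / (12/10) + 12/10) / 2)\<^sup>2" by (simp add: power2_eq_square field_simps)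
    hence "sqrt (w / pi) \<le> (w / pi / (12/10) + 12/10) / 2" using w(2) by (intro real_le_lsqrt) auto
    also have "\<dots> \<le> 1328/10000 * w + 6/10"
    proof -
      have "w \<le> w * (pi * (31872/100000))" using w(2) pi_approx by simp
      hence "w / pi \<le> 31872/100000 * w" by (simp add: field_simps)
      hence "(w / pi) * (5/12) + 6/10 \<le> 31872 / 100000 * w * (5/12) + 6/10" by (intro add_right_mono mult_right_mono) auto
      moreover have "(w / pi / (12/10) + 12/10) / 2 = (w / pi) * (5/12) + 6/10" by simp
      moreover have "31872 / 100000 * w * (5/12) + 6/10 = 1328/10000 * w + 6/10" by simp
      ultimately show ?thesis by (simp only:)
    qed
    finally show ?thesis unfolding sw .
  qed
  have X: "dual_sum y s (m, k) = w' * real_of_int (m * m) + w * real_of_int (k * k)" for m k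
    by (simp add: dual_sum_def w w'_def power2_eq_square algebra_simps)
  have Z: "dual_diff y s (m, k) = w' * real_of_int (m * m) - w * real_of_int (k * k)" for m k
    by (simp add: dual_diff_def w w'_def power2_eq_square algebra_simps)
  have Xge: "w * real_of_int (sqi m k) \<le> dual_sum y s (m, k)" for m k
    unfolding X using ww' mult_right_mono[OF ww', of "real_of_int (m * m)"] by (simp add: algebra_simps)
  obtain \<tau> where tau: "((\<lambda>i. exp (- (2/5) * (real_of_int (fst i))\<^sup>2) * exp (- (2/5) * (real_of_int (snd i))\<^sup>2)) has_sum \<tau>) UNIV"
     "0 \<le> \<tau>" "\<tau> \<le> (1 + 2 / (2/5))\<^sup>2"
    by (rule exp_gauss_pair_sum[of "2/5"]) auto
  have far: "T (m, k) \<le> (dual_sum y s (m, k)) ^ 2 * exp (- dual_sum y s (m, k)) / 6" if q: "sqi m k \<ge> 2" for m k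
  proof -
    define x where "x = dual_sum y s (m, k)"
    have "2 * w \<le> w * real_of_int (sqi m k)" using q w(2) by (simp add: mult.commute del: of_int_add of_int_mult)
    hence x: "2 * w \<le> x" using Xge[of m k] by (simp add: x_def)
    hence x1: "x \<ge> 1" using w(2) by simp
    have "\<bar>dual_diff y s (m, k)\<bar> \<le> x" unfolding x_def using y0 s0 by (intro dual_diff_le) auto
    hence "\<bar>cosmk (1/2) (m, k) * dual_diff y s (m, k)\<bar> \<le> 1 * x"
      unfolding abs_mult by (intro mult_mono abs_cosmk) auto
    hence 1: "- (cosmk (1/2) (m, k) * dual_diff y s (m, k)) * exp (-x) \<le> x * exp (-x)"
      by (intro mult_right_mono) auto
    have "T (m, k) \<le> sqrt (y / s) * (x * exp (-x))"
      unfolding T_def x_def[symmetric] using 1 y0 s0 by (intro mult_left_mono) auto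
    also have "\<dots> \<le> (x / 6) * (x * exp (-x))" using sq x x1 by (intro mult_right_mono) auto
    also have "\<dots> = x ^ 2 * exp (-x) / 6" by (simp add: power2_eq_square)
    finally show ?thesis unfolding x_def .
  qed
  have "Usum UNIV (1/2) y s \<le> 2 * (61/1000) + 72/10000 + 1/100000 * \<tau>"
  proof (rule has_sum_mono[OF T has_sum_add[OF dual_U_table_sum has_sum_cmult_right[OF tau(1)]]])
    fix i :: "int \<times> int"
    obtain m k where i: "i = (m, k)" by (cases i)
    let ?E = "1/100000 * (exp (- (2/5) * (real_of_int (fst i))\<^sup>2) * exp (- (2/5) * (real_of_int (snd i))\<^sup>2))"
    have E: "?E \<ge> 0" by simp
    define x where "x = dual_sum y s (m, k)"
    consider (a) "m = 0" "k = 0" | (b) "m = 0" "k * k = 1" | (c) "m * m = 1" "k = 0" | (d) "m * m = 1" "k * k = 1"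
       | (e) "sqi m k \<ge> 4"
      using sqi_classification[of m k] by fastforce
    thus "T i \<le> dual_U_table (61/1000) i + ?E"
    proof cases
      case a
      have "T i = 0" by (simp add: T_def i a dual_diff_def dual_sum_def)
      moreover have "dual_U_table (61/1000) i = 0" by (simp add: dual_U_table_def i a)
      ultimately show ?thesis using E by linarith
    next
      case b
      have "T i = sqrt (y / s) * (w * exp (-w))" by (simp add: T_def i X Z b cosmk_def del: of_int_mult)
      also have "\<dots> \<le> (1328/10000 * w + 6/10) * (w * exp (-w))" using sq2 w(2) by (intro mult_right_mono) auto
      also have "\<dots> = 1328/10000 * (w ^ 2 * exp (-w)) + 6/10 * (w ^ 1 * exp (-w))" by (simp add: power2_eq_square algebra_simps)
      also have "\<dots> \<le> 1328/10000 * ((448/100) ^ 2 * exp (- (448/100))) + 6/10 * ((448/100) ^ 1 * exp (- (448/100)))"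
        using w(2) by (intro add_mono mult_left_mono power_exp_decreasing) auto
      also have "\<dots> \<le> 1328/10000 * ((448/100) ^ 2 * (1134/100000)) + 6/10 * ((448/100) ^ 1 * (1134/100000))"
        by (intro add_mono mult_left_mono exp_minus_le_power16[of _ "7558/10000"]) (simp_all add: power_divide)
      also have "\<dots> \<le> 61/1000" by (simp add: power_divide)
      finally have "T i \<le> 61/1000" .
      moreover have "dual_U_table (61/1000) i = 61/1000" by (simp add: dual_U_table_def i b)
      ultimately show ?thesis using E by linarith
    next
      case c
      have "T i = - (sqrt (y / s) * (w' * exp (-w')))" by (simp add: T_def i X Z c cosmk_def del: of_int_mult)
      moreover have "0 \<le> sqrt (y / s) * (w' * exp (-w'))" using y0 s0 by (simp add: w'_def)
      moreover have "dual_U_table (61/1000) i = 0" using c by (auto simp add: dual_U_table_def i)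
      ultimately show ?thesis using E by linarith
    next
      case d
      have "x \<ge> 896/100" using Xge[of m k] w(2) d unfolding x_def by simp
      hence "x ^ 2 * exp (-x) / 6 \<le> (896/100) ^ 2 * exp (- (896/100)) / 6"
        by (intro divide_right_mono power_exp_decreasing) auto
      also have "\<dots> \<le> (896/100) ^ 2 * (1300/10000000) / 6"
        by (intro divide_right_mono mult_left_mono exp_minus_le_power16[of _ "57163/100000"]) (simp_all add: power_divide)
      also have "\<dots> \<le> 18/10000" by (simp add: power_divide)
      finally have "T i \<le> 18/10000" using far[of m k, unfolded d] unfolding i x_def by linarith
      moreover have "dual_U_table (61/1000) i = 18/10000" using d by (auto simp add: dual_U_table_def i)
      ultimately show ?thesis using E by linarith
    next
      case e
      define q where "q = real_of_int (sqi m k)"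
      have q: "q \<ge> 4" using e unfolding q_def by linarith
      have "w * q \<le> x" using Xge[of m k] unfolding q_def x_def .
      moreover have "448/100 * q \<le> w * q" using w(2) q by (intro mult_right_mono) auto
      ultimately have x: "448/100 * q \<le> x" by simp
      hence x0: "x > 0" using q by simp
      have "x ^ 2 * exp (-x) / 6 \<le> 136/10 * exp (x / 5) * exp (-x) / 6"
        using sq_le_exp_fifth[of x] x0 by (intro divide_right_mono mult_right_mono) auto
      also have "\<dots> = 136/60 * exp (- (4/5 * x))" by (simp flip: exp_add)
      also have "\<dots> \<le> 136/60 * (exp (- (1251/100)) * exp (- (2/5 * q)))"
        using x q by (intro mult_left_mono) (simp_all flip: exp_add)
      also have "\<dots> \<le> 136/60 * (398/100000000 * exp (- (2/5 * q)))"
        by (intro mult_left_mono mult_right_mono exp_minus_le_power16[of _ "45970/100000"]) (simp_all add: power_divide)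
      also have "\<dots> \<le> 1/100000 * exp (- (2/5 * q))" by simp
      also have "exp (- (2/5 * q)) = exp (- (2/5) * (real_of_int (fst i))\<^sup>2) * exp (- (2/5) * (real_of_int (snd i))\<^sup>2)"
        by (simp add: q_def i power2_eq_square add_divide_distrib flip: exp_add)
      finally have "T i \<le> ?E" using far[of m k] e unfolding i x_def by linarith
      moreover have "dual_U_table (61/1000) i = 0" using e by (auto simp add: dual_U_table_def i)
      ultimately show ?thesis by linarith
    qed
  qed
  moreover have "\<tau> \<le> 36" using tau(3) by simp
  ultimately show ?thesis by linarith
qed

text \<open>Beyond the range of small deformations, the exponent \<open>\<omega> / u\<close> of
  \<open>(0, 1)\<close> and the dual exponent \<open>pi * y / s\<close> have product
  \<open>pi\<^sup>2\<close>. Either the first is at least 22/10 and the spatial bound works, or the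
  second is at least 448/100 and the dual one does.\<close>

lemma Usum_large_s:
  assumes s: "115/100 \<le> s" and u: "1 < u"
  shows "Usum UNIV (1/2) (sqrt 3 / 2 * u) s < Usum UNIV (1/2) (sqrt 3 / 2) s"
proof (cases "u \<le> 1963/1000")
  case True
  thus ?thesis using Usum_near s u by simp
next
  case False
  define \<omega> where "\<omega> = 2 * pi * s / sqrt 3"
  have w: "417/100 \<le> \<omega>" unfolding \<omega>_def by (rule omega_ge_417[OF s])
  have u0: "u > 0" using u by simp
  note low = Usum_hex_lower[OF s \<omega>_def]
  show ?thesis
  proof (cases "22/10 \<le> \<omega> / u")
    case True
    \<comment> \<open>The exponent at the cut-off for \<open>u\<close>, an upper bound for the
      actual \<open>\<omega> / u\<close>; as \<open>hfun\<close> decreases, this is the worst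
      case.\<close>
    define v where "v = \<omega> / (1963/1000)"
    have "\<omega> / u \<le> v" unfolding v_def using False w by (intro divide_left_mono) auto
    hence v: "22/10 \<le> v" using True by linarith
    have wv: "\<omega> = 1963/1000 * v" by (simp add: v_def)
    have "hfun v \<le> hfun (\<omega> / u)" using True \<open>\<omega> / u \<le> v\<close> by (intro hfun_decreasing) auto
    moreover have "6 * hfun \<omega> + 24/100 * exp (-\<omega>) < 2 * hfun v"
    proof -
      have e: "8 \<le> exp (963/1000 * v)"
      proof -
        have "114/100 \<le> exp (211/1600 :: real)" using exp_lower_Taylor_quadratic[of "211/1600"] by (simp add: power_divide)
        hence "(114/100) ^ 16 \<le> exp (211/1600 :: real) ^ 16" by (intro power_mono) auto
        also have "\<dots> = exp (211/100)" by (simp flip: exp_of_nat_mult)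
        also have "\<dots> \<le> exp (963/1000 * v)" using v by simp
        finally show ?thesis by (simp add: power_divide)
      qed
      have "6 * (\<omega> - 1/2) + 24/100 < 2 * (v - 1/2) * 8" using v by (simp add: wv)
      also have "\<dots> \<le> 2 * (v - 1/2) * exp (963/1000 * v)" using v e by (intro mult_left_mono) auto
      finally have "(6 * (\<omega> - 1/2) + 24/100) * exp (-\<omega>) < 2 * (v - 1/2) * exp (963/1000 * v) * exp (-\<omega>)"
        by (intro mult_strict_right_mono) auto
      also have "\<dots> = 2 * (v - 1/2) * (exp (963/1000 * v) * exp (-\<omega>))" by (rule mult.assoc)
      also have "exp (963/1000 * v) * exp (-\<omega>) = exp (-v)" by (simp add: wv flip: exp_add)
      also have "2 * (v - 1/2) * exp (-v) = 2 * hfun v" by (simp only: hfun_def mult.assoc)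
      finally show ?thesis by (simp add: hfun_def algebra_simps)
    qed
    moreover have "Usum UNIV (1/2) (sqrt 3 / 2 * u) s \<le> 1/2 - 2 * hfun (\<omega> / u)"
      by (rule Usum_far_spatial[OF s _ \<omega>_def True]) (use False in simp)
    ultimately show ?thesis using low by linarith
  next
    case 2: False
    have "448/100 \<le> pi * (sqrt 3 / 2 * u) / s"
    proof -
      have "\<omega> / u * (pi * (sqrt 3 / 2 * u) / s) = pi * pi" using u0 s by (simp add: \<omega>_def field_simps)
      moreover have "9859/1000 \<le> pi * pi" using mult_mono[of "314/100" pi "314/100" pi] pi_approx by simp
      moreover have "\<omega> / u * (pi * (sqrt 3 / 2 * u) / s) \<le> 22/10 * (pi * (sqrt 3 / 2 * u) / s)"
        using 2 u0 s by (intro mult_right_mono) auto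
      ultimately show ?thesis by linarith
    qed
    hence up: "Usum UNIV (1/2) (sqrt 3 / 2 * u) s \<le> 132/1000"
      using u0 s by (intro Usum_dual_upper[OF _ _ refl]) auto
    have "hfun \<omega> \<le> hfun (417/100)" using w by (intro hfun_decreasing) auto
    moreover have "exp (-\<omega>) \<le> exp (- (417/100))" using w by simp
    moreover have "exp (- (417/100)) \<le> (1550/100000::real)"
      by (rule exp_minus_le_power16[of _ "77058/100000"]) (simp_all add: power_divide)
    moreover have "hfun (417/100) = 367/100 * exp (- (417/100))" by (simp add: hfun_def)
    ultimately have "6 * hfun \<omega> + 24/100 * exp (-\<omega>) < 1/2 - 132/1000" by linarith
    thus ?thesis using low up by linarith
  qed
qed

theorem Usum_less_hex:
  assumes s: "1 < s" and x: "0 \<le> x" "x \<le> 1/2" and y: "sqrt 3 / 2 \<le> y" and ne: "x \<noteq> 1/2 \<or> y \<noteq> sqrt 3 / 2"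
  shows "Usum UNIV x y s < Usum UNIV (1/2) (sqrt 3 / 2) s"
proof -
  define u where "u = y / (sqrt 3 / 2)"
  have yu: "y = sqrt 3 / 2 * u" by (simp add: u_def)
  have half: "Usum UNIV (1/2) y s < Usum UNIV (1/2) (sqrt 3 / 2) s" if "y \<noteq> sqrt 3 / 2"
  proof -
    have "u > 1" using y that by (simp add: u_def field_simps)
    thus ?thesis unfolding yu using Usum_small_s Usum_large_s s by (cases "s \<le> 115/100") auto
  qed
  show ?thesis
  proof (cases "x = 1/2")
    case True
    show ?thesis unfolding True using half ne True by blast
  next
    case False
    hence "Usum UNIV x y s < Usum UNIV (1/2) y s" using Usum_less_half[OF y s] x by simp
    thus ?thesis using half order.strict_trans by blast
  qed
qed

section \<open>Reduction to the fundamental domain and conclusion\<close>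

text \<open>Makes \<open>Gsum\<close> increase at the hexagonal point, which the comparison of
  ratios requires in addition to that of differences.\<close>

lemma Usum_hex_nonneg:
  assumes "1 < s"
  shows "0 \<le> Usum UNIV (1/2) (sqrt 3 / 2) s"
proof (cases "s \<le> 115/100")
  case True
  have y0: "(sqrt 3 / 2 :: real) > 0" by simp
  define \<phi> where "\<phi> = (\<lambda>t. exp (t/2) * Usum UNIV (1/2) (sqrt 3 / 2) (exp t))"
  have "\<phi> 0 \<le> \<phi> (ln s)"
  proof (rule DERIV_nonneg_imp_nondecreasing[of 0 "ln s" \<phi>])
    show "0 \<le> ln s" using assms by simp
    fix t assume t: "0 \<le> t" "t \<le> ln s"
    have r: "1 \<le> exp t" using t by simp
    have "2 \<le> 2 * pi * exp t / sqrt 3"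
    proof -
      have "sqrt 3 \<le> 2" using sqrt3_bounds by simp
      also have "2 * 1 \<le> pi * exp t" using r pi_approx by (intro mult_mono) auto
      finally show ?thesis by (simp add: field_simps)
    qed
    hence "0 \<le> Vsum UNIV (1/2) (sqrt 3 / 2) (exp t)"
      using Vsum_hex_lower[OF r order_refl] gfun_nonneg[of "2 * pi * exp t / sqrt 3"] by linarith
    hence "0 \<le> exp (t/2) * Vsum UNIV (1/2) (sqrt 3 / 2) (exp t)" by simp
    moreover have "(\<phi> has_real_derivative exp (t/2) * Vsum UNIV (1/2) (sqrt 3 / 2) (exp t)) (at t)"
      unfolding \<phi>_def by (rule Usum_deriv[OF y0])
    ultimately show "\<exists>d. (\<phi> has_real_derivative d) (at t) \<and> 0 \<le> d" by blast
  qed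
  hence "0 \<le> exp (ln s / 2) * Usum UNIV (1/2) (sqrt 3 / 2) s"
    using assms by (simp add: \<phi>_def Usum_at_1)
  thus ?thesis by (simp add: zero_le_mult_iff)
next
  case False
  define \<omega> where "\<omega> = 2 * pi * s / sqrt 3"
  have w: "417/100 \<le> \<omega>" unfolding \<omega>_def by (rule omega_ge_417) (use False in simp)
  have "hfun \<omega> \<le> hfun (417/100)" using w by (intro hfun_decreasing) auto
  moreover have "exp (-\<omega>) \<le> exp (- (417/100))" using w by simp
  moreover have "exp (- (417/100)) \<le> (1550/100000::real)"
    by (rule exp_minus_le_power16[of _ "77058/100000"]) (simp_all add: power_divide)
  moreover have "hfun (417/100) = 367/100 * exp (- (417/100))" by (simp add: hfun_def)
  ultimately have "0 \<le> 1/2 - 6 * hfun \<omega> - 24/100 * exp (-\<omega>)" by linarith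
  also have "\<dots> \<le> Usum UNIV (1/2) (sqrt 3 / 2) s" by (rule Usum_hex_lower[OF _ \<omega>_def]) (use False in simp)
  finally show ?thesis .
qed

section \<open>From derivatives back to values: behaviour for large parameter\<close>

lemma Gsum_ge: "y > 0 \<Longrightarrow> exp (t/2) \<le> Gsum UNIV x y t"
proof -
  assume y: "y > 0"
  let ?F = "\<lambda>i. exp (t/2) * exp (- lat_form x y (exp t) i)"
  have "?F summable_on UNIV" by (intro summable_on_cmult_right lat_summable_basic(1) y) simp
  hence "sum ?F {(0, 0)} \<le> infsum ?F UNIV" by (intro finite_sum_le_infsum) auto
  thus ?thesis by (simp add: Gsum_def lat_form_def)
qed

text \<open>The origin contributes \<open>exp (t/2)\<close>, which is also a lower bound for
  \<open>Gsum\<close> everywhere. All other exponents are at least 2 at \<open>t = 0\<close> and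
  grow like \<open>exp t\<close>, so they leave at most \<open>exp (-t)\<close> times the sum
  \<open>K\<close> at \<open>t = 0\<close>.\<close>

lemma Gsum_hex_le:
  obtains K where "0 \<le> K" "\<And>t. 0 \<le> t \<Longrightarrow> Gsum UNIV (1/2) (sqrt 3 / 2) t \<le> exp (t/2) + K * exp (-t)"
proof
  define \<omega> where "\<omega> = 2 * pi / sqrt 3"
  have w: "2 \<le> \<omega>"
  proof -
    have "sqrt 3 \<le> 2" using sqrt3_bounds by simp
    also have "2 \<le> pi" using pi_approx by simp
    finally show ?thesis by (simp add: \<omega>_def field_simps)
  qed
  have y0: "(sqrt 3 / 2 :: real) > 0" by simp
  have q: "lat_form (1/2) (sqrt 3 / 2) 1 i = \<omega> * hexN i" for i
    using lat_form_half[of 1 1] by (simp add: hex_form_1 \<omega>_def)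
  define K where "K = (\<Sum>\<^sub>\<infinity>i. exp (- lat_form (1/2) (sqrt 3 / 2) 1 i))"
  have KS: "((\<lambda>i. exp (- lat_form (1/2) (sqrt 3 / 2) 1 i)) has_sum K) UNIV"
    unfolding K_def by (intro has_sum_infsum lat_summable_basic y0) simp
  show "0 \<le> K" unfolding K_def by (intro infsum_nonneg) auto
  fix t :: real assume t: "0 \<le> t"
  have S: "((\<lambda>i. exp (t/2) * exp (- lat_form (1/2) (sqrt 3 / 2) (exp t) i)) has_sum Gsum UNIV (1/2) (sqrt 3 / 2) t) UNIV"
    unfolding Gsum_def by (intro has_sum_infsum summable_on_cmult_right lat_summable_basic(1) y0) simp
  have Z: "((\<lambda>i::int \<times> int. if i \<in> {(0,0)} then 1 else 0) has_sum (1::real)) UNIV"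
    by (rule has_sum_finite_neutralI[of "{(0,0)}"]) auto
  have "Gsum UNIV (1/2) (sqrt 3 / 2) t \<le> exp (t/2) * 1 + exp (-t) * K"
  proof (rule has_sum_mono[OF S has_sum_add[OF has_sum_cmult_right[OF Z] has_sum_cmult_right[OF KS]]])
    fix i :: "int \<times> int"
    show "exp (t/2) * exp (- lat_form (1/2) (sqrt 3 / 2) (exp t) i)
       \<le> exp (t/2) * (if i \<in> {(0,0)} then 1 else 0) + exp (-t) * exp (- lat_form (1/2) (sqrt 3 / 2) 1 i)"
    proof (cases "i = (0, 0)")
      case True
      thus ?thesis by (simp add: lat_form_def)
    next
      case False
      have "1 \<le> hexN i" by (cases rule: hexN_cases[of i]) (use False in auto)
      hence "2 * 1 \<le> \<omega> * hexN i" using w by (intro mult_mono) auto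
      hence "t * 2 \<le> (exp t - 1) * (\<omega> * hexN i)"
        using t exp_ge_add_one_self[of t] by (intro mult_mono) linarith+
      moreover have "lat_form (1/2) (sqrt 3 / 2) (exp t) i = exp t * (\<omega> * hexN i)"
        by (subst lat_form_scale) (simp add: q)
      ultimately have "t/2 - lat_form (1/2) (sqrt 3 / 2) (exp t) i \<le> - t - lat_form (1/2) (sqrt 3 / 2) 1 i"
        using t by (simp add: q algebra_simps)
      thus ?thesis using False by (simp flip: exp_add)
    qed
  qed
  thus "Gsum UNIV (1/2) (sqrt 3 / 2) t \<le> exp (t/2) + K * exp (-t)" by (simp add: mult.commute)
qed

lemma hex_extremal:
  assumes x: "0 \<le> x" "x \<le> 1/2" and y: "sqrt 3 / 2 \<le> y" and ne: "x \<noteq> 1/2 \<or> y \<noteq> sqrt 3 / 2"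
  shows Gsum_hex_less: "0 \<le> t \<Longrightarrow> Gsum UNIV (1/2) (sqrt 3 / 2) t < Gsum UNIV x y t"
    and Gsum_diff_hex: "0 \<le> t \<Longrightarrow> t < t' \<Longrightarrow> Gsum UNIV x y t' - Gsum UNIV x y t < Gsum UNIV (1/2) (sqrt 3 / 2) t' - Gsum UNIV (1/2) (sqrt 3 / 2) t"
proof -
  have y0: "y > 0" "(sqrt 3 / 2 :: real) > 0" using y by (auto intro: less_le_trans[of 0 "sqrt 3 / 2"])
  define H where "H = (\<lambda>t. Gsum UNIV (1/2) (sqrt 3 / 2) t - Gsum UNIV x y t)"
  have DH: "(H has_real_derivative (exp (t/2) * Usum UNIV (1/2) (sqrt 3 / 2) (exp t) - exp (t/2) * Usum UNIV x y (exp t))) (at t)" for t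
    unfolding H_def by (intro DERIV_diff Gsum_deriv y0)
  \<comment> \<open>Strictness for \<open>Usum\<close> requires \<open>s > 1\<close>; using the
    derivative on the open interval only, the case \<open>t = 0\<close>, that is
    \<open>\<alpha> = 1\<close>, is included.\<close>
  have mono: "H t < H t'" if t: "0 \<le> t" "t < t'" for t t'
  proof (rule DERIV_pos_imp_increasing_open[OF t(2)])
    fix r assume "t < r" "r < t'"
    hence "1 < exp r" using t by simp
    from Usum_less_hex[OF this x y ne]
    show "\<exists>d. (H has_real_derivative d) (at r) \<and> 0 < d" using DH[of r] by (intro exI conjI) auto
  next
    show "continuous_on {t..t'} H" using DH by (intro DERIV_continuous_on) (auto intro: has_field_derivative_at_within)
  qed
  show "Gsum UNIV x y t' - Gsum UNIV x y t < Gsum UNIV (1/2) (sqrt 3 / 2) t' - Gsum UNIV (1/2) (sqrt 3 / 2) t"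
    if "0 \<le> t" "t < t'" using mono[OF that] by (simp add: H_def)
  show "Gsum UNIV (1/2) (sqrt 3 / 2) t < Gsum UNIV x y t" if t: "0 \<le> t"
  proof (rule ccontr)
    assume "\<not> ?thesis"
    hence "0 \<le> H t" by (simp add: H_def)
    define \<delta> where "\<delta> = H (t + 1)"
    have d: "\<delta> > 0" using mono[of t "t + 1"] t \<open>0 \<le> H t\<close> by (simp add: \<delta>_def)
    obtain K where K: "0 \<le> K" "\<And>t. 0 \<le> t \<Longrightarrow> Gsum UNIV (1/2) (sqrt 3 / 2) t \<le> exp (t/2) + K * exp (-t)"
      using Gsum_hex_le by blast
    \<comment> \<open>Large enough that \<open>K / (1 + r) \<le> \<delta>\<close>, while
      \<open>H r\<close> exceeds \<open>\<delta>\<close> by monotonicity.\<close>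
    define r where "r = t + 2 + K / \<delta>"
    have Kd: "0 \<le> K / \<delta>" using K d by simp
    have r: "0 \<le> r" "t + 1 < r" using t Kd by (auto simp: r_def)
    have "\<delta> < H r" unfolding \<delta>_def using t r by (intro mono) auto
    also have "H r \<le> K * exp (-r)" using K(2)[OF r(1)] Gsum_ge[OF y0(1), of r x] by (simp add: H_def)
    also have "\<dots> = K / exp r" by (simp add: exp_minus field_simps)
    also have "\<dots> \<le> K / (1 + r)" using K r exp_ge_add_one_self[of r] by (intro divide_left_mono) auto
    also have "\<dots> \<le> \<delta>"
    proof -
      have "K \<le> \<delta> * (1 + r)"
      proof -
        have "K = \<delta> * (K / \<delta>)" using d by simp
        also have "\<dots> \<le> \<delta> * (1 + r)" using d t by (intro mult_left_mono) (auto simp: r_def)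
        finally show ?thesis .
      qed
      thus ?thesis using r by (simp add: field_simps)
    qed
    finally show False by simp
  qed
qed

lemma Gsum_hex_mono:
  assumes "0 \<le> t" "t \<le> t'"
  shows "Gsum UNIV (1/2) (sqrt 3 / 2) t \<le> Gsum UNIV (1/2) (sqrt 3 / 2) t'"
proof (rule DERIV_nonneg_imp_nondecreasing[OF assms(2)])
  fix r assume "t \<le> r" "r \<le> t'"
  hence "1 \<le> exp r" using assms by simp
  hence "0 \<le> Usum UNIV (1/2) (sqrt 3 / 2) (exp r)"
    using Usum_hex_nonneg[of "exp r"] Usum_at_1[of "sqrt 3 / 2" "1/2"] by (cases "exp r = 1") auto
  hence "0 \<le> exp (r/2) * Usum UNIV (1/2) (sqrt 3 / 2) (exp r)" by simp
  moreover have "(Gsum UNIV (1/2) (sqrt 3 / 2) has_real_derivative exp (r/2) * Usum UNIV (1/2) (sqrt 3 / 2) (exp r)) (at r)"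
    by (rule Gsum_deriv) simp
  ultimately show "\<exists>d. (Gsum UNIV (1/2) (sqrt 3 / 2) has_real_derivative d) (at r) \<and> 0 \<le> d" by blast
qed

section \<open>Symmetries of theta and the modular group\<close>

lemma Gsum_uminus: "Gsum UNIV (-x) y t = Gsum UNIV x y t"
proof -
  have b: "bij (\<lambda>i :: int \<times> int. (fst i, - snd i))"
    by (rule o_bij[of "\<lambda>i. (fst i, - snd i)"]) auto
  have e: "lat_form x y (exp t) (fst i, - snd i) = lat_form (-x) y (exp t) i" for i
  proof (cases i)
    case (Pair m n)
    have "(real_of_int m * x + real_of_int (- n))\<^sup>2 = (real_of_int m * (-x) + real_of_int n)\<^sup>2"
      by (simp add: power2_eq_square algebra_simps)
    thus ?thesis by (simp add: Pair lat_form_def)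
  qed
  show ?thesis unfolding Gsum_def
    using infsum_reindex_bij_betw[OF b, of "\<lambda>i. exp (t/2) * exp (- lat_form x y (exp t) i)"] by (simp add: e)
qed

lemma theta_Gsum:
  assumes "\<alpha> > 0"
  shows "theta \<alpha> z = Gsum UNIV (Re z) (Im z) (ln \<alpha>) / sqrt \<alpha>"
proof -
  have e: "exp (ln \<alpha> / 2) = sqrt \<alpha>" using assms by (simp add: ln_sqrt[symmetric])
  have "- pi * \<alpha> * (cmod (of_int m * z + of_int n))\<^sup>2 / Im z = - lat_form (Re z) (Im z) \<alpha> (m, n)" for m n
    by (simp add: lat_form_def cmod_power2)
  hence "theta \<alpha> z = (\<Sum>\<^sub>\<infinity>i. exp (- lat_form (Re z) (Im z) \<alpha> i))"
    by (simp add: theta_def case_prod_unfold)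
  moreover have "Gsum UNIV (Re z) (Im z) (ln \<alpha>) = sqrt \<alpha> * (\<Sum>\<^sub>\<infinity>i. exp (- lat_form (Re z) (Im z) \<alpha> i))"
    using assms by (simp add: Gsum_def e infsum_cmult_right')
  ultimately show ?thesis using assms by simp
qed

lemma theta_pos:
  assumes "\<alpha> > 0" "Im z > 0"
  shows "theta \<alpha> z > 0"
  using Gsum_ge[OF assms(2), of "ln \<alpha>" "Re z"] assms
  by (simp add: theta_Gsum) (meson divide_pos_pos exp_gt_zero less_le_trans real_sqrt_gt_zero)

context
  fixes a b c d :: int and w :: complex
  assumes det: "a * d - b * c = 1" and w: "Im w > 0"
begin

lemma moebius_denominator: "of_int c * w + of_int d \<noteq> 0"
proof
  assume z: "of_int c * w + of_int d = 0"
  hence "Im (of_int c * w + of_int d) = 0" by simp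
  hence "c = 0" using w by simp
  hence "d = 0" using z by simp
  thus False using det \<open>c = 0\<close> by simp
qed

lemma Im_moebius: "Im ((of_int a * w + of_int b) / (of_int c * w + of_int d)) = Im w / (cmod (of_int c * w + of_int d))\<^sup>2"
proof -
  have det': "real_of_int a * real_of_int d - real_of_int b * real_of_int c = 1"
    using det by (metis of_int_1 of_int_diff of_int_mult)
  have "(a * Im w) * (c * Re w + d) - (a * Re w + b) * (c * Im w) = (real_of_int a * d - real_of_int b * c) * Im w"
    by (simp add: algebra_simps)
  thus ?thesis by (simp add: Im_divide cmod_power2 det')
qed

lemma Im_moebius_pos: "Im ((of_int a * w + of_int b) / (of_int c * w + of_int d)) > 0"
  unfolding Im_moebius using w moebius_denominator by simp

text \<open>\<open>m * z + n\<close> equals \<open>m' * w + n'\<close> divided by the denominator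
  \<open>D\<close>, where \<open>(m', n')\<close> is the row \<open>(m, n)\<close> times the matrix,
  a bijection of the index set. The factor \<open>(cmod D)\<^sup>2\<close> cancels against that in
  \<open>Im z\<close>.\<close>

lemma theta_moebius: "theta \<alpha> ((of_int a * w + of_int b) / (of_int c * w + of_int d)) = theta \<alpha> w"
proof -
  define D where "D = of_int c * w + of_int d"
  define z where "z = (of_int a * w + of_int b) / D"
  have D: "D \<noteq> 0" unfolding D_def by (rule moebius_denominator)
  define g where "g = (\<lambda>i :: int \<times> int. (fst i * a + snd i * c, fst i * b + snd i * d))"
  define g' where "g' = (\<lambda>i :: int \<times> int. (fst i * d - snd i * c, snd i * a - fst i * b))"
  have "g' (g i) = i" "g (g' i) = i" for i
  proof -
    have "(m * a + n * c) * d - (m * b + n * d) * c = m * (a * d - b * c)" "(m * b + n * d) * a - (m * a + n * c) * b = n * (a * d - b * c)"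
       "(m * d - n * c) * a + (n * a - m * b) * c = m * (a * d - b * c)" "(m * d - n * c) * b + (n * a - m * b) * d = n * (a * d - b * c)" for m n
      by (simp_all add: algebra_simps)
    thus "g' (g i) = i" "g (g' i) = i" by (simp_all add: g_def g'_def det)
  qed
  hence b: "bij g" by (intro o_bij[of g' g]) (auto simp: fun_eq_iff)
  have e: "exp (- pi * \<alpha> * (cmod (of_int m * z + of_int n))\<^sup>2 / Im z)
     = exp (- pi * \<alpha> * (cmod (of_int (fst (g (m, n))) * w + of_int (snd (g (m, n)))))\<^sup>2 / Im w)" for m n
  proof -
    have "of_int m * z + of_int n = (of_int (fst (g (m, n))) * w + of_int (snd (g (m, n)))) / D"
      using D by (simp add: z_def g_def field_simps) (simp add: D_def algebra_simps)
    moreover have "Im z = Im w / (cmod D)\<^sup>2" unfolding z_def D_def by (rule Im_moebius)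
    ultimately show ?thesis using D by (simp add: norm_divide power_divide)
  qed
  define f where "f = (\<lambda>(m, n). exp (- pi * \<alpha> * (cmod (of_int m * w + of_int n))\<^sup>2 / Im w))"
  have "(case i of (m, n) \<Rightarrow> exp (- pi * \<alpha> * (cmod (of_int m * z + of_int n))\<^sup>2 / Im z)) = f (g i)" for i
    by (cases i) (simp only: prod.case e f_def case_prod_beta fst_conv snd_conv)
  hence "theta \<alpha> z = (\<Sum>\<^sub>\<infinity>i. f (g i))" unfolding theta_def by (intro infsum_cong)
  also have "\<dots> = infsum f UNIV" by (rule infsum_reindex_bij_betw[OF b])
  also have "\<dots> = theta \<alpha> w" by (simp only: theta_def f_def)
  finally have "theta \<alpha> z = theta \<alpha> w" .
  thus ?thesis by (simp add: z_def D_def)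
qed

end

text \<open>The bottom row of the inverse matrix is a shortest nonzero vector of the lattice.\<close>

lemma fundamental_domain_reduction:
  assumes z: "Im z > 0"
  obtains a b c d :: int and w where "a * d - b * c = 1" "Im w > 0" "z = (of_int a * w + of_int b) / (of_int c * w + of_int d)"
    "\<bar>Re w\<bar> \<le> 1/2" "1 \<le> cmod w"
proof -
  define f where "f = (\<lambda>i :: int \<times> int. (cmod (of_int (fst i) * z + of_int (snd i)))\<^sup>2)"
  \<comment> \<open>A shortest nonzero vector is no longer than \<open>(0, 1)\<close>, where
    \<open>f\<close> is 1. The set of such candidates is finite, so a minimum exists.\<close>
  define S where "S = {i :: int \<times> int. i \<noteq> (0, 0) \<and> f i \<le> 1}"
  have fin: "finite S"
  proof -
    define \<kappa> where "\<kappa> = pi * Im z / (1 + (Re z)\<^sup>2 + (Im z)\<^sup>2)"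
    have kap: "\<kappa> > 0" using z by (auto simp: \<kappa>_def intro!: divide_pos_pos add_pos_nonneg)
    define R where "R = pi / Im z / \<kappa>"
    have "S \<subseteq> {- \<lceil>R\<rceil>..\<lceil>R\<rceil>} \<times> {- \<lceil>R\<rceil>..\<lceil>R\<rceil>}"
    proof
      fix i assume i: "i \<in> S"
      have "\<kappa> * sqn i \<le> lat_form (Re z) (Im z) 1 i" using lat_form_ge[of "Im z" 1 "Re z" i] z by (simp add: \<kappa>_def)
      also have "\<dots> = pi / Im z * f i" by (cases i) (simp add: lat_form_def f_def cmod_power2)
      also have "\<dots> \<le> pi / Im z * 1" using i z by (intro mult_left_mono) (auto simp: S_def)
      finally have q: "sqn i \<le> R"
        unfolding R_def pos_le_divide_eq[OF kap] mult.commute[of "sqn i"] by linarith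
      have "m \<in> {- \<lceil>R\<rceil>..\<lceil>R\<rceil>}" if "(real_of_int m)\<^sup>2 \<le> R" for m
      proof -
        have "\<bar>m\<bar> \<le> m\<^sup>2" using self_le_power[of "\<bar>m\<bar>" 2] by (cases "m = 0") auto
        hence "real_of_int \<bar>m\<bar> \<le> (real_of_int m)\<^sup>2" by (metis of_int_le_iff of_int_power)
        hence "real_of_int \<bar>m\<bar> \<le> R" using that by linarith
        hence "\<bar>m\<bar> \<le> \<lceil>R\<rceil>" by linarith
        thus ?thesis by auto
      qed
      moreover have "(real_of_int (fst i))\<^sup>2 \<le> R" "(real_of_int (snd i))\<^sup>2 \<le> R"
        using q zero_le_power2[of "real_of_int (fst i)"] zero_le_power2[of "real_of_int (snd i)"] by linarith+
      ultimately show "i \<in> {- \<lceil>R\<rceil>..\<lceil>R\<rceil>} \<times> {- \<lceil>R\<rceil>..\<lceil>R\<rceil>}" by (cases i) auto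
    qed
    thus ?thesis by (rule finite_subset) auto
  qed
  have "(0, 1) \<in> S" by (simp add: S_def f_def)
  hence ne: "S \<noteq> {}" by blast
  obtain c d where cd: "(c, d) = arg_min_on f S" by (cases "arg_min_on f S") auto
  have cdS: "(c, d) \<in> S" unfolding cd by (rule arg_min_if_finite(1)[OF fin ne])
  have min: "f (c, d) \<le> f i" if "i \<noteq> (0, 0)" for i
  proof (cases "i \<in> S")
    case True
    thus ?thesis using arg_min_if_finite(2)[OF fin ne] unfolding cd by (meson not_le)
  next
    case False
    thus ?thesis using that cdS by (auto simp: S_def)
  qed
  have cd0: "(c, d) \<noteq> (0, 0)" using cdS by (simp add: S_def)
  have fpos: "f i > 0" if "i \<noteq> (0, 0)" for i
  proof -
    have "of_int (fst i) * z + of_int (snd i) \<noteq> 0"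
    proof
      assume h: "of_int (fst i) * z + of_int (snd i) = 0"
      hence "Im (of_int (fst i) * z + of_int (snd i)) = 0" by simp
      hence "fst i = 0" using z by simp
      thus False using h that by (cases i) auto
    qed
    thus ?thesis by (simp add: f_def)
  qed
  \<comment> \<open>A common divisor above 1 could be divided out, giving a shorter vector.\<close>
  have cop: "gcd c d = 1"
  proof -
    define g where "g = gcd c d"
    have "g \<noteq> 0" using cd0 by (auto simp: g_def)
    moreover have "g \<ge> 0" by (simp add: g_def)
    ultimately have g: "g \<ge> 1" by linarith
    have gd: "c = g * (c div g)" "d = g * (d div g)" by (simp_all add: g_def)
    have "f (c, d) = (real_of_int g)\<^sup>2 * f (c div g, d div g)"
    proof -
      have "of_int c * z + of_int d = of_int g * (of_int (c div g) * z + of_int (d div g))"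
        by (subst gd(1), subst gd(2)) (simp add: algebra_simps)
      thus ?thesis by (simp add: f_def norm_mult power_mult_distrib)
    qed
    moreover have nz: "(c div g, d div g) \<noteq> (0, 0)" using cd0 gd by auto
    ultimately have "(real_of_int g)\<^sup>2 * f (c div g, d div g) \<le> 1 * f (c div g, d div g)"
      using min[OF nz] by simp
    hence "(real_of_int g)\<^sup>2 \<le> 1" using fpos[OF nz] by (simp only: mult_le_cancel_right)
    hence "real_of_int g \<le> 1" using g by (simp add: power2_le_iff_abs_le abs_square_le_1)
    thus ?thesis using g by (simp add: g_def)
  qed
  obtain u v where uv: "u * c + v * d = 1" using bezout_int[of c d] cop by metis
  define D where "D = of_int c * z + of_int d"
  have D: "D \<noteq> 0" using fpos[OF cd0] by (auto simp: f_def D_def)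
  define w0 where "w0 = (of_int v * z + of_int (- u)) / D"
  \<comment> \<open>The translation that brings the real part of \<open>w0\<close> into the interval
    from -1/2 to 1/2; it adds \<open>n\<close> times the bottom row to the top row and keeps the
    determinant.\<close>
  define n where "n = - \<lfloor>Re w0 + 1/2\<rfloor>"
  define a b where "a = v + n * c" and "b = n * d - u"
  define w where "w = (of_int a * z + of_int b) / D"
  have det: "a * d - b * c = 1" using uv by (simp add: a_def b_def algebra_simps)
  have ww: "w = w0 + of_int n" using D by (simp add: w_def w0_def a_def b_def field_simps) (simp add: D_def algebra_simps)
  have Imw: "Im w > 0" unfolding w_def D_def by (rule Im_moebius_pos[OF det z])
  have "Re w = Re w0 - real_of_int \<lfloor>Re w0 + 1/2\<rfloor>" by (simp add: ww n_def)
  hence Re: "\<bar>Re w\<bar> \<le> 1/2" using floor_correct[of "Re w0 + 1/2"] by linarith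
  have ab0: "(a, b) \<noteq> (0, 0)" using det by auto
  have "cmod w \<ge> 1"
  proof -
    have "f (c, d) \<le> f (a, b)" by (rule min[OF ab0])
    hence "cmod D \<le> cmod (of_int a * z + of_int b)" unfolding f_def D_def by simp
    thus ?thesis using D by (simp add: w_def norm_divide)
  qed
  moreover have "z = (of_int d * w + of_int (- b)) / (of_int (- c) * w + of_int a)"
  proof -
    have det': "of_int a * of_int d - of_int b * of_int c = (1 :: complex)"
      using det by (metis of_int_1 of_int_diff of_int_mult)
    have wD: "w * D = of_int a * z + of_int b" using D by (simp add: w_def)
    have "(of_int (- c) * w + of_int a) * D = of_int a * D - of_int c * (w * D)" by (simp add: algebra_simps)
    also have "\<dots> = of_int a * of_int d - of_int b * of_int c" unfolding wD by (simp add: D_def algebra_simps)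
    finally have 1: "(of_int (- c) * w + of_int a) * D = 1" using det' by simp
    have "(of_int d * w + of_int (- b)) * D = of_int d * (w * D) - of_int b * D" by (simp add: algebra_simps)
    also have "\<dots> = (of_int a * of_int d - of_int b * of_int c) * z" unfolding wD by (simp add: D_def algebra_simps)
    finally have 2: "(of_int d * w + of_int (- b)) * D = z" using det' by simp
    have "of_int (- c) * w + of_int a \<noteq> 0" using 1 by auto
    thus ?thesis using 1 2 D by (metis mult_divide_mult_cancel_right div_by_1)
  qed
  moreover have "d * a - (- b) * (- c) = 1" using det by (simp add: algebra_simps)
  ultimately show thesis using that[of d a "- b" "- c" w] Imw Re by blast
qed

lemma modular_action_vector:
  "modular_action (vector [vector [a, b], vector [c, d]]) z = (of_int a * z + of_int b) / (of_int c * z + of_int d)"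
  "vector [vector [a, b], vector [c, d]] \<in> SL2Z \<longleftrightarrow> a * d - b * c = 1"
  by (simp_all add: modular_action_def SL2Z_def det_2)

lemma exp_i_pi_third: "exp (\<i> * of_real pi / 3) = Complex (1/2) (sqrt 3 / 2)"
proof -
  have "exp (\<i> * of_real pi / 3) = cis (pi / 3)" by (simp add: cis_conv_exp)
  thus ?thesis by (simp add: cis.code cos_60 sin_60 complex_eq_iff)
qed

section \<open>The quotient of theta functions\<close>

lemma quotient_less_hex:
  assumes ab: "1 \<le> \<alpha>" "\<alpha> < \<beta>" and k: "1 \<le> k"
    and w: "Im w > 0" "\<bar>Re w\<bar> \<le> 1/2" "1 \<le> cmod w" and ne: "\<bar>Re w\<bar> \<noteq> 1/2 \<or> Im w \<noteq> sqrt 3 / 2"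
  shows "theta_quotient \<alpha> \<beta> k w < theta_quotient \<alpha> \<beta> k (Complex (1/2) (sqrt 3 / 2))"
proof -
  define z0 where "z0 = Complex (1/2) (sqrt 3 / 2)"
  define x y where "x = \<bar>Re w\<bar>" and "y = Im w"
  have a0: "\<alpha> > 0" "\<beta> > 0" using ab by auto
  have x: "0 \<le> x" "x \<le> 1/2" using w by (auto simp: x_def)
  have y: "sqrt 3 / 2 \<le> y"
  proof -
    have "1 \<le> (cmod w)\<^sup>2" using w(3) by simp
    also have "\<dots> = x\<^sup>2 + y\<^sup>2" by (simp add: cmod_power2 x_def y_def)
    also have "x\<^sup>2 \<le> (1/2)\<^sup>2" using x by (intro power_mono) auto
    finally have "3 \<le> (2 * y)\<^sup>2" by (simp add: power2_eq_square)
    hence "sqrt 3 \<le> 2 * y" using w(1) by (intro real_le_lsqrt) (auto simp: y_def)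
    thus ?thesis by simp
  qed
  have ne': "x \<noteq> 1/2 \<or> y \<noteq> sqrt 3 / 2" using ne by (simp add: x_def y_def)
  have Gw: "Gsum UNIV (Re w) (Im w) t = Gsum UNIV x y t" for t
    using Gsum_uminus[of "Re w" "Im w" t] by (auto simp: x_def y_def abs_if)
  define A B a b where "A = Gsum UNIV x y (ln \<alpha>)" and "B = Gsum UNIV x y (ln \<beta>)"
    and "a = Gsum UNIV (1/2) (sqrt 3 / 2) (ln \<alpha>)" and "b = Gsum UNIV (1/2) (sqrt 3 / 2) (ln \<beta>)"
  have t: "0 \<le> ln \<alpha>" "ln \<alpha> < ln \<beta>" using ab by auto
  have aA: "a < A" unfolding a_def A_def by (rule Gsum_hex_less[OF x y ne' t(1)])
  have diff: "B - A < b - a" unfolding a_def A_def b_def B_def by (rule Gsum_diff_hex[OF x y ne' t])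
  have abm: "a \<le> b" unfolding a_def b_def using t by (intro Gsum_hex_mono) auto
  have ap: "a > 0" using Gsum_ge[of "sqrt 3 / 2" "ln \<alpha>" "1/2"] unfolding a_def
    by (simp add: less_le_trans[OF exp_gt_zero])
  \<comment> \<open>A smaller increment over a larger base gives a smaller ratio; the sign of
    \<open>(b - a) * (A - a)\<close> is where \<open>a \<le> b\<close> and \<open>a < A\<close>
    enter.\<close>
  have ratio: "B / A < b / a"
  proof -
    have "B * a < (A + (b - a)) * a" using diff ap by (intro mult_strict_right_mono) auto
    also have "\<dots> = b * A - (b - a) * (A - a)" by (simp add: algebra_simps)
    also have "\<dots> \<le> b * A" using abm aA by simp
    finally show ?thesis using ap aA by (simp add: field_simps)
  qed
  have th: "theta \<alpha> w = A / sqrt \<alpha>" "theta \<beta> w = B / sqrt \<beta>" "theta \<alpha> z0 = a / sqrt \<alpha>" "theta \<beta> z0 = b / sqrt \<beta>"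
    using a0 by (simp_all add: theta_Gsum Gw A_def B_def a_def b_def z0_def)
  have split: "theta_quotient \<alpha> \<beta> k z = theta \<beta> z / theta \<alpha> z * theta \<alpha> z powr (1 - k)" if "theta \<alpha> z > 0" for z
    using that by (simp add: theta_quotient_def powr_diff)
  have p: "0 < theta \<alpha> z0" using ap a0 by (simp add: th)
  have le: "theta \<alpha> z0 \<le> theta \<alpha> w" using aA a0 by (simp add: th divide_right_mono)
  have "theta \<beta> w / theta \<alpha> w < theta \<beta> z0 / theta \<alpha> z0"
  proof -
    have "theta \<beta> w / theta \<alpha> w = B / A * (sqrt \<alpha> / sqrt \<beta>)" "theta \<beta> z0 / theta \<alpha> z0 = b / a * (sqrt \<alpha> / sqrt \<beta>)"
      by (simp_all add: th)
    moreover have "B / A * (sqrt \<alpha> / sqrt \<beta>) < b / a * (sqrt \<alpha> / sqrt \<beta>)"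
      using a0 by (intro mult_strict_right_mono ratio) auto
    ultimately show ?thesis by (simp only:)
  qed
  moreover have "theta \<alpha> w powr (1 - k) \<le> theta \<alpha> z0 powr (1 - k)"
    using p le k by (intro powr_mono2') auto
  moreover have "0 < theta \<beta> z0 / theta \<alpha> z0" using p ap abm a0 by (simp add: th)
  ultimately have "theta \<beta> w / theta \<alpha> w * theta \<alpha> w powr (1 - k) < theta \<beta> z0 / theta \<alpha> z0 * theta \<alpha> z0 powr (1 - k)"
    using theta_pos[OF a0(1) w(1)] theta_pos[OF a0(2) w(1)] by (intro mult_less_le_imp_less) auto
  thus ?thesis using p le unfolding z0_def[symmetric] by (simp add: split)
qed

text \<open>In dual form \<open>theta s (i * y)\<close> is \<open>sqrt (y / s) * F s y\<close>, and
  \<open>F s y\<close> stays between 1 and \<open>F s 1\<close> for \<open>y \<ge> 1\<close>. Hence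
  the quotient is at least a constant times \<open>sqrt y powr (1 - k)\<close>.\<close>

lemma quotient_unbounded:
  assumes a: "\<alpha> > 0" "\<beta> > 0" and k: "0 < k" "k < 1"
  obtains y where "y > 0" "M < theta_quotient \<alpha> \<beta> k (Complex 0 y)"
proof -
  define F where "F = (\<lambda>s y. \<Sum>\<^sub>\<infinity>i. exp (- dual_sum y s i))"
  have th: "theta s (Complex 0 y) = sqrt y * F s y / sqrt s" if "s > 0" "y > 0" for s y
    using that Gsum_dual[OF that(2), of UNIV 0 "ln s"] by (simp add: theta_Gsum F_def cosmk_def case_prod_unfold)
  have sm: "(\<lambda>i. exp (- dual_sum y s i)) summable_on UNIV" if "s > 0" "y > 0" for s y
    using dual_summable_basic(1)[OF that(2,1), of "\<lambda>_. 1" UNIV] by simp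
  have F1: "1 \<le> F s y" if "s > 0" "y > 0" for s y
  proof -
    have "sum (\<lambda>i. exp (- dual_sum y s i)) {(0, 0)} \<le> F s y"
      unfolding F_def by (intro finite_sum_le_infsum sm that) auto
    thus ?thesis by (simp add: dual_sum_def)
  qed
  have FK: "F s y \<le> F s 1" if "s > 0" "y \<ge> 1" for s y
    unfolding F_def
  proof (rule infsum_mono)
    fix i :: "int \<times> int"
    have "0 \<le> dual_sum 1 s i" using that by (intro dual_sum_nonneg) auto
    moreover have "dual_sum y s i = y * dual_sum 1 s i" by (cases i) (simp add: dual_sum_def)
    ultimately show "exp (- dual_sum y s i) \<le> exp (- dual_sum 1 s i)"
      using mult_right_mono[OF that(2), of "dual_sum 1 s i"] by simp
  qed (use that sm in auto)
  define K C where "K = F \<alpha> 1 / sqrt \<alpha>" and "C = 1 / sqrt \<beta> / K powr k"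
  have K: "K > 0" using F1[of \<alpha> 1] a by (simp add: K_def)
  have C: "C > 0" using a K by (simp add: C_def)
  \<comment> \<open>Chosen so that \<open>C * r powr (1 - k) = max M 0 + C\<close>, which exceeds
    \<open>M\<close>.\<close>
  define r where "r = (max M 0 / C + 1) powr (1 / (1 - k))"
  have b1: "1 \<le> max M 0 / C + 1" using C by simp
  have r: "1 \<le> r" unfolding r_def using b1 k by (intro ge_one_powr_ge_zero) auto
  have rk: "r powr (1 - k) = max M 0 / C + 1"
    unfolding r_def using b1 k by (simp add: powr_powr)
  define y where "y = r\<^sup>2"
  have y: "1 \<le> y" "sqrt y = r" using r by (auto simp: y_def)
  have 1: "r / sqrt \<beta> \<le> theta \<beta> (Complex 0 y)"
    using th[of \<beta> y] F1[of \<beta> y] a y r by (simp add: divide_right_mono)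
  have 2: "theta \<alpha> (Complex 0 y) \<le> r * K"
    using th[of \<alpha> y] FK[of \<alpha> y] a y r by (simp add: K_def divide_right_mono)
  have 3: "0 < theta \<alpha> (Complex 0 y)" using a y by (intro theta_pos) auto
  have "C * (max M 0 / C + 1) = max M 0 + C" using C by (simp add: field_simps)
  hence "M < C * (max M 0 / C + 1)" using C by linarith
  also have "\<dots> = C * r powr (1 - k)" by (simp add: rk)
  also have "\<dots> = r / sqrt \<beta> / (r * K) powr k"
    using r K by (simp add: C_def powr_mult powr_diff field_simps)
  also have "\<dots> \<le> theta \<beta> (Complex 0 y) / theta \<alpha> (Complex 0 y) powr k"
    using 1 2 3 r a k by (intro frac_le powr_mono2) (auto intro: order_trans[OF _ 1])
  finally show thesis using y by (intro that[of y]) (auto simp: theta_quotient_def)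
qed

theorem corollary1p1:
  fixes \<alpha> \<beta> k :: real
  assumes "1 \<le> \<alpha>" and "\<alpha> < \<beta>"
  shows "(1 \<le> k \<longrightarrow>
            maximizer_on_H (theta_quotient \<alpha> \<beta> k) (exp (\<i> * of_real pi / 3)) \<and>
            (\<forall>z. maximizer_on_H (theta_quotient \<alpha> \<beta> k) z \<longrightarrow>
                 (\<exists>A\<in>SL2Z. z = modular_action A (exp (\<i> * of_real pi / 3))))) \<and>
         (0 < k \<and> k < 1 \<longrightarrow>
            \<not> (\<exists>z. maximizer_on_H (theta_quotient \<alpha> \<beta> k) z))"
proof (intro conjI impI)
  define z0 where "z0 = Complex (1/2) (sqrt 3 / 2)"
  have E: "exp (\<i> * of_real pi / 3) = z0" by (simp add: z0_def exp_i_pi_third)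
  have cases: "theta_quotient \<alpha> \<beta> k z < theta_quotient \<alpha> \<beta> k z0 \<or>
      theta_quotient \<alpha> \<beta> k z = theta_quotient \<alpha> \<beta> k z0 \<and> (\<exists>A\<in>SL2Z. z = modular_action A z0)"
    if k: "1 \<le> k" and z: "Im z > 0" for z
  proof -
    obtain a b c d w where w: "a * d - b * c = 1" "Im w > 0" "z = (of_int a * w + of_int b) / (of_int c * w + of_int d)"
      "\<bar>Re w\<bar> \<le> 1/2" "1 \<le> cmod w"
      using fundamental_domain_reduction[OF z] by metis
    have q: "theta_quotient \<alpha> \<beta> k z = theta_quotient \<alpha> \<beta> k w"
      unfolding theta_quotient_def w(3) theta_moebius[OF w(1,2)] ..
    show ?thesis
    proof (cases "\<bar>Re w\<bar> = 1/2 \<and> Im w = sqrt 3 / 2")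
      case False
      thus ?thesis using quotient_less_hex[OF assms k w(2,4,5)] q by (auto simp: z0_def)
    next
      case True
      \<comment> \<open>The other corner of the fundamental domain, with real part -1/2, is
        \<open>z0 - 1\<close>.\<close>
      define e :: int where "e = (if Re w = 1/2 then 0 else 1)"
      have we: "w = (of_int 1 * z0 + of_int (- e)) / (of_int 0 * z0 + of_int 1)"
        using True by (auto simp: complex_eq_iff z0_def e_def abs_if split: if_splits)
      have "theta s w = theta s z0" for s
        unfolding we by (rule theta_moebius) (simp_all add: z0_def)
      moreover have "z = (of_int a * z0 + of_int (b - a * e)) / (of_int c * z0 + of_int (d - c * e))"
        unfolding w(3) we by (simp add: algebra_simps)
      moreover have "a * (d - c * e) - (b - a * e) * c = 1" using w(1) by (simp add: algebra_simps)
      ultimately show ?thesis using q modular_action_vector[of a "b - a * e" c "d - c * e"]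
        by (intro disjI2 conjI bexI[of _ "vector [vector [a, b - a * e], vector [c, d - c * e]]"]) (auto simp: theta_quotient_def)
    qed
  qed
  {
    assume k: "1 \<le> k"
    show "maximizer_on_H (theta_quotient \<alpha> \<beta> k) (exp (\<i> * of_real pi / 3))"
      unfolding E maximizer_on_H_def is_arg_max_def
      using cases[OF k] by (force simp: upper_half_plane_def z0_def)
    show "\<forall>z. maximizer_on_H (theta_quotient \<alpha> \<beta> k) z \<longrightarrow> (\<exists>A\<in>SL2Z. z = modular_action A (exp (\<i> * of_real pi / 3)))"
    proof (intro allI impI)
      fix z assume "maximizer_on_H (theta_quotient \<alpha> \<beta> k) z"
      hence "Im z > 0" "\<not> theta_quotient \<alpha> \<beta> k z < theta_quotient \<alpha> \<beta> k z0"
        by (auto simp: maximizer_on_H_def is_arg_max_def upper_half_plane_def z0_def)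
      thus "\<exists>A\<in>SL2Z. z = modular_action A (exp (\<i> * of_real pi / 3))" using cases[OF k] unfolding E by blast
    qed
  next
    assume k: "0 < k \<and> k < 1"
    show "\<not> (\<exists>z. maximizer_on_H (theta_quotient \<alpha> \<beta> k) z)"
    proof
      assume "\<exists>z. maximizer_on_H (theta_quotient \<alpha> \<beta> k) z"
      then obtain z where z: "maximizer_on_H (theta_quotient \<alpha> \<beta> k) z" ..
      obtain y where "y > 0" "theta_quotient \<alpha> \<beta> k z < theta_quotient \<alpha> \<beta> k (Complex 0 y)"
        using quotient_unbounded[of \<alpha> \<beta> k] k assms by (metis less_le_trans less_trans zero_less_one)
      thus False using z by (auto simp: maximizer_on_H_def is_arg_max_def upper_half_plane_def)
    qed
  }
qed

end
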